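(* There is an open dense subset $\mathcal{P}$ of the space of polygons such that every $\gamma\in\mathcal{P}$ has the following properties: (a) $I(\gamma)$ is a piecewise smooth $1$-manifold whose arc components are proper, the aspect ratio function $\rho:I(\gamma)\to(0,\infty)$ is injective in a neighborhood of each smooth point of $I(\gamma)$, and $\rho^{-1}(1)$ consists entirely of smooth points; (b) $$\Omega(\gamma)+\Omega_H(\gamma)+\Omega_E(\gamma)\equiv 0 \pmod 2,$$ where $\Omega(\gamma)$ is the number of unlabeled inscribed squares of $\gamma$, $\Omega_H(\gamma)$ is the number of unlabeled hyperbolic components of $I(\gamma)$, and $\Omega_E(\gamma)$ is the number of unlabeled elliptic components of $I(\gamma)$.
   Context: A polygon is a polygonal Jordan loop in $\mathbb{R}^2$. For each $N\ge 3$ the space of labeled $N$-gons is topologized as a subset of $\mathbb{R}^{2N}$ by listing vertices; an open dense subset $\mathcal{P}$ of polygons means a family of sets $\mathcal{P}(N)$, $N\ge3$, with $\mathcal{P}(N)$ open and dense in the space of labeled $N$-gons. Rectangles are non-degenerate. $I(\gamma)\subset(\mathbb{R}^2)^4=\mathbb{R}^8$ is the space of labeled rectangles $(R_0,R_1,R_2,R_3)$ with all vertices on $\gamma$, labeled counterclockwise around the rectangle. The aspect ratio is $\rho(R)=|R_2-R_1|/|R_1-R_0|$. A piecewise smooth $1$-manifold is a topological $1$-manifold (without boundary) that is a smooth curve in $\mathbb{R}^8$ away from a locally finite set of points; the smooth points are those at which it is smooth. An arc component of $I(\gamma)$ is a connected component homeomorphic to an (open) arc; it is proper if, towards each end, the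 aspect ratio tends to $0$ or to $\infty$, the rectangles at each end accumulate on a chord of $\gamma$ (a non-degenerate segment with endpoints on $\gamma$), and the chords at the two ends are distinct. A hyperbolic component is an arc component along which the aspect ratio tends to $0$ towards one end and to $\infty$ towards the other. The group $\mathbb{Z}/4$ acts freely on $I(\gamma)$ by cyclically relabeling vertices, and hence permutes the components of $I(\gamma)$; an elliptic component is a connected component stabilized (as a set) by the $\mathbb{Z}/4$ action; it is a loop. An unlabeled component is the $\mathbb{Z}/4$-orbit of a component (hyperbolic, respectively elliptic, if its members are), and an unlabeled inscribed square is a $\mathbb{Z}/4$-orbit of points of $\rho^{-1}(1)$. *)

theory Defs
  imports "HOL-Analysis.Analysis"
begin

section \<open>Polygons\<close>

text \<open>
  A labeled \<open>N\<close>-gon is given by vertices \<open>v 0, \<dots>, v (N - 1)\<close>. The loop below traverses the edge from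
  \<open>v k\<close> to \<open>v (k + 1)\<close> (indices modulo \<open>N\<close>) on the parameter interval \<open>[k / N, (k + 1) / N]\<close>. It
  closes up by construction, so \<^const>\<open>simple_path\<close> says that it is a Jordan loop.
\<close>

definition polygon_path :: "nat \<Rightarrow> (nat \<Rightarrow> real^2) \<Rightarrow> real \<Rightarrow> real^2" where
  "polygon_path N v t =
     (let k = nat \<lfloor>real N * t\<rfloor>
      in linepath (v (k mod N)) (v (Suc k mod N)) (frac (real N * t)))"

abbreviation polygon_curve :: "nat \<Rightarrow> (nat \<Rightarrow> real^2) \<Rightarrow> (real^2) set" where
  "polygon_curve N v \<equiv> path_image (polygon_path N v)"

text \<open>
  The ambient product topology is that of \<open>(\<real>\<^sup>2)\<^sup>N\<close>; its points are the functions that are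
  \<^const>\<open>undefined\<close> outside \<open>{..<N}\<close>.
\<close>

definition polygon_space :: "nat \<Rightarrow> (nat \<Rightarrow> real^2) topology" where
  "polygon_space N =
     subtopology (product_topology (\<lambda>_. euclidean) {..<N}) {v. simple_path (polygon_path N v)}"


section \<open>Inscribed rectangles\<close>

text \<open>
  Points of \<open>(\<real>\<^sup>2)\<^sup>4\<close> are indexed by the type \<open>4\<close> of integers modulo 4, with elements
  \<open>0, 1, 2, 3\<close>.
\<close>

definition cross2 :: "real^2 \<Rightarrow> real^2 \<Rightarrow> real" where
  "cross2 x y = x$1 * y$2 - x$2 * y$1"

text \<open>
  Positivity of the cross product of consecutive sides expresses both the counterclockwise labeling
  and non-degeneracy.
\<close>

definition ccw_rectangle :: "real^2^4 \<Rightarrow> bool" where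
  "ccw_rectangle R \<longleftrightarrow>
     R$3 - R$0 = R$2 - R$1 \<and>
     (R$1 - R$0) \<bullet> (R$2 - R$1) = 0 \<and>
     cross2 (R$1 - R$0) (R$2 - R$1) > 0"

definition inscribed_rectangles :: "(real^2) set \<Rightarrow> (real^2^4) set" where
  "inscribed_rectangles \<gamma> = {R. ccw_rectangle R \<and> (\<forall>i. R$i \<in> \<gamma>)}"

definition aspect_ratio :: "real^2^4 \<Rightarrow> real" where
  "aspect_ratio R = norm (R$2 - R$1) / norm (R$1 - R$0)"

definition relabel :: "4 \<Rightarrow> real^2^4 \<Rightarrow> real^2^4" where
  "relabel k R = (\<chi> i. R$(i + k))"


section \<open>Piecewise smooth 1-manifolds\<close>

definition topological_1_manifold :: "'a::euclidean_space set \<Rightarrow> bool" where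
  "topological_1_manifold M \<longleftrightarrow>
     (\<forall>p\<in>M. \<exists>U. openin (top_of_set M) U \<and> p \<in> U \<and> U homeomorphic (UNIV :: real set))"

definition C_infinity_on :: "real set \<Rightarrow> (real \<Rightarrow> 'a::real_normed_vector) \<Rightarrow> bool" where
  "C_infinity_on S f \<longleftrightarrow>
     (\<exists>D. D 0 = f \<and> (\<forall>n. \<forall>t\<in>S. (D n has_vector_derivative D (Suc n) t) (at t)))"

text \<open>
  \<open>M\<close> is a smooth (embedded) curve at \<open>p\<close>: near \<open>p\<close> it has a regular smooth parametrization that is
  a homeomorphism onto a neighborhood of \<open>p\<close> in \<open>M\<close>.
\<close>

definition smooth_point :: "'a::euclidean_space set \<Rightarrow> 'a \<Rightarrow> bool" where
  "smooth_point M p \<longleftrightarrow>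
     (\<exists>e>0. \<exists>U f g.
        openin (top_of_set M) U \<and> homeomorphism {-e<..<e} U f g \<and> f 0 = p \<and>
        C_infinity_on {-e<..<e} f \<and> (\<forall>t\<in>{-e<..<e}. vector_derivative f (at t) \<noteq> 0))"

definition piecewise_smooth_1_manifold :: "'a::euclidean_space set \<Rightarrow> bool" where
  "piecewise_smooth_1_manifold M \<longleftrightarrow>
     topological_1_manifold M \<and>
     (\<exists>F. locally_finite_in (top_of_set M) ((\<lambda>x. {x}) ` F) \<and> (\<forall>p\<in>M - F. smooth_point M p))"


section \<open>Components\<close>

text \<open>
  The two ends of an arc parametrized over \<open>{0<..<1}\<close> are \<^term>\<open>at_right (0::real)\<close> and
  \<^term>\<open>at_left (1::real)\<close>. The notions below do not depend on the parametrization, up to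
  exchanging the two ends.
\<close>

definition arc_component :: "'a::euclidean_space set \<Rightarrow> 'a set \<Rightarrow> bool" where
  "arc_component M C \<longleftrightarrow> C \<in> components M \<and> C homeomorphic {0<..<1::real}"

definition chord :: "(real^2) set \<Rightarrow> (real^2) set \<Rightarrow> bool" where
  "chord \<gamma> S \<longleftrightarrow> (\<exists>a\<in>\<gamma>. \<exists>b\<in>\<gamma>. a \<noteq> b \<and> S = closed_segment a b)"

text \<open>
  The rectangles \<open>f t\<close> accumulate on \<open>S\<close>: their vertices converge, and the limiting
  degenerate rectangle is \<open>S\<close>.
\<close>

definition accumulates_on :: "(real \<Rightarrow> real^2^4) \<Rightarrow> real filter \<Rightarrow> (real^2) set \<Rightarrow> bool" where
  "accumulates_on f F S \<longleftrightarrow> (\<exists>L. (f \<longlongrightarrow> L) F \<and> convex hull (range (\<lambda>i. L$i)) = S)"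

definition proper_end :: "(real \<Rightarrow> real^2^4) \<Rightarrow> real filter \<Rightarrow> (real^2) set \<Rightarrow> bool" where
  "proper_end f F S \<longleftrightarrow>
     (((\<lambda>t. aspect_ratio (f t)) \<longlongrightarrow> 0) F \<or> filterlim (\<lambda>t. aspect_ratio (f t)) at_top F) \<and>
     accumulates_on f F S"

definition proper_arc :: "(real^2) set \<Rightarrow> (real^2^4) set \<Rightarrow> bool" where
  "proper_arc \<gamma> C \<longleftrightarrow>
     (\<exists>f g S T. homeomorphism {0<..<1::real} C f g \<and>
        chord \<gamma> S \<and> proper_end f (at_right 0) S \<and>
        chord \<gamma> T \<and> proper_end f (at_left 1) T \<and>
        S \<noteq> T)"

definition hyperbolic_component :: "(real^2) set \<Rightarrow> (real^2^4) set \<Rightarrow> bool" where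
  "hyperbolic_component \<gamma> C \<longleftrightarrow>
     arc_component (inscribed_rectangles \<gamma>) C \<and>
     (\<exists>f g. homeomorphism {0<..<1::real} C f g \<and>
        ((\<lambda>t. aspect_ratio (f t)) \<longlongrightarrow> 0) (at_right 0) \<and>
        filterlim (\<lambda>t. aspect_ratio (f t)) at_top (at_left 1))"

definition elliptic_component :: "(real^2) set \<Rightarrow> (real^2^4) set \<Rightarrow> bool" where
  "elliptic_component \<gamma> C \<longleftrightarrow>
     C \<in> components (inscribed_rectangles \<gamma>) \<and> (\<forall>k. relabel k ` C = C)"


section \<open>Unlabeled objects\<close>

definition unlabeled_squares :: "(real^2) set \<Rightarrow> (real^2^4) set set" where
  "unlabeled_squares \<gamma> =
     (\<lambda>R. range (\<lambda>k. relabel k R)) ` {R \<in> inscribed_rectangles \<gamma>. aspect_ratio R = 1}"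

definition unlabeled_components :: "(real^2) set \<Rightarrow> (real^2^4) set set set" where
  "unlabeled_components \<gamma> =
     (\<lambda>C. range (\<lambda>k. relabel k ` C)) ` components (inscribed_rectangles \<gamma>)"

definition unlabeled_hyperbolic :: "(real^2) set \<Rightarrow> (real^2^4) set set set" where
  "unlabeled_hyperbolic \<gamma> =
     {X \<in> unlabeled_components \<gamma>. \<forall>C\<in>X. hyperbolic_component \<gamma> C}"

definition unlabeled_elliptic :: "(real^2) set \<Rightarrow> (real^2^4) set set set" where
  "unlabeled_elliptic \<gamma> =
     {X \<in> unlabeled_components \<gamma>. \<forall>C\<in>X. elliptic_component \<gamma> C}"

end

theory Submission
  imports Defs "HOL-Computational_Algebra.Polynomial"
begin

text \<open>
  Give each edge of the polygon a number and prescribe, for each corner of a rectangle, the edge on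
  which it has to lie. For a fixed aspect ratio \<open>r\<close> the four incidences are linear equations
  for the rectangle, so at most one rectangle solves them once finitely many polynomial expressions in the vertex
  coordinates are nonzero, and it is a rational function of \<open>r\<close>. This makes \<open>I(\<gamma>)\<close> a finite union of pieces
  of rational curves, each parametrized by the aspect ratio. The pieces are glued at the rectangles with a
  corner at a vertex of the polygon: generically just one corner is at a vertex, it runs through
  the vertex with nonzero speed (\<open>simple_root\<close>), and there exactly two pieces meet (\<open>two_sided_vertex\<close>).
  So \<open>I(\<gamma>)\<close> is a 1-manifold, smooth off a locally finite set.

  An open dense set of polygons is obtained by keeping away from the zeros of finitely many polynomials
  (\<open>generic_polygons_open\<close>, \<open>generic_polygons_dense\<close>). That such a polynomial is not identically zero
  is checked on polygons whose edge lines are tangent to a parabola, where all of them take a simple form.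

  Write \<open>\<tau> = ln \<rho>\<close>. Every point has a chart on which \<open>\<tau>\<close> has slope \<open>\<plusminus>1\<close> on both sides of it, so paths can be
  parametrized by the total variation of \<open>\<tau>\<close>. The rectangles with \<open>\<bar>\<tau>\<bar> \<le> K\<close> form a compact set
  (\<open>compact_bounded_ratio\<close>), because a rectangle that shrinks to a point with bounded aspect ratio would
  lie on at most two edges. So each component is the image of one such path, defined on the whole line,
  and it is either a loop or an injective line along which \<open>\<bar>\<tau>\<bar>\<close> tends to infinity at both ends.

  Relabeling by one step is a free action of the cyclic group of order four that changes the sign of \<open>\<tau>\<close>, and squares are the
  zeros of \<open>\<tau>\<close>, which are transversal. Squares on a component, counted up to relabeling, are therefore sign
  changes of \<open>\<tau>\<close> (\<open>component_cases\<close>): on a line their number is odd iff \<open>\<tau>\<close> has different signs at the ends,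
  that is, iff the component is hyperbolic. On a loop they are counted along a fundamental domain of the
  stabilizer; the values of \<open>\<tau>\<close> at its ends have opposite signs iff the stabilizing relabeling is odd, that is, iff
  it generates the group and the component is elliptic. Summing over unlabeled components gives the congruence.

  Along an end, where \<open>\<rho>\<close> may be assumed to tend to 0, the rectangle stays on one rational curve and is bounded, so it
  converges (\<open>path_end_exists\<close>), to a chord. A chord determines the rational curve which approaches
  it (\<open>path_end_unique\<close>), so two ends with the same chord would meet up to relabeling, which is
  impossible for the two ends of one arc.

  Finally, where two pieces form a fold of \<open>\<rho>\<close> the curve cannot be smooth: a regular parametrization would make
  \<open>\<tau>\<close> stationary, while the distance to the fold point is bounded by a multiple of the change of \<open>\<tau>\<close>.
  This gives local injectivity of \<open>\<rho>\<close> at smooth points (\<open>smooth_point_injective\<close>).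
\<close>

section \<open>Paths along which a function has unit speed\<close>

text \<open>
  Zero is the only zero of \<open>\<psi>\<close>, so \<open>\<psi>\<close> has a constant sign on each side of it, and injectivity
  excludes equal signs.
\<close>

lemma abs_preserving_imp_linear:
  fixes \<psi> :: "real \<Rightarrow> real"
  assumes d: "d > 0" and cont: "continuous_on {-d<..<d} \<psi>" and inj: "inj_on \<psi> {-d<..<d}"
    and abs: "\<And>u. \<bar>u\<bar> < d \<Longrightarrow> \<bar>\<psi> u\<bar> = \<bar>u\<bar>"
  shows "\<exists>c\<in>{1,-1}. \<forall>u. \<bar>u\<bar> < d \<longrightarrow> \<psi> u = c * u"
proof -
  have z: "\<psi> 0 = 0" using abs[of 0] d by simp
  have mono: "(\<psi> a < \<psi> x \<and> \<psi> x < \<psi> b) \<or> (\<psi> b < \<psi> x \<and> \<psi> x < \<psi> a)"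
    if "-d < a" "a < x" "x < b" "b < d" for a x b
    using that by (intro continuous_inj_imp_mono continuous_on_subset[OF cont] inj_on_subset[OF inj]) auto
  define b where "b = d / 2"
  have b: "0 < b" "b < d" using d by (auto simp: b_def)
  have *: "(\<psi> b = b \<longrightarrow> \<psi> u = u) \<and> (\<psi> b = - b \<longrightarrow> \<psi> u = - u)" if "\<bar>u\<bar> < d" for u
  proof -
    consider "u < 0" | "u = 0" | "0 < u" "u < b" | "u = b" | "b < u" by linarith
    then show ?thesis
    proof cases
      case 1 then show ?thesis using mono[of u 0 b] abs[of u] that b z by linarith
    next
      case 3 then show ?thesis using mono[of 0 u b] abs[of u] that b z by linarith
    next
      case 5 then show ?thesis using mono[of 0 b u] abs[of u] that b z by linarith
    qed (use z b in auto)
  qed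
  have "\<psi> b = b \<or> \<psi> b = - b" using abs[of b] b by linarith
  then show ?thesis
  proof
    assume "\<psi> b = b" then show ?thesis using * by (intro bexI[of _ 1]) auto
  next
    assume "\<psi> b = -b" then show ?thesis using * by (intro bexI[of _ "-1"]) auto
  qed
qed

text \<open>
  The value \<open>\<tau> (h (t + u))\<close> may be \<open>\<tau> (h t) + u\<close> for all small \<open>u\<close>, \<open>\<tau> (h t) - u\<close> for all of them, or switch at
  \<open>u = 0\<close>: folds of \<open>\<tau>\<close> are allowed, and the parameter measures the total variation of \<open>\<tau>\<close>.
\<close>

definition unit_speed_at :: "'a::metric_space set \<Rightarrow> ('a \<Rightarrow> real) \<Rightarrow> (real \<Rightarrow> 'a) \<Rightarrow> real \<Rightarrow> bool" where
  "unit_speed_at X \<tau> h t \<longleftrightarrow> (\<exists>d>0. h ` {t-d<..<t+d} \<subseteq> X \<and> continuous_on {t-d<..<t+d} h \<and>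
      inj_on h {t-d<..<t+d} \<and> (\<forall>u. \<bar>u\<bar> < d \<longrightarrow> \<bar>\<tau> (h (t+u)) - \<tau> (h t)\<bar> = \<bar>u\<bar>))"

definition unit_chart :: "'a::metric_space set \<Rightarrow> ('a \<Rightarrow> real) \<Rightarrow> real \<Rightarrow> (real \<Rightarrow> 'a) \<Rightarrow> bool" where
  "unit_chart X \<tau> e f \<longleftrightarrow> e > 0 \<and> (\<forall>t\<in>{-e<..<e}. unit_speed_at X \<tau> f t) \<and>
      openin (top_of_set X) (f ` {-e<..<e}) \<and> (\<exists>g. homeomorphism {-e<..<e} (f ` {-e<..<e}) f g)"

lemma unit_speed_at_reparam:
  assumes k: "unit_speed_at X \<tau> k t'" and d: "d > 0" and c: "c \<in> {1,-1::real}"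
    and eq: "\<And>u. \<bar>u\<bar> < d \<Longrightarrow> h (t+u) = k (t' + c*u)"
  shows "unit_speed_at X \<tau> h t"
proof -
  obtain d' where d': "d' > 0" "k ` {t'-d'<..<t'+d'} \<subseteq> X" "continuous_on {t'-d'<..<t'+d'} k"
      "inj_on k {t'-d'<..<t'+d'}" "\<And>u. \<bar>u\<bar> < d' \<Longrightarrow> \<bar>\<tau> (k (t'+u)) - \<tau> (k t')\<bar> = \<bar>u\<bar>"
    using k unfolding unit_speed_at_def by blast
  define m where "m = min d d'"
  have m: "m > 0" "m \<le> d" "m \<le> d'" using d d' by (auto simp: m_def)
  have heq: "h x = k (t' + c * (x - t))" if "x \<in> {t-m<..<t+m}" for x
    using eq[of "x - t"] that m by (auto simp: abs_less_iff)
  have inI: "t' + c * (x - t) \<in> {t'-d'<..<t'+d'}" if "x \<in> {t-m<..<t+m}" for x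
    using that m c by auto
  have 1: "h ` {t-m<..<t+m} \<subseteq> X" using heq inI d'(2) by auto
  have "continuous_on {t-m<..<t+m} (k \<circ> (\<lambda>x. t' + c * (x - t)))"
    by (rule continuous_on_compose) (auto intro!: continuous_intros continuous_on_subset[OF d'(3)] inI)
  then have 2: "continuous_on {t-m<..<t+m} h"
    by (rule continuous_on_eq) (simp add: heq)
  have 3: "inj_on h {t-m<..<t+m}"
  proof (rule inj_onI)
    fix x y assume xy: "x \<in> {t-m<..<t+m}" "y \<in> {t-m<..<t+m}" "h x = h y"
    then have "t' + c * (x - t) = t' + c * (y - t)"
      using d'(4) heq inI by (auto dest!: inj_onD)
    then show "x = y" using c by auto
  qed
  have 4: "\<bar>\<tau> (h (t+u)) - \<tau> (h t)\<bar> = \<bar>u\<bar>" if "\<bar>u\<bar> < m" for u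
    using heq[of "t+u"] heq[of t] that m d'(5)[of "c*u"] c by (auto simp: abs_less_iff)
  show ?thesis unfolding unit_speed_at_def using m(1) 1 2 3 4 by blast
qed

lemma unit_speed_at_affine:
  assumes "unit_speed_at X \<tau> k (b + c*t)" "c \<in> {1,-1::real}"
  shows "unit_speed_at X \<tau> (\<lambda>u. k (b + c*u)) t"
  by (rule unit_speed_at_reparam[OF assms(1) zero_less_one assms(2)]) (simp add: algebra_simps)

lemma unit_speed_at_cong:
  assumes "unit_speed_at X \<tau> k t" "open S" "t \<in> S" "\<And>x. x \<in> S \<Longrightarrow> h x = k x"
  shows "unit_speed_at X \<tau> h t"
proof -
  obtain d where d: "d > 0" "ball t d \<subseteq> S" using assms openE by blast
  show ?thesis
    by (rule unit_speed_at_reparam[OF assms(1) d(1), of 1]) (use d assms(4) in \<open>auto simp: ball_def dist_real_def subset_eq\<close>)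
qed

lemma unit_speed_at_isCont:
  assumes "unit_speed_at X \<tau> h t" shows "isCont h t" "h t \<in> X"
proof -
  obtain d where d: "d > 0" "continuous_on {t-d<..<t+d} h" "h ` {t-d<..<t+d} \<subseteq> X"
    using assms unfolding unit_speed_at_def by blast
  then show "isCont h t" by (simp add: continuous_on_eq_continuous_at)
  have "t \<in> {t-d<..<t+d}" using d by auto
  then show "h t \<in> X" using d by blast
qed

lemma unit_chart_shift:
  assumes f: "unit_chart X \<tau> e f" and e: "e' > 0" "\<bar>x\<bar> + e' \<le> e" and c: "c \<in> {1,-1::real}"
  shows "unit_chart X \<tau> e' (\<lambda>u. f (x + c*u))"
proof -
  obtain g where g: "homeomorphism {-e<..<e} (f ` {-e<..<e}) f g" using f unfolding unit_chart_def by blast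
  have I: "x + c*u \<in> {-e<..<e}" if "u \<in> {-e'<..<e'}" for u using that e c by auto
  have im: "(\<lambda>u. x + c*u) ` {-e'<..<e'} = {x-e'<..<x+e'}"
  proof -
    have "y \<in> (\<lambda>u. x + c*u) ` {-e'<..<e'}" if "y \<in> {x-e'<..<x+e'}" for y
      using that c by (intro image_eqI[of _ _ "c*(y-x)"]) auto
    then show ?thesis using c by auto
  qed
  have sub: "{x-e'<..<x+e'} \<subseteq> {-e<..<e}" using e by auto
  have imf: "(\<lambda>u. f (x + c*u)) ` {-e'<..<e'} = f ` {x-e'<..<x+e'}"
    unfolding im[symmetric] image_image ..
  have 1: "unit_speed_at X \<tau> (\<lambda>u. f (x + c*u)) t" if "t \<in> {-e'<..<e'}" for t
    using unit_speed_at_affine[OF _ c] f I[OF that] unfolding unit_chart_def by blast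
  have "openin (top_of_set (f ` {-e<..<e})) (f ` {x-e'<..<x+e'})"
    using homeomorphism_imp_open_map[OF g, of "{x-e'<..<x+e'}"] sub by (simp add: open_subset)
  then have 2: "openin (top_of_set X) (f ` {x-e'<..<x+e'})"
    using f unfolding unit_chart_def by (meson openin_trans)
  have h1: "homeomorphism {x-e'<..<x+e'} (f ` {x-e'<..<x+e'}) f g"
    using homeomorphism_of_subsets[OF g] sub by blast
  have h2: "homeomorphism {-e'<..<e'} {x-e'<..<x+e'} (\<lambda>u. x + c*u) (\<lambda>y. c*(y-x))"
    unfolding homeomorphism_def im using c by (auto intro!: continuous_intros image_eqI[where x="x + c*_"] simp: image_iff)
  have "\<exists>g'. homeomorphism {-e'<..<e'} (f ` {x-e'<..<x+e'}) (\<lambda>u. f (x + c*u)) g'"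
    using homeomorphism_compose[OF h2 h1] by (auto simp: o_def)
  then show ?thesis unfolding unit_chart_def imf using 1 2 e(1) by simp
qed

locale unit_speed_space =
  fixes X :: "'a::metric_space set" and \<tau> :: "'a \<Rightarrow> real"
  assumes charts: "\<And>p. p \<in> X \<Longrightarrow> \<exists>e f. unit_chart X \<tau> e f \<and> f 0 = p"
    and compact_sublevel: "\<And>K. compact {x\<in>X. \<bar>\<tau> x\<bar> \<le> K}"
    and continuous_tau: "continuous_on X \<tau>"
begin

abbreviation "unit_on I h \<equiv> (\<forall>t\<in>I. unit_speed_at X \<tau> h t)"

text \<open>
  Two unit speed paths through the same point of a chart differ locally by a shift and a reversal, since the transition
  map preserves the absolute value of the parameter.
\<close>

lemma chart_rigid:
  assumes f: "unit_chart X \<tau> e f" and h: "unit_speed_at X \<tau> h t" and x: "\<bar>x\<bar> < e" "h t = f x"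
  shows "\<exists>d>0. \<exists>c\<in>{1,-1}. \<forall>u. \<bar>u\<bar> < d \<longrightarrow> \<bar>x + c*u\<bar> < e \<and> h (t+u) = f (x + c*u)"
proof -
  obtain d0 where d0: "d0 > 0" "h ` {t-d0<..<t+d0} \<subseteq> X" "continuous_on {t-d0<..<t+d0} h"
      "inj_on h {t-d0<..<t+d0}" "\<And>u. \<bar>u\<bar> < d0 \<Longrightarrow> \<bar>\<tau> (h (t+u)) - \<tau> (h t)\<bar> = \<bar>u\<bar>"
    using h unfolding unit_speed_at_def by blast
  have "x \<in> {-e<..<e}" using x by auto
  then have "unit_speed_at X \<tau> f x" using f unfolding unit_chart_def by blast
  then obtain df where df: "df > 0" "\<And>u. \<bar>u\<bar> < df \<Longrightarrow> \<bar>\<tau> (f (x+u)) - \<tau> (f x)\<bar> = \<bar>u\<bar>"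
    unfolding unit_speed_at_def by blast
  let ?U = "f ` {-e<..<e}"
  obtain g where g: "homeomorphism {-e<..<e} ?U f g" using f unfolding unit_chart_def by blast
  obtain O' where O': "open O'" "?U = X \<inter> O'" using f unfolding unit_chart_def openin_open by blast
  have fg: "f (g y) = y" "g y \<in> {-e<..<e}" if "y \<in> ?U" for y
    using g that unfolding homeomorphism_def by auto
  have gf: "g (f y) = y" if "y \<in> {-e<..<e}" for y using g that unfolding homeomorphism_def by auto
  have htU: "h t \<in> ?U" using x(2) imageI[of x "{-e<..<e}" f] x(1) by (simp add: abs_less_iff)
  have hc: "isCont h t" using h unit_speed_at_isCont by blast
  have "\<forall>\<^sub>F y in at t. h y \<in> O'"
    using hc O'(1) htU O'(2) unfolding isCont_def by (metis IntE topological_tendstoD)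
  then obtain d1 where d1: "d1 > 0" "\<And>y. y \<noteq> t \<Longrightarrow> dist y t < d1 \<Longrightarrow> h y \<in> O'"
    unfolding eventually_at by blast
  define d2 where "d2 = min d0 d1"
  have d2: "d2 > 0" "d2 \<le> d0" "d2 \<le> d1" using d0 d1 by (auto simp: d2_def)
  have hU: "h y \<in> ?U" if "\<bar>y - t\<bar> < d2" for y
  proof (cases "y = t")
    case False
    then have "h y \<in> O'" using d1(2)[of y] that d2 by (simp add: dist_real_def)
    moreover have "h y \<in> X" using d0(2) that d2 by (auto simp: abs_less_iff image_subset_iff)
    ultimately show ?thesis using O' by blast
  qed (use htU in simp)
  define \<phi> where "\<phi> y = g (h y)" for y
  have c1: "continuous_on {t-d2<..<t+d2} \<phi>"
    unfolding \<phi>_def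
  proof (rule continuous_on_compose2[of ?U g])
    show "continuous_on ?U g" using g unfolding homeomorphism_def by blast
    show "continuous_on {t-d2<..<t+d2} h" using d0(3) d2 by (auto elim!: continuous_on_subset)
    show "h ` {t-d2<..<t+d2} \<subseteq> ?U" using hU by (auto simp: abs_less_iff)
  qed
  have "isCont \<phi> t" using c1 d2 by (simp add: continuous_on_eq_continuous_at)
  moreover have pt: "\<phi> t = x" unfolding \<phi>_def x(2) using gf[of x] x(1) by (simp add: abs_less_iff)
  ultimately obtain d3 where d3: "d3 > 0" "\<And>y. dist y t < d3 \<Longrightarrow> dist (\<phi> y) x < df"
    unfolding continuous_at_eps_delta using df(1) by metis
  define d where "d = min d2 d3"
  have d: "d > 0" "d \<le> d2" "d \<le> d3" using d2 d3 by (auto simp: d_def)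
  define \<psi> where "\<psi> u = \<phi> (t+u) - x" for u
  have fh: "f (\<phi> (t+u)) = h (t+u)" if "\<bar>u\<bar> < d" for u unfolding \<phi>_def using fg hU[of "t+u"] that d by auto
  have "\<exists>c\<in>{1,-1}. \<forall>u. \<bar>u\<bar> < d \<longrightarrow> \<psi> u = c * u"
  proof (rule abs_preserving_imp_linear[OF d(1)])
    show "continuous_on {-d<..<d} \<psi>" unfolding \<psi>_def
      by (intro continuous_intros continuous_on_compose2[OF c1]) (use d in auto)
    show "inj_on \<psi> {-d<..<d}"
    proof (rule inj_onI)
      fix u w assume uw: "u \<in> {-d<..<d}" "w \<in> {-d<..<d}" "\<psi> u = \<psi> w"
      then have "h (t+u) = h (t+w)" using fh[of u] fh[of w] by (auto simp: \<psi>_def abs_less_iff)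
      then show "u = w" using inj_onD[OF d0(4)] uw d d2 by fastforce
    qed
    show "\<bar>\<psi> u\<bar> = \<bar>u\<bar>" if "\<bar>u\<bar> < d" for u
    proof -
      have "\<bar>\<phi> (t+u) - x\<bar> < df" using d3(2)[of "t+u"] that d by (auto simp: dist_real_def)
      then have "\<bar>\<tau> (f (x + (\<phi> (t+u) - x))) - \<tau> (f x)\<bar> = \<bar>\<psi> u\<bar>" unfolding \<psi>_def by (rule df(2))
      then show ?thesis using fh[OF that] x d0(5)[of u] that d d2 by simp
    qed
  qed
  then obtain c where c: "c \<in> {1,-1}" "\<And>u. \<bar>u\<bar> < d \<Longrightarrow> \<psi> u = c * u" by blast
  have "\<bar>x + c*u\<bar> < e \<and> h (t+u) = f (x + c*u)" if "\<bar>u\<bar> < d" for u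
  proof -
    have p: "\<phi> (t+u) = x + c*u" using c(2)[OF that] by (simp add: \<psi>_def)
    have "\<phi> (t+u) \<in> {-e<..<e}" unfolding \<phi>_def using fg(2) hU[of "t+u"] that d by auto
    then show ?thesis using fh[OF that] p by (auto simp: abs_less_iff)
  qed
  then show ?thesis using d(1) c(1) by blast
qed

lemma germs_agree:
  assumes h: "unit_speed_at X \<tau> h a" and k: "unit_speed_at X \<tau> k b" and eq: "h a = k b"
  shows "\<exists>d>0. \<exists>c\<in>{1,-1}. \<forall>u. \<bar>u\<bar> < d \<longrightarrow> h (a+u) = k (b+c*u)"
proof -
  obtain e f where f: "unit_chart X \<tau> e f" "f 0 = h a" using charts unit_speed_at_isCont(2)[OF h] by blast
  have e: "e > 0" using f unfolding unit_chart_def by blast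
  obtain d1 c1 where 1: "d1 > 0" "c1 \<in> {1,-1}" "\<And>u. \<bar>u\<bar> < d1 \<Longrightarrow> h (a+u) = f (0 + c1*u)"
    using chart_rigid[OF f(1) h, of 0] e f(2) by (metis abs_zero)
  obtain d2 c2 where 2: "d2 > 0" "c2 \<in> {1,-1}" "\<And>u. \<bar>u\<bar> < d2 \<Longrightarrow> k (b+u) = f (0 + c2*u)"
    using chart_rigid[OF f(1) k, of 0] e f(2) eq by (metis abs_zero)
  show ?thesis
  proof (intro exI[of _ "min d1 d2"] conjI bexI[of _ "c1*c2"] allI impI)
    fix u assume "\<bar>u\<bar> < min d1 d2"
    then show "h (a+u) = k (b + c1*c2*u)" using 1(2,3) 2(2) 2(3)[of "c1*c2*u"] by (auto simp: abs_mult)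
  qed (use 1 2 in auto)
qed

text \<open>
  The set of parameters around which the two paths agree is open by definition and closed because of the
  rigidity of charts; a change of direction is excluded because both paths are locally injective.
\<close>

lemma unit_on_unique:
  assumes I: "open I" "connected I" and h: "unit_on I h" and k: "unit_on I k"
    and t0: "t0 \<in> I" "d0 > 0" "\<And>u. \<bar>u\<bar> < d0 \<Longrightarrow> h (t0+u) = k (t0+u)" and t: "t \<in> I"
  shows "h t = k t"
proof -
  define S where "S = {t. \<exists>d>0. \<forall>u. \<bar>u\<bar> < d \<longrightarrow> h (t+u) = k (t+u)}"
  have open_S: "open S" unfolding open_dist
  proof
    fix t assume "t \<in> S"
    then obtain d where d: "d > 0" "\<And>u. \<bar>u\<bar> < d \<Longrightarrow> h (t+u) = k (t+u)" unfolding S_def by blast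
    have "y \<in> S" if "dist y t < d/2" for y
      unfolding S_def
    proof (intro CollectI exI[of _ "d/2"] conjI allI impI)
      fix u :: real assume "\<bar>u\<bar> < d/2"
      then have "\<bar>y - t + u\<bar> < d" using that unfolding dist_real_def by arith
      then show "h (y+u) = k (y+u)" using d(2)[of "y - t + u"] by simp
    qed (use d in auto)
    then show "\<exists>e>0. \<forall>y. dist y t < e \<longrightarrow> y \<in> S" using d(1) by (intro exI[of _ "d/2"]) auto
  qed
  have nbhd: "\<exists>d>0. \<forall>y. dist y t < d \<longrightarrow> y \<notin> S" if tI: "t \<in> I" "t \<notin> S" for t
  proof (cases "h t = k t")
    case True
    obtain d c where dc: "d > 0" "c \<in> {1,-1}" "\<And>u. \<bar>u\<bar> < d \<Longrightarrow> h (t+u) = k (t+c*u)"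
      using germs_agree[of h t k t] h k tI True by blast
    have c: "c = -1" using dc tI(2) unfolding S_def by auto
    obtain d1 where d1: "d1 > 0" "inj_on h {t-d1<..<t+d1}" using h tI unfolding unit_speed_at_def by blast
    have "y \<notin> S" if y: "dist y t < min d d1 / 2" for y
    proof
      assume "y \<in> S"
      then obtain d2 where d2: "d2 > 0" "\<And>u. \<bar>u\<bar> < d2 \<Longrightarrow> h (y+u) = k (y+u)" unfolding S_def by blast
      define z where "z = (if y = t then t + min (d2/2) (min d d1 / 2) else y)"
      have zz: "z \<noteq> t" "dist z t < min d d1" using y dc(1) d1(1) d2(1) by (auto simp: z_def dist_real_def min_def)
      have "h z = k z" using d2(1) d2(2)[of "z - y"] dc(1) d1(1) by (auto simp: z_def min_def abs_if)
      moreover have "h (t - (z - t)) = k z" using dc(3)[of "-(z-t)"] c zz by (simp add: dist_real_def abs_less_iff)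
      ultimately have "h z = h (2*t - z)" by (simp add: algebra_simps)
      then have "z = 2*t - z" using inj_onD[OF d1(2)] zz(2) by (auto simp: dist_real_def abs_less_iff)
      then show False using zz(1) by simp
    qed
    then show ?thesis using dc(1) d1(1) by (intro exI[of _ "min d d1 / 2"]) auto
  next
    case False
    have "isCont (\<lambda>t. dist (h t) (k t)) t"
      using unit_speed_at_isCont(1) h k tI(1) by (intro continuous_intros) blast+
    moreover have "dist (h t) (k t) > 0" using False by simp
    ultimately have "\<forall>\<^sub>F y in at t. dist (h y) (k y) > 0"
      unfolding isCont_def by (rule order_tendstoD(1))
    then have "\<forall>\<^sub>F y in nhds t. dist (h y) (k y) > 0"
      using False by (simp add: eventually_nhds_conv_at)
    then obtain d where d: "d > 0" "\<And>y. dist y t < d \<Longrightarrow> dist (h y) (k y) > 0" unfolding eventually_nhds_metric by blast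
    have "y \<notin> S" if "dist y t < d" for y
    proof
      assume "y \<in> S"
      then obtain d' where "d' > 0" "\<And>u. \<bar>u\<bar> < d' \<Longrightarrow> h (y+u) = k (y+u)" unfolding S_def by blast
      from this(2)[of 0] this(1) d(2)[OF that] show False by simp
    qed
    then show ?thesis using d(1) by blast
  qed
  have "closedin (top_of_set I) (I \<inter> S)"
    unfolding closedin_def
  proof (intro conjI)
    have "openin (top_of_set I) (I - S)"
      unfolding openin_euclidean_subtopology_iff
    proof (intro conjI ballI)
      fix x assume "x \<in> I - S"
      then obtain d where d: "d > 0" "\<forall>y. dist y x < d \<longrightarrow> y \<notin> S" using nbhd[of x] by blast
      then show "\<exists>e>0. \<forall>x'\<in>I. dist x' x < e \<longrightarrow> x' \<in> I - S" by blast
    qed auto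
    then show "openin (top_of_set I) (topspace (top_of_set I) - I \<inter> S)" by (simp add: Diff_Int_distrib2 Diff_Int)
  qed auto
  moreover have "openin (top_of_set I) (I \<inter> S)" using open_S by (simp add: openin_open_Int)
  ultimately have "I \<inter> S = {} \<or> I \<inter> S = I" using I(2) connected_clopen by blast
  moreover have "t0 \<in> S" using t0(2,3) unfolding S_def by blast
  ultimately have "t \<in> S" using t0(1) t by blast
  then obtain d where "d > 0" "\<And>u. \<bar>u\<bar> < d \<Longrightarrow> h (t+u) = k (t+u)" unfolding S_def by blast
  then show ?thesis by (metis abs_zero add.right_neutral)
qed

text \<open>
  By rigidity the paths agree up to an isometry of the line near the common point, and then everywhere by
  \<open>unit_on_unique\<close>.
\<close>

lemma unit_on_UNIV_meet:
  assumes h: "unit_on UNIV h" and k: "unit_on UNIV k" and eq: "h a = k b"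
  shows "\<exists>c\<in>{1,-1}. \<forall>u. h (a+u) = k (b+c*u)"
proof -
  obtain d c where dc: "d > 0" "c \<in> {1,-1}" "\<And>u. \<bar>u\<bar> < d \<Longrightarrow> h (a+u) = k (b+c*u)"
    using germs_agree[of h a k b] h k eq by blast
  have 1: "unit_on UNIV (\<lambda>u. h (a+u))"
    using unit_speed_at_affine[of X \<tau> h a 1] h by simp
  have 2: "unit_on UNIV (\<lambda>u. k (b+c*u))"
    using unit_speed_at_affine[of X \<tau> k b c] k dc(2) by blast
  have "h (a+u) = k (b+c*u)" for u
    using unit_on_unique[OF open_UNIV _ 1 2 _ dc(1), of 0 u] dc(3) by auto
  then show ?thesis using dc(2) by blast
qed

lemma unit_on_lipschitz:
  assumes h: "unit_on {a..b} h" and ab: "a \<le> b"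
  shows "\<bar>\<tau> (h b) - \<tau> (h a)\<bar> \<le> b - a"
proof -
  define P where "P x y \<longleftrightarrow> (a \<le> x \<and> y \<le> b \<longrightarrow> \<bar>\<tau> (h y) - \<tau> (h x)\<bar> \<le> y - x)" for x y
  have "P a b"
  proof (rule Bolzano[OF ab])
    show "P x z" if "P x y" "P y z" "x \<le> y" "y \<le> z" for x y z
      using that unfolding P_def by linarith
    fix x assume x: "a \<le> x" "x \<le> b"
    then have "unit_speed_at X \<tau> h x" using h by auto
    then obtain d where d: "d > 0" "\<And>u. \<bar>u\<bar> < d \<Longrightarrow> \<bar>\<tau> (h (x+u)) - \<tau> (h x)\<bar> = \<bar>u\<bar>"
      unfolding unit_speed_at_def by blast
    show "\<exists>d>0. \<forall>y z. y \<le> x \<and> x \<le> z \<and> z - y < d \<longrightarrow> P y z"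
    proof (intro exI[of _ d] conjI allI impI)
      fix y z assume yz: "y \<le> x \<and> x \<le> z \<and> z - y < d"
      have "\<bar>\<tau> (h z) - \<tau> (h x)\<bar> = z - x" using d(2)[of "z-x"] yz by simp
      moreover have "\<bar>\<tau> (h y) - \<tau> (h x)\<bar> = x - y" using d(2)[of "y-x"] yz by simp
      ultimately show "P y z" unfolding P_def by linarith
    qed (use d in auto)
  qed
  then show ?thesis by (simp add: P_def)
qed

text \<open>
  By compactness of the set where \<open>\<tau>\<close> is bounded, charts do not get arbitrarily small there. This is the reason why unit speed paths can
  be continued for ever: in bounded time \<open>\<tau>\<close> stays bounded.
\<close>

lemma uniform_charts: "\<exists>e>0. \<forall>q\<in>X. \<bar>\<tau> q\<bar> \<le> K \<longrightarrow> (\<exists>f. unit_chart X \<tau> e f \<and> f 0 = q)"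
proof (rule ccontr)
  assume con: "\<not> ?thesis"
  have "\<exists>q. q \<in> X \<and> \<bar>\<tau> q\<bar> \<le> K \<and> \<not> (\<exists>f. unit_chart X \<tau> (1/real (Suc n)) f \<and> f 0 = q)" for n
    using con by (metis divide_pos_pos of_nat_0_less_iff zero_less_Suc zero_less_one)
  then obtain q where q: "\<And>n. q n \<in> X" "\<And>n. \<bar>\<tau> (q n)\<bar> \<le> K" "\<And>n. \<not> (\<exists>f. unit_chart X \<tau> (1/real (Suc n)) f \<and> f 0 = q n)"
    by metis
  obtain l r where l: "l \<in> X" "strict_mono r" "(q \<circ> r) \<longlonglongrightarrow> l"
    using compact_sublevel[of K, unfolded compact_def, rule_format, of q] q by auto
  obtain e f where f: "unit_chart X \<tau> e f" "f 0 = l" using charts l by blast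
  have e: "e > 0" using f unfolding unit_chart_def by blast
  have "unit_chart X \<tau> (e/2) (\<lambda>u. f (0 + 1*u))" using unit_chart_shift[OF f(1), of "e/2" 0 1] e by auto
  then have "openin (top_of_set X) (f ` {-(e/2)<..<e/2})" unfolding unit_chart_def by simp
  then obtain O' where O': "open O'" "f ` {-(e/2)<..<e/2} = X \<inter> O'" unfolding openin_open by blast
  have "l \<in> O'" using O'(2) f(2) e by (metis IntE add.inverse_neutral greaterThanLessThan_iff half_gt_zero imageI neg_less_0_iff_less)
  then have "\<forall>\<^sub>F n in sequentially. (q \<circ> r) n \<in> O'" using l(3) O'(1) topological_tendstoD by blast
  moreover have "\<forall>\<^sub>F n in sequentially. 1 / real (Suc n) < e/2"
    using order_tendstoD(2)[OF LIMSEQ_inverse_real_of_nat, of "e/2"] e by (simp add: inverse_eq_divide)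
  ultimately have "\<forall>\<^sub>F n in sequentially. (q \<circ> r) n \<in> O' \<and> 1 / real (Suc n) < e/2" by eventually_elim auto
  then obtain n where n: "q (r n) \<in> O'" "1 / real (Suc n) < e/2" by (auto simp: eventually_sequentially)
  have "r n \<ge> n" using l(2) by (simp add: seq_suble)
  then have n2: "1 / real (Suc (r n)) < e/2" using n(2) by (smt (verit) Suc_le_mono frac_le of_nat_0_less_iff of_nat_le_iff zero_less_Suc)
  obtain x where x: "x \<in> {-(e/2)<..<e/2}" "q (r n) = f x" using O'(2) n(1) q(1) by blast
  have "unit_chart X \<tau> (1/real (Suc (r n))) (\<lambda>u. f (x + 1*u))"
    by (rule unit_chart_shift[OF f(1)]) (use x n2 in auto)
  then show False using q(3)[of "r n"] x by auto
qed

end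

section \<open>Components are images of unit speed paths\<close>

context unit_speed_space begin

lemma unit_on_chart: "unit_chart X \<tau> e f \<Longrightarrow> unit_on {-e<..<e} f"
  unfolding unit_chart_def by blast

lemma chart_follow:
  assumes f: "unit_chart X \<tau> e f" and I: "open I" "connected I" "t \<in> I" and h: "unit_on I h"
    and x: "\<bar>x\<bar> < e" "h t = f x"
  shows "\<exists>c\<in>{1,-1}. \<forall>u. \<bar>x + c*u\<bar> < e \<and> t + u \<in> I \<longrightarrow> h (t+u) = f (x + c*u)"
proof -
  obtain d c where dc: "d > 0" "c \<in> {1,-1}" "\<And>u. \<bar>u\<bar> < d \<Longrightarrow> h (t+u) = f (x + c*u)"
    using chart_rigid[OF f, of h t x] x h I(3) by metis
  define J where "J = {u. \<bar>x + c*u\<bar> < e \<and> t + u \<in> I}"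
  have J1: "{u. \<bar>x + c*u\<bar> < e} = (if c = 1 then {-e-x<..<e-x} else {x-e<..<x+e})"
    using dc(2) by (auto simp: abs_less_iff)
  have J2: "{u. t + u \<in> I} = (+) (-t) ` I" by (force simp: image_iff)
  have J: "J = (if c = 1 then {-e-x<..<e-x} else {x-e<..<x+e}) \<inter> (+) (-t) ` I"
    unfolding J1[symmetric] J2[symmetric] J_def by auto
  have oJ: "open J" unfolding J by (intro open_Int open_translation I(1)) simp
  have "convex I" using I(2) is_interval_convex is_interval_connected_1 by blast
  then have "convex J" unfolding J by (auto intro!: convex_Int convex_translation)
  then have cJ: "connected J" by (rule convex_connected)
  have 1: "unit_on J (\<lambda>u. h (t + 1*u))" by (intro ballI unit_speed_at_affine) (use h in \<open>auto simp: J_def\<close>)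
  have 2: "unit_on J (\<lambda>u. f (x + c*u))"
    by (intro ballI unit_speed_at_affine[OF _ dc(2)]) (use unit_on_chart[OF f] in \<open>auto simp: J_def abs_less_iff\<close>)
  have "h (t+u) = f (x + c*u)" if "u \<in> J" for u
    using unit_on_unique[OF oJ cJ 1 2 _ dc(1) _ that, of 0] dc(3) x I(3) by (auto simp: J_def)
  then show ?thesis using dc(2) unfolding J_def by blast
qed

text \<open>
  A chart of uniform size around a point shortly before time \<open>a\<close> continues the path by a fixed amount.
\<close>

lemma extend_right:
  assumes e0: "e0 > 0" and a: "e0 \<le> a" "a < T"
    and h: "unit_on {-e0<..<a} h" and K: "\<bar>\<tau> (h 0)\<bar> + T \<le> K"
    and \<epsilon>: "\<epsilon> > 0" "\<And>q. q \<in> X \<Longrightarrow> \<bar>\<tau> q\<bar> \<le> K \<Longrightarrow> \<exists>f. unit_chart X \<tau> \<epsilon> f \<and> f 0 = q"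
  shows "\<exists>h'. unit_on {-e0<..<a+\<epsilon>/2} h' \<and> (\<forall>t<a. h' t = h t)"
proof -
  define \<delta> where "\<delta> = min \<epsilon> e0 / 2"
  have \<delta>: "\<delta> > 0" "\<delta> \<le> \<epsilon>/2" "\<delta> \<le> e0/2" using e0 \<epsilon>(1) by (auto simp: \<delta>_def)
  have in1: "a - \<delta> \<in> {-e0<..<a}" using \<delta> a e0 by auto
  have "unit_speed_at X \<tau> h (a - \<delta>)" using h in1 by blast
  then have q: "h (a - \<delta>) \<in> X" by (rule unit_speed_at_isCont(2))
  have "\<bar>\<tau> (h (a - \<delta>)) - \<tau> (h 0)\<bar> \<le> a - \<delta> - 0"
    by (rule unit_on_lipschitz) (use h \<delta> a e0 in auto)
  then have "\<bar>\<tau> (h (a - \<delta>))\<bar> \<le> K" using K a \<delta> by linarith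
  then obtain f where f: "unit_chart X \<tau> \<epsilon> f" "f 0 = h (a - \<delta>)" using \<epsilon>(2)[OF q] by blast
  have "\<exists>c\<in>{1,-1}. \<forall>u. \<bar>0 + c*u\<bar> < \<epsilon> \<and> a - \<delta> + u \<in> {-e0<..<a} \<longrightarrow> h (a - \<delta> + u) = f (0 + c*u)"
    by (rule chart_follow[OF f(1) open_greaterThanLessThan connected_Ioo in1 h]) (use f(2) \<epsilon>(1) in auto)
  then obtain c where c: "c \<in> {1,-1}" "\<And>u. \<bar>0 + c*u\<bar> < \<epsilon> \<Longrightarrow> a - \<delta> + u \<in> {-e0<..<a} \<Longrightarrow> h (a - \<delta> + u) = f (0 + c*u)"
    by blast
  define k where "k t = f (-(c*(a-\<delta>)) + c*t)" for t
  define h' where "h' t = (if t < a then h t else k t)" for t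
  have hk: "h' t = k t" if "t \<in> {a-2*\<delta><..<a-\<delta>+\<epsilon>}" for t
  proof (cases "t < a")
    case True
    have "\<bar>0 + c*(t-(a-\<delta>))\<bar> < \<epsilon>" using that c(1) \<delta> True by (auto simp: abs_mult)
    then have "h (a - \<delta> + (t-(a-\<delta>))) = f (0 + c*(t-(a-\<delta>)))" using True that \<delta> a e0 by (intro c(2)) auto
    then show ?thesis using True by (simp add: h'_def k_def algebra_simps)
  qed (simp add: h'_def)
  have "unit_speed_at X \<tau> h' t" if t: "t \<in> {-e0<..<a+\<epsilon>/2}" for t
  proof (cases "t < a")
    case True
    show ?thesis by (rule unit_speed_at_cong[of X \<tau> h t "{..<a}"]) (use h t True in \<open>auto simp: h'_def\<close>)
  next
    case False
    have "\<bar>-(c*(a-\<delta>)) + c*t\<bar> < \<epsilon>" using c(1) False t \<delta> by auto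
    then have "unit_speed_at X \<tau> f (-(c*(a-\<delta>)) + c*t)" using unit_on_chart[OF f(1)] by (auto simp: abs_less_iff)
    then have "unit_speed_at X \<tau> k t" unfolding k_def by (rule unit_speed_at_affine[OF _ c(1)])
    then show ?thesis
      by (rule unit_speed_at_cong[where S="{a-2*\<delta><..<a-\<delta>+\<epsilon>}"]) (use hk False t \<delta> in auto)
  qed
  then show ?thesis by (intro exI[of _ h']) (auto simp: h'_def)
qed

lemma extend_to:
  assumes f: "unit_chart X \<tau> e0 f"
  shows "\<exists>h. unit_on {-e0<..<T} h \<and> (\<forall>t\<in>{-e0<..<e0}. h t = f t)"
proof -
  have e0: "e0 > 0" using f unfolding unit_chart_def by blast
  define T' where "T' = max T e0 + 1"
  obtain \<epsilon> where \<epsilon>: "\<epsilon> > 0" "\<And>q. q \<in> X \<Longrightarrow> \<bar>\<tau> q\<bar> \<le> \<bar>\<tau> (f 0)\<bar> + T' \<Longrightarrow> \<exists>f. unit_chart X \<tau> \<epsilon> f \<and> f 0 = q"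
    using uniform_charts[of "\<bar>\<tau> (f 0)\<bar> + T'"] by blast
  have "\<exists>h a. (a \<ge> T' \<or> a \<ge> e0 + real n * (\<epsilon>/2)) \<and> a \<ge> e0 \<and> unit_on {-e0<..<a} h \<and> (\<forall>t\<in>{-e0<..<e0}. h t = f t)" for n
  proof (induction n)
    case 0
    show ?case using unit_on_chart[OF f] by (intro exI[of _ f] exI[of _ e0]) auto
  next
    case (Suc n)
    then obtain h a where h: "a \<ge> T' \<or> a \<ge> e0 + real n * (\<epsilon>/2)" "a \<ge> e0" "unit_on {-e0<..<a} h" "\<forall>t\<in>{-e0<..<e0}. h t = f t" by blast
    show ?case
    proof (cases "a \<ge> T'")
      case False
      have "h 0 = f 0" using h(4) e0 by auto
      then obtain h' where h': "unit_on {-e0<..<a+\<epsilon>/2} h'" "\<forall>t<a. h' t = h t"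
        using extend_right[OF e0 h(2) _ h(3) _ \<epsilon>, of T' "\<bar>\<tau> (f 0)\<bar> + T'"] False by auto
      have "e0 + real (Suc n) * (\<epsilon>/2) = e0 + real n * (\<epsilon>/2) + \<epsilon>/2" by (simp add: field_simps)
      then have "a + \<epsilon>/2 \<ge> e0 + real (Suc n) * (\<epsilon>/2)" "a + \<epsilon>/2 \<ge> e0" using h(1,2) False \<epsilon>(1) by linarith+
      moreover have "\<forall>t\<in>{-e0<..<e0}. h' t = f t" using h(2,4) h'(2) by auto
      ultimately show ?thesis using h'(1) by blast
    qed (use h in blast)
  qed
  moreover obtain n where "real n > T' / (\<epsilon>/2)" using reals_Archimedean2 by blast
  then have "e0 + real n * (\<epsilon>/2) \<ge> T'" using \<epsilon>(1) e0 by (simp add: field_simps)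
  ultimately obtain h a where h: "a \<ge> T'" "unit_on {-e0<..<a} h" "\<forall>t\<in>{-e0<..<e0}. h t = f t"
    by (meson order_trans)
  have "{-e0<..<T} \<subseteq> {-e0<..<a}" using h(1) by (auto simp: T'_def)
  then show ?thesis using h by blast
qed

lemma extend_ray:
  assumes f: "unit_chart X \<tau> e0 f"
  shows "\<exists>h. unit_on {-e0<..} h \<and> (\<forall>t\<in>{-e0<..<e0}. h t = f t)"
proof -
  have e0: "e0 > 0" using f unfolding unit_chart_def by blast
  obtain H where H: "\<And>T. unit_on {-e0<..<T} (H T)" "\<And>T. \<forall>t\<in>{-e0<..<e0}. H T t = f t"
    using extend_to[OF f] by metis
  have agree: "H T t = H T' t" if "T \<le> T'" "-e0 < t" "t < T" for T T' t
  proof -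
    have "-e0 < T" using that by simp
    define t0 where "t0 = (- e0 + min T e0) / 2"
    define d0 where "d0 = (min T e0 + e0) / 2"
    have t0: "-e0 < t0" "t0 < T" "t0 < e0" "d0 > 0" using \<open>-e0 < T\<close> e0 by (auto simp: t0_def d0_def min_def)
    have "t0 - d0 = -e0" "t0 + d0 = min T e0" by (simp_all add: t0_def d0_def field_simps)
    then have eq: "H T (t0+u) = H T' (t0+u)" if "\<bar>u\<bar> < d0" for u
      using H(2)[of T] H(2)[of T'] that by (auto simp: abs_less_iff)
    show ?thesis
      by (rule unit_on_unique[of "{-e0<..<T}" _ _ t0 d0]) (use H(1)[of T] H(1)[of T'] that t0 eq in auto)
  qed
  define h where "h t = H (t+1) t" for t
  have hT: "h t = H T t" if "-e0 < t" "t < T" for t T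
  proof (cases "t+1 \<le> T")
    case True
    show ?thesis unfolding h_def by (rule agree[OF True that(1)]) simp
  next
    case False
    show ?thesis unfolding h_def by (rule agree[OF _ that, symmetric]) (use False in simp)
  qed
  have "unit_speed_at X \<tau> h t" if "t \<in> {-e0<..}" for t
    by (rule unit_speed_at_cong[of X \<tau> "H (t+1)" t "{-e0<..<t+1}"]) (use H(1)[of "t+1"] hT that in auto)
  moreover have "h t = f t" if "t \<in> {-e0<..<e0}" for t unfolding h_def using H(2) that by blast
  ultimately show ?thesis by blast
qed

text \<open>
  The two rays that start at \<open>p\<close> in opposite directions are glued along the chart at \<open>p\<close>.
\<close>

lemma unit_path_exists:
  assumes p: "p \<in> X"
  shows "\<exists>h. unit_on UNIV h \<and> h 0 = p"
proof -
  obtain e f where f: "unit_chart X \<tau> e f" "f 0 = p" using charts[OF p] by blast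
  have e: "e > 0" using f unfolding unit_chart_def by blast
  have f': "unit_chart X \<tau> e (\<lambda>u. f (0 + (-1)*u))" by (rule unit_chart_shift[OF f(1)]) (use e in auto)
  obtain h1 where h1: "unit_on {-e<..} h1" "\<forall>t\<in>{-e<..<e}. h1 t = f t" using extend_ray[OF f(1)] by blast
  obtain h2 where h2: "unit_on {-e<..} h2" "\<forall>t\<in>{-e<..<e}. h2 t = f (0 + (-1)*t)" using extend_ray[OF f'] by blast
  define h where "h t = (if t > -e then h1 t else h2 (-t))" for t
  have hk: "h t = h2 (0 + (-1)*t)" if "t < e" for t
  proof (cases "t > -e")
    case True
    then have "h t = f t" using h1(2) that by (simp add: h_def)
    moreover have "h2 (-t) = f (0 + (-1)*(-t))" by (rule bspec[OF h2(2)]) (use True that in simp)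
    ultimately show ?thesis by simp
  qed (simp add: h_def)
  have "unit_speed_at X \<tau> h t" for t
  proof (cases "t > -e")
    case True
    have "unit_speed_at X \<tau> h1 t" using h1(1) True by blast
    then show ?thesis by (rule unit_speed_at_cong[where S="{-e<..}"]) (use True in \<open>auto simp: h_def\<close>)
  next
    case False
    have "0 + (-1)*t \<in> {-e<..}" using False e by simp
    then have "unit_speed_at X \<tau> h2 (0 + (-1)*t)" using h2(1) by blast
    then have "unit_speed_at X \<tau> (\<lambda>t. h2 (0 + (-1)*t)) t" by (rule unit_speed_at_affine) simp
    then show ?thesis
    proof (rule unit_speed_at_cong[where S="{..<e}"])
      show "t \<in> {..<e}" using False e by simp
      show "h x = h2 (0 + (-1)*x)" if "x \<in> {..<e}" for x using that by (intro hk) simp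
    qed simp
  qed
  moreover have "h 0 = p" using bspec[OF h1(2), of 0] f(2) e by (simp add: h_def)
  ultimately show ?thesis by blast
qed

lemma unit_path_continuous: "unit_on UNIV h \<Longrightarrow> continuous_on A h"
  using unit_speed_at_isCont(1) continuous_at_imp_continuous_on by blast

text \<open>
  By \<open>chart_follow\<close> the path keeps step with the chart for as long as the chart lasts.
\<close>

lemma chart_absorbed:
  assumes f: "unit_chart X \<tau> e f" and h: "unit_on UNIV h" and x: "\<bar>x\<bar> < e" "h t = f x"
  shows "f ` {-e<..<e} \<subseteq> range h"
proof
  fix y assume "y \<in> f ` {-e<..<e}"
  then obtain z where "z \<in> {-e<..<e}" and zy: "y = f z" by blast
  then have z: "\<bar>z\<bar> < e" "y = f z" by auto
  obtain c where c: "c \<in> {1,-1}" "\<And>u. \<bar>x + c*u\<bar> < e \<Longrightarrow> h (t+u) = f (x + c*u)"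
    using chart_follow[OF f open_UNIV connected_UNIV UNIV_I h x] by blast
  have "x + c*(c*(z-x)) = z" using c(1) by auto
  then show "y \<in> range h" using c(2)[of "c*(z-x)"] z by (metis rangeI)
qed

text \<open>
  By \<open>chart_absorbed\<close> each chart lies in the image or is disjoint from it; hence the image is open and closed
  in \<open>X\<close>.
\<close>

lemma range_unit_path_component:
  assumes h: "unit_on UNIV h"
  shows "range h \<in> components X"
proof -
  have sub: "range h \<subseteq> X" using h unit_speed_at_isCont(2) by blast
  have conn: "connected (range h)" by (rule connected_continuous_image[OF unit_path_continuous[OF h] connected_UNIV])
  have nb: "\<exists>U. openin (top_of_set X) U \<and> q \<in> U \<and> (U \<subseteq> range h \<or> U \<inter> range h = {})" if q: "q \<in> X" for q
  proof -
    obtain e f where f: "unit_chart X \<tau> e f" "f 0 = q" using charts[OF q] by blast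
    have e: "e > 0" "openin (top_of_set X) (f ` {-e<..<e})" using f unfolding unit_chart_def by blast+
    have "f ` {-e<..<e} \<subseteq> range h" if ne: "f ` {-e<..<e} \<inter> range h \<noteq> {}"
    proof -
      obtain x t where "x \<in> {-e<..<e}" "h t = f x" using ne by (metis Int_emptyI imageE)
      then show ?thesis using chart_absorbed[OF f(1) h, of x t] by (auto simp: abs_less_iff)
    qed
    moreover have "q \<in> f ` {-e<..<e}" using f(2) e(1) by (intro image_eqI[of _ _ 0]) auto
    ultimately show ?thesis using e(2) by blast
  qed
  have op: "openin (top_of_set X) (range h)"
  proof (subst openin_subopen, intro ballI)
    fix q assume q: "q \<in> range h"
    then obtain U where "openin (top_of_set X) U" "q \<in> U" "U \<subseteq> range h \<or> U \<inter> range h = {}" using nb sub by blast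
    then show "\<exists>T. openin (top_of_set X) T \<and> q \<in> T \<and> T \<subseteq> range h" using q by blast
  qed
  have op2: "openin (top_of_set X) (X - range h)"
  proof (subst openin_subopen, intro ballI)
    fix q assume q: "q \<in> X - range h"
    then obtain U where U: "openin (top_of_set X) U" "q \<in> U" "U \<subseteq> range h \<or> U \<inter> range h = {}" using nb by blast
    then have "U \<subseteq> X" using openin_imp_subset by blast
    then show "\<exists>T. openin (top_of_set X) T \<and> q \<in> T \<and> T \<subseteq> X - range h" using U q by blast
  qed
  have cl: "closedin (top_of_set X) (range h)"
    using op2 sub by (simp add: closedin_def)
  show ?thesis unfolding in_components_maximal
  proof (intro conjI allI impI)
    fix d assume d: "d \<noteq> {} \<and> range h \<subseteq> d \<and> d \<subseteq> X \<and> connected d"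
    have "openin (top_of_set d) (range h)" "closedin (top_of_set d) (range h)"
      using op cl d openin_subset_trans closedin_subset_trans by blast+
    then show "d = range h" using d connected_clopen[of d] by blast
  qed (use sub conn in auto)
qed

lemma component_path:
  assumes "C \<in> components X"
  obtains h where "unit_on UNIV h" "range h = C"
proof -
  obtain p where p: "p \<in> X" "p \<in> C" using assms in_components_nonempty in_components_subset by blast
  obtain h where h: "unit_on UNIV h" "h 0 = p" using unit_path_exists[OF p(1)] by blast
  have "range h \<inter> C \<noteq> {}" using h(2) p(2) by blast
  then have "range h = C" using range_unit_path_component[OF h(1)] assms components_nonoverlap by blast
  then show ?thesis using that h by blast
qed

text \<open>
  A continuous bijection from the line need not be a homeomorphism. Here it is one because charts are open in \<open>X\<close>.
\<close>

lemma injective_path_homeomorphism: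
  assumes h: "unit_on UNIV h" and inj: "inj h"
  shows "homeomorphism UNIV (range h) h (inv h)"
proof -
  have op: "openin (top_of_set (range h)) (h ` U)" if oU: "open U" for U
  proof -
  have "openin (top_of_set X) (h ` U)"
  proof (rule openin_subopen[THEN iffD2], intro ballI)
    fix y assume "y \<in> h ` U"
    then obtain t where t: "t \<in> U" "y = h t" by blast
    obtain d where d: "d > 0" "\<And>s. dist s t < d \<Longrightarrow> s \<in> U" using oU t(1) unfolding open_dist by blast
    have "h t \<in> X" using h unit_speed_at_isCont(2) by blast
    then obtain e f where f: "unit_chart X \<tau> e f" "f 0 = h t" using charts by blast
    have e: "e > 0" using f unfolding unit_chart_def by blast
    define e' where "e' = min e d"
    have e': "e' > 0" "e' \<le> e" "e' \<le> d" using e d by (auto simp: e'_def)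
    have f': "unit_chart X \<tau> e' (\<lambda>u. f (0 + 1*u))" by (rule unit_chart_shift[OF f(1)]) (use e' in auto)
    then have o: "openin (top_of_set X) (f ` {-e'<..<e'})" unfolding unit_chart_def by simp
    obtain c where c: "c \<in> {1,-1}" "\<And>u. \<bar>0 + c*u\<bar> < e \<Longrightarrow> h (t+u) = f (0 + c*u)"
      using chart_follow[OF f(1) open_UNIV connected_UNIV UNIV_I h, of 0 t] f(2) e by (metis UNIV_I abs_zero)
    have "f ` {-e'<..<e'} \<subseteq> h ` U"
    proof
      fix z assume "z \<in> f ` {-e'<..<e'}"
      then obtain x where "x \<in> {-e'<..<e'}" and zx: "z = f x" by blast
      then have x: "\<bar>x\<bar> < e'" "z = f x" by auto
      have "h (t + c*x) = f (0 + c*(c*x))" by (rule c(2)) (use c(1) x e' in auto)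
      then have "z = h (t + c*x)" using c(1) x(2) by auto
      moreover have "t + c*x \<in> U" by (rule d(2)) (use c(1) x e' in \<open>auto simp: dist_real_def\<close>)
      ultimately show "z \<in> h ` U" by blast
    qed
    moreover have "y \<in> f ` {-e'<..<e'}" using f(2) t(2) e'(1) by (intro image_eqI[of _ _ 0]) auto
    ultimately show "\<exists>T. openin (top_of_set X) T \<and> y \<in> T \<and> T \<subseteq> h ` U" using o by blast
  qed
  then show "openin (top_of_set (range h)) (h ` U)"
    using openin_subset_trans[of X "h ` U" "range h"] h unit_speed_at_isCont(2) by blast
  qed
  have op': "openin (top_of_set (range h)) (h ` U)" if "openin (top_of_set UNIV) U" for U
    by (rule op) (use that in \<open>metis open_openin subtopology_UNIV\<close>)
  have "continuous_on (range h) (inv h)"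
    by (rule continuous_on_inverse_open_map[OF unit_path_continuous[OF h, of UNIV] refl inv_f_f[OF inj] op'])
  then show ?thesis
    unfolding homeomorphism_def using unit_path_continuous[OF h, of UNIV] inj by (simp add: f_inv_into_f image_inv_f_f)
qed

end

section \<open>Transversal zeros and sign changes\<close>

lemma same_sign_if_no_zeros:
  fixes g :: "real \<Rightarrow> real"
  assumes "continuous_on {x..y} g" "x \<le> y" "\<And>t. t \<in> {x..y} \<Longrightarrow> g t \<noteq> 0"
  shows "g x * g y > 0"
proof (rule ccontr)
  assume n: "\<not> g x * g y > 0"
  have xy: "g x \<noteq> 0" "g y \<noteq> 0" using assms by auto
  then consider "g x \<le> 0" "0 \<le> g y" | "g y \<le> 0" "0 \<le> g x"
    using n by (meson linorder_not_le mult_neg_neg mult_pos_pos order_le_less)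
  then show False
  proof cases
    case 1 then show False using IVT'[of g x 0 y] assms by (metis atLeastAtMost_iff)
  next
    case 2 then show False using IVT2'[of g y 0 x] assms by (metis atLeastAtMost_iff)
  qed
qed

text \<open>
  Transversality makes the sign change at each zero, so the sign at \<open>b\<close> is the sign at \<open>a\<close> times \<open>-1\<close> to
  the number of zeros.
\<close>

lemma odd_card_zeros_iff_sign_change:
  fixes g :: "real \<Rightarrow> real"
  assumes "continuous_on {a..b} g" "a < b" "finite {t\<in>{a<..<b}. g t = 0}" "g a \<noteq> 0" "g b \<noteq> 0"
    and "\<And>t. t \<in> {a<..<b} \<Longrightarrow> g t = 0 \<Longrightarrow> \<exists>c\<in>{1,-1}. \<exists>d>0. \<forall>u. \<bar>u\<bar> < d \<longrightarrow> g (t+u) = c*u"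
  shows "odd (card {t\<in>{a<..<b}. g t = 0}) \<longleftrightarrow> g a * g b < 0"
proof -
  have "n = card {t\<in>{a<..<b}. g t = 0} \<Longrightarrow> odd n \<longleftrightarrow> g a * g b < 0" for n
  using assms
proof (induction n arbitrary: b)
  case 0
  then have "{t\<in>{a<..<b}. g t = 0} = {}" by (metis (no_types, lifting) card_0_eq)
  then have "g t \<noteq> 0" if "t \<in> {a..b}" for t
    using that "0.prems"(5,6) by (cases "t = a \<or> t = b") (blast, force)
  then have "g a * g b > 0" using same_sign_if_no_zeros[of a b g] "0.prems"(2,3) by simp
  then show ?case by simp
next
  case (Suc n)
  let ?Z = "{t\<in>{a<..<b}. g t = 0}"
  have ne: "?Z \<noteq> {}" "finite ?Z" using Suc.prems(4,1) by (metis card.empty nat.distinct(1)) (rule Suc.prems(4))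
  define z where "z = Max ?Z"
  have z: "z \<in> ?Z" unfolding z_def using Max_in[OF ne(2,1)] .
  have zmax: "t \<le> z" if "t \<in> ?Z" for t unfolding z_def using Max_ge[OF ne(2) that] .
  obtain c d where cd: "c \<in> {1,-1}" "d > 0" "\<And>u. \<bar>u\<bar> < d \<Longrightarrow> g (z+u) = c*u" using Suc.prems(7)[of z] z by blast
  define m where "m = Max (insert a (?Z - {z}))"
  have m: "m < z" unfolding m_def using ne z zmax by (subst Max_less_iff) (auto simp: order.strict_iff_order)
  have mge: "t \<le> m" if "t = a \<or> t \<in> ?Z - {z}" for t unfolding m_def using that ne by (intro Max_ge) auto
  define r where "r = min d (min (z - m) (b - z)) / 2"
  have r: "r > 0" "r < d" "r < z - m" "r < b - z" using cd(2) m z by (auto simp: r_def)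
  define w where "w = z - r"
  define y where "y = z + r"
  have gw: "g w = - (c*r)" using cd(3)[of "-r"] r by (simp add: w_def)
  have gy: "g y = c*r" using cd(3)[of r] r by (simp add: y_def)
  have aw: "a < w" using mge[of a] r by (simp add: w_def)
  have wb: "w < b" using r z by (simp add: w_def)
  have Zw: "{t\<in>{a<..<w}. g t = 0} = ?Z - {z}"
    using mge r wb by (fastforce simp: w_def)
  have "card (?Z - {z}) = n" using Suc.prems(1) z ne by simp
  then have cw: "n = card {t\<in>{a<..<w}. g t = 0}" using Zw by simp
  have IH: "odd n \<longleftrightarrow> g a * g w < 0"
  proof (rule Suc.IH[OF cw _ aw])
    show "continuous_on {a..w} g" by (rule continuous_on_subset[OF Suc.prems(2)]) (use wb in auto)
    show "finite {t\<in>{a<..<w}. g t = 0}" unfolding Zw using ne by simp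
    show "g w \<noteq> 0" using gw r cd(1) by auto
    show "\<exists>c\<in>{1,-1}. \<exists>d>0. \<forall>u. \<bar>u\<bar> < d \<longrightarrow> g (t+u) = c*u" if "t \<in> {a<..<w}" "g t = 0" for t
      using Suc.prems(7)[of t] that wb by auto
  qed (rule Suc.prems(5))
  have "g y * g b > 0"
  proof (rule same_sign_if_no_zeros[of y b g])
    show "continuous_on {y..b} g" by (rule continuous_on_subset[OF Suc.prems(2)]) (use z r in \<open>auto simp: y_def\<close>)
    show "y \<le> b" using r by (simp add: y_def)
    fix t assume t: "t \<in> {y..b}"
    show "g t \<noteq> 0"
    proof
      assume "g t = 0"
      then have "t \<in> ?Z" using t Suc.prems(6) z r by (cases "t = b") (auto simp: y_def)
      then show False using zmax[of t] t r by (auto simp: y_def)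
    qed
  qed
  then have "(g a * g b < 0) = (\<not> g a * g w < 0)"
    using gw gy cd(1) r(1) Suc.prems(5) by (auto simp: zero_less_mult_iff mult_less_0_iff)
  then show ?case using IH by simp
qed
  then show ?thesis by blast
qed

section \<open>A free action of order four that flips the sign\<close>

text \<open>
  The abstract setting of the count: \<open>X\<close> stands for the space of rectangles, \<open>\<tau>\<close> for the logarithm of the aspect ratio
  and \<open>s\<close> for relabeling by one step.
\<close>

locale free_flip_space = unit_speed_space X \<tau> for X :: "'a::metric_space set" and \<tau> +
  fixes s :: "'a \<Rightarrow> 'a"
  assumes s_in: "\<And>x. x \<in> X \<Longrightarrow> s x \<in> X"
    and s_cont: "continuous_on X s"
    and s_four: "\<And>x. x \<in> X \<Longrightarrow> s (s (s (s x))) = x"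
    and s_free: "\<And>x. x \<in> X \<Longrightarrow> s (s x) \<noteq> x"
    and s_tau: "\<And>x. x \<in> X \<Longrightarrow> \<tau> (s x) = - \<tau> x"
    and regular_zero: "\<And>x. x \<in> X \<Longrightarrow> \<tau> x = 0 \<Longrightarrow> \<exists>e f. unit_chart X \<tau> e f \<and> f 0 = x \<and> (\<forall>u. \<bar>u\<bar> < e \<longrightarrow> \<tau> (f u) = u)"
begin

lemma pow_in: "x \<in> X \<Longrightarrow> (s ^^ n) x \<in> X"
  by (induction n) (auto intro: s_in)

lemma pow_four_mult: "x \<in> X \<Longrightarrow> (s ^^ (4 * k)) x = x"
proof (induction k)
  case (Suc k)
  have "(s ^^ (4 * Suc k)) x = s (s (s (s ((s ^^ (4*k)) x))))" by (simp add: eval_nat_numeral)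
  then show ?case using Suc s_four by simp
qed simp

lemma pow_add: "(s ^^ (m + n)) x = (s ^^ m) ((s ^^ n) x)"
  by (simp add: funpow_add)

lemma pow_mod: "x \<in> X \<Longrightarrow> (s ^^ n) x = (s ^^ (n mod 4)) x"
  using pow_add[of "n mod 4" "4 * (n div 4)" x] pow_four_mult[of x "n div 4"] by simp

lemma pow_fix_iff:
  assumes x: "x \<in> X" shows "(s ^^ n) x = x \<longleftrightarrow> 4 dvd n"
proof -
  have f1: "s x \<noteq> x" using s_free[OF x] by metis
  have f3: "s (s (s x)) \<noteq> x" using s_four[OF x] f1 by metis
  have "n mod 4 < 4" by simp
  then consider "n mod 4 = 0" | "n mod 4 = 1" | "n mod 4 = 2" | "n mod 4 = 3" by linarith
  then show ?thesis
  proof cases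
    case 1
    then have "(s ^^ n) x = (s ^^ 0) x" using pow_mod[OF x, of n] by metis
    then show ?thesis using 1 by (simp add: dvd_eq_mod_eq_0)
  next
    case 2
    then have "(s ^^ n) x = (s ^^ 1) x" using pow_mod[OF x, of n] by metis
    then show ?thesis using 2 f1 by (simp add: dvd_eq_mod_eq_0)
  next
    case 3
    then have "(s ^^ n) x = (s ^^ 2) x" using pow_mod[OF x, of n] by metis
    then have "(s ^^ n) x = s (s x)" by (simp add: eval_nat_numeral)
    then show ?thesis using 3 s_free[OF x] by (simp add: dvd_eq_mod_eq_0)
  next
    case 4
    then have "(s ^^ n) x = (s ^^ 3) x" using pow_mod[OF x, of n] by metis
    then have "(s ^^ n) x = s (s (s x))" by (simp add: eval_nat_numeral)
    then show ?thesis using 4 f3 by (simp add: dvd_eq_mod_eq_0)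
  qed
qed

lemma pow_eq_iff:
  assumes x: "x \<in> X" shows "(s ^^ m) x = (s ^^ n) x \<longleftrightarrow> m mod 4 = n mod 4"
proof
  assume eq: "(s ^^ m) x = (s ^^ n) x"
  have "(s ^^ (3*n + m)) x = (s ^^ (3*n + n)) x" unfolding pow_add eq ..
  also have "\<dots> = x" using pow_four_mult[OF x, of n] by simp
  finally have "4 dvd 3*n + m" using pow_fix_iff[OF x] by blast
  then show "m mod 4 = n mod 4" by presburger
next
  assume "m mod 4 = n mod 4" then show "(s ^^ m) x = (s ^^ n) x" using pow_mod[OF x] by metis
qed

lemma pow_inverse: "x \<in> X \<Longrightarrow> (s ^^ (3*n)) ((s ^^ n) x) = x" "x \<in> X \<Longrightarrow> (s ^^ n) ((s ^^ (3*n)) x) = x"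
  using pow_four_mult[of x n] by (simp_all flip: pow_add)

lemma pow_tau: "x \<in> X \<Longrightarrow> \<tau> ((s ^^ n) x) = (-1)^n * \<tau> x"
  by (induction n) (auto simp: s_tau pow_in)

lemma pow_cont: "continuous_on X (s ^^ n)"
proof (induction n)
  case (Suc n)
  have "continuous_on X (s \<circ> (s ^^ n))"
    by (rule continuous_on_compose[OF Suc]) (use s_cont pow_in in \<open>auto intro: continuous_on_subset\<close>)
  then show ?case by simp
qed (simp add: continuous_on_id id_def)

lemma unit_speed_pow:
  assumes h: "unit_speed_at X \<tau> h t" shows "unit_speed_at X \<tau> (\<lambda>t. (s ^^ n) (h t)) t"
proof -
  obtain d where d: "d > 0" "h ` {t-d<..<t+d} \<subseteq> X" "continuous_on {t-d<..<t+d} h"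
      "inj_on h {t-d<..<t+d}" "\<And>u. \<bar>u\<bar> < d \<Longrightarrow> \<bar>\<tau> (h (t+u)) - \<tau> (h t)\<bar> = \<bar>u\<bar>"
    using h unfolding unit_speed_at_def by blast
  have hX: "h x \<in> X" if "x \<in> {t-d<..<t+d}" for x using d(2) that by blast
  have "continuous_on {t-d<..<t+d} (\<lambda>t. (s ^^ n) (h t))"
    by (rule continuous_on_compose2[OF pow_cont d(3,2)])
  moreover have "inj_on (\<lambda>t. (s ^^ n) (h t)) {t-d<..<t+d}"
  proof (rule inj_onI)
    fix x y assume xy: "x \<in> {t-d<..<t+d}" "y \<in> {t-d<..<t+d}" "(s ^^ n) (h x) = (s ^^ n) (h y)"
    have "h x = (s ^^ (3*n)) ((s ^^ n) (h x))" by (rule pow_inverse(1)[OF hX[OF xy(1)], symmetric])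
    also have "\<dots> = (s ^^ (3*n)) ((s ^^ n) (h y))" unfolding xy(3) ..
    also have "\<dots> = h y" by (rule pow_inverse(1)[OF hX[OF xy(2)]])
    finally show "x = y" using inj_onD[OF d(4)] xy by blast
  qed
  moreover have "\<bar>\<tau> ((s ^^ n) (h (t+u))) - \<tau> ((s ^^ n) (h t))\<bar> = \<bar>u\<bar>" if "\<bar>u\<bar> < d" for u
  proof -
    have "h (t+u) \<in> X" "h t \<in> X" using that d(1) by (auto intro!: hX)
    then have "\<tau> ((s ^^ n) (h (t+u))) - \<tau> ((s ^^ n) (h t)) = (-1)^n * (\<tau> (h (t+u)) - \<tau> (h t))"
      by (simp add: pow_tau algebra_simps)
    then show ?thesis using d(5)[OF that] by (simp add: abs_mult)
  qed
  ultimately show ?thesis unfolding unit_speed_at_def using d(1) hX pow_in by blast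
qed

text \<open>
  A power of \<open>s\<close> that maps one point of a complete path to another acts on the path by an isometry of the line. A
  reflection would fix the midpoint, so that power of \<open>s\<close> is the identity, and the path would be folded there,
  against local injectivity.
\<close>

lemma unit_path_translate:
  assumes h: "unit_on UNIV h" and eq: "(s ^^ n) (h a) = h b"
  shows "(s ^^ n) (h (a+u)) = h (b+u)"
proof -
  have hX: "h t \<in> X" for t using h unit_speed_at_isCont(2) by blast
  have k: "unit_on UNIV (\<lambda>t. (s ^^ n) (h t))" using h unit_speed_pow by blast
  obtain c where c: "c \<in> {1,-1}" "\<And>u. (s ^^ n) (h (a+u)) = h (b+c*u)"
    using unit_on_UNIV_meet[OF k h eq] by blast
  have "c \<noteq> -1"
  proof
    assume c1: "c = -1"
    define m where "m = (a+b)/2"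
    have am: "a + ((b-a)/2 + y) = m + y" "b - ((b-a)/2 + y) = m - y" for y
      by (simp_all add: m_def field_simps)
    have r: "(s ^^ n) (h (m+y)) = h (m-y)" for y
      using c(2)[of "(b-a)/2 + y"] unfolding c1 mult_minus_left mult_1 add_uminus_conv_diff am .
    have "4 dvd n" using r[of 0] pow_fix_iff[OF hX, of n m] by simp
    then have r': "h (m+y) = h (m-y)" for y using r[of y] pow_fix_iff[OF hX] by metis
    obtain d where d: "d > 0" "inj_on h {m-d<..<m+d}" using h unfolding unit_speed_at_def by blast
    have "m + d/2 = m - d/2" using r'[of "d/2"] d(1) by (intro inj_onD[OF d(2)]) auto
    then show False using d(1) by simp
  qed
  then show ?thesis using c by auto
qed

definition orb :: "'a \<Rightarrow> 'a set" where "orb x = range (\<lambda>n. (s ^^ n) x)"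

lemma orb_eq_iff: assumes "x \<in> X" "y \<in> X" shows "orb x = orb y \<longleftrightarrow> (\<exists>n. y = (s ^^ n) x)"
proof
  assume "orb x = orb y"
  moreover have "(s ^^ 0) y \<in> orb y" unfolding orb_def by blast
  ultimately show "\<exists>n. y = (s ^^ n) x" unfolding orb_def by auto
next
  have sub: "orb ((s ^^ n) x) \<subseteq> orb x" for n x
    unfolding orb_def using pow_add by (metis (no_types, lifting) image_subsetI rangeI)
  assume "\<exists>n. y = (s ^^ n) x"
  then obtain n where n: "y = (s ^^ n) x" by blast
  then have "x = (s ^^ (3*n)) y" using pow_inverse(1)[OF assms(1)] by simp
  then show "orb x = orb y" using sub[of n x] sub[of "3*n" y] n by simp
qed

text \<open>
  Squares up to relabeling that have some labeling in the component \<open>C\<close>.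
\<close>

definition zero_orbits :: "'a set \<Rightarrow> 'a set set" where
  "zero_orbits C = orb ` {x\<in>X. \<tau> x = 0 \<and> orb x \<inter> C \<noteq> {}}"

lemma finite_zeros_on_interval:
  assumes h: "unit_on UNIV h"
  shows "finite {t\<in>{a..b}. \<tau> (h t) = 0}"
    and "\<tau> (h t) = 0 \<Longrightarrow> \<exists>c\<in>{1,-1}. \<exists>d>0. \<forall>u. \<bar>u\<bar> < d \<longrightarrow> \<tau> (h (t+u)) = c*u"
proof -
  have hX: "h t \<in> X" for t using h unit_speed_at_isCont(2) by blast
  show cr: "\<exists>c\<in>{1,-1}. \<exists>d>0. \<forall>u. \<bar>u\<bar> < d \<longrightarrow> \<tau> (h (t+u)) = c*u" if z: "\<tau> (h t) = 0" for t
  proof -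
    obtain e f where f: "unit_chart X \<tau> e f" "f 0 = h t" "\<And>u. \<bar>u\<bar> < e \<Longrightarrow> \<tau> (f u) = u"
      using regular_zero[OF hX z] by blast
    have e: "e > 0" using f unfolding unit_chart_def by blast
    have "h t = f 0" "\<bar>0\<bar> < e" "unit_speed_at X \<tau> h t" using f e h by auto
    from chart_rigid[OF f(1) this(3,2,1)]
    obtain d c where "d > 0" "c \<in> {1,-1}" "\<And>u. \<bar>u\<bar> < d \<Longrightarrow> \<bar>0+c*u\<bar> < e \<and> h (t+u) = f (0+c*u)" by blast
    then show ?thesis using f(3) by (metis add_0)
  qed
  have "finite ({a..b} \<inter> {t. \<tau> (h t) = 0})"
  proof (rule finite_not_islimpt_in_compact)
    fix z assume "z \<in> {a..b}"
    show "\<not> z islimpt {t. \<tau> (h t) = 0}"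
    proof
      assume l: "z islimpt {t. \<tau> (h t) = 0}"
      have "continuous_on UNIV (\<lambda>t. \<tau> (h t))"
        by (rule continuous_on_compose2[OF continuous_tau unit_path_continuous[OF h]]) (use hX in auto)
      then have "closed {t. \<tau> (h t) = 0}"
        by (simp add: closed_Collect_eq)
      then have "\<tau> (h z) = 0" using l closed_limpt by blast
      then obtain c d where "c \<in> {1,-1}" "d > 0" "\<And>u. \<bar>u\<bar> < d \<Longrightarrow> \<tau> (h (z+u)) = c*u" using cr by blast
      note cd = this
      obtain y where y: "\<tau> (h y) = 0" "y \<noteq> z" "dist y z < d" using l cd(2) unfolding islimpt_approachable by blast
      have "\<tau> (h (z + (y - z))) = c * (y - z)" using y by (intro cd(3)) (simp add: dist_real_def)
      then show False using y cd(1) by auto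
    qed
  qed simp
  then show "finite {t\<in>{a..b}. \<tau> (h t) = 0}" by (simp add: Int_def)
qed

context
  fixes h :: "real \<Rightarrow> 'a"
  assumes h: "unit_on UNIV h"
begin

lemma path_in [simp]: "h t \<in> X"
  using h unit_speed_at_isCont(2) by blast

lemma continuous_tau_path: "continuous_on A (\<lambda>t. \<tau> (h t))"
  by (rule continuous_on_compose2[OF continuous_tau unit_path_continuous[OF h]]) auto

text \<open>
  The parameters whose point is equivalent to \<open>h 0\<close>. They form a discrete closed subgroup of the line, which is
  either trivial or generated by a positive element.
\<close>

abbreviation "Per \<equiv> {t. \<exists>n. h t = (s ^^ n) (h 0)}"

lemma Per_iff: "(\<exists>n. h b = (s ^^ n) (h a)) \<longleftrightarrow> b - a \<in> Per"
proof
  assume "\<exists>n. h b = (s ^^ n) (h a)"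
  then obtain n where n: "(s ^^ n) (h a) = h b" by metis
  then have "(s ^^ n) (h (a + (-a))) = h (b + (-a))" by (rule unit_path_translate[OF h])
  then show "b - a \<in> Per" by (auto intro: sym)
next
  assume "b - a \<in> Per"
  then obtain n where n: "(s ^^ n) (h 0) = h (b - a)" by auto
  then have "(s ^^ n) (h (0 + a)) = h (b - a + a)" by (rule unit_path_translate[OF h])
  then show "\<exists>n. h b = (s ^^ n) (h a)" by (intro exI[of _ n]) simp
qed

lemma orb_path_iff: "orb (h a) = orb (h b) \<longleftrightarrow> b - a \<in> Per"
  using orb_eq_iff[of "h a" "h b"] Per_iff[of b a] by simp

lemma Per_diff: "a \<in> Per \<Longrightarrow> b \<in> Per \<Longrightarrow> a - b \<in> Per"
  using orb_path_iff[of 0 a] orb_path_iff[of 0 b] orb_path_iff[of b a] by simp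

lemma zero_orbits_path: "zero_orbits (range h) = (\<lambda>t. orb (h t)) ` {t. \<tau> (h t) = 0}"
proof (intro equalityI subsetI)
  fix A assume "A \<in> zero_orbits (range h)"
  then obtain x where x: "x \<in> X" "\<tau> x = 0" "orb x \<inter> range h \<noteq> {}" "A = orb x" unfolding zero_orbits_def by blast
  then obtain n t where nt: "(s ^^ n) x = h t" unfolding orb_def by force
  then have "orb (h t) = orb x" using orb_eq_iff[of x "h t"] x(1) by (metis path_in)
  moreover have "\<tau> (h t) = 0" using pow_tau[OF x(1), of n] nt x(2) by simp
  ultimately show "A \<in> (\<lambda>t. orb (h t)) ` {t. \<tau> (h t) = 0}" using x(4) by blast
next
  fix A assume "A \<in> (\<lambda>t. orb (h t)) ` {t. \<tau> (h t) = 0}"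
  then obtain t where t: "A = orb (h t)" "\<tau> (h t) = 0" by blast
  have "(s ^^ 0) (h t) \<in> orb (h t)" unfolding orb_def by blast
  then have "orb (h t) \<inter> range h \<noteq> {}" by auto
  then show "A \<in> zero_orbits (range h)" using t unfolding zero_orbits_def by auto
qed

lemma Per_discrete: "\<exists>\<delta>>0. \<forall>t. 0 < t \<and> t < \<delta> \<longrightarrow> t \<notin> Per"
proof -
  have sep: "\<exists>\<delta>>0. \<forall>t. 0 < t \<and> t < \<delta> \<longrightarrow> h t \<noteq> (s ^^ n) (h 0)" for n
  proof (cases "4 dvd n")
    case True
    then have eq: "(s ^^ n) (h 0) = h 0" using pow_fix_iff by simp
    obtain d where d: "d > 0" "inj_on h {0-d<..<0+d}" using h unfolding unit_speed_at_def by blast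
    have "h t \<noteq> h 0" if "0 < t \<and> t < d" for t
    proof
      assume "h t = h 0" then have "t = 0" using that by (intro inj_onD[OF d(2)]) auto
      then show False using that by simp
    qed
    then show ?thesis using d(1) eq by metis
  next
    case False
    then have ne: "dist (h 0) ((s ^^ n) (h 0)) > 0" using pow_fix_iff[of "h 0" n] by simp
    have "isCont h 0" using h unit_speed_at_isCont(1) by blast
    then obtain d where d: "d > 0" "\<And>t. dist t 0 < d \<Longrightarrow> dist (h t) (h 0) < dist (h 0) ((s ^^ n) (h 0))"
      unfolding continuous_at_eps_delta using ne by metis
    have "h t \<noteq> (s ^^ n) (h 0)" if "0 < t \<and> t < d" for t
      using d(2)[of t] that by (auto simp: dist_commute dist_real_def)
    then show ?thesis using d(1) by blast
  qed
  then obtain \<delta> where \<delta>: "\<And>n. \<delta> n > 0" "\<And>n t. 0 < t \<Longrightarrow> t < \<delta> n \<Longrightarrow> h t \<noteq> (s ^^ n) (h 0)" by metis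
  define m where "m = Min (\<delta> ` {..<4::nat})"
  have m0: "m > 0" unfolding m_def using \<delta>(1) by (subst Min_gr_iff) (auto simp: lessThan_empty_iff)
  have mle: "m \<le> \<delta> n" if "n < 4" for n unfolding m_def using that by (intro Min_le) auto
  have "t \<notin> Per" if t: "0 < t \<and> t < m" for t
  proof
    assume "t \<in> Per"
    then obtain n where n: "h t = (s ^^ n) (h 0)" by auto
    then have "h t = (s ^^ (n mod 4)) (h 0)" using pow_mod[of "h 0" n] by simp
    then show False using \<delta>(2)[of t "n mod 4"] mle[of "n mod 4"] t by fastforce
  qed
  then show ?thesis using m0 by blast
qed

lemma Per_closed: "closed Per"
proof -
  have "Per = h -` ((\<lambda>n. (s ^^ n) (h 0)) ` {..<4})"
  proof (intro equalityI subsetI)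
    fix t assume "t \<in> Per"
    then obtain n where "h t = (s ^^ n) (h 0)" by auto
    then have "h t = (s ^^ (n mod 4)) (h 0)" using pow_mod[of "h 0" n] by simp
    then show "t \<in> h -` ((\<lambda>n. (s ^^ n) (h 0)) ` {..<4})" by auto
  qed auto
  moreover have "closed (h -` ((\<lambda>n. (s ^^ n) (h 0)) ` {..<4}))"
    by (rule closed_vimage) (auto intro!: finite_imp_closed unit_path_continuous[OF h])
  ultimately show ?thesis by simp
qed

lemma minimal_period:
  assumes "a \<in> Per" "a \<noteq> 0"
  obtains T where "T > 0" "T \<in> Per" "\<And>t. 0 < t \<Longrightarrow> t < T \<Longrightarrow> t \<notin> Per"
proof -
  obtain \<delta> where \<delta>: "\<delta> > 0" "\<And>t. 0 < t \<Longrightarrow> t < \<delta> \<Longrightarrow> t \<notin> Per" using Per_discrete by blast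
  define A where "A = Per \<inter> {\<delta>..}"
  have P0: "0 \<in> Per" by (auto intro: exI[of _ 0])
  have "\<bar>a\<bar> \<in> Per" using assms(1) Per_diff[OF P0 assms(1)] by (cases "a \<ge> 0") (simp_all only: abs_of_nonneg abs_of_neg diff_0 not_le)
  then have ne: "A \<noteq> {}" using \<delta>(2)[of "\<bar>a\<bar>"] assms(2) unfolding A_def by force
  have bdd: "bdd_below A" unfolding A_def by (auto intro: bdd_belowI[of _ \<delta>])
  have cl: "closed A" unfolding A_def by (intro closed_Int Per_closed) simp
  have In: "Inf A \<in> A" by (rule closed_contains_Inf[OF ne bdd cl])
  show ?thesis
  proof
    show "Inf A > 0" "Inf A \<in> Per" using In \<delta>(1) unfolding A_def by auto
    fix t assume t: "0 < t" "t < Inf A"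
    show "t \<notin> Per"
    proof
      assume "t \<in> Per"
      then have "t \<in> A" using \<delta>(2)[of t] t unfolding A_def by force
      then show False using cInf_lower[OF _ bdd] t(2) by force
    qed
  qed
qed

lemma Per_mult:
  assumes T: "h T = (s ^^ j) (h 0)"
  shows "h (t + real m * T) = (s ^^ (j*m)) (h t)"
proof (induction m)
  case (Suc m)
  have "h (t + real (Suc m) * T) = h (T + (t + real m * T))" by (simp add: algebra_simps)
  also have "\<dots> = (s ^^ j) (h (0 + (t + real m * T)))"
    using unit_path_translate[OF h T[symmetric], of "t + real m * T"] by simp
  also have "\<dots> = (s ^^ j) ((s ^^ (j*m)) (h t))" using Suc by simp
  also have "\<dots> = (s ^^ (j * Suc m)) (h t)" by (simp flip: pow_add)
  finally show ?case .
qed simp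

lemma exists_nonzero: "\<exists>t. \<tau> (h t) \<noteq> 0"
proof -
  obtain d where d: "d > 0" "\<And>u. \<bar>u\<bar> < d \<Longrightarrow> \<bar>\<tau> (h (0+u)) - \<tau> (h 0)\<bar> = \<bar>u\<bar>"
    using h unfolding unit_speed_at_def by blast
  have "\<bar>\<tau> (h (d/2)) - \<tau> (h 0)\<bar> = d/2" using d(2)[of "d/2"] d(1) by simp
  then show ?thesis using d(1) by (cases "\<tau> (h 0) = 0") (auto intro: exI[of _ "d/2"])
qed

text \<open>
  An interval of length \<open>T\<close> is a fundamental domain, and \<open>\<tau>\<close> at its right end is \<open>(-1)^j\<close> times \<open>\<tau>\<close> at its left
  end. So the number of zeros is odd iff \<open>j\<close> is, that is, iff \<open>s^j\<close> generates the group and \<open>s\<close> preserves the image.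
\<close>

lemma periodic_case:
  assumes T: "T > 0" "h T = (s ^^ j) (h 0)" "\<And>t. 0 < t \<Longrightarrow> t < T \<Longrightarrow> t \<notin> Per"
  shows "finite (zero_orbits (range h))" "odd (card (zero_orbits (range h))) \<longleftrightarrow> odd j"
    "s ` range h = range h \<longleftrightarrow> odd j" "compact (range h)"
proof -
  have TP: "T \<in> Per" using T(2) by auto
  have mT: "real m * T \<in> Per" for m using Per_mult[OF T(2), of 0 m] by auto
  have four: "h (t + real (4*m) * T) = h t" for t m
    using Per_mult[OF T(2), of t "4*m"] pow_four_mult[of "h t" "j*m"] by (simp add: mult.left_commute)
  \<comment> \<open>A fundamental domain whose ends are no zeros.\<close>
  obtain x where x: "\<tau> (h x) \<noteq> 0" using exists_nonzero by blast
  \<comment> \<open>Every parameter can be moved into a given interval of length \<open>T\<close>. Multiples of four periods are added first, so that only a natural number of periods has to be subtracted.\<close>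
  have reduce: "\<exists>m::nat. \<exists>k::nat. t + real (4*k)*T - real m * T \<in> {y..<y+T}" for t y
  proof -
    obtain k where "real k > \<bar>t - y\<bar> / T" using reals_Archimedean2 by blast
    then have "real k * T > \<bar>t - y\<bar>" using T(1) by (simp add: field_simps)
    then have k: "t + real (4*k)*T - y \<ge> 0" using T(1) by simp
    define m where "m = nat \<lfloor>(t + real (4*k)*T - y) / T\<rfloor>"
    have "real m = of_int \<lfloor>(t + real (4*k)*T - y) / T\<rfloor>" unfolding m_def using k T(1) by simp
    then have "real m \<le> (t + real (4*k)*T - y) / T" "(t + real (4*k)*T - y) / T < real m + 1" by linarith+
    then have "real m * T \<le> t + real (4*k)*T - y" "t + real (4*k)*T - y < (real m + 1) * T"
      using T(1) by (simp_all add: field_simps)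
    then have "t + real (4*k)*T - real m * T \<in> {y..<y+T}" by (simp add: algebra_simps)
    then show ?thesis by blast
  qed
  let ?Z = "{t\<in>{x<..<x+T}. \<tau> (h t) = 0}"
  have xT: "\<tau> (h (x+T)) = (-1)^j * \<tau> (h x)"
    using Per_mult[OF T(2), of x 1] pow_tau[of "h x" j] by simp
  have Z: "zero_orbits (range h) = (\<lambda>t. orb (h t)) ` ?Z" unfolding zero_orbits_path
  proof (intro equalityI image_subsetI)
    fix t assume "t \<in> {t. \<tau> (h t) = 0}"
    then have t: "\<tau> (h t) = 0" by simp
    obtain m k :: nat where mk: "t + real (4*k)*T - real m * T \<in> {x..<x+T}" using reduce by blast
    let ?u = "t + real (4*k)*T - real m * T"
    have ht: "h t = (s ^^ (j*m)) (h ?u)" using Per_mult[OF T(2), of ?u m] four[of t k] by simp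
    then have o: "orb (h t) = orb (h ?u)" using orb_eq_iff[of "h ?u" "h t"] by (metis path_in)
    have z: "\<tau> (h ?u) = 0" using ht t pow_tau[of "h ?u" "j*m"] by simp
    then have "?u \<in> ?Z" using mk x by (cases "?u = x") auto
    then show "orb (h t) \<in> (\<lambda>t. orb (h t)) ` ?Z" unfolding o by (rule imageI)
  qed auto
  have inj: "inj_on (\<lambda>t. orb (h t)) ?Z"
  proof (rule inj_onI)
    fix a b assume ab: "a \<in> ?Z" "b \<in> ?Z" "orb (h a) = orb (h b)"
    have "b - a \<in> Per" "a - b \<in> Per" using ab(3) orb_path_iff[of a b] orb_path_iff[of b a] by simp_all
    then show "a = b" using T(3)[of "b-a"] T(3)[of "a-b"] ab(1,2) by force
  qed
  have finZ: "finite ?Z" by (rule finite_subset[OF _ finite_zeros_on_interval(1)[OF h, of x "x+T"]]) auto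
  show "finite (zero_orbits (range h))" unfolding Z using finZ by simp
  have "odd (card ?Z) \<longleftrightarrow> \<tau> (h x) * \<tau> (h (x+T)) < 0"
    by (rule odd_card_zeros_iff_sign_change[OF continuous_tau_path]) (use T(1) finZ x xT finite_zeros_on_interval(2)[OF h] in auto)
  also have "\<dots> \<longleftrightarrow> odd j"
  proof -
    have sq: "\<tau> (h x) * \<tau> (h (x+T)) = (-1)^j * (\<tau> (h x))\<^sup>2" unfolding xT by (simp add: power2_eq_square)
    have "(\<tau> (h x))\<^sup>2 > 0" using x by simp
    then show ?thesis unfolding sq by (cases "odd j") auto
  qed
  finally show "odd (card (zero_orbits (range h))) \<longleftrightarrow> odd j" unfolding Z card_image[OF inj] .
  show "s ` range h = range h \<longleftrightarrow> odd j"
  proof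
    assume "s ` range h = range h"
    then obtain t where t: "s (h 0) = h t" by (metis image_iff rangeI)
    obtain m k :: nat where mk: "t + real (4*k)*T - real m * T \<in> {0..<0+T}" using reduce by blast
    let ?u = "t + real (4*k)*T - real m * T"
    have ht: "h t = (s ^^ (j*m)) (h ?u)" using Per_mult[OF T(2), of ?u m] four[of t k] by simp
    have "h ?u = (s ^^ (3*(j*m))) (h t)" using ht pow_inverse(1)[of "h ?u" "j*m"] by simp
    also have "\<dots> = (s ^^ (3*(j*m) + 1)) (h 0)" using t pow_add[of "3*(j*m)" 1 "h 0"] by simp
    finally have "?u \<in> Per" by blast
    then have "?u = 0" using T(3)[of ?u] mk by force
    then have "(s ^^ 1) (h 0) = (s ^^ (j*m)) (h 0)" using ht t by simp
    then have "1 mod 4 = (j*m) mod 4" using pow_eq_iff[OF path_in, of 1 0 "j*m"] by blast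
    then have "odd (j*m)" by presburger
    then show "odd j" by simp
  next
    assume "odd j"
    then have "(j*j) mod 4 = 1 mod 4"
    proof -
      obtain q where "j = 2*q+1" using \<open>odd j\<close> oddE by blast
      then have "j*j = 1 + 4*(q*q+q)" by (simp add: algebra_simps)
      then show ?thesis by (metis mod_mult_self2)
    qed
    then have sj: "(s ^^ (j*j)) (h t) = s (h t)" for t using pow_eq_iff[of "h t" "j*j" 1] by simp
    have a: "s (h t) = h (t + real j * T)" for t using Per_mult[OF T(2), of t j] sj by simp
    have b: "h t = s (h (t + real (3*j) * T))" for t
    proof -
      have "s (h (t + real (3*j) * T)) = h (t + real (3*j)*T + real j * T)" by (rule a)
      also have "\<dots> = h (t + real (4*j) * T)" by (simp add: algebra_simps)
      finally show ?thesis using four by simp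
    qed
    show "s ` range h = range h"
    proof (intro equalityI subsetI)
      fix y assume "y \<in> s ` range h" then show "y \<in> range h" using a by auto
    next
      fix y assume "y \<in> range h" then show "y \<in> s ` range h" using b by (metis imageE imageI rangeI)
    qed
  qed
  have "range h = h ` {0..4*T}"
  proof (intro equalityI subsetI)
    fix y assume "y \<in> range h"
    then obtain t where y: "y = h t" by blast
    obtain m k :: nat where mk: "t + real (4*k)*T - real m * T \<in> {0..<0+T}" using reduce by blast
    define r where "r = t + real (4*k)*T - real m * T + real (m mod 4) * T"
    have "real m = real (4*(m div 4)) + real (m mod 4)" by (metis mult_div_mod_eq of_nat_add)
    then have "t + real (4*k)*T = r + real (4*(m div 4)) * T" unfolding r_def by (simp add: algebra_simps)
    then have "h t = h r" using four[of t k] four[of r "m div 4"] by simp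
    moreover have "m mod 4 \<le> 3" by presburger
    then have "real (m mod 4) * T \<le> 3 * T" using T(1) by (intro mult_right_mono) simp_all
    moreover have "0 \<le> real (m mod 4) * T" using T(1) by simp
    ultimately have "r \<in> {0..4*T}" using mk unfolding r_def atLeastAtMost_iff atLeastLessThan_iff by linarith
    then show "y \<in> h ` {0..4*T}" using y \<open>h t = h r\<close> by blast
  qed auto
  then show "compact (range h)" using compact_continuous_image[OF unit_path_continuous[OF h] compact_Icc] by metis
qed

text \<open>
  Without periods all translates of the path are disjoint. The path is a homeomorphism onto
  its component, so it spends only bounded time in the compact set where \<open>\<bar>\<tau>\<bar> \<le> K\<close>.
\<close>

lemma injective_case:
  assumes P0: "\<And>t. t \<in> Per \<Longrightarrow> t = 0"
  shows "(s ^^ n) (h a) = h b \<Longrightarrow> a = b \<and> 4 dvd n"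
    and "s ` range h \<noteq> range h"
    and "\<exists>B. \<forall>t. \<bar>t\<bar> > B \<longrightarrow> \<bar>\<tau> (h t)\<bar> > K"
    and "\<not> compact (range h)"
proof -
  have meet: "a = b \<and> 4 dvd n" if "(s ^^ n) (h a) = h b" for n a b
  proof -
    have "b - a \<in> Per" using Per_iff[of b a] that[symmetric] by blast
    then have "a = b" using P0 by force
    then show ?thesis using that pow_fix_iff[of "h a" n] by simp
  qed
  show "(s ^^ n) (h a) = h b \<Longrightarrow> a = b \<and> 4 dvd n" by (rule meet)
  show "s ` range h \<noteq> range h"
  proof
    assume "s ` range h = range h"
    then obtain t where "s (h 0) = h t" by (metis image_iff rangeI)
    then have "4 dvd (1::nat)" using meet[of 1 0 t] by simp
    then show False by simp
  qed
  have inj: "inj h" using meet[of 0] by (auto intro: injI)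
  have hom: "homeomorphism UNIV (range h) h (inv h)" by (rule injective_path_homeomorphism[OF h inj])
  have esc: "\<exists>B. \<forall>t. \<bar>t\<bar> > B \<longrightarrow> \<bar>\<tau> (h t)\<bar> > K" for K
  proof -
    obtain D where D: "closed D" "range h = X \<inter> D"
      using closedin_component[OF range_unit_path_component[OF h]] unfolding closedin_closed by blast
    have "compact ({x\<in>X. \<bar>\<tau> x\<bar> \<le> K} \<inter> D)" using compact_sublevel D(1) by (rule compact_Int_closed)
    moreover have "continuous_on ({x\<in>X. \<bar>\<tau> x\<bar> \<le> K} \<inter> D) (inv h)"
      using hom D(2) unfolding homeomorphism_def by (auto intro: continuous_on_subset)
    ultimately have "bounded (inv h ` ({x\<in>X. \<bar>\<tau> x\<bar> \<le> K} \<inter> D))"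
      by (intro compact_imp_bounded compact_continuous_image)
    then obtain B where B: "\<And>y. y \<in> inv h ` ({x\<in>X. \<bar>\<tau> x\<bar> \<le> K} \<inter> D) \<Longrightarrow> \<bar>y\<bar> \<le> B" unfolding bounded_real by blast
    have "\<bar>\<tau> (h t)\<bar> > K" if "\<bar>t\<bar> > B" for t
    proof (rule ccontr)
      assume "\<not> \<bar>\<tau> (h t)\<bar> > K"
      moreover have "h t \<in> X \<inter> D" using D(2) by blast
      ultimately have "h t \<in> {x\<in>X. \<bar>\<tau> x\<bar> \<le> K} \<inter> D" by simp
      then have "inv h (h t) \<in> inv h ` ({x\<in>X. \<bar>\<tau> x\<bar> \<le> K} \<inter> D)" by (rule imageI)
      then have "\<bar>t\<bar> \<le> B" using B[of t] inv_f_f[OF inj, of t] by simp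
      then show False using that by simp
    qed
    then show ?thesis by blast
  qed
  show "\<exists>B. \<forall>t. \<bar>t\<bar> > B \<longrightarrow> \<bar>\<tau> (h t)\<bar> > K" by (rule esc)
  show "\<not> compact (range h)"
  proof
    assume "compact (range h)"
    then have "compact (UNIV :: real set)" using hom homeomorphic_compactness unfolding homeomorphic_def by blast
    then show False by simp
  qed
qed

lemma injective_case_parity:
  assumes P0: "\<And>t. t \<in> Per \<Longrightarrow> t = 0"
    and b: "b > 0" "\<And>t. \<bar>t\<bar> \<ge> b \<Longrightarrow> \<tau> (h t) \<noteq> 0"
  shows "finite (zero_orbits (range h))"
    "odd (card (zero_orbits (range h))) \<longleftrightarrow> \<tau> (h (-b)) * \<tau> (h b) < 0"
proof -
  let ?Z = "{t\<in>{-b<..<b}. \<tau> (h t) = 0}"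
  have Z: "{t. \<tau> (h t) = 0} = ?Z" using b(2) by force
  have finZ: "finite ?Z" by (rule finite_subset[OF _ finite_zeros_on_interval(1)[OF h, of "-b" b]]) auto
  have inj: "inj_on (\<lambda>t. orb (h t)) ?Z"
  proof (rule inj_onI)
    fix a c assume "orb (h a) = orb (h c)"
    then have "c - a \<in> Per" using orb_path_iff by blast
    then show "a = c" using P0 by force
  qed
  show "finite (zero_orbits (range h))" unfolding zero_orbits_path Z using finZ by simp
  have "\<tau> (h (-b)) \<noteq> 0" "\<tau> (h b) \<noteq> 0" using b by auto
  then have "odd (card ?Z) \<longleftrightarrow> \<tau> (h (-b)) * \<tau> (h b) < 0"
    by (intro odd_card_zeros_iff_sign_change[OF continuous_tau_path] finZ finite_zeros_on_interval(2)[OF h]) (use b(1) in auto)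
  then show "odd (card (zero_orbits (range h))) \<longleftrightarrow> \<tau> (h (-b)) * \<tau> (h b) < 0"
    unfolding zero_orbits_path Z card_image[OF inj] .
qed

end

end

lemma escaping_limit_dichotomy:
  fixes g :: "real \<Rightarrow> real"
  assumes g: "continuous_on UNIV g" and esc: "\<And>K. \<exists>B. \<forall>t. t > B \<longrightarrow> \<bar>g t\<bar> > K"
  shows "filterlim g at_top at_top \<or> filterlim g at_bot at_top"
proof -
  obtain B0 where B0: "\<And>t. t > B0 \<Longrightarrow> \<bar>g t\<bar> > 0" using esc[of 0] by blast
  define t0 where "t0 = B0 + 1"
  have s: "g t0 * g t > 0" if "t \<ge> t0" for t
    by (rule same_sign_if_no_zeros[OF continuous_on_subset[OF g] that]) (use B0 in \<open>auto simp: t0_def\<close>)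
  show ?thesis
  proof (cases "g t0 > 0")
    case True
    have "\<forall>\<^sub>F t in at_top. K \<le> g t" for K
    proof -
      obtain B where B: "\<And>t. t > B \<Longrightarrow> \<bar>g t\<bar> > K" using esc by blast
      have "K \<le> g t" if "t \<ge> max t0 (B+1)" for t
        using s[of t] True B[of t] that by (simp add: zero_less_mult_iff)
      then show ?thesis unfolding eventually_at_top_linorder by blast
    qed
    then show ?thesis unfolding filterlim_at_top by blast
  next
    case False
    then have neg: "g t0 < 0" using B0[of t0] by (simp add: t0_def)
    have "\<forall>\<^sub>F t in at_top. g t \<le> K" for K
    proof -
      obtain B where B: "\<And>t. t > B \<Longrightarrow> \<bar>g t\<bar> > -K" using esc by blast
      have "g t \<le> K" if "t \<ge> max t0 (B+1)" for t
        using s[of t] neg B[of t] that by (simp add: zero_less_mult_iff)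
      then show ?thesis unfolding eventually_at_top_linorder by blast
    qed
    then show ?thesis unfolding filterlim_at_bot by blast
  qed
qed

context free_flip_space begin

definition hyperbolic_path :: "(real \<Rightarrow> 'a) \<Rightarrow> bool" where
  "hyperbolic_path h \<longleftrightarrow> filterlim (\<lambda>t. \<tau> (h t)) at_bot at_bot \<and> filterlim (\<lambda>t. \<tau> (h t)) at_top at_top"

text \<open>
  The dichotomy behind the parity formula. In the case \<open>loop\<close>, \<open>s ` C = C\<close> is the elliptic case; in the case
  \<open>arc\<close>, different signs of \<open>\<tau>\<close> at the two ends are the hyperbolic case.
\<close>

lemma component_cases:
  assumes C: "C \<in> components X"
  obtains (loop) "compact C" "finite (zero_orbits C)" "odd (card (zero_orbits C)) \<longleftrightarrow> s ` C = C"
  | (arc) h where "\<not> compact C" "s ` C \<noteq> C" "unit_on UNIV h" "range h = C"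
      "\<And>a b n. (s ^^ n) (h a) = h b \<Longrightarrow> a = b \<and> 4 dvd n"
      "filterlim (\<lambda>t. \<tau> (h t)) at_top at_top \<or> filterlim (\<lambda>t. \<tau> (h t)) at_bot at_top"
      "filterlim (\<lambda>t. \<tau> (h t)) at_top at_bot \<or> filterlim (\<lambda>t. \<tau> (h t)) at_bot at_bot"
      "finite (zero_orbits C)"
      "odd (card (zero_orbits C)) \<longleftrightarrow> hyperbolic_path h \<or> hyperbolic_path (\<lambda>t. h (-t))"
proof -
  obtain h where h: "unit_on UNIV h" and hC: "range h = C" using component_path[OF C] by blast
  show thesis
  proof (cases "\<exists>t. t \<noteq> 0 \<and> (\<exists>n. h t = (s ^^ n) (h 0))")
    case True
    then obtain a where a: "a \<noteq> 0" "a \<in> {t. \<exists>n. h t = (s ^^ n) (h 0)}" by blast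
    obtain T where T: "T > 0" "T \<in> {t. \<exists>n. h t = (s ^^ n) (h 0)}"
        "\<And>t. 0 < t \<Longrightarrow> t < T \<Longrightarrow> t \<notin> {t. \<exists>n. h t = (s ^^ n) (h 0)}"
      using minimal_period[OF h a(2,1)] by blast
    then obtain j where "h T = (s ^^ j) (h 0)" by blast
    from periodic_case[OF h T(1) this T(3)] show thesis unfolding hC by (intro loop) auto
  next
    case False
    then have P0: "t = 0" if "t \<in> {t. \<exists>n. h t = (s ^^ n) (h 0)}" for t using that by blast
    note ic = injective_case[OF h P0, unfolded hC]
    define g where "g t = \<tau> (h t)" for t
    have cg: "continuous_on UNIV g" unfolding g_def by (rule continuous_tau_path[OF h])
    have cg': "continuous_on UNIV (\<lambda>t. g (-t))"
      by (rule continuous_on_compose2[OF cg]) (auto intro: continuous_intros)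
    have esc: "\<exists>B. \<forall>t. t > B \<longrightarrow> \<bar>g t\<bar> > K" "\<exists>B. \<forall>t. t > B \<longrightarrow> \<bar>g (-t)\<bar> > K" for K
    proof -
      obtain B where B: "\<forall>t. \<bar>t\<bar> > B \<longrightarrow> \<bar>\<tau> (h t)\<bar> > K" using ic(3) by blast
      have "\<bar>g t\<bar> > K" "\<bar>g (-t)\<bar> > K" if "t > B" for t
        using B[rule_format, of t] B[rule_format, of "-t"] that by (auto simp: g_def)
      then show "\<exists>B. \<forall>t. t > B \<longrightarrow> \<bar>g t\<bar> > K" "\<exists>B. \<forall>t. t > B \<longrightarrow> \<bar>g (-t)\<bar> > K" by blast+
    qed
    have e1: "filterlim g at_top at_top \<or> filterlim g at_bot at_top"
      by (rule escaping_limit_dichotomy[OF cg esc(1)])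
    have e2: "filterlim (\<lambda>t. g (-t)) at_top at_top \<or> filterlim (\<lambda>t. g (-t)) at_bot at_top"
      by (rule escaping_limit_dichotomy[OF cg' esc(2)])
    have pos: "\<forall>\<^sub>F t in at_top. f t > 0" if "filterlim f at_top at_top" for f :: "real \<Rightarrow> real"
      using that unfolding filterlim_at_top_dense by blast
    have neg: "\<forall>\<^sub>F t in at_top. f t < 0" if "filterlim f at_bot at_top" for f :: "real \<Rightarrow> real"
      using that unfolding filterlim_at_bot_dense by blast
    have np: "\<not> (filterlim f at_top at_top \<and> filterlim f at_bot at_top)" for f :: "real \<Rightarrow> real"
    proof
      assume "filterlim f at_top at_top \<and> filterlim f at_bot at_top"
      then have "\<forall>\<^sub>F t in at_top. f t > 0 \<and> f t < 0" using pos neg by (intro eventually_conj) blast+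
      then have "\<forall>\<^sub>F t::real in at_top. False" by eventually_elim auto
      then show False by simp
    qed
    define up where "up f \<longleftrightarrow> filterlim f at_top at_top" for f :: "real \<Rightarrow> real"
    have ev: "\<forall>\<^sub>F t in at_top. f t \<noteq> 0 \<and> (f t > 0 \<longleftrightarrow> up f)"
      if "filterlim f at_top at_top \<or> filterlim f at_bot at_top" for f :: "real \<Rightarrow> real"
    proof (cases "up f")
      case True
      then have "\<forall>\<^sub>F t in at_top. f t > 0" using pos unfolding up_def by blast
      then show ?thesis by eventually_elim (use True in auto)
    next
      case False
      then have "\<forall>\<^sub>F t in at_top. f t < 0" using neg that unfolding up_def by blast
      then show ?thesis by eventually_elim (use False in auto)
    qed
    have "\<forall>\<^sub>F t in at_top. (g t \<noteq> 0 \<and> (g t > 0 \<longleftrightarrow> up g)) \<and> (g (-t) \<noteq> 0 \<and> (g (-t) > 0 \<longleftrightarrow> up (\<lambda>t. g (-t))))"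
      by (intro eventually_conj ev e1 e2)
    then obtain b0 where b0: "\<And>t. t \<ge> b0 \<Longrightarrow> (g t \<noteq> 0 \<and> (g t > 0 \<longleftrightarrow> up g)) \<and> (g (-t) \<noteq> 0 \<and> (g (-t) > 0 \<longleftrightarrow> up (\<lambda>t. g (-t))))"
      unfolding eventually_at_top_linorder by blast
    define b where "b = max b0 1"
    have b: "b > 0" "b \<ge> b0" by (auto simp: b_def)
    have nz: "\<tau> (h t) \<noteq> 0" if "\<bar>t\<bar> \<ge> b" for t
      using b0[of t] b0[of "-t"] that b by (cases "t \<ge> 0") (auto simp: g_def)
    note par = injective_case_parity[OF h P0 b(1) nz, unfolded hC]
    have "\<tau> (h (-b)) * \<tau> (h b) < 0 \<longleftrightarrow> up g \<noteq> up (\<lambda>t. g (-t))"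
      using b0[OF b(2)] unfolding g_def by (auto simp: mult_less_0_iff)
    also have "\<dots> \<longleftrightarrow> hyperbolic_path h \<or> hyperbolic_path (\<lambda>t. h (-t))"
      using e1 e2 np[of g] np[of "\<lambda>t. g (-t)"]
      unfolding hyperbolic_path_def up_def filterlim_at_bot_mirror g_def minus_minus by blast
    finally have odd: "odd (card (zero_orbits C)) \<longleftrightarrow> hyperbolic_path h \<or> hyperbolic_path (\<lambda>t. h (-t))"
      using par(2) by blast
    show thesis
    proof (rule arc[OF ic(4,2) h hC ic(1) _ _ par(1) odd])
      show "filterlim (\<lambda>t. \<tau> (h t)) at_top at_top \<or> filterlim (\<lambda>t. \<tau> (h t)) at_bot at_top" using e1 unfolding g_def .
      show "filterlim (\<lambda>t. \<tau> (h t)) at_top at_bot \<or> filterlim (\<lambda>t. \<tau> (h t)) at_bot at_bot"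
        using e2 unfolding g_def filterlim_at_bot_mirror .
    qed
  qed
qed

end

section \<open>Polygons off the zeros of finitely many polynomials\<close>

definition nxt :: "nat \<Rightarrow> nat \<Rightarrow> nat" where "nxt N k = Suc k mod N"

abbreviation edge :: "nat \<Rightarrow> (nat \<Rightarrow> real^2) \<Rightarrow> nat \<Rightarrow> (real^2) set" where
  "edge N v k \<equiv> closed_segment (v k) (v (nxt N k))"

definition dir :: "nat \<Rightarrow> (nat \<Rightarrow> real^2) \<Rightarrow> nat \<Rightarrow> real^2" where
  "dir N v k = v (nxt N k) - v k"

lemma nxt_less: "k < N \<Longrightarrow> nxt N k < N" by (simp add: nxt_def)

lemma edge_iff: "x \<in> edge N v k \<longleftrightarrow> (\<exists>l\<in>{0..1}. x = v k + l *\<^sub>R dir N v k)"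
  unfolding in_segment dir_def by (auto simp: algebra_simps)

text \<open>
  At \<open>l = 1\<close> the parameter belongs to the next edge, and for \<open>k = N - 1\<close> it is the end of the loop; the formula
  holds in these cases too.
\<close>

lemma polygon_path_on_edge:
  assumes k: "k < N" and l: "l \<in> {0..1}"
  shows "polygon_path N v ((real k + l) / real N) = v k + l *\<^sub>R dir N v k"
proof -
  have N: "real N * ((real k + l) / real N) = real k + l" using k by simp
  show ?thesis
  proof (cases "l = 1")
    case True
    have "\<lfloor>real k + l\<rfloor> = int (Suc k)" "frac (real k + l) = 0" unfolding True by (simp_all add: frac_def)
    then have "nat \<lfloor>real k + l\<rfloor> = Suc k" by simp
    then show ?thesis
      unfolding polygon_path_def Let_def N linepath_def \<open>frac (real k + l) = 0\<close> \<open>nat \<lfloor>real k + l\<rfloor> = Suc k\<close>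
      by (simp add: True dir_def nxt_def)
  next
    case False
    then have "\<lfloor>real k + l\<rfloor> = int k" using l by (simp add: floor_eq_iff)
    then have "nat \<lfloor>real k + l\<rfloor> = k" "frac (real k + l) = l" by (simp_all add: frac_def)
    then show ?thesis unfolding polygon_path_def Let_def N using k
      by (simp add: linepath_def dir_def nxt_def algebra_simps)
  qed
qed

lemma polygon_parameter:
  assumes N: "N > 0" and t: "t \<in> {0..1}"
  obtains k l where "k < N" "l \<in> {0..1}" "t = (real k + l) / real N"
proof (cases "t = 1")
  case True
  show thesis by (rule that[of "N - 1" 1]) (use N True in \<open>auto simp: of_nat_diff\<close>)
next
  case False
  define k where "k = nat \<lfloor>real N * t\<rfloor>"
  have "0 \<le> real N * t" "real N * t < real N" using N t False by auto
  then have k: "real k \<le> real N * t" "real N * t < real k + 1" "k < N"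
    unfolding k_def by (auto simp: nat_less_iff floor_less_iff)
  show thesis by (rule that[of k "real N * t - real k"]) (use k N in auto)
qed

lemma polygon_curve_edges:
  assumes N: "N > 0" shows "polygon_curve N v = (\<Union>k<N. edge N v k)"
proof (intro equalityI subsetI)
  fix x assume "x \<in> polygon_curve N v"
  then obtain t where t: "t \<in> {0..1}" "x = polygon_path N v t" unfolding path_image_def by auto
  obtain k l where kl: "k < N" "l \<in> {0..1}" "t = (real k + l) / real N" using polygon_parameter[OF N t(1)] by blast
  have "x = v k + l *\<^sub>R dir N v k" using polygon_path_on_edge[OF kl(1,2)] kl(3) t(2) by simp
  then have "x \<in> edge N v k" using kl(2) edge_iff by blast
  then show "x \<in> (\<Union>k<N. edge N v k)" using kl(1) by blast
next
  fix x assume "x \<in> (\<Union>k<N. edge N v k)"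
  then obtain k l where kl: "k < N" "l \<in> {0..1}" "x = v k + l *\<^sub>R dir N v k" using edge_iff by blast
  have "(real k + l) / real N \<in> {0..1}" using kl by (auto simp: divide_simps)
  then show "x \<in> polygon_curve N v" unfolding path_image_def
    using polygon_path_on_edge[OF kl(1,2)] kl(3) by (metis imageI)
qed

locale simple_polygon =
  fixes N :: nat and v :: "nat \<Rightarrow> real^2"
  assumes N3: "N \<ge> 3" and simple: "simple_path (polygon_path N v)"
begin

lemma same_point:
  assumes j: "j < N" "l \<in> {0..1}" and k: "k < N" "m \<in> {0..1}"
    and eq: "v j + l *\<^sub>R dir N v j = v k + m *\<^sub>R dir N v k"
  shows "real j + l = real k + m \<or> (j = 0 \<and> l = 0 \<and> Suc k = N \<and> m = 1) \<or> (k = 0 \<and> m = 0 \<and> Suc j = N \<and> l = 1)"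
proof -
  have I: "(real j + l) / real N \<in> {0..1}" "(real k + m) / real N \<in> {0..1}" using j k by (auto simp: divide_simps)
  have "polygon_path N v ((real j + l) / real N) = polygon_path N v ((real k + m) / real N)"
    using eq polygon_path_on_edge[OF j] polygon_path_on_edge[OF k] by simp
  then have "(real j + l) / real N = (real k + m) / real N
     \<or> (real j + l) / real N = 0 \<and> (real k + m) / real N = 1
     \<or> (real j + l) / real N = 1 \<and> (real k + m) / real N = 0"
    using simple I unfolding simple_path_def loop_free_def by blast
  moreover have "real N > 0" using N3 by simp
  ultimately have "real j + l = real k + m \<or> (real j + l = 0 \<and> real k + m = real N) \<or> (real j + l = real N \<and> real k + m = 0)"
    by (auto simp: field_simps)
  moreover have "real n + x = 0 \<Longrightarrow> n = 0 \<and> x = 0" if "x \<in> {0..1}" for n x using that by auto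
  moreover have "real n + x = real N \<Longrightarrow> n < N \<Longrightarrow> Suc n = N \<and> x = 1" if "x \<in> {0..1}" for n x
  proof -
    assume a: "real n + x = real N" "n < N"
    then have "real (Suc n) \<le> real N" "real N \<le> real (Suc n)" using that by (simp_all only: of_nat_le_iff Suc_leI) auto
    then show "Suc n = N \<and> x = 1" using a by simp
  qed
  ultimately show ?thesis using j k by metis
qed

lemma edge_inter:
  assumes "j < N" "k < N" "j \<noteq> k" "x \<in> edge N v j" "x \<in> edge N v k"
  shows "(k = nxt N j \<and> x = v k) \<or> (j = nxt N k \<and> x = v j)"
proof -
  obtain l where l: "l \<in> {0..1}" "x = v j + l *\<^sub>R dir N v j" using assms(4) edge_iff by blast
  obtain m where m: "m \<in> {0..1}" "x = v k + m *\<^sub>R dir N v k" using assms(5) edge_iff by blast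
  have *: "b = Suc a \<and> y = 0" if "real a + z = real b + y" "a < b" "z \<in> {0..1}" "y \<in> {0..1}" for a b y z
  proof -
    have "real b \<le> real a + 1" using that by auto
    then have "b \<le> Suc a" by linarith
    then have "b = Suc a" using that(2) by simp
    then show ?thesis using that by auto
  qed
  from same_point[OF assms(1) l(1) assms(2) m(1)] l(2) m(2)
  consider "real j + l = real k + m" | "j = 0" "l = 0" "Suc k = N" | "k = 0" "m = 0" "Suc j = N" by auto
  then show ?thesis
  proof cases
    case 1
    show ?thesis
    proof (cases "j < k")
      case True
      then have "k = Suc j" "m = 0" using *[OF 1 True l(1) m(1)] by auto
      then show ?thesis using m(2) assms(2) by (simp add: nxt_def)
    next
      case False
      then have "k < j" using assms(3) by simp
      then have "j = Suc k" "l = 0" using *[OF 1[symmetric] _ m(1) l(1)] by auto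
      then show ?thesis using l(2) assms(1) by (simp add: nxt_def)
    qed
  next
    case 2 then show ?thesis using l(2) by (auto simp: nxt_def)
  next
    case 3 then show ?thesis using m(2) by (auto simp: nxt_def)
  qed
qed

lemma nxt_neq: "k < N \<Longrightarrow> nxt N k \<noteq> k"
  using N3 unfolding nxt_def by (cases "Suc k = N") auto

lemma nxt_nxt_neq: "k < N \<Longrightarrow> nxt N (nxt N k) \<noteq> k"
proof -
  assume "k < N"
  then consider "Suc (Suc k) < N" | "Suc (Suc k) = N" | "Suc k = N" by linarith
  then show ?thesis using N3 unfolding nxt_def by cases auto
qed

lemma dir_nonzero: assumes "k < N" shows "dir N v k \<noteq> 0"
proof
  assume "dir N v k = 0"
  then have "real k + 0 = real k + 1 \<or> (k = 0 \<and> Suc k = N)"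
    using same_point[OF assms _ assms, of 0 1] by auto
  then show False using N3 by auto
qed

lemma vertex_on_edge: assumes j: "j < N" and k: "k < N"
  shows "v j \<in> edge N v k \<longleftrightarrow> j = k \<or> j = nxt N k"
proof
  assume "v j \<in> edge N v k"
  show "j = k \<or> j = nxt N k"
  proof (cases "j = k")
    case False
    have "v j \<in> edge N v j" by simp
    then have "(k = nxt N j \<and> v j = v k) \<or> j = nxt N k" using edge_inter[OF j k False _ \<open>v j \<in> edge N v k\<close>] by auto
    moreover have "v j \<noteq> v (nxt N j)" using dir_nonzero[OF j] by (simp add: dir_def)
    ultimately show ?thesis by auto
  qed auto
qed auto

end

lemma continuous_polygon_path:
  assumes N: "N > 0" shows "continuous_on {0..1} (polygon_path N v)"
proof -
  have c: "continuous_on {real k / real N..(real k + 1) / real N} (polygon_path N v)" if k: "k < N" for k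
  proof -
    have "continuous_on {real k / real N..(real k + 1) / real N} (\<lambda>t. v k + (real N * t - real k) *\<^sub>R dir N v k)"
      by (intro continuous_intros)
    moreover have "v k + (real N * t - real k) *\<^sub>R dir N v k = polygon_path N v t"
      if t: "t \<in> {real k / real N..(real k + 1) / real N}" for t
    proof -
      have "real N * t - real k \<in> {0..1}" using t N by (auto simp: field_simps)
      then show ?thesis using polygon_path_on_edge[OF k, of "real N * t - real k" v] N by simp
    qed
    ultimately show ?thesis by (rule continuous_on_eq)
  qed
  have "continuous_on (\<Union>k\<in>{..<N}. {real k / real N..(real k + 1) / real N}) (polygon_path N v)"
    by (rule continuous_on_closed_Union) (use c in auto)
  moreover have "{0..1} \<subseteq> (\<Union>k\<in>{..<N}. {real k / real N..(real k + 1) / real N})"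
  proof
    fix t :: real assume "t \<in> {0..1}"
    then obtain k l where "k < N" "l \<in> {0..1}" "t = (real k + l) / real N" using polygon_parameter[OF N] by blast
    then show "t \<in> (\<Union>k\<in>{..<N}. {real k / real N..(real k + 1) / real N})"
      using N by (intro UN_I[of k]) (auto simp: divide_right_mono)
  qed
  ultimately show ?thesis by (rule continuous_on_subset)
qed

text \<open>
  Simplicity in terms of conditions that are open in the vertices: edges without common vertex are disjoint, and at a corner the
  path does not fold back. The second condition says that \<open>0\<close> is not on the segment between the two edge directions,
  so it survives perturbation, unlike the fact that the adjacent edges meet only in the corner.
\<close>

lemma simple_polygonI:
  assumes N: "N \<ge> 3"
    and far: "\<And>j k. j < N \<Longrightarrow> k < N \<Longrightarrow> j \<noteq> k \<Longrightarrow> k \<noteq> nxt N j \<Longrightarrow> j \<noteq> nxt N k \<Longrightarrow> edge N v j \<inter> edge N v k = {}"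
    and corner: "\<And>j x. j < N \<Longrightarrow> x \<in> {0..1} \<Longrightarrow> (1-x) *\<^sub>R dir N v j + x *\<^sub>R dir N v (nxt N j) \<noteq> 0"
  shows "simple_path (polygon_path N v)"
  unfolding simple_path_def loop_free_def
proof (intro conjI ballI impI)
  have N0: "N > 0" using N by simp
  show "path (polygon_path N v)" unfolding path_def by (rule continuous_polygon_path[OF N0])
  have d0: "dir N v j \<noteq> 0" if "j < N" for j using corner[OF that, of 0] by simp
  have adj: "l = 1 \<and> m = 0" if "j < N" "l \<in> {0..1}" "m \<in> {0..1}"
      "v j + l *\<^sub>R dir N v j = v (nxt N j) + m *\<^sub>R dir N v (nxt N j)" for j l m
  proof (rule ccontr)
    assume n: "\<not> (l = 1 \<and> m = 0)"
    define r where "r = (1 - l) + m"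
    have r: "r > 0" using n that(2,3) by (auto simp: r_def)
    have "(1-l) *\<^sub>R dir N v j + m *\<^sub>R dir N v (nxt N j) = 0"
      using that(4) unfolding dir_def[of N v j] by (simp add: algebra_simps)
    then have "(1/r) *\<^sub>R ((1-l) *\<^sub>R dir N v j + m *\<^sub>R dir N v (nxt N j)) = 0" by simp
    then have "((1-l)/r) *\<^sub>R dir N v j + (m/r) *\<^sub>R dir N v (nxt N j) = 0" by (simp add: scaleR_add_right)
    moreover have "(1-l)/r = 1 - m/r" using r by (simp add: field_simps r_def)
    moreover have "m/r \<in> {0..1}" using r that(2,3) by (auto simp: r_def field_simps)
    ultimately show False using corner[OF that(1), of "m/r"] by simp
  qed
  fix s t assume s: "s \<in> {0..1::real}" and t: "t \<in> {0..1::real}" and eq: "polygon_path N v s = polygon_path N v t"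
  obtain j l where j: "j < N" "l \<in> {0..1}" "s = (real j + l) / real N" using polygon_parameter[OF N0 s] by blast
  obtain k m where k: "k < N" "m \<in> {0..1}" "t = (real k + m) / real N" using polygon_parameter[OF N0 t] by blast
  have e: "v j + l *\<^sub>R dir N v j = v k + m *\<^sub>R dir N v k"
    using eq polygon_path_on_edge[OF j(1,2)] polygon_path_on_edge[OF k(1,2)] j(3) k(3) by simp
  have succ: "(real a + 1) / real N = (real (nxt N a)) / real N \<or> ((real a + 1) / real N = 1 \<and> real (nxt N a) / real N = 0)"
    if "a < N" for a
    using that N by (cases "Suc a = N") (auto simp: nxt_def)
  consider "j = k" | "k = nxt N j" | "j = nxt N k"
  proof -
    have "v j + l *\<^sub>R dir N v j \<in> edge N v j" using j(2) edge_iff by blast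
    moreover have "v j + l *\<^sub>R dir N v j \<in> edge N v k" using e k(2) edge_iff by metis
    ultimately have "edge N v j \<inter> edge N v k \<noteq> {}" by blast
    then show thesis using far[OF j(1) k(1)] that by blast
  qed
  then show "s = t \<or> s = 0 \<and> t = 1 \<or> s = 1 \<and> t = 0"
  proof cases
    case 1
    then have "(l - m) *\<^sub>R dir N v j = 0" using e by (simp add: algebra_simps)
    then show ?thesis using d0[OF j(1)] j k 1 by simp
  next
    case 2
    then have "l = 1 \<and> m = 0" using adj[OF j(1,2) k(2)] e by simp
    then show ?thesis using succ[OF j(1)] 2 j(3) k(3) by auto
  next
    case 3
    then have "m = 1 \<and> l = 0" using adj[OF k(1,2) j(2)] e by simp
    then show ?thesis using succ[OF k(1)] 3 j(3) k(3) by auto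
  qed
qed

definition blend :: "nat \<Rightarrow> (nat \<Rightarrow> real^2) \<Rightarrow> (nat \<Rightarrow> real^2) \<Rightarrow> real \<Rightarrow> nat \<Rightarrow> real^2" where
  "blend N v w t = (\<lambda>k\<in>{..<N}. v k + t *\<^sub>R (w k - v k))"

text \<open>
  By compactness there is one bound for \<open>t\<close> that is good for all \<open>z\<close>.
\<close>

lemma eventually_nonzero_on_compact:
  fixes a b :: "'a::topological_space \<Rightarrow> 'b::real_normed_vector"
  assumes K: "compact K" and a: "continuous_on K a" and b: "continuous_on K b" and nz: "\<And>z. z \<in> K \<Longrightarrow> a z \<noteq> 0"
  shows "\<forall>\<^sub>F t in nhds (0::real). \<forall>z\<in>K. a z + t *\<^sub>R b z \<noteq> 0"
proof (cases "K = {}")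
  case False
  obtain z0 where z0: "z0 \<in> K" "\<And>z. z \<in> K \<Longrightarrow> norm (a z0) \<le> norm (a z)"
    using continuous_attains_inf[OF K False continuous_on_norm[OF a]] by blast
  obtain z1 where z1: "z1 \<in> K" "\<And>z. z \<in> K \<Longrightarrow> norm (b z) \<le> norm (b z1)"
    using continuous_attains_sup[OF K False continuous_on_norm[OF b]] by blast
  have m: "norm (a z0) > 0" using nz z0(1) by simp
  have nb: "norm (b z1) + 1 > 0" by (simp add: add_nonneg_pos)
  show ?thesis unfolding eventually_nhds_metric
  proof (intro exI[of _ "norm (a z0) / (norm (b z1) + 1)"] conjI allI impI ballI)
    show "norm (a z0) / (norm (b z1) + 1) > 0" using m nb by simp
    fix t :: real and z assume t: "dist t 0 < norm (a z0) / (norm (b z1) + 1)" and z: "z \<in> K"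
    have "\<bar>t\<bar> * norm (b z) \<le> \<bar>t\<bar> * (norm (b z1) + 1)" using z1(2)[OF z] by (intro mult_left_mono) auto
    also have "\<dots> < norm (a z0)" using t nb by (simp add: field_simps)
    also have "\<dots> \<le> norm (a z)" by (rule z0(2)[OF z])
    finally have "norm (t *\<^sub>R b z) < norm (a z)" by simp
    then show "a z + t *\<^sub>R b z \<noteq> 0" by (metis add.inverse_inverse add_eq_0_iff norm_minus_cancel order_less_irrefl)
  qed
qed simp

lemma dir_blend: "k < N \<Longrightarrow> dir N (blend N v w t) k = dir N v k + t *\<^sub>R (dir N w k - dir N v k)"
  by (simp add: dir_def blend_def nxt_less algebra_simps)

lemma eventually_simple:
  assumes N: "N \<ge> 3" and simple: "simple_path (polygon_path N v)"
  shows "\<forall>\<^sub>F t in nhds 0. simple_path (polygon_path N (blend N v w t))"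
proof -
  interpret simple_polygon N v using assms by unfold_locales
  define pt where "pt u k x = u k + x *\<^sub>R dir N u k" for u :: "nat \<Rightarrow> real^2" and k x
  have pt_blend: "pt (blend N v w t) k x = pt v k x + t *\<^sub>R (pt w k x - pt v k x)" if "k < N" for t k x
    unfolding pt_def dir_blend[OF that] using that by (simp add: blend_def algebra_simps)
  \<comment> \<open>The pairs of edges without a common vertex.\<close>
  define I where "I = {(j,k). j < N \<and> k < N \<and> j \<noteq> k \<and> k \<noteq> nxt N j \<and> j \<noteq> nxt N k}"
  have finI: "finite I" by (rule finite_subset[of _ "{..<N} \<times> {..<N}"]) (auto simp: I_def)
  have "\<forall>\<^sub>F t in nhds 0. \<forall>i\<in>I. \<forall>z\<in>{0..1}\<times>{0..1}.
      (pt v (fst i) (fst z) - pt v (snd i) (snd z)) + t *\<^sub>R ((pt w (fst i) (fst z) - pt v (fst i) (fst z)) - (pt w (snd i) (snd z) - pt v (snd i) (snd z))) \<noteq> 0"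
  proof (intro eventually_ball_finite[OF finI] ballI eventually_nonzero_on_compact)
    fix i z assume i: "i \<in> I" and z: "z \<in> {0..1::real}\<times>{0..1::real}"
    obtain j k where jk: "i = (j,k)" by (cases i)
    show "pt v (fst i) (fst z) - pt v (snd i) (snd z) \<noteq> 0"
    proof
      assume "pt v (fst i) (fst z) - pt v (snd i) (snd z) = 0"
      then have e: "pt v j (fst z) = pt v k (snd z)" unfolding jk by simp
      have "pt v j (fst z) \<in> edge N v j" unfolding edge_iff pt_def using z by auto
      moreover have "pt v j (fst z) \<in> edge N v k" unfolding e unfolding edge_iff pt_def using z by auto
      ultimately show False using edge_inter[of j k] i unfolding jk I_def by auto
    qed
  qed (auto simp: pt_def intro!: compact_Times continuous_intros)
  moreover have "\<forall>\<^sub>F t in nhds 0. \<forall>j\<in>{..<N}. \<forall>x\<in>{0..1}.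
      ((1-x) *\<^sub>R dir N v j + x *\<^sub>R dir N v (nxt N j)) + t *\<^sub>R ((1-x) *\<^sub>R (dir N w j - dir N v j) + x *\<^sub>R (dir N w (nxt N j) - dir N v (nxt N j))) \<noteq> 0"
  proof (rule eventually_ball_finite, simp, rule ballI, rule eventually_nonzero_on_compact)
    fix j x assume j: "j \<in> {..<N}" and x: "x \<in> {0..1::real}"
    show "(1-x) *\<^sub>R dir N v j + x *\<^sub>R dir N v (nxt N j) \<noteq> 0"
    proof
      assume 0: "(1-x) *\<^sub>R dir N v j + x *\<^sub>R dir N v (nxt N j) = 0"
      have "v j + x *\<^sub>R dir N v j = v (nxt N j) + x *\<^sub>R dir N v (nxt N j)"
        using 0 unfolding dir_def[of N v j] by (simp add: algebra_simps)
      then have "v j + x *\<^sub>R dir N v j \<in> edge N v j" "v j + x *\<^sub>R dir N v j \<in> edge N v (nxt N j)"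
        using x edge_iff[of "v j + x *\<^sub>R dir N v j"] by blast+
      then have "v j + x *\<^sub>R dir N v j = v (nxt N j) \<or> j = nxt N (nxt N j)"
        using edge_inter[of j "nxt N j"] j nxt_less[of j N] nxt_neq[of j] by auto
      then have e: "v j + x *\<^sub>R dir N v j = v (nxt N j)" using nxt_nxt_neq[of j] j by auto
      then have "(x - 1) *\<^sub>R dir N v j = 0" by (simp add: dir_def algebra_simps)
      then have "x = 1" using dir_nonzero[of j] j by simp
      then show False using 0 dir_nonzero[of "nxt N j"] j nxt_less[of j N] by simp
    qed
  qed (auto intro!: continuous_intros)
  ultimately show ?thesis
  proof eventually_elim
    case (elim t)
    show ?case
    proof (rule simple_polygonI[OF N])
      fix j k assume jk: "j < N" "k < N" "j \<noteq> k" "k \<noteq> nxt N j" "j \<noteq> nxt N k"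
      show "edge N (blend N v w t) j \<inter> edge N (blend N v w t) k = {}"
      proof (rule ccontr)
        assume "\<not> ?thesis"
        then obtain l m where lm: "l \<in> {0..1}" "m \<in> {0..1}" "pt (blend N v w t) j l = pt (blend N v w t) k m"
        proof -
          obtain x where x: "x \<in> edge N (blend N v w t) j" "x \<in> edge N (blend N v w t) k"
            using \<open>\<not> edge N (blend N v w t) j \<inter> edge N (blend N v w t) k = {}\<close> by blast
          show thesis using x[unfolded edge_iff] that unfolding pt_def by metis
        qed
        then show False using elim(1)[THEN bspec[of _ _ "(j,k)"], THEN bspec[of _ _ "(l,m)"]] jk pt_blend
          by (simp add: I_def algebra_simps)
      qed
    next
      fix j x assume jx: "j < N" "x \<in> {0..1::real}"
      then show "(1-x) *\<^sub>R dir N (blend N v w t) j + x *\<^sub>R dir N (blend N v w t) (nxt N j) \<noteq> 0"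
        unfolding dir_blend[OF jx(1)] dir_blend[OF nxt_less[OF jx(1)]]
        using elim(2)[THEN bspec[of _ _ j], THEN bspec[of _ _ x]]
        by (simp add: algebra_simps)
    qed
  qed
qed

text \<open>
  Polynomial functions of the vertex coordinates.
\<close>

inductive vpoly :: "nat \<Rightarrow> ((nat \<Rightarrow> real^2) \<Rightarrow> real) \<Rightarrow> bool" for N where
  const: "vpoly N (\<lambda>_. c)"
| coord: "k < N \<Longrightarrow> vpoly N (\<lambda>v. v k $ i)"
| add: "vpoly N f \<Longrightarrow> vpoly N g \<Longrightarrow> vpoly N (\<lambda>v. f v + g v)"
| mult: "vpoly N f \<Longrightarrow> vpoly N g \<Longrightarrow> vpoly N (\<lambda>v. f v * g v)"

lemma vpoly_uminus: "vpoly N f \<Longrightarrow> vpoly N (\<lambda>v. - f v)"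
  using vpoly.mult[OF vpoly.const[of N "-1"]] by simp

lemma vpoly_diff: "vpoly N f \<Longrightarrow> vpoly N g \<Longrightarrow> vpoly N (\<lambda>v. f v - g v)"
  using vpoly.add[OF _ vpoly_uminus, of N f g] by simp

lemma vpoly_power: "vpoly N f \<Longrightarrow> vpoly N (\<lambda>v. f v ^ n)"
  by (induction n) (auto intro: vpoly.intros)

lemmas vpoly_intros = vpoly.intros vpoly_uminus vpoly_diff vpoly_power

lemma vpoly_cong: "vpoly N f \<Longrightarrow> (\<And>k. k < N \<Longrightarrow> v k = w k) \<Longrightarrow> f v = f w"
  by (induction rule: vpoly.induct) auto

text \<open>
  On the line through two polygons a polynomial condition becomes a polynomial in one variable, so it vanishes
  identically or has finitely many zeros.
\<close>

lemma vpoly_blend: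
  assumes "vpoly N f" shows "\<exists>p. \<forall>t. f (blend N v w t) = poly p t"
  using assms
proof (induction rule: vpoly.induct)
  case (const c)
  show ?case by (rule exI[of _ "[:c:]"]) simp
next
  case (coord k i)
  then show ?case by (intro exI[of _ "[:v k $ i, (w k - v k) $ i:]"]) (simp add: blend_def)
next
  case (add f g)
  then obtain p q where "\<forall>t. f (blend N v w t) = poly p t" "\<forall>t. g (blend N v w t) = poly q t" by blast
  then show ?case by (intro exI[of _ "p + q"]) simp
next
  case (mult f g)
  then obtain p q where "\<forall>t. f (blend N v w t) = poly p t" "\<forall>t. g (blend N v w t) = poly q t" by blast
  then show ?case by (intro exI[of _ "p * q"]) simp
qed

lemma vpoly_continuous:
  "vpoly N f \<Longrightarrow> continuous_map (product_topology (\<lambda>_. euclidean) {..<N}) euclideanreal f"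
proof (induction rule: vpoly.induct)
  case (coord k i)
  have 1: "continuous_map (product_topology (\<lambda>_. euclidean) {..<N}) euclidean (\<lambda>v::nat \<Rightarrow> real^2. v k)"
    by (rule continuous_map_product_projection) (use coord in simp)
  have 2: "continuous_map euclidean euclideanreal (\<lambda>x::real^2. x $ i)"
    by (simp add: continuous_on_component)
  show ?case using continuous_map_compose[OF 1 2] by (simp add: o_def)
qed (auto intro: continuous_map_real_mult continuous_map_add)

lemma blend_0: "k < N \<Longrightarrow> blend N v w 0 k = v k" and blend_1: "k < N \<Longrightarrow> blend N v w 1 k = w k"
  by (simp_all add: blend_def)

lemma vpoly_finite_zeros_on_line:
  assumes "vpoly N f" "f w \<noteq> 0"
  shows "finite {t. f (blend N v w t) = 0}" "finite {t. f (blend N w v t) = 0}"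
proof -
  obtain p where p: "\<forall>t. f (blend N v w t) = poly p t" using vpoly_blend[OF assms(1)] by blast
  have "f (blend N v w 1) = f w" by (rule vpoly_cong[OF assms(1)]) (simp add: blend_1)
  then have "p \<noteq> 0" using p assms(2) by auto
  then show "finite {t. f (blend N v w t) = 0}" using p poly_roots_finite by simp
  obtain q where q: "\<forall>t. f (blend N w v t) = poly q t" using vpoly_blend[OF assms(1)] by blast
  have "f (blend N w v 0) = f w" by (rule vpoly_cong[OF assms(1)]) (simp add: blend_0)
  then have "q \<noteq> 0" using q assms(2) by auto
  then show "finite {t. f (blend N w v t) = 0}" using q poly_roots_finite by simp
qed

text \<open>
  A product of nonzero polynomials is nonzero; here without multiplying them, by moving along a line.
\<close>

lemma common_nonzero:
  assumes "finite F" "\<And>f. f \<in> F \<Longrightarrow> vpoly N f" "\<And>f. f \<in> F \<Longrightarrow> \<exists>w. f w \<noteq> 0"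
  shows "\<exists>w. \<forall>f\<in>F. f w \<noteq> 0"
  using assms
proof (induction F rule: finite_induct)
  case (insert g F)
  obtain w where w: "\<forall>f\<in>F. f w \<noteq> 0" using insert by auto
  obtain u where u: "g u \<noteq> 0" using insert.prems(2)[of g] by blast
  have "finite ((\<Union>f\<in>F. {t. f (blend N w u t) = 0}) \<union> {t. g (blend N w u t) = 0})"
  proof (intro finite_UnI finite_UN_I insert.hyps)
    show "finite {t. f (blend N w u t) = 0}" if "f \<in> F" for f
      by (rule vpoly_finite_zeros_on_line(2)) (use insert.prems(1) w that in auto)
    show "finite {t. g (blend N w u t) = 0}"
      by (rule vpoly_finite_zeros_on_line(1)) (use insert.prems(1) u in auto)
  qed
  then obtain t where "t \<notin> (\<Union>f\<in>F. {t. f (blend N w u t) = 0}) \<union> {t. g (blend N w u t) = 0}"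
    using ex_new_if_finite infinite_UNIV_char_0 by blast
  then show ?case by (intro exI[of _ "blend N w u t"]) auto
qed simp

text \<open>
  Conditions that vanish identically are ignored. So openness and density hold for every finite family, and which members of
  the family are not identically zero can be found out separately.
\<close>

definition generic_polygons :: "nat \<Rightarrow> ((nat \<Rightarrow> real^2) \<Rightarrow> real) set \<Rightarrow> (nat \<Rightarrow> real^2) set" where
  "generic_polygons N F = {v \<in> topspace (polygon_space N). \<forall>f\<in>F. (\<exists>w. f w \<noteq> 0) \<longrightarrow> f v \<noteq> 0}"

lemma generic_polygons_open:
  assumes F: "finite F" "\<And>f. f \<in> F \<Longrightarrow> vpoly N f"
  shows "openin (polygon_space N) (generic_polygons N F)"
proof -
  have o: "openin (polygon_space N) {v \<in> topspace (polygon_space N). f v \<noteq> 0}" if "f \<in> F" for f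
  proof -
    have "continuous_map (polygon_space N) euclideanreal f"
      unfolding polygon_space_def by (rule continuous_map_from_subtopology[OF vpoly_continuous[OF F(2)[OF that]]])
    from openin_continuous_map_preimage[OF this, of "- {0}"] show ?thesis by (simp add: open_Compl)
  qed
  have "openin (polygon_space N) (topspace (polygon_space N) \<inter> (\<Inter>f\<in>{f\<in>F. \<exists>w. f w \<noteq> 0}. {v \<in> topspace (polygon_space N). f v \<noteq> 0}))"
    by (rule openin_Int_Inter) (use F o in auto)
  moreover have "topspace (polygon_space N) \<inter> (\<Inter>f\<in>{f\<in>F. \<exists>w. f w \<noteq> 0}. {v \<in> topspace (polygon_space N). f v \<noteq> 0}) = generic_polygons N F"
    unfolding generic_polygons_def by auto
  ultimately show ?thesis by simp
qed

text \<open>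
  Move from \<open>v\<close> towards a point where no condition vanishes: on this line the conditions have finitely many zeros, and
  for small parameters the polygon remains simple.
\<close>

lemma generic_polygons_dense:
  assumes N: "N \<ge> 3" and F: "finite F" "\<And>f. f \<in> F \<Longrightarrow> vpoly N f"
  shows "polygon_space N closure_of generic_polygons N F = topspace (polygon_space N)"
proof (intro equalityI subsetI closure_of_subset_topspace[THEN subsetD])
  fix v assume v: "v \<in> topspace (polygon_space N)"
  then have vs: "simple_path (polygon_path N v)" and vx: "v \<in> extensional {..<N}"
    unfolding polygon_space_def topspace_subtopology topspace_product_topology PiE_def by blast+
  define F' where "F' = {f\<in>F. \<exists>w. f w \<noteq> 0}"
  obtain w where w: "\<forall>f\<in>F'. f w \<noteq> 0"
  proof -
    have "\<exists>w. \<forall>f\<in>F'. f w \<noteq> 0"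
      by (rule common_nonzero[of F' N]) (use F in \<open>simp_all add: F'_def\<close>)
    then show thesis using that by blast
  qed
  have v0: "blend N v w 0 = v"
  proof
    show "blend N v w 0 k = v k" for k
      using extensional_arb[OF vx, of k] by (cases "k < N") (simp_all add: blend_def)
  qed
  show "v \<in> polygon_space N closure_of generic_polygons N F" unfolding in_closure_of
  proof (intro conjI allI impI v)
    fix T assume T: "v \<in> T \<and> openin (polygon_space N) T"
    then obtain U where U: "openin (product_topology (\<lambda>_. euclidean) {..<N}) U" "T = U \<inter> {v. simple_path (polygon_path N v)}"
      unfolding polygon_space_def openin_subtopology by blast
    have "continuous_map euclideanreal (product_topology (\<lambda>_. euclidean) {..<N}) (blend N v w)"
      unfolding continuous_map_componentwise by (auto simp: blend_def intro!: continuous_intros)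
    from openin_continuous_map_preimage[OF this U(1)] have "open {t. blend N v w t \<in> U}" by simp
    moreover have "blend N v w 0 \<in> U" using v0 T U(2) by simp
    ultimately have "\<forall>\<^sub>F t in nhds 0. blend N v w t \<in> U" unfolding eventually_nhds by blast
    then have "\<forall>\<^sub>F t in nhds 0. blend N v w t \<in> U \<and> simple_path (polygon_path N (blend N v w t))"
      using eventually_simple[OF N vs] by eventually_elim auto
    then obtain d where d: "d > 0" "\<And>t. dist t 0 < d \<Longrightarrow> blend N v w t \<in> U \<and> simple_path (polygon_path N (blend N v w t))"
      unfolding eventually_nhds_metric by blast
    have "finite (\<Union>f\<in>F'. {t. f (blend N v w t) = 0})"
    proof (rule finite_UN_I)
      show "finite F'" using F(1) by (simp add: F'_def)
      show "finite {t. f (blend N v w t) = 0}" if "f \<in> F'" for f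
        by (rule vpoly_finite_zeros_on_line(1)) (use F(2) w that in \<open>auto simp: F'_def\<close>)
    qed
    moreover have "infinite {0<..<d}" using d(1) by simp
    ultimately have "\<not> {0<..<d} \<subseteq> (\<Union>f\<in>F'. {t. f (blend N v w t) = 0})" using finite_subset by blast
    then obtain t where t: "t \<in> {0<..<d}" "t \<notin> (\<Union>f\<in>F'. {t. f (blend N v w t) = 0})" by blast
    have "blend N v w t \<in> T" using d(2)[of t] t(1) U(2) by auto
    moreover have "blend N v w t \<in> topspace (polygon_space N)"
      using calculation T openin_subset by blast
    then have "blend N v w t \<in> generic_polygons N F"
      unfolding generic_polygons_def using t(2) by (auto simp: F'_def)
    ultimately show "\<exists>y. y \<in> generic_polygons N F \<and> y \<in> T" by blast
  qed
qed

section \<open>The genericity conditions\<close>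

text \<open>
  The conditions below are expressed by cross and dot products of the edge directions, by the cross product of edge
  direction \<open>i\<close> with \<open>v i - v k\<close>, whose vanishing means that vertex \<open>k\<close> is on the line of edge \<open>i\<close>,
  and by dot products of edge directions with differences of vertices.
\<close>

definition crs where "crs N v i j = cross2 (dir N v i) (dir N v j)"
definition dotp where "dotp N v i j = dir N v i \<bullet> dir N v j"
definition voff where "voff N v i k = cross2 (dir N v i) (v i - v k)"
definition vdot where "vdot N v i j k = dir N v i \<bullet> (v j - v k)"

text \<open>
  Let \<open>a1\<close>, \<open>a2\<close>, \<open>a3\<close> be the offsets of a point from the lines of the edges \<open>i1\<close>, \<open>i2\<close>, \<open>i3\<close>.
  If the edges \<open>i1\<close> and \<open>i3\<close> are not orthogonal, then a (possibly degenerate) rectangle of aspect ratio \<open>r\<close> that starts at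
  this point and has its other corners on these lines exists iff
  \<open>coef2 * r\<^sup>2 + coef1 * r + coef0 = 0\<close>; the left-hand side results from eliminating the first side of the
  rectangle from the three incidences. It is linear in the offsets. The coefficients \<open>vq\<close> are its values at the vertex
  \<open>k\<close>, the coefficients \<open>dq\<close> describe its change along edge \<open>k\<close>.
\<close>

definition coef2 where "coef2 N v i1 i2 i3 a1 = a1 * crs N v i2 i3"
definition coef1 where "coef1 N v i1 i2 i3 a1 a2 a3 = a2 * dotp N v i1 i3 - a1 * dotp N v i2 i3 - a3 * dotp N v i1 i2"
definition coef0 where "coef0 N v i1 i2 i3 a3 = a3 * crs N v i1 i2"

abbreviation "vq2 N v k i1 i2 i3 \<equiv> coef2 N v i1 i2 i3 (voff N v i1 k)"
abbreviation "vq1 N v k i1 i2 i3 \<equiv> coef1 N v i1 i2 i3 (voff N v i1 k) (voff N v i2 k) (voff N v i3 k)"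
abbreviation "vq0 N v k i1 i2 i3 \<equiv> coef0 N v i1 i2 i3 (voff N v i3 k)"
abbreviation "dq2 N v k i1 i2 i3 \<equiv> coef2 N v i1 i2 i3 (crs N v i1 k)"
abbreviation "dq1 N v k i1 i2 i3 \<equiv> coef1 N v i1 i2 i3 (crs N v i1 k) (crs N v i2 k) (crs N v i3 k)"
abbreviation "dq0 N v k i1 i2 i3 \<equiv> coef0 N v i1 i2 i3 (crs N v i3 k)"

definition disc where
  "disc N v k i1 i2 i3 = (vq1 N v k i1 i2 i3)\<^sup>2 - 4 * vq2 N v k i1 i2 i3 * vq0 N v k i1 i2 i3"
text \<open>
  The resultant of two quadratic polynomials. If both leading or both constant coefficients vanish, then the resultant
  vanishes, and a common positive root is governed by \<open>rel_lo\<close> or \<open>rel_hi\<close> instead.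
\<close>

definition resultant where
  "resultant (a2::real) a1 a0 b2 b1 b0 = (a2*b0 - a0*b2)\<^sup>2 - (a2*b1 - a1*b2) * (a1*b0 - a0*b1)"
definition rel_res where
  "rel_res N v k i1 i2 i3 = resultant (vq2 N v k i1 i2 i3) (vq1 N v k i1 i2 i3) (vq0 N v k i1 i2 i3)
     (dq2 N v k i1 i2 i3) (dq1 N v k i1 i2 i3) (dq0 N v k i1 i2 i3)"
definition rel_hi where
  "rel_hi N v k i1 i2 i3 = vq2 N v k i1 i2 i3 * dq1 N v k i1 i2 i3 - vq1 N v k i1 i2 i3 * dq2 N v k i1 i2 i3"
definition rel_lo where
  "rel_lo N v k i1 i2 i3 = vq1 N v k i1 i2 i3 * dq0 N v k i1 i2 i3 - vq0 N v k i1 i2 i3 * dq1 N v k i1 i2 i3"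
text \<open>
  This vanishes if there is a rectangle that has vertices \<open>k\<close> and \<open>j\<close> as adjacent corners and the other two corners on the
  lines of the edges \<open>i\<close> and \<open>l\<close>; \<open>diag_rel\<close> is the analogue for opposite corners.
\<close>

definition side_rel where
  "side_rel N v k j i l = voff N v i j * vdot N v l j k - voff N v l k * vdot N v i j k"
definition diag_rel where
  "diag_rel N v k j i l = crs N v i l * (voff N v l j * vdot N v i j k + voff N v i k * vdot N v l j k)
     - ((voff N v l j)\<^sup>2 * dotp N v i i + 2 * voff N v l j * voff N v i k * dotp N v i l + (voff N v i k)\<^sup>2 * dotp N v l l)"
text \<open>
  The value at \<open>r = 1\<close> of the quadratic polynomial of vertex \<open>k\<close>: it vanishes if a square on the lines has its first corner
  at this vertex.
\<close>

definition square_rel where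
  "square_rel N v k i1 i2 i3 = vq2 N v k i1 i2 i3 + vq1 N v k i1 i2 i3 + vq0 N v k i1 i2 i3"

definition conds :: "nat \<Rightarrow> ((nat \<Rightarrow> real^2) \<Rightarrow> real) set" where
  "conds N = (\<Union>i\<in>{..<N}. \<Union>j\<in>{..<N}. \<Union>k\<in>{..<N}. \<Union>l\<in>{..<N}.
     {\<lambda>v. crs N v i j, \<lambda>v. dotp N v i j, \<lambda>v. voff N v i j, \<lambda>v. vdot N v i j k, \<lambda>v. voff N v i k + voff N v i j,
      \<lambda>v. disc N v k i j l, \<lambda>v. rel_res N v k i j l, \<lambda>v. rel_hi N v k i j l, \<lambda>v. rel_lo N v k i j l,
      \<lambda>v. side_rel N v k j i l, \<lambda>v. diag_rel N v k j i l, \<lambda>v. square_rel N v k i j l})"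

lemma finite_conds: "finite (conds N)"
  unfolding conds_def by (intro finite_UN_I) auto

lemma vpoly_basic:
  assumes "i < N" "j < N" "k < N"
  shows "vpoly N (\<lambda>v. crs N v i j)" "vpoly N (\<lambda>v. dotp N v i j)" "vpoly N (\<lambda>v. voff N v i j)" "vpoly N (\<lambda>v. vdot N v i j k)"
  unfolding crs_def dotp_def voff_def vdot_def cross2_def inner_vec_def sum_2 dir_def vector_minus_component inner_real_def
  by (intro vpoly_intros assms nxt_less)+

lemma vpoly_conds: "f \<in> conds N \<Longrightarrow> vpoly N f"
  unfolding conds_def disc_def rel_res_def resultant_def rel_hi_def rel_lo_def side_rel_def diag_rel_def square_rel_def coef2_def coef1_def coef0_def
  by (elim UN_E insertE emptyE) (simp_all, (intro vpoly_intros vpoly_basic; simp)+)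

definition prv :: "nat \<Rightarrow> nat \<Rightarrow> nat" where "prv N k = (if k = 0 then N - 1 else k - 1)"

lemma prv_less: "k < N \<Longrightarrow> prv N k < N" by (auto simp: prv_def)
lemma prv_nxt: "k < N \<Longrightarrow> prv N (nxt N k) = k" by (cases "Suc k = N") (auto simp: prv_def nxt_def)
lemma nxt_prv: "k < N \<Longrightarrow> nxt N (prv N k) = k" by (auto simp: prv_def nxt_def)

lemma prv_neq: "N \<ge> 3 \<Longrightarrow> k < N \<Longrightarrow> prv N k \<noteq> k" by (auto simp: prv_def)
lemma prv_prv_neq: "N \<ge> 3 \<Longrightarrow> k < N \<Longrightarrow> prv N (prv N k) \<noteq> k" by (auto simp: prv_def)
text \<open>
  The intersection of the tangents to the parabola \<open>y = x\<^sup>2\<close> at the abscissas \<open>t (prv N k)\<close> and \<open>t k\<close>. So the line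
  of edge \<open>k\<close> is the tangent at \<open>t k\<close>, its direction depends on \<open>t k\<close> only up to scaling, and each condition turns into
  an explicit polynomial in the \<open>t k\<close>. These polygons serve only to show that a condition is not identically zero; they need
  not be simple.
\<close>

definition parabolic :: "nat \<Rightarrow> (nat \<Rightarrow> real) \<Rightarrow> nat \<Rightarrow> real^2" where
  "parabolic N t k = vector [(t (prv N k) + t k) / 2, t (prv N k) * t k]"

locale parabola_witness =
  fixes N :: nat and t :: "nat \<Rightarrow> real"
  assumes N3: "N \<ge> 3" and inj: "inj_on t {..<N}"
begin

definition s where "s k = (t (nxt N k) - t (prv N k)) / 2"

abbreviation "w \<equiv> parabolic N t"

lemma t_neq: "i < N \<Longrightarrow> j < N \<Longrightarrow> i \<noteq> j \<Longrightarrow> t i \<noteq> t j"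
  using inj by (auto dest: inj_onD)

lemma s_nz: "k < N \<Longrightarrow> s k \<noteq> 0"
proof -
  assume k: "k < N"
  have "nxt N k \<noteq> prv N k" using k N3 by (cases "Suc k = N") (auto simp: nxt_def prv_def)
  then show ?thesis using t_neq[of "nxt N k" "prv N k"] k nxt_less prv_less by (auto simp: s_def)
qed

lemma dir_w: "k < N \<Longrightarrow> dir N w k $ 1 = s k" "k < N \<Longrightarrow> dir N w k $ 2 = 2 * s k * t k"
  by (simp_all add: dir_def parabolic_def prv_nxt s_def field_simps)

lemma crs_w: "i < N \<Longrightarrow> j < N \<Longrightarrow> crs N w i j = s i * s j * (2 * (t j - t i))"
  by (simp add: crs_def cross2_def dir_w algebra_simps)

lemma dotp_w: "i < N \<Longrightarrow> j < N \<Longrightarrow> dotp N w i j = s i * s j * (1 + 4 * t i * t j)"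
  by (simp add: dotp_def inner_vec_def sum_2 dir_w algebra_simps)

lemma voff_w: "i < N \<Longrightarrow> k < N \<Longrightarrow> voff N w i k = - s i * ((t i - t (prv N k)) * (t i - t k))"
proof -
  assume i: "i < N" and k: "k < N"
  have "voff N w i k = s i * (w i $ 2 - w k $ 2) - (w i $ 1 - w k $ 1) * (2 * s i * t i)"
    by (simp add: voff_def cross2_def dir_w i)
  also have "\<dots> = - s i * ((t i - t (prv N k)) * (t i - t k))"
    by (simp add: parabolic_def field_simps)
  finally show ?thesis .
qed

lemma vdot_w: "i < N \<Longrightarrow> vdot N w i j k = s i * (((t (prv N j) + t j) - (t (prv N k) + t k)) / 2 + 2 * t i * (t (prv N j) * t j - t (prv N k) * t k))"
  by (simp add: vdot_def inner_vec_def sum_2 dir_w) (simp add: parabolic_def field_simps)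

lemma vdot_pos:
  assumes "i < N" "t i > 0" "t (prv N k) + t k < t (prv N j) + t j" "t (prv N k) * t k < t (prv N j) * t j"
  shows "\<exists>c>0. vdot N w i j k = s i * c"
proof -
  have "2 * t i * (t (prv N j) * t j - t (prv N k) * t k) > 0" using assms by simp
  then show ?thesis using vdot_w[OF assms(1), of j k] assms(3) by (intro exI[of _ "((t (prv N j) + t j) - (t (prv N k) + t k)) / 2 + 2 * t i * (t (prv N j) * t j - t (prv N k) * t k)"]) (simp add: add_pos_pos)
qed

end

lemma inj_override: "inj f \<Longrightarrow> (\<And>m. f m \<noteq> a) \<Longrightarrow> inj (\<lambda>m. if m = k then a else f m)"
  unfolding inj_def by metis

text \<open>
  Parameters of this form are distinct and positive, and are ordered first by level. A condition is mostly seen to be nonzero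
  by choosing levels for which all its terms have the same sign.
\<close>

lemma level_inj:
  fixes lev :: "nat \<Rightarrow> nat" shows "inj_on (\<lambda>m. real (lev m * N + m + 1)) {..<N}"
proof (rule inj_onI)
  fix x y assume xy: "x \<in> {..<N}" "y \<in> {..<N}" "real (lev x * N + x + 1) = real (lev y * N + y + 1)"
  then have "lev x * N + x = lev y * N + y" by (simp only: of_nat_eq_iff)
  then have "(lev x * N + x) mod N = (lev y * N + y) mod N" by simp
  then show "x = y" using xy by simp
qed

lemma level_less:
  fixes lev :: "nat \<Rightarrow> nat" assumes "lev x < lev y" "x < N" "y < N"
  shows "real (lev x * N + x + 1) < real (lev y * N + y + 1)"
proof -
  have "lev x * N + N \<le> lev y * N" using mult_le_mono1[of "Suc (lev x)" "lev y" N] assms(1) by simp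
  then have "lev x * N + x + 1 < lev y * N + y + 1" using assms(2) by linarith
  then show ?thesis by (simp only: of_nat_less_iff)
qed

lemma vertex_order:
  fixes t :: "nat \<Rightarrow> real"
  assumes N: "N \<ge> 3" and jk: "j < N" "k < N" "j \<noteq> k" and pos: "\<And>m. t m > 0"
    and less: "\<And>a b. a \<in> {k, prv N k} - {j, prv N j} \<Longrightarrow> b \<in> {j, prv N j} - {k, prv N k} \<Longrightarrow> t a < t b"
  shows "t (prv N k) + t k < t (prv N j) + t j \<and> t (prv N k) * t k < t (prv N j) * t j"
proof -
  have pn: "prv N k \<noteq> prv N j" using jk nxt_prv by metis
  have n: "prv N k \<noteq> k" "prv N j \<noteq> j" using prv_neq N jk by auto
  have nb: "\<not> (prv N k = j \<and> prv N j = k)" using prv_prv_neq N jk by auto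
  show ?thesis
  proof -
    consider "prv N k = j" "prv N j \<noteq> k" | "prv N j = k" "prv N k \<noteq> j" | "prv N k \<noteq> j" "prv N j \<noteq> k" using nb by blast
    then show ?thesis
    proof cases
      case 1
      then have "t k < t (prv N j)" using n jk by (intro less) auto
      then show ?thesis using 1 pos[of j] by (simp add: mult.commute)
    next
      case 2
      then have "t (prv N k) < t j" using n jk by (intro less) auto
      then show ?thesis using 2 pos[of k] by (simp add: mult.commute)
    next
      case 3
      have "t k < t j" "t (prv N k) < t (prv N j)" using 3 jk n pn by (auto intro!: less)
      then show ?thesis using pos[of k] pos[of "prv N k"] by (auto intro: mult_strict_mono less_imp_le add_strict_mono)
    qed
  qed
qed

context
  fixes N :: nat assumes N3: "N \<ge> 3"
begin

lemma witness_level: "parabola_witness N (\<lambda>m. real (lev m * N + m + 1))"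
  by unfold_locales (rule N3, rule level_inj)

lemma ex_crs: assumes "i < N" "j < N" "i \<noteq> j" shows "\<exists>w. crs N w i j \<noteq> 0"
proof -
  interpret parabola_witness N "\<lambda>m. real (0 * N + m + 1)" by (rule witness_level)
  show ?thesis using crs_w[OF assms(1,2)] s_nz assms by (intro exI[of _ w]) auto
qed

lemma ex_dotp: assumes "i < N" "j < N" shows "\<exists>w. dotp N w i j \<noteq> 0"
proof -
  interpret parabola_witness N "\<lambda>m. real (0 * N + m + 1)" by (rule witness_level)
  have "1 + 4 * real (0 * N + i + 1) * real (0 * N + j + 1) > 0" by (intro add_pos_nonneg) auto
  then show ?thesis using dotp_w[OF assms(1,2)] s_nz assms by (intro exI[of _ w]) (simp del: of_nat_add of_nat_mult)
qed

lemma ex_voff: assumes "i < N" "k < N" "i \<noteq> k" "i \<noteq> prv N k" shows "\<exists>w. voff N w i k \<noteq> 0"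
proof -
  interpret parabola_witness N "\<lambda>m. real (0 * N + m + 1)" by (rule witness_level)
  show ?thesis using voff_w[OF assms(1,2)] s_nz t_neq[of i k] t_neq[of i "prv N k"] prv_less assms by (intro exI[of _ w]) auto
qed

lemma ex_vdot: assumes "i < N" "j < N" "k < N" "j \<noteq> k" shows "\<exists>w. vdot N w i j k \<noteq> 0"
proof -
  define lev where "lev m = (if m \<in> {k, prv N k} - {j, prv N j} then 0 else 1::nat)" for m
  define t where "t m = real (lev m * N + m + 1)" for m
  have t: "t = (\<lambda>m. real (lev m * N + m + 1))" by (auto simp: t_def)
  interpret parabola_witness N t unfolding t by (rule witness_level)
  have vo: "t (prv N k) + t k < t (prv N j) + t j \<and> t (prv N k) * t k < t (prv N j) * t j"
  proof (rule vertex_order[OF N3 assms(2-4)])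
    show "t m > 0" for m unfolding t_def by (simp only: of_nat_0_less_iff)
    fix a b assume "a \<in> {k, prv N k} - {j, prv N j}" "b \<in> {j, prv N j} - {k, prv N k}"
    then show "t a < t b" unfolding t_def using assms prv_less[of _ N] by (intro level_less) (auto simp: lev_def)
  qed
  obtain c where "c > 0" "vdot N w i j k = s i * c"
  proof -
    have "t i > 0" unfolding t_def by (simp only: of_nat_0_less_iff)
    then show thesis using vdot_pos[OF assms(1) _ conjunct1[OF vo] conjunct2[OF vo]] that by blast
  qed
  then show ?thesis using s_nz[OF assms(1)] by (intro exI[of _ w]) auto
qed

lemma ex_voff_sum: assumes "i < N" "j < N" "k < N" "\<not> (i \<in> {k, prv N k} \<and> i \<in> {j, prv N j})"
  shows "\<exists>w. voff N w i k + voff N w i j \<noteq> 0"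
proof -
  define lev where "lev m = (if m = i then 1 else 0::nat)" for m
  define t where "t m = real (lev m * N + m + 1)" for m
  have t: "t = (\<lambda>m. real (lev m * N + m + 1))" by (auto simp: t_def)
  interpret parabola_witness N t unfolding t by (rule witness_level)
  have le: "t m \<le> t i" if "m < N" for m
    using level_less[of lev m i N] that assms(1) unfolding t_def by (cases "m = i") (auto simp: lev_def)
  define a where "a k = (t i - t (prv N k)) * (t i - t k)" for k
  have a0: "a k \<ge> 0" if "k < N" for k using le that prv_less unfolding a_def by (simp add: mult_nonneg_nonneg)
  have az: "a k = 0 \<longleftrightarrow> i \<in> {k, prv N k}" if "k < N" for k
    using t_neq[of i k] t_neq[of i "prv N k"] assms(1) that prv_less unfolding a_def by auto
  have "voff N w i k + voff N w i j = - s i * (a k + a j)" unfolding voff_w[OF assms(1,3)] voff_w[OF assms(1,2)] a_def by (simp add: algebra_simps)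
  moreover have "a k + a j > 0" using a0[of k] a0[of j] az[of k] az[of j] assms by (metis add_nonneg_eq_0_iff add_nonneg_nonneg order_le_less)
  ultimately show ?thesis using s_nz[OF assms(1)] by (intro exI[of _ w]) auto
qed

lemma ex_disc:
  assumes "k < N" "i1 < N" "i2 < N" "i3 < N" "i1 \<notin> {k, prv N k}" "i3 \<notin> {k, prv N k}" "i1 \<noteq> i2" "i2 \<noteq> i3" "i1 \<noteq> i3"
  shows "\<exists>w. disc N w k i1 i2 i3 \<noteq> 0"
proof -
  define lev where "lev m = (if m = i1 \<or> m = i3 then 1 else 0::nat)" for m
  define t where "t m = real (lev m * N + m + 1)" for m
  have t: "t = (\<lambda>m. real (lev m * N + m + 1))" by (auto simp: t_def)
  interpret parabola_witness N t unfolding t by (rule witness_level)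
  have gt: "t m < t i1" "t m < t i3" if "m < N" "m \<noteq> i1" "m \<noteq> i3" for m
    using level_less[of lev m _ N] that assms unfolding t_def by (auto simp: lev_def)
  have pk: "prv N k < N" using prv_less assms(1) by blast
  define P where "P = ((t i1 - t (prv N k)) * (t i1 - t k)) * ((t i3 - t (prv N k)) * (t i3 - t k)) * ((t i3 - t i2) * (t i1 - t i2))"
  have g: "t k < t i1" "t k < t i3" "t (prv N k) < t i1" "t (prv N k) < t i3" "t i2 < t i1" "t i2 < t i3"
    by (rule gt; use assms pk in force)+
  have "P > 0" unfolding P_def by (intro mult_pos_pos) (simp_all add: g)
  moreover have "(s i1 * s i2 * s i3)\<^sup>2 > 0" using s_nz assms by simp
  ultimately have "(s i1 * s i2 * s i3)\<^sup>2 * P > 0" by simp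
  moreover have "vq2 N w k i1 i2 i3 * vq0 N w k i1 i2 i3 = - 4 * ((s i1 * s i2 * s i3)\<^sup>2 * P)"
    unfolding P_def coef2_def coef0_def voff_w[OF assms(2,1)] voff_w[OF assms(4,1)] crs_w[OF assms(3,4)] crs_w[OF assms(2,3)]
    by algebra
  ultimately have "vq2 N w k i1 i2 i3 * vq0 N w k i1 i2 i3 < 0" by linarith
  moreover have "disc N w k i1 i2 i3 = (vq1 N w k i1 i2 i3)\<^sup>2 - 4 * (vq2 N w k i1 i2 i3 * vq0 N w k i1 i2 i3)"
    by (simp add: disc_def)
  moreover have "(vq1 N w k i1 i2 i3)\<^sup>2 \<ge> 0" by simp
  ultimately have "disc N w k i1 i2 i3 > 0" by linarith
  then show ?thesis by (intro exI[of _ w]) auto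
qed

lemma ex_side_rel:
  assumes "i < N" "l < N" "j < N" "k < N" "j \<noteq> k" "i \<notin> {j, prv N j}" "l \<notin> {k, prv N k}"
  shows "\<exists>w. side_rel N w k j i l \<noteq> 0"
proof -
  have pn: "prv N k \<noteq> prv N j" using assms nxt_prv by metis
  have n: "prv N k \<noteq> k" "prv N j \<noteq> j" using prv_neq N3 assms by auto
  have nb: "\<not> (prv N k = j \<and> prv N j = k)" using prv_prv_neq N3 assms by auto
  have ex: "\<exists>\<alpha> \<beta>. {k, prv N k} = {\<alpha>, \<beta>} \<and> \<alpha> \<noteq> \<beta> \<and> \<alpha> \<notin> {j, prv N j} \<and> i \<noteq> \<beta>"
  proof -
    consider "i = k" | "i = prv N k" | "i \<notin> {k, prv N k}" "k \<notin> {j, prv N j}" | "i \<notin> {k, prv N k}" "prv N k \<notin> {j, prv N j}"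
      using nb assms(5) pn by auto
    then show ?thesis
    proof cases
      case 1 show ?thesis by (rule exI[of _ k], rule exI[of _ "prv N k"]) (use 1 n assms(6) in auto)
    next
      case 2 show ?thesis by (rule exI[of _ "prv N k"], rule exI[of _ k]) (use 2 n assms(6) in auto)
    next
      case 3 show ?thesis by (rule exI[of _ k], rule exI[of _ "prv N k"]) (use 3 n in auto)
    next
      case 4 show ?thesis by (rule exI[of _ "prv N k"], rule exI[of _ k]) (use 4 n in auto)
    qed
  qed
  then obtain \<alpha> \<beta> where ab: "{k, prv N k} = {\<alpha>, \<beta>}" "\<alpha> \<noteq> \<beta>" "\<alpha> \<notin> {j, prv N j}" "i \<noteq> \<beta>" by blast
  have abN: "\<alpha> < N" "\<beta> < N" using ab(1) assms(4) prv_less[OF assms(4)] by (auto simp: doubleton_eq_iff)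
  have l: "l \<noteq> \<alpha>" "l \<noteq> \<beta>" using ab(1) assms(7) by auto
  define t where "t = (\<lambda>m. if m = l then 3 else if m = \<alpha> then 2 else if m = \<beta> then 4 else if m = i then 1 else 5 + real m)"
  interpret parabola_witness N t
    by unfold_locales (rule N3, rule inj_on_subset[OF _ subset_UNIV], unfold t_def, intro inj_override, auto simp: inj_def)
  have tl: "t l = 3" and ta: "t \<alpha> = 2" and tb: "t \<beta> = 4" using l ab(2) by (simp_all add: t_def)
  have ti: "t i \<le> 3" "i \<noteq> l \<Longrightarrow> t i \<le> 2" using ab(4) by (simp_all add: t_def)
  have y: "(t m = 3 \<and> m = l) \<or> t m = 4 \<or> t m \<ge> 5" if "m \<in> {j, prv N j}" for m
  proof -
    have "m \<noteq> \<alpha>" "m \<noteq> i" using that ab(3) assms(6) by auto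
    then show ?thesis by (simp add: t_def)
  qed
  have yi: "t m > t i" if "m \<in> {j, prv N j}" for m
  proof -
    have "m \<noteq> i" using that assms(6) by auto
    then show ?thesis using y[OF that] ti by fastforce
  qed
  have ydist: "t j \<noteq> t (prv N j)" by (rule t_neq) (use n prv_less assms in auto)
  have x: "t (prv N k) + t k = 6" "t (prv N k) * t k = 8"
    using ab(1) ta tb by (auto simp: doubleton_eq_iff)
  define y1 where "y1 = t (prv N j)"
  define y2 where "y2 = t j"
  have yy: "(y1 = 3 \<or> y1 = 4 \<or> y1 \<ge> 5) \<and> (y2 = 3 \<or> y2 = 4 \<or> y2 \<ge> 5) \<and> y1 \<noteq> y2"
    using y[of j] y[of "prv N j"] ydist by (auto simp: y1_def y2_def)
  have "y1 + y2 > 6 \<and> y1 * y2 > 8"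
  proof -
    have "y1 \<ge> 3" "y2 \<ge> 3" "y1 \<ge> 4 \<or> y2 \<ge> 4" using yy by auto
    moreover have "y1 * y2 \<ge> 3 * 3" by (rule mult_mono) (use \<open>y1 \<ge> 3\<close> \<open>y2 \<ge> 3\<close> in auto)
    ultimately show ?thesis by auto
  qed
  then have vo: "t (prv N k) + t k < t (prv N j) + t j" "t (prv N k) * t k < t (prv N j) * t j"
    unfolding x y1_def y2_def by auto
  have pos: "t m > 0" for m by (simp add: t_def)
  obtain c where c: "c > 0" "vdot N w i j k = s i * c" using vdot_pos[OF assms(1) pos vo] by blast
  obtain d where d: "d > 0" "vdot N w l j k = s l * d" using vdot_pos[OF assms(2) pos vo] by blast
  define A where "A = (t i - t (prv N j)) * (t i - t j)"
  define B where "B = (t l - t (prv N k)) * (t l - t k)"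
  have A: "A > 0" unfolding A_def using yi[of j] yi[of "prv N j"] by (simp add: mult_neg_neg)
  have B: "B < 0" unfolding B_def using ab(1) ta tb tl by (auto simp: doubleton_eq_iff)
  have "side_rel N w k j i l = - (s i * s l) * (A * d - B * c)"
    unfolding side_rel_def c d voff_w[OF assms(1,3)] voff_w[OF assms(2,4)] A_def[symmetric] B_def[symmetric] by (simp add: algebra_simps)
  moreover have "A * d - B * c > 0" using mult_pos_pos[OF A d(1)] mult_neg_pos[OF B c(1)] by linarith
  ultimately have "side_rel N w k j i l \<noteq> 0" using s_nz assms by simp
  then show ?thesis by blast
qed

lemma ex_diag_rel:
  assumes "i < N" "l < N" "j < N" "k < N" "j \<noteq> k" "i \<noteq> l"
    and "\<not> (i \<in> {k, prv N k} \<and> l \<in> {j, prv N j})" "\<not> (i \<in> {j, prv N j} \<and> l \<in> {k, prv N k})"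
    and "\<not> (i \<in> {k, prv N k} \<and> i \<in> {j, prv N j})" "\<not> (l \<in> {k, prv N k} \<and> l \<in> {j, prv N j})"
  shows "\<exists>w. diag_rel N w k j i l \<noteq> 0"
proof -
  define KS where "KS = {k, prv N k}"
  define JS where "JS = {j, prv N j}"
  define lev where "lev m = (if m = i \<and> i \<notin> JS then 0 else if m \<in> KS - JS then 1 else if m \<in> KS then 2
     else if m \<in> JS \<and> m \<noteq> l then 3 else if m \<in> JS then 4 else if m = l then 5 else 4::nat)" for m
  define t where "t m = real (lev m * N + m + 1)" for m
  have t: "t = (\<lambda>m. real (lev m * N + m + 1))" by (auto simp: t_def)
  interpret parabola_witness N t unfolding t by (rule witness_level)
  have less: "t a < t b" if "lev a < lev b" "a < N" "b < N" for a b unfolding t_def by (rule level_less[OF that])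
  have KN: "a < N" if "a \<in> KS" for a using that assms(4) prv_less by (auto simp: KS_def)
  have JN: "a < N" if "a \<in> JS" for a using that assms(3) prv_less by (auto simp: JS_def)
  note as = assms(6-10)[folded KS_def JS_def]
  have vo': "t (prv N k) + t k < t (prv N j) + t j \<and> t (prv N k) * t k < t (prv N j) * t j"
  proof (rule vertex_order[OF N3 assms(3-5)])
    show "t m > 0" for m unfolding t_def by (simp only: of_nat_0_less_iff)
    fix a b assume "a \<in> {k, prv N k} - {j, prv N j}" "b \<in> {j, prv N j} - {k, prv N k}"
    then have ab: "a \<in> KS - JS" "b \<in> JS - KS" by (simp_all add: KS_def JS_def)
    then show "t a < t b" using KN JN by (intro less) (auto simp: lev_def)
  qed
  note vo = conjunct1[OF vo'] conjunct2[OF vo']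
  have pos: "t m > 0" for m unfolding t_def by (simp only: of_nat_0_less_iff)
  obtain c where c: "c > 0" "vdot N w i j k = s i * c" using vdot_pos[OF assms(1) pos vo] by blast
  obtain d where d: "d > 0" "vdot N w l j k = s l * d" using vdot_pos[OF assms(2) pos vo] by blast
  define A where "A = (t i - t (prv N k)) * (t i - t k)"
  define B where "B = (t l - t (prv N j)) * (t l - t j)"
  have il: "t i < t l"
    by (rule less) (use as assms(1,2) in \<open>auto simp: lev_def\<close>)
  have A: "A \<ge> 0"
  proof (cases "i \<in> JS")
    case True
    then have "t a < t i" if "a \<in> KS" for a using that as KN assms(1) by (intro less) (auto simp: lev_def)
    then have "t k < t i" "t (prv N k) < t i" by (auto simp: KS_def)
    then show ?thesis unfolding A_def by simp
  next
    case False
    have "t i \<le> t a" if "a \<in> KS" for a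
      using that as KN assms(1) less[of i a] False by (cases "a = i") (auto simp: lev_def intro!: less_imp_le less)
    then have "t i \<le> t k" "t i \<le> t (prv N k)" by (auto simp: KS_def)
    then show ?thesis unfolding A_def by (simp add: mult_nonpos_nonpos)
  qed
  have B: "B \<ge> 0"
  proof (cases "l \<in> JS")
    case True
    then show ?thesis unfolding B_def JS_def by auto
  next
    case lJ: False
    show ?thesis
    proof (cases "l \<in> KS")
      case True
      then have "t l < t a" if "a \<in> JS" for a using that as JN lJ assms(2) by (intro less) (auto simp: lev_def)
      then have "t l < t j" "t l < t (prv N j)" by (auto simp: JS_def)
      then show ?thesis unfolding B_def by (simp add: mult_nonpos_nonpos)
    next
      case False
      then have "t a < t l" if "a \<in> JS" for a using that as JN lJ assms(2) by (intro less) (auto simp: lev_def)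
      then have "t j < t l" "t (prv N j) < t l" by (auto simp: JS_def)
      then show ?thesis unfolding B_def by simp
    qed
  qed
  have pj: "prv N j < N" "prv N k < N" using prv_less assms by auto
  have Az: "A = 0 \<longleftrightarrow> i \<in> KS" using t_neq[of i k] t_neq[of i "prv N k"] assms pj unfolding A_def KS_def by auto
  have Bz: "B = 0 \<longleftrightarrow> l \<in> JS" using t_neq[of l j] t_neq[of l "prv N j"] assms pj unfolding B_def JS_def by auto
  have AB: "A > 0 \<or> B > 0" using A B Az Bz as by auto
  have sp: "(s i * s l)\<^sup>2 > 0" using s_nz assms by simp
  have eq: "diag_rel N w k j i l = - (s i * s l)\<^sup>2 * (2 * (t l - t i) * (B * c + A * d)
      + (B\<^sup>2 + 2 * A * B + A\<^sup>2 + (2 * B * t i + 2 * A * t l)\<^sup>2))"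
    unfolding diag_rel_def c d voff_w[OF assms(1,4)] voff_w[OF assms(2,3)] A_def[symmetric] B_def[symmetric]
    unfolding crs_w[OF assms(1,2)] dotp_w[OF assms(1,1)] dotp_w[OF assms(1,2)] dotp_w[OF assms(2,2)] by algebra
  have "B * c + A * d > 0" using A B AB c(1) d(1) by (metis add_nonneg_pos add_pos_nonneg mult_nonneg_nonneg mult_pos_pos order_less_imp_le)
  then have "2 * (t l - t i) * (B * c + A * d) > 0" using il by simp
  moreover have "B\<^sup>2 + 2 * A * B + A\<^sup>2 + (2 * B * t i + 2 * A * t l)\<^sup>2 \<ge> 0" using A B by simp
  ultimately have "diag_rel N w k j i l < 0" unfolding eq using sp by (simp add: mult_pos_pos add_pos_nonneg)
  then show ?thesis by (intro exI[of _ w]) auto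
qed

end

section \<open>Resultants and the square condition at the witnesses\<close>

lemma resultant_shift: "resultant (a2+C*b2) (a1+C*b1) (a0+C*b0) b2 b1 b0 = resultant a2 a1 a0 b2 b1 b0"
  unfolding resultant_def by algebra

lemma resultant_scale: "resultant (S*a2) (S*a1) (S*a0) (T*b2) (T*b1) (T*b0) = (S*T)\<^sup>2 * resultant a2 a1 a0 b2 b1 b0"
  unfolding resultant_def by algebra

context parabola_witness begin

lemma voff_shift: assumes "i < N" "k < N"
  shows "voff N w i k = - s i * (t i - t k)\<^sup>2 + (t k - t (prv N k)) / (2 * s k) * crs N w i k"
  unfolding voff_w[OF assms] crs_w[OF assms] using s_nz[OF assms(2)] by (simp add: power2_eq_square field_simps)

text \<open>
  By \<open>voff_shift\<close> the quadratic of vertex \<open>k\<close> is, up to a multiple of the quadratic of the direction of edge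
  \<open>k\<close>, the one of the point of tangency of that edge. Resultants ignore such multiples, so
  vertex \<open>k\<close> is in effect replaced by a point that depends on \<open>t k\<close> alone.
\<close>

lemma relative_coefficients:
  assumes k: "k < N" and i: "i1 < N" "i2 < N" "i3 < N"
  defines "S \<equiv> s i1 * s i2 * s i3" and "C \<equiv> (t k - t (prv N k)) / (2 * s k)"
    and "\<phi>2 \<equiv> - (t i1 - t k)\<^sup>2 * (2 * (t i3 - t i2))"
    and "\<phi>1 \<equiv> - (t i2 - t k)\<^sup>2 * (1 + 4 * t i1 * t i3) + (t i1 - t k)\<^sup>2 * (1 + 4 * t i2 * t i3) + (t i3 - t k)\<^sup>2 * (1 + 4 * t i1 * t i2)"
    and "\<phi>0 \<equiv> - (t i3 - t k)\<^sup>2 * (2 * (t i2 - t i1))"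
    and "\<gamma>2 \<equiv> - 2 * (t i1 - t k) * (2 * (t i3 - t i2))"
    and "\<gamma>1 \<equiv> - 2 * (t i2 - t k) * (1 + 4 * t i1 * t i3) + 2 * (t i1 - t k) * (1 + 4 * t i2 * t i3) + 2 * (t i3 - t k) * (1 + 4 * t i1 * t i2)"
    and "\<gamma>0 \<equiv> - 2 * (t i3 - t k) * (2 * (t i2 - t i1))"
  shows "rel_res N w k i1 i2 i3 = (S * (S * s k))\<^sup>2 * resultant \<phi>2 \<phi>1 \<phi>0 \<gamma>2 \<gamma>1 \<gamma>0"
    "rel_hi N w k i1 i2 i3 = S * (S * s k) * (\<phi>2 * \<gamma>1 - \<phi>1 * \<gamma>2)"
    "rel_lo N w k i1 i2 i3 = S * (S * s k) * (\<phi>1 * \<gamma>0 - \<phi>0 * \<gamma>1)"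
    "S * (S * s k) \<noteq> 0"
proof -
  have D: "dq2 N w k i1 i2 i3 = (S * s k) * \<gamma>2" "dq1 N w k i1 i2 i3 = (S * s k) * \<gamma>1" "dq0 N w k i1 i2 i3 = (S * s k) * \<gamma>0"
    unfolding coef2_def coef1_def coef0_def S_def \<gamma>2_def \<gamma>1_def \<gamma>0_def
      crs_w[OF i(1) k] crs_w[OF i(2) k] crs_w[OF i(3) k] crs_w[OF i(2,3)] crs_w[OF i(1,2)] dotp_w[OF i(1,3)] dotp_w[OF i(2,3)] dotp_w[OF i(1,2)]
    by algebra+
  have A: "vq2 N w k i1 i2 i3 = S * \<phi>2 + C * dq2 N w k i1 i2 i3" "vq1 N w k i1 i2 i3 = S * \<phi>1 + C * dq1 N w k i1 i2 i3"
      "vq0 N w k i1 i2 i3 = S * \<phi>0 + C * dq0 N w k i1 i2 i3"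
    unfolding coef2_def coef1_def coef0_def S_def \<phi>2_def \<phi>1_def \<phi>0_def
      voff_shift[OF i(1) k, folded C_def] voff_shift[OF i(2) k, folded C_def] voff_shift[OF i(3) k, folded C_def]
      crs_w[OF i(2,3)] crs_w[OF i(1,2)] dotp_w[OF i(1,3)] dotp_w[OF i(2,3)] dotp_w[OF i(1,2)]
    by algebra+
  show "rel_res N w k i1 i2 i3 = (S * (S * s k))\<^sup>2 * resultant \<phi>2 \<phi>1 \<phi>0 \<gamma>2 \<gamma>1 \<gamma>0"
    unfolding rel_res_def A resultant_shift unfolding D resultant_scale ..
  show "rel_hi N w k i1 i2 i3 = S * (S * s k) * (\<phi>2 * \<gamma>1 - \<phi>1 * \<gamma>2)"
    unfolding rel_hi_def A D by algebra
  show "rel_lo N w k i1 i2 i3 = S * (S * s k) * (\<phi>1 * \<gamma>0 - \<phi>0 * \<gamma>1)"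
    unfolding rel_lo_def A D by algebra
  show "S * (S * s k) \<noteq> 0" unfolding S_def using s_nz k i by simp
qed

lemma square_rel_w:
  assumes k: "k < N" and i: "i1 < N" "i2 < N" "i3 < N"
  defines "a \<equiv> \<lambda>i. - ((t i - t (prv N k)) * (t i - t k))"
  shows "square_rel N w k i1 i2 i3 = (s i1 * s i2 * s i3) *
     (a i1 * (2 * (t i3 - t i2) - (1 + 4 * t i2 * t i3)) + a i2 * (1 + 4 * t i1 * t i3) + a i3 * (2 * (t i2 - t i1) - (1 + 4 * t i1 * t i2)))"
  unfolding square_rel_def coef2_def coef1_def coef0_def voff_w[OF i(1) k] voff_w[OF i(2) k] voff_w[OF i(3) k]
     crs_w[OF i(2,3)] crs_w[OF i(1,2)] dotp_w[OF i(1,3)] dotp_w[OF i(2,3)] dotp_w[OF i(1,2)] a_def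
  by algebra

end

context
  fixes N :: nat assumes N3: "N \<ge> 3"
begin

lemma ex_rel:
  assumes kN: "k < N" and iN: "i1 < N" "i2 < N" "i3 < N"
  shows "k \<noteq> i1 \<Longrightarrow> k \<noteq> i2 \<Longrightarrow> k \<noteq> i3 \<Longrightarrow> i1 \<noteq> i2 \<Longrightarrow> i2 \<noteq> i3 \<Longrightarrow> \<exists>w. rel_res N w k i1 i2 i3 \<noteq> 0"
    and "k = i2 \<Longrightarrow> k \<noteq> i1 \<Longrightarrow> k \<noteq> i3 \<Longrightarrow> i1 \<noteq> i3 \<Longrightarrow> \<exists>w. rel_res N w k i1 i2 i3 \<noteq> 0"
    and "k = i1 \<Longrightarrow> k \<noteq> i2 \<Longrightarrow> k \<noteq> i3 \<Longrightarrow> i2 \<noteq> i3 \<Longrightarrow> \<exists>w. rel_lo N w k i1 i2 i3 \<noteq> 0"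
    and "i2 = i3 \<Longrightarrow> k \<noteq> i1 \<Longrightarrow> k \<noteq> i2 \<Longrightarrow> i1 \<noteq> i2 \<Longrightarrow> \<exists>w. rel_lo N w k i1 i2 i3 \<noteq> 0"
    and "k = i3 \<Longrightarrow> k \<noteq> i1 \<Longrightarrow> k \<noteq> i2 \<Longrightarrow> i1 \<noteq> i2 \<Longrightarrow> \<exists>w. rel_hi N w k i1 i2 i3 \<noteq> 0"
    and "i1 = i2 \<Longrightarrow> k \<noteq> i1 \<Longrightarrow> k \<noteq> i3 \<Longrightarrow> i1 \<noteq> i3 \<Longrightarrow> \<exists>w. rel_hi N w k i1 i2 i3 \<noteq> 0"
proof -
  \<comment> \<open>With the tangency point of edge \<open>k\<close> at the origin, the remaining values are small numbers.\<close>
  define t where "t = (\<lambda>m. if m = k then 0 else if m = i1 then 1 else if m = i2 then 2 else if m = i3 then 3 else 10 + real m)"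
  interpret parabola_witness N t
    by unfold_locales (rule N3, rule inj_on_subset[OF _ subset_UNIV], unfold t_def, intro inj_override, auto simp: inj_def)
  note c = relative_coefficients[OF assms]
  have fin: "\<exists>w. rel_res N w k i1 i2 i3 \<noteq> 0" if "rel_res N w k i1 i2 i3 \<noteq> 0" using that by blast
  have fin2: "\<exists>w. rel_lo N w k i1 i2 i3 \<noteq> 0" if "rel_lo N w k i1 i2 i3 \<noteq> 0" using that by blast
  have fin3: "\<exists>w. rel_hi N w k i1 i2 i3 \<noteq> 0" if "rel_hi N w k i1 i2 i3 \<noteq> 0" using that by blast
  have tk: "t k = 0" by (simp add: t_def)
  show "\<exists>w. rel_res N w k i1 i2 i3 \<noteq> 0" if "k \<noteq> i1" "k \<noteq> i2" "k \<noteq> i3" "i1 \<noteq> i2" "i2 \<noteq> i3"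
  proof (rule fin, cases "i1 = i3")
    case True
    then have "t i1 = 1" "t i2 = 2" "t i3 = 1" using that by (simp_all add: t_def)
    then show "rel_res N w k i1 i2 i3 \<noteq> 0" unfolding c(1) using c(4) by (simp add: tk resultant_def)
  next
    case False
    then have "t i1 = 1" "t i2 = 2" "t i3 = 3" using that by (simp_all add: t_def)
    then show "rel_res N w k i1 i2 i3 \<noteq> 0" unfolding c(1) using c(4) by (simp add: tk resultant_def)
  qed
  show "\<exists>w. rel_res N w k i1 i2 i3 \<noteq> 0" if "k = i2" "k \<noteq> i1" "k \<noteq> i3" "i1 \<noteq> i3"
  proof (rule fin)
    have "t i1 = 1" "t i2 = 0" "t i3 = 3" using that by (simp_all add: t_def)
    then show "rel_res N w k i1 i2 i3 \<noteq> 0" unfolding c(1) using c(4) by (simp add: tk resultant_def)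
  qed
  show "\<exists>w. rel_lo N w k i1 i2 i3 \<noteq> 0" if "k = i1" "k \<noteq> i2" "k \<noteq> i3" "i2 \<noteq> i3"
  proof (rule fin2)
    have "t i1 = 0" "t i2 = 2" "t i3 = 3" using that by (simp_all add: t_def)
    then show "rel_lo N w k i1 i2 i3 \<noteq> 0" unfolding c(3) using c(4) by (simp add: tk)
  qed
  show "\<exists>w. rel_lo N w k i1 i2 i3 \<noteq> 0" if "i2 = i3" "k \<noteq> i1" "k \<noteq> i2" "i1 \<noteq> i2"
  proof (rule fin2)
    have "t i1 = 1" "t i2 = 2" "t i3 = 2" using that by (simp_all add: t_def)
    then show "rel_lo N w k i1 i2 i3 \<noteq> 0" unfolding c(3) using c(4) by (simp add: tk)
  qed
  show "\<exists>w. rel_hi N w k i1 i2 i3 \<noteq> 0" if "k = i3" "k \<noteq> i1" "k \<noteq> i2" "i1 \<noteq> i2"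
  proof (rule fin3)
    have "t i1 = 1" "t i2 = 2" "t i3 = 0" using that by (simp_all add: t_def)
    then show "rel_hi N w k i1 i2 i3 \<noteq> 0" unfolding c(2) using c(4) by (simp add: tk)
  qed
  show "\<exists>w. rel_hi N w k i1 i2 i3 \<noteq> 0" if "i1 = i2" "k \<noteq> i1" "k \<noteq> i3" "i1 \<noteq> i3"
  proof (rule fin3)
    have "t i1 = 1" "t i2 = 1" "t i3 = 3" using that by (simp_all add: t_def)
    then show "rel_hi N w k i1 i2 i3 \<noteq> 0" unfolding c(2) using c(4) by (simp add: tk)
  qed
qed

text \<open>
  The levels place \<open>t\<close> of each edge with respect to the interval from \<open>t (prv N k)\<close> to \<open>t k\<close>, which decides the
  sign of the offset of vertex \<open>k\<close> from the line of that edge, up to the factor \<open>s\<close>.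
\<close>

lemma ex_square_rel:
  assumes kN: "k < N" and iN: "i1 < N" "i2 < N" "i3 < N"
    and out: "\<not> (i1 \<in> {k, prv N k} \<and> i2 \<in> {k, prv N k} \<and> i3 \<in> {k, prv N k})"
  shows "\<exists>w. square_rel N w k i1 i2 i3 \<noteq> 0"
proof -
  define KS where "KS = {k, prv N k}"
  define lev where "lev m = (if i1 = i2 \<and> i2 \<noteq> i3 then (if m = prv N k then 1 else if m = k then 3 else if m = i1 then 0 else if m = i3 then 2 else 4)
     else (if m = prv N k then 0 else if m = k then 2 else if m = i2 then 3 else if m \<in> {i1,i3} then 1 else (4::nat)))" for m
  define t where "t m = real (lev m * N + m + 1)" for m
  have t: "t = (\<lambda>m. real (lev m * N + m + 1))" by (auto simp: t_def)
  interpret parabola_witness N t unfolding t by (rule witness_level[OF N3])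
  have less: "t a < t b" if "lev a < lev b" "a < N" "b < N" for a b unfolding t_def by (rule level_less[OF that])
  have pN: "prv N k < N" using prv_less kN by blast
  have pk: "prv N k \<noteq> k" using prv_neq[OF N3 kN] .
  have t1: "t m \<ge> 1" for m unfolding t_def by simp
  define a where "a i = - ((t i - t (prv N k)) * (t i - t k))" for i
  have a0: "a i = 0" if "i \<in> KS" for i using that by (auto simp: a_def KS_def)
  have a_mid: "a i > 0" if "t (prv N k) < t i" "t i < t k" for i
    using that by (simp add: a_def mult_pos_neg)
  have a_hi: "a i < 0" if "t (prv N k) < t i" "t k < t i" for i
    using that by (simp add: a_def)
  have a_lo: "a i < 0" if "t (prv N k) > t i" "t k > t i" for i
    using that by (simp add: a_def mult_neg_neg)
  have S: "s i1 * s i2 * s i3 \<noteq> 0" using s_nz iN by simp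
  define E where "E = a i1 * (2 * (t i3 - t i2) - (1 + 4 * t i2 * t i3)) + a i2 * (1 + 4 * t i1 * t i3) + a i3 * (2 * (t i2 - t i1) - (1 + 4 * t i1 * t i2))"
  have sq: "square_rel N w k i1 i2 i3 = (s i1 * s i2 * s i3) * E"
    unfolding E_def a_def by (rule square_rel_w[OF assms(1-4)])
  have pp0: "1 + 4 * t x * t y > 0" for x y using t1[of x] t1[of y] by (intro add_pos_nonneg mult_nonneg_nonneg) auto
  have out': "\<not> (i1 \<in> KS \<and> i2 \<in> KS \<and> i3 \<in> KS)" using out by (simp add: KS_def)
  have "E < 0 \<or> (i1 = i2 \<and> i2 = i3 \<and> E \<noteq> 0)"
  proof -
    consider "i1 = i2" "i2 = i3" | "i1 = i2" "i2 \<noteq> i3" | "i2 = i3" "i1 \<noteq> i2" | "i2 \<noteq> i1" "i2 \<noteq> i3" by blast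
    then show ?thesis
    proof cases
      case 1
      then have "i1 \<notin> KS" using out' by blast
      then have "a i1 \<noteq> 0" using t_neq[of i1 k] t_neq[of i1 "prv N k"] iN kN pN by (auto simp: a_def KS_def)
      moreover have "E = - a i1 * (1 + 4 * t i1 * t i1)" using 1 by (simp add: E_def algebra_simps)
      ultimately have "E \<noteq> 0" using pp0[of i1 i1] by simp
      then show ?thesis using 1 by blast
    next
      case 2
      have E: "E = 2 * (a i1 * (t i3 - t i1)) - a i3 * (1 + 4 * t i1 * t i1)" using 2 by (simp add: E_def algebra_simps)
      have a3: "a i3 \<ge> 0" "i3 \<notin> KS \<Longrightarrow> a i3 > 0"
      proof -
        show p: "a i3 > 0" if "i3 \<notin> KS"
          by (rule a_mid) (rule less; use that 2 iN kN pN pk in \<open>auto simp: lev_def KS_def\<close>)+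
        show "a i3 \<ge> 0" using p a0 by (cases "i3 \<in> KS") auto
      qed
      show ?thesis
      proof (cases "i1 \<in> KS")
        case True
        then have "a i3 > 0" using 2 out' a3 by blast
        then show ?thesis using E a0[OF True] pp0[of i1 i1] by simp
      next
        case False
        have "t i1 < t i3" by (rule less; use False 2 iN kN pN pk in \<open>auto simp: lev_def KS_def\<close>)
        moreover have "a i1 < 0"
          by (rule a_lo) (rule less; use False 2 iN kN pN pk in \<open>auto simp: lev_def KS_def\<close>)+
        ultimately have "a i1 * (t i3 - t i1) < 0" by (simp add: mult_neg_pos)
        moreover have "a i3 * (1 + 4 * t i1 * t i1) \<ge> 0" using a3(1) pp0[of i1 i1] by simp
        ultimately show ?thesis using E by linarith
      qed
    next
      case 3
      have E: "E = 2 * (a i2 * (t i2 - t i1)) - a i1 * (1 + 4 * t i2 * t i2)" using 3 by (simp add: E_def algebra_simps)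
      have a1: "a i1 \<ge> 0" "i1 \<notin> KS \<Longrightarrow> a i1 > 0"
      proof -
        show p: "a i1 > 0" if "i1 \<notin> KS"
          by (rule a_mid) (rule less; use that 3 iN kN pN pk in \<open>auto simp: lev_def KS_def\<close>)+
        show "a i1 \<ge> 0" using p a0 by (cases "i1 \<in> KS") auto
      qed
      show ?thesis
      proof (cases "i2 \<in> KS")
        case True
        then have "a i1 > 0" using 3 out' a1 by blast
        then show ?thesis using E a0[OF True] pp0[of i2 i2] by simp
      next
        case False
        have "t i1 < t i2" by (rule less; use False 3 iN kN pN pk in \<open>auto simp: lev_def KS_def\<close>)
        moreover have "a i2 < 0"
          by (rule a_hi) (rule less; use False 3 iN kN pN pk in \<open>auto simp: lev_def KS_def\<close>)+
        ultimately have "a i2 * (t i2 - t i1) < 0" by (simp add: mult_neg_pos)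
        moreover have "a i1 * (1 + 4 * t i2 * t i2) \<ge> 0" using a1(1) pp0[of i2 i2] by simp
        ultimately show ?thesis using E by linarith
      qed
    next
      case 4
      have am: "a i \<ge> 0 \<and> (i \<notin> KS \<longrightarrow> a i > 0)" if "i = i1 \<or> i = i3" for i
      proof -
        have p: "a i > 0" if "i \<notin> KS"
          by (rule a_mid) (rule less; use that \<open>i = i1 \<or> i = i3\<close> 4 iN kN pN pk in \<open>auto simp: lev_def KS_def\<close>)+
        then show ?thesis using a0 by (cases "i \<in> KS") auto
      qed
      have a2: "a i2 \<le> 0 \<and> (i2 \<notin> KS \<longrightarrow> a i2 < 0)"
      proof -
        have p: "a i2 < 0" if "i2 \<notin> KS"
          by (rule a_hi) (rule less; use that 4 iN kN pN pk in \<open>auto simp: lev_def KS_def\<close>)+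
        then show ?thesis using a0 by (cases "i2 \<in> KS") auto
      qed
      have neg: "2 * (t x - t y) - (1 + 4 * t y * t x) < 0" for x y
      proof -
        have "1 * t x \<le> t y * t x" by (rule mult_right_mono) (use t1[of x] t1[of y] in auto)
        moreover have "4 * t y * t x = 4 * (t y * t x)" by (rule mult.assoc)
        ultimately show ?thesis using t1[of x] t1[of y] unfolding right_diff_distrib by linarith
      qed
      have n1: "2 * (t i3 - t i2) - (1 + 4 * t i2 * t i3) < 0" by (rule neg)
      have n3: "2 * (t i2 - t i1) - (1 + 4 * t i1 * t i2) < 0" by (rule neg)
      have "a i1 * (2 * (t i3 - t i2) - (1 + 4 * t i2 * t i3)) \<le> 0" "a i2 * (1 + 4 * t i1 * t i3) \<le> 0"
          "a i3 * (2 * (t i2 - t i1) - (1 + 4 * t i1 * t i2)) \<le> 0"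
        using am[of i1] am[of i3] a2 n1 n3 pp0[of i1 i3] by (simp_all add: mult_nonneg_nonpos mult_nonpos_nonneg)
      moreover have "a i1 * (2 * (t i3 - t i2) - (1 + 4 * t i2 * t i3)) < 0 \<or> a i2 * (1 + 4 * t i1 * t i3) < 0 \<or>
          a i3 * (2 * (t i2 - t i1) - (1 + 4 * t i1 * t i2)) < 0"
        using am[of i1] am[of i3] a2 n1 n3 pp0[of i1 i3] out' mult_pos_neg mult_neg_pos by blast
      ultimately show ?thesis unfolding E_def by linarith
    qed
  qed
  then have "E \<noteq> 0" by auto
  then have "square_rel N w k i1 i2 i3 \<noteq> 0" unfolding sq using S by simp
  then show ?thesis by blast
qed

end

locale generic_polygon =
  fixes N :: nat and v :: "nat \<Rightarrow> real^2"
  assumes N_ge: "N \<ge> 3" and generic: "v \<in> generic_polygons N (conds N)"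
begin

sublocale simple_polygon N v
  by unfold_locales (use N_ge generic in \<open>auto simp: generic_polygons_def polygon_space_def\<close>)

lemma generic_nonzero: "f \<in> conds N \<Longrightarrow> \<exists>w. f w \<noteq> 0 \<Longrightarrow> f v \<noteq> 0"
  using generic unfolding generic_polygons_def by blast

lemma in_conds:
  assumes "i < N" "j < N" "k < N" "l < N"
  shows "(\<lambda>v. crs N v i j) \<in> conds N" "(\<lambda>v. dotp N v i j) \<in> conds N" "(\<lambda>v. voff N v i j) \<in> conds N"
    "(\<lambda>v. vdot N v i j k) \<in> conds N" "(\<lambda>v. voff N v i k + voff N v i j) \<in> conds N"
    "(\<lambda>v. disc N v k i j l) \<in> conds N" "(\<lambda>v. rel_res N v k i j l) \<in> conds N" "(\<lambda>v. rel_hi N v k i j l) \<in> conds N"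
    "(\<lambda>v. rel_lo N v k i j l) \<in> conds N" "(\<lambda>v. side_rel N v k j i l) \<in> conds N" "(\<lambda>v. diag_rel N v k j i l) \<in> conds N"
    "(\<lambda>v. square_rel N v k i j l) \<in> conds N"
  unfolding conds_def
  by (rule UN_I[of i], simp add: assms, rule UN_I[of j], simp add: assms, rule UN_I[of k], simp add: assms,
      rule UN_I[of l], simp add: assms, (rule insertI1 | rule insertI2)+)+

lemma crs_nz: "i < N \<Longrightarrow> j < N \<Longrightarrow> i \<noteq> j \<Longrightarrow> crs N v i j \<noteq> 0"
  using generic_nonzero[OF in_conds(1)[of i j j j]] ex_crs[OF N_ge] by simp

lemma crs_self [simp]: "crs N v i i = 0" by (simp add: crs_def cross2_def)

lemma dotp_nz: "i < N \<Longrightarrow> j < N \<Longrightarrow> dotp N v i j \<noteq> 0"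
  using generic_nonzero[OF in_conds(2)[of i j j j]] ex_dotp[OF N_ge] by simp

lemma voff_zero: "i < N \<Longrightarrow> k < N \<Longrightarrow> voff N v i k = 0 \<longleftrightarrow> i = k \<or> i = prv N k"
proof
  assume i: "i < N" "k < N" "voff N v i k = 0"
  then show "i = k \<or> i = prv N k" using generic_nonzero[OF in_conds(3)[of i k k k]] ex_voff[OF N_ge, of i k] by auto
next
  assume i: "i < N" "k < N" "i = k \<or> i = prv N k"
  then consider "k = i" | "k = nxt N i" using nxt_prv by metis
  then show "voff N v i k = 0" by cases (auto simp: voff_def cross2_def dir_def algebra_simps)
qed

lemma vdot_nz: "i < N \<Longrightarrow> j < N \<Longrightarrow> k < N \<Longrightarrow> j \<noteq> k \<Longrightarrow> vdot N v i j k \<noteq> 0"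
  using generic_nonzero[OF in_conds(4)[of i j k k]] ex_vdot[OF N_ge] by simp

lemma voff_sum_nz: "i < N \<Longrightarrow> j < N \<Longrightarrow> k < N \<Longrightarrow> \<not> (i \<in> {k, prv N k} \<and> i \<in> {j, prv N j}) \<Longrightarrow> voff N v i k + voff N v i j \<noteq> 0"
  using generic_nonzero[OF in_conds(5)[of i j k k]] ex_voff_sum[OF N_ge, of i j k] by simp

lemma side_rel_nz: "i < N \<Longrightarrow> l < N \<Longrightarrow> j < N \<Longrightarrow> k < N \<Longrightarrow> j \<noteq> k \<Longrightarrow> i \<notin> {j, prv N j} \<Longrightarrow> l \<notin> {k, prv N k} \<Longrightarrow> side_rel N v k j i l \<noteq> 0"
  by (rule generic_nonzero[OF in_conds(10)]) (auto intro!: ex_side_rel[OF N_ge])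

lemma diag_rel_nz:
  assumes "i < N" "l < N" "j < N" "k < N" "j \<noteq> k" "i \<noteq> l"
    "\<not> (i \<in> {k, prv N k} \<and> l \<in> {j, prv N j})" "\<not> (i \<in> {j, prv N j} \<and> l \<in> {k, prv N k})"
    "\<not> (i \<in> {k, prv N k} \<and> i \<in> {j, prv N j})" "\<not> (l \<in> {k, prv N k} \<and> l \<in> {j, prv N j})"
  shows "diag_rel N v k j i l \<noteq> 0"
  by (rule generic_nonzero[OF in_conds(11)[OF assms(1,3,4,2)] ex_diag_rel[OF N_ge assms]])

lemma square_rel_nz:
  assumes "k < N" "i1 < N" "i2 < N" "i3 < N" "\<not> (i1 \<in> {k, prv N k} \<and> i2 \<in> {k, prv N k} \<and> i3 \<in> {k, prv N k})"
  shows "square_rel N v k i1 i2 i3 \<noteq> 0"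
  by (rule generic_nonzero[OF in_conds(12)[OF assms(2,3,1,4)] ex_square_rel[OF N_ge assms]])

text \<open>
  If the two quadratics had a common root \<open>r\<close>, then sliding the first corner along edge \<open>k\<close> would give a whole
  family of rectangles of aspect ratio \<open>r\<close>. The six cases are the possible coincidences among the four edges; in two of them the
  resultant settles the matter, in the others a common factor \<open>r\<close> or a common vanishing leading coefficient has to be
  split off.
\<close>

lemma no_common_root:
  assumes kN: "k < N" and iN: "i1 < N" "i2 < N" "i3 < N" and three: "card {k, i1, i2, i3} \<ge> 3" and r: "r > 0"
    and f: "vq2 N v k i1 i2 i3 * r\<^sup>2 + vq1 N v k i1 i2 i3 * r + vq0 N v k i1 i2 i3 = 0"
    and g: "dq2 N v k i1 i2 i3 * r\<^sup>2 + dq1 N v k i1 i2 i3 * r + dq0 N v k i1 i2 i3 = 0"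
  shows False
proof -
  have res: "rel_res N v k i1 i2 i3 = 0"
    using f g unfolding rel_res_def resultant_def by algebra
  have hi: "rel_hi N v k i1 i2 i3 = 0" if "vq0 N v k i1 i2 i3 = 0" "dq0 N v k i1 i2 i3 = 0"
  proof -
    have "(vq2 N v k i1 i2 i3 * r + vq1 N v k i1 i2 i3) * r = 0" "(dq2 N v k i1 i2 i3 * r + dq1 N v k i1 i2 i3) * r = 0"
      using f g that by (simp_all add: power2_eq_square algebra_simps)
    then have "vq2 N v k i1 i2 i3 * r + vq1 N v k i1 i2 i3 = 0" "dq2 N v k i1 i2 i3 * r + dq1 N v k i1 i2 i3 = 0"
      using r by simp_all
    then show ?thesis unfolding rel_hi_def by algebra
  qed
  have lo: "rel_lo N v k i1 i2 i3 = 0" if "vq2 N v k i1 i2 i3 = 0" "dq2 N v k i1 i2 i3 = 0"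
  proof -
    have "vq1 N v k i1 i2 i3 * r + vq0 N v k i1 i2 i3 = 0" "dq1 N v k i1 i2 i3 * r + dq0 N v k i1 i2 i3 = 0"
      using f g that by simp_all
    then show ?thesis unfolding rel_lo_def using r by algebra
  qed
  have A_self: "voff N v k k = 0" by (simp add: voff_def cross2_def)
  note gen = generic_nonzero[OF in_conds(7)[OF iN(1,2) kN iN(3)]] generic_nonzero[OF in_conds(8)[OF iN(1,2) kN iN(3)]]
     generic_nonzero[OF in_conds(9)[OF iN(1,2) kN iN(3)]]
  have two: "card {a, b} \<le> 2" for a b :: nat by (simp add: card_insert_if)
  consider "k \<noteq> i1" "k \<noteq> i2" "k \<noteq> i3" "i1 \<noteq> i2" "i2 \<noteq> i3"
    | "k = i2" "k \<noteq> i1" "k \<noteq> i3" "i1 \<noteq> i3" | "k = i1" "k \<noteq> i2" "k \<noteq> i3" "i2 \<noteq> i3"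
    | "i2 = i3" "k \<noteq> i1" "k \<noteq> i2" "i1 \<noteq> i2" | "k = i3" "k \<noteq> i1" "k \<noteq> i2" "i1 \<noteq> i2"
    | "i1 = i2" "k \<noteq> i1" "k \<noteq> i3" "i1 \<noteq> i3"
    using three by (auto simp: card_insert_if split: if_splits)
  then show False
  proof cases
    case 1 then show False using ex_rel(1)[OF N_ge kN iN] gen(1) res by blast
  next
    case 2 then show False using ex_rel(2)[OF N_ge kN iN] gen(1) res by blast
  next
    case 3
    then have "vq2 N v k i1 i2 i3 = 0" "dq2 N v k i1 i2 i3 = 0" using A_self by (simp_all add: coef2_def)
    then show False using ex_rel(3)[OF N_ge kN iN] 3 gen(3) lo by blast
  next
    case 4
    then have "vq2 N v k i1 i2 i3 = 0" "dq2 N v k i1 i2 i3 = 0" by (simp_all add: coef2_def)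
    then show False using ex_rel(4)[OF N_ge kN iN] 4 gen(3) lo by blast
  next
    case 5
    then have "vq0 N v k i1 i2 i3 = 0" "dq0 N v k i1 i2 i3 = 0" using A_self by (simp_all add: coef0_def)
    then show False using ex_rel(5)[OF N_ge kN iN] 5 gen(2) hi by blast
  next
    case 6
    then have "vq0 N v k i1 i2 i3 = 0" "dq0 N v k i1 i2 i3 = 0" by (simp_all add: coef0_def)
    then show False using ex_rel(6)[OF N_ge kN iN] 6 gen(2) hi by blast
  qed
qed

text \<open>
  For a rectangle with its first corner at vertex \<open>k\<close> this says that the corner moves through the vertex with nonzero
  speed when the aspect ratio changes. The hypothesis \<open>out\<close> excludes that all corners are on the two edges at the vertex.
\<close>

lemma simple_root:
  assumes kN: "k < N" and iN: "i1 < N" "i2 < N" "i3 < N" and r: "r > 0"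
    and out: "\<not> (i1 \<in> {k, prv N k} \<and> i2 \<in> {k, prv N k} \<and> i3 \<in> {k, prv N k})"
    and f: "vq2 N v k i1 i2 i3 * r\<^sup>2 + vq1 N v k i1 i2 i3 * r + vq0 N v k i1 i2 i3 = 0"
  shows "2 * vq2 N v k i1 i2 i3 * r + vq1 N v k i1 i2 i3 \<noteq> 0"
proof
  assume d: "2 * vq2 N v k i1 i2 i3 * r + vq1 N v k i1 i2 i3 = 0"
  have eq: "vq2 N v k i1 i2 i3 * r\<^sup>2 = vq0 N v k i1 i2 i3"
    using f d by algebra
  have z: "vq2 N v k i1 i2 i3 = 0 \<longleftrightarrow> vq0 N v k i1 i2 i3 = 0" using eq r by auto
  have dz: "disc N v k i1 i2 i3 = 0"
  proof -
    have "vq1 N v k i1 i2 i3 = - (2 * vq2 N v k i1 i2 i3 * r)" using d by linarith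
    then show ?thesis unfolding disc_def eq[symmetric] by (simp add: power2_eq_square)
  qed
  show False
  proof (cases "vq2 N v k i1 i2 i3 = 0")
    case True
    then have 0: "vq2 N v k i1 i2 i3 = 0" "vq0 N v k i1 i2 i3 = 0" "vq1 N v k i1 i2 i3 = 0" using z d by auto
    have a1: "voff N v i1 k = 0 \<or> i2 = i3" using 0(1) crs_nz[OF iN(2,3)] unfolding coef2_def by auto
    have a3: "voff N v i3 k = 0 \<or> i1 = i2" using 0(2) crs_nz[OF iN(1,2)] unfolding coef0_def by auto
    have p: "dotp N v i1 i3 \<noteq> 0" "dotp N v i2 i3 \<noteq> 0" "dotp N v i1 i2 \<noteq> 0" using dotp_nz iN by auto
    have c1: "voff N v i2 k * dotp N v i1 i3 = voff N v i1 k * dotp N v i2 i3 + voff N v i3 k * dotp N v i1 i2"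
      using 0(3) unfolding coef1_def by simp
    have "voff N v i1 k = 0 \<and> voff N v i2 k = 0 \<and> voff N v i3 k = 0"
    proof -
      consider "voff N v i1 k = 0" "voff N v i3 k = 0" | "i2 = i3" "voff N v i3 k = 0" | "voff N v i1 k = 0" "i1 = i2" | "i2 = i3" "i1 = i2"
        using a1 a3 by blast
      then show ?thesis using c1 p by cases auto
    qed
    then show False using voff_zero kN iN out by auto
  next
    case False
    then have n: "voff N v i1 k \<noteq> 0" "i2 \<noteq> i3" "voff N v i3 k \<noteq> 0" "i1 \<noteq> i2"
      using z unfolding coef2_def coef0_def by auto
    show False
    proof (cases "i1 = i3")
      case True
      have "vq2 N v k i1 i2 i3 * vq0 N v k i1 i2 i3 = - (voff N v i1 k * crs N v i1 i2)\<^sup>2"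
        using True by (simp add: coef2_def coef0_def crs_def cross2_def power2_eq_square algebra_simps)
      \<comment> \<open>With \<open>i1 = i3\<close> the outer coefficients have opposite signs, while a double root makes their product a square.\<close>
      moreover have "(voff N v i1 k * crs N v i1 i2)\<^sup>2 > 0" using n crs_nz iN by simp
      ultimately have "vq2 N v k i1 i2 i3 * vq0 N v k i1 i2 i3 < 0" by simp
      moreover have "vq2 N v k i1 i2 i3 * vq0 N v k i1 i2 i3 = (vq2 N v k i1 i2 i3 * r)\<^sup>2"
        unfolding eq[symmetric] by (simp add: power2_eq_square)
      ultimately show False by (metis not_less zero_le_power2)
    next
      case False
      have "i1 \<notin> {k, prv N k}" "i3 \<notin> {k, prv N k}" using n voff_zero kN iN by auto
      then have "\<exists>w. disc N w k i1 i2 i3 \<noteq> 0" using ex_disc[OF N_ge kN iN] n False by blast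
      then show False using generic_nonzero[OF in_conds(6)[OF iN(1,2) kN iN(3)]] dz by blast
    qed
  qed
qed

end

section \<open>Rectangles with corners on given edges\<close>

lemma all_4: "(\<forall>i::4. P i) \<longleftrightarrow> P 0 \<and> P 1 \<and> P 2 \<and> P 3"
proof -
  have "(4::4) = 0" by simp
  then show ?thesis using forall_4[of P] by metis
qed

lemma numeral_type_4: "(4::4) = 0" "(5::4) = 1" "(6::4) = 2"
  by simp_all

definition perp :: "real^2 \<Rightarrow> real^2" where "perp u = vector [- u$2, u$1]"

lemma perp_nth [simp]: "perp u $ 1 = - u$2" "perp u $ 2 = u$1" by (simp_all add: perp_def)

lemma inner_2: "(x::real^2) \<bullet> y = x$1 * y$1 + x$2 * y$2" by (simp add: inner_vec_def sum_2)

lemma eq_2_iff: "(x::real^2) = y \<longleftrightarrow> x$1 = y$1 \<and> x$2 = y$2" by (simp add: vec_eq_iff forall_2)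

lemma cross2_perp: "cross2 d (perp u) = d \<bullet> u" by (simp add: cross2_def inner_2)

lemma cramer_2: "cross2 a b *\<^sub>R u = - cross2 b u *\<^sub>R a + cross2 a u *\<^sub>R b"
  by (simp add: eq_2_iff cross2_def algebra_simps)

lemma zero_if_cross2_zero: "cross2 a u = 0 \<Longrightarrow> cross2 b u = 0 \<Longrightarrow> cross2 a b \<noteq> 0 \<Longrightarrow> u = 0"
  using cramer_2[of a b u] by simp

lemma zero_if_parallel_orthogonal: "cross2 a u = 0 \<Longrightarrow> a \<bullet> u = 0 \<Longrightarrow> a \<noteq> 0 \<Longrightarrow> u = 0"
proof -
  assume "cross2 a u = 0" "a \<bullet> u = 0" "a \<noteq> 0"
  moreover have "(a \<bullet> a) * (u \<bullet> u) = (a \<bullet> u)\<^sup>2 + (cross2 a u)\<^sup>2"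
    by (simp add: inner_2 cross2_def power2_eq_square algebra_simps)
  ultimately show "u = 0" by simp
qed

text \<open>
  As \<open>perp\<close> is the counterclockwise quarter turn, this is a counterclockwise rectangle if \<open>u \<noteq> 0\<close> and \<open>r > 0\<close>.
\<close>

definition rect :: "real^2 \<Rightarrow> real^2 \<Rightarrow> real \<Rightarrow> real^2^4" where
  "rect z u r = (\<chi> i. if i = 0 then z else if i = 1 then z + u else if i = 2 then z + u + r *\<^sub>R perp u else z + r *\<^sub>R perp u)"

lemma rect_nth [simp]: "rect z u r $ 0 = z" "rect z u r $ 1 = z + u" "rect z u r $ 2 = z + u + r *\<^sub>R perp u"
  "rect z u r $ 3 = z + r *\<^sub>R perp u"
  by (simp_all add: rect_def)

lemma norm_perp [simp]: "norm (perp u) = norm u"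
  by (simp add: norm_eq_sqrt_inner inner_2 algebra_simps)

lemma ccw_rect: assumes "u \<noteq> 0" "r > 0" shows "ccw_rectangle (rect z u r)" "aspect_ratio (rect z u r) = r"
proof -
  have "cross2 u (r *\<^sub>R perp u) = r * (u \<bullet> u)" by (simp add: cross2_def inner_2 algebra_simps)
  moreover have "u \<bullet> (r *\<^sub>R perp u) = 0" by (simp add: inner_2)
  ultimately show "ccw_rectangle (rect z u r)" using assms unfolding ccw_rectangle_def by simp
  show "aspect_ratio (rect z u r) = r" using assms unfolding aspect_ratio_def by simp
qed

lemma ccw_rectD:
  assumes "ccw_rectangle R"
  shows "R $ 1 \<noteq> R $ 0" "aspect_ratio R > 0" "R = rect (R $ 0) (R $ 1 - R $ 0) (aspect_ratio R)"
proof -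
  define u where "u = R $ 1 - R $ 0"
  define w where "w = R $ 2 - R $ 1"
  have h: "R $ 3 - R $ 0 = w" "u \<bullet> w = 0" "cross2 u w > 0" using assms by (auto simp: ccw_rectangle_def u_def w_def)
  have u0: "u \<noteq> 0" using h(3) by (auto simp: cross2_def)
  then show "R $ 1 \<noteq> R $ 0" by (simp add: u_def)
  define c where "c = cross2 u w / (u \<bullet> u)"
  have uu: "u \<bullet> u > 0" using u0 by simp
  have c: "c > 0" using h(3) uu by (simp add: c_def)
  have "(u \<bullet> u) *\<^sub>R w = (u \<bullet> w) *\<^sub>R u + cross2 u w *\<^sub>R perp u"
    by (simp add: eq_2_iff inner_2 cross2_def algebra_simps)
  then have "(u \<bullet> u) *\<^sub>R w = (u \<bullet> u) *\<^sub>R (c *\<^sub>R perp u)" using h(2) uu by (simp add: c_def)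
  then have w: "w = c *\<^sub>R perp u" using uu by (metis less_irrefl scaleR_left_imp_eq)
  have ar: "aspect_ratio R = c"
  proof -
    have "aspect_ratio R = norm w / norm u" by (simp add: aspect_ratio_def u_def w_def)
    then show ?thesis using w c u0 by simp
  qed
  then show "aspect_ratio R > 0" using c by simp
  have e3: "R $ 3 = R $ 0 + w" using h(1) by (simp add: algebra_simps)
  have e2: "R $ 2 = R $ 1 + w" by (simp add: w_def)
  show "R = rect (R $ 0) (R $ 1 - R $ 0) (aspect_ratio R)"
    unfolding vec_eq_iff[of R] all_4 ar u_def[symmetric]
    using e2 e3 w by (simp add: u_def)
qed

lemma ccw_relabel:
  assumes R: "ccw_rectangle R"
  shows "ccw_rectangle (relabel 1 R)" "aspect_ratio (relabel 1 R) = 1 / aspect_ratio R"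
proof -
  have h: "R $ 3 - R $ 0 = R $ 2 - R $ 1" "(R $ 1 - R $ 0) \<bullet> (R $ 2 - R $ 1) = 0" "cross2 (R $ 1 - R $ 0) (R $ 2 - R $ 1) > 0"
    using R unfolding ccw_rectangle_def by auto
  have n: "relabel 1 R $ 0 = R $ 1" "relabel 1 R $ 1 = R $ 2" "relabel 1 R $ 2 = R $ 3" "relabel 1 R $ 3 = R $ 0"
    by (simp_all add: relabel_def numeral_type_4)
  have 1: "R $ 3 - R $ 2 = - (R $ 1 - R $ 0)" "R $ 0 - R $ 1 = - (R $ 1 - R $ 0)" using h(1) by (simp_all add: algebra_simps)
  show "ccw_rectangle (relabel 1 R)" unfolding ccw_rectangle_def n 1 using h(2,3)
    by (simp add: inner_commute cross2_def algebra_simps)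
  show "aspect_ratio (relabel 1 R) = 1 / aspect_ratio R" unfolding aspect_ratio_def n 1 norm_minus_cancel by simp
qed

lemma relabel_add: "relabel a (relabel b R) = relabel (a + b) R"
  by (simp add: relabel_def vec_eq_iff add_ac)

lemma relabel_0 [simp]: "relabel 0 R = R" by (simp add: relabel_def vec_eq_iff)

lemma relabel_nth: "relabel a R $ i = R $ (i + a)" by (simp add: relabel_def)

text \<open>
  Facts about arbitrary relabelings follow from those about relabeling by one step.
\<close>

lemma relabel_induct:
  assumes "P R" "\<And>R. P R \<Longrightarrow> P (relabel 1 R)" shows "P (relabel a R)"
proof -
  have "P (relabel (of_nat n) R)" for n
  proof (induction n)
    case (Suc n)
    have "relabel 1 (relabel (of_nat n) R) = relabel (of_nat (Suc n)) R" by (simp add: relabel_add)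
    then show ?case using assms(2)[OF Suc] by simp
  qed (use assms in simp)
  moreover have "a = of_nat 0 \<or> a = of_nat 1 \<or> a = of_nat 2 \<or> a = of_nat 3"
    using all_4[of "\<lambda>a. a = of_nat 0 \<or> a = of_nat 1 \<or> a = of_nat 2 \<or> a = of_nat 3"] by simp
  ultimately show ?thesis by metis
qed

lemma ccw_relabel_any: "ccw_rectangle R \<Longrightarrow> ccw_rectangle (relabel a R)"
  by (rule relabel_induct) (auto intro: ccw_relabel)

context simple_polygon begin

text \<open>
  A linear function whose zero set is the line of edge \<open>i\<close>.
\<close>

definition off :: "nat \<Rightarrow> real^2 \<Rightarrow> real" where "off i z = cross2 (dir N v i) (v i - z)"

definition sits :: "(4 \<Rightarrow> nat) \<Rightarrow> real^2^4 \<Rightarrow> bool" where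
  "sits k R \<longleftrightarrow> (\<forall>i. k i < N \<and> R $ i \<in> edge N v (k i))"

definition on_lines :: "(4 \<Rightarrow> nat) \<Rightarrow> real^2^4 \<Rightarrow> bool" where
  "on_lines k R \<longleftrightarrow> (\<forall>i. k i < N \<and> off (k i) (R $ i) = 0)"

lemma off_vertex: "off i (v k) = voff N v i k" by (simp add: off_def voff_def)

lemma off_add: "off i (z + x *\<^sub>R e) = off i z - x * cross2 (dir N v i) e"
  by (simp add: off_def cross2_def algebra_simps)

lemma off_edge: "x \<in> edge N v i \<Longrightarrow> off i x = 0"
  unfolding edge_iff by (auto simp: off_def cross2_def algebra_simps)

lemma sits_on_lines: "sits k R \<Longrightarrow> on_lines k R"
  unfolding sits_def on_lines_def using off_edge by blast

lemma sits_relabel: "sits k R \<Longrightarrow> sits (\<lambda>i. k (i + a)) (relabel a R)"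
  by (simp add: sits_def relabel_nth)

lemma inscribed_iff: "R \<in> inscribed_rectangles (polygon_curve N v) \<longleftrightarrow> ccw_rectangle R \<and> (\<exists>k. sits k R)"
proof -
  have "N > 0" using N3 by simp
  then have "(\<forall>i. R $ i \<in> polygon_curve N v) \<longleftrightarrow> (\<exists>k. sits k R)"
  proof -
    have "(\<forall>i. R $ i \<in> polygon_curve N v) \<longleftrightarrow> (\<forall>i. \<exists>j. j < N \<and> R $ i \<in> edge N v j)"
      unfolding polygon_curve_edges[OF \<open>N > 0\<close>] by auto
    also have "\<dots> \<longleftrightarrow> (\<exists>k. sits k R)" unfolding sits_def by (rule choice_iff)
    finally show ?thesis .
  qed
  then show ?thesis unfolding inscribed_rectangles_def by blast
qed

lemma off_line_param:
  assumes i: "i < N" and x: "off i x = 0"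
  shows "x = v i + (((x - v i) \<bullet> dir N v i) / (dir N v i \<bullet> dir N v i)) *\<^sub>R dir N v i"
proof -
  define d where "d = dir N v i"
  define y where "y = x - v i"
  have d: "d \<bullet> d \<noteq> 0" using dir_nonzero[OF i] by (simp add: d_def)
  have "cross2 d y = 0" using x by (simp add: off_def d_def y_def cross2_def algebra_simps)
  moreover have "(d \<bullet> d) *\<^sub>R y = (y \<bullet> d) *\<^sub>R d + cross2 d y *\<^sub>R perp d"
    by (simp add: eq_2_iff inner_2 cross2_def algebra_simps)
  ultimately have "(d \<bullet> d) *\<^sub>R y = (y \<bullet> d) *\<^sub>R d" by simp
  then have "(1 / (d \<bullet> d)) *\<^sub>R ((d \<bullet> d) *\<^sub>R y) = (1 / (d \<bullet> d)) *\<^sub>R ((y \<bullet> d) *\<^sub>R d)" by simp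
  then have "y = ((y \<bullet> d) / (d \<bullet> d)) *\<^sub>R d" using d by simp
  then show ?thesis unfolding y_def d_def by (metis add_diff_cancel_left' diff_add_cancel add.commute)
qed

end

context generic_polygon begin

abbreviation "quad2 i1 i2 i3 z \<equiv> coef2 N v i1 i2 i3 (off i1 z)"
abbreviation "quad1 i1 i2 i3 z \<equiv> coef1 N v i1 i2 i3 (off i1 z) (off i2 z) (off i3 z)"
abbreviation "quad0 i1 i2 i3 z \<equiv> coef0 N v i1 i2 i3 (off i3 z)"

text \<open>
  The compatibility polynomial of the lines \<open>i1\<close>, \<open>i2\<close>, \<open>i3\<close> for a rectangle that starts at \<open>z\<close>.
\<close>

definition Quad :: "nat \<Rightarrow> nat \<Rightarrow> nat \<Rightarrow> real^2 \<Rightarrow> real \<Rightarrow> real" where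
  "Quad i1 i2 i3 z r = quad2 i1 i2 i3 z * r\<^sup>2 + quad1 i1 i2 i3 z * r + quad0 i1 i2 i3 z"

text \<open>
  The rate at which \<open>Quad\<close> decreases when \<open>z\<close> moves along edge \<open>k\<close>.
\<close>

definition Del :: "nat \<Rightarrow> nat \<Rightarrow> nat \<Rightarrow> nat \<Rightarrow> real \<Rightarrow> real" where
  "Del k i1 i2 i3 r = dq2 N v k i1 i2 i3 * r\<^sup>2 + dq1 N v k i1 i2 i3 * r + dq0 N v k i1 i2 i3"

lemma Quad_vertex: "Quad i1 i2 i3 (v k) r = vq2 N v k i1 i2 i3 * r\<^sup>2 + vq1 N v k i1 i2 i3 * r + vq0 N v k i1 i2 i3"
  by (simp add: Quad_def off_vertex)

lemma Quad_add: "Quad i1 i2 i3 (z + x *\<^sub>R dir N v k) r = Quad i1 i2 i3 z r - x * Del k i1 i2 i3 r"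
  unfolding Quad_def Del_def off_add crs_def[of N v _ k, symmetric] coef2_def coef1_def coef0_def by (simp add: algebra_simps)

text \<open>
  The first side of the rectangle, from the incidences of the corners 1 and 3 alone; they prescribe a cross product and
  a dot product of the side, and determine it because the edge directions \<open>i1\<close> and \<open>i3\<close> are not orthogonal.
\<close>

definition side :: "nat \<Rightarrow> nat \<Rightarrow> real^2 \<Rightarrow> real \<Rightarrow> real^2" where
  "side i1 i3 z r = (1 / dotp N v i1 i3) *\<^sub>R (off i1 z *\<^sub>R perp (dir N v i3) + (off i3 z / r) *\<^sub>R dir N v i1)"

lemma lines_rect_iff:
  "off i (z + u) = 0 \<longleftrightarrow> cross2 (dir N v i) u = off i z"
  "off i (z + u + r *\<^sub>R perp u) = 0 \<longleftrightarrow> cross2 (dir N v i) u + r * (dir N v i \<bullet> u) = off i z"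
  "off i (z + r *\<^sub>R perp u) = 0 \<longleftrightarrow> r * (dir N v i \<bullet> u) = off i z"
  by (auto simp: off_def cross2_def inner_2 algebra_simps)

lemma rect_on_lines_imp:
  assumes i: "i1 < N" "i2 < N" "i3 < N" and r: "r \<noteq> 0"
    and 1: "cross2 (dir N v i1) u = off i1 z" and 2: "cross2 (dir N v i2) u + r * (dir N v i2 \<bullet> u) = off i2 z"
    and 3: "r * (dir N v i3 \<bullet> u) = off i3 z"
  shows "Quad i1 i2 i3 z r = 0" "u = side i1 i3 z r"
proof -
  show "Quad i1 i2 i3 z r = 0"
    unfolding Quad_def coef2_def coef1_def coef0_def crs_def dotp_def 1[symmetric] 2[symmetric] 3[symmetric] cross2_def inner_2
    by algebra
  have p: "dotp N v i1 i3 \<noteq> 0" using dotp_nz i by blast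
  have "dotp N v i1 i3 *\<^sub>R u = off i1 z *\<^sub>R perp (dir N v i3) + (off i3 z / r) *\<^sub>R dir N v i1"
  proof -
    have "off i3 z / r = dir N v i3 \<bullet> u" using 3 r by (simp add: field_simps)
    then show ?thesis unfolding 1[symmetric] by (simp add: eq_2_iff dotp_def cross2_def inner_2 algebra_simps)
  qed
  then have "(1 / dotp N v i1 i3) *\<^sub>R (dotp N v i1 i3 *\<^sub>R u) = side i1 i3 z r" unfolding side_def by simp
  then show "u = side i1 i3 z r" using p by simp
qed

lemma side_on_lines:
  assumes i: "i1 < N" "i2 < N" "i3 < N" and r: "r \<noteq> 0" and Q: "Quad i1 i2 i3 z r = 0"
  defines "u \<equiv> side i1 i3 z r"
  shows "cross2 (dir N v i1) u = off i1 z" "cross2 (dir N v i2) u + r * (dir N v i2 \<bullet> u) = off i2 z" "r * (dir N v i3 \<bullet> u) = off i3 z"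
proof -
  have p: "dotp N v i1 i3 \<noteq> 0" using dotp_nz i by blast
  define a1 where "a1 = dir N v i1"
  define a2 where "a2 = dir N v i2"
  define a3 where "a3 = dir N v i3"
  have pd: "dotp N v i1 i3 = a1$1 * a3$1 + a1$2 * a3$2" by (simp add: dotp_def inner_2 a1_def a3_def)
  define q where "q = dotp N v i1 i3"
  have q: "q \<noteq> 0" "q = a1$1 * a3$1 + a1$2 * a3$2" using p pd by (simp_all add: q_def)
  have u1: "q * u $ 1 = off i1 z * - (a3 $ 2) + (off i3 z / r) * a1 $ 1"
    and u2: "q * u $ 2 = off i1 z * a3 $ 1 + (off i3 z / r) * a1 $ 2"
    using q(1) unfolding u_def side_def q_def[symmetric] by (simp_all add: a1_def a3_def)
  have "q * cross2 a1 u = q * off i1 z"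
    using u1 u2 q(2) unfolding cross2_def by algebra
  then show "cross2 (dir N v i1) u = off i1 z" using q(1) by (simp add: a1_def)
  have "q * (a3 \<bullet> u) = q * (off i3 z / r)"
    using u1 u2 q(2) unfolding inner_2 by algebra
  then have i3: "a3 \<bullet> u = off i3 z / r" using q(1) mult_left_cancel by blast
  then show "r * (dir N v i3 \<bullet> u) = off i3 z" using r by (simp add: a3_def)
  define b3 where "b3 = off i3 z / r"
  have b3: "off i3 z = r * b3" using r by (simp add: b3_def)
  have Q0: "off i1 z * cross2 a2 a3 * r\<^sup>2 + (off i2 z * q - off i1 z * (a2 \<bullet> a3) - r * b3 * (a1 \<bullet> a2)) * r + r * b3 * cross2 a1 a2 = 0"
    using Q unfolding Quad_def coef2_def coef1_def coef0_def q_def[symmetric] unfolding crs_def dotp_def b3 a1_def a2_def a3_def .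
  then have Q1: "off i1 z * cross2 a2 a3 * r + (off i2 z * q - off i1 z * (a2 \<bullet> a3) - r * b3 * (a1 \<bullet> a2)) + b3 * cross2 a1 a2 = 0"
    using r by algebra
  have "q * (cross2 a2 u + r * (a2 \<bullet> u)) = q * off i2 z"
    using Q1 u1[folded b3_def] u2[folded b3_def] unfolding cross2_def inner_2 by algebra
  then show "cross2 (dir N v i2) u + r * (dir N v i2 \<bullet> u) = off i2 z" using q(1) by (simp add: a2_def)
qed

text \<open>
  Two parallel sides on two different edges would make these edges parallel, on one edge the rectangle would be
  degenerate; three corners on one line are impossible as well.
\<close>

lemma no_two_opposite_pairs:
  assumes R: "ccw_rectangle R" and k: "on_lines k R"
  shows "\<not> (k 0 = k 1 \<and> k 2 = k 3)" "\<not> (k 0 = k 1 \<and> k 1 = k 2)"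
proof -
  define u where "u = R $ 1 - R $ 0"
  define r where "r = aspect_ratio R"
  have Rr: "R = rect (R $ 0) u r" and r: "r > 0" and u: "u \<noteq> 0" using ccw_rectD[OF R] by (auto simp: u_def r_def)
  have kN: "k i < N" for i using k by (simp add: on_lines_def)
  have o: "off (k i) (R $ i) = 0" for i using k by (simp add: on_lines_def)
  have o0: "off (k 0) (R $ 0) = 0" and o1: "off (k 1) (R $ 0 + u) = 0" and o2: "off (k 2) (R $ 0 + u + r *\<^sub>R perp u) = 0"
    and o3: "off (k 3) (R $ 0 + r *\<^sub>R perp u) = 0"
    using o[of 0] o[of 1] o[of 2] o[of 3] Rr rect_nth by metis+
  have d: "dir N v (k i) \<noteq> 0" for i using dir_nonzero kN by blast
  show "\<not> (k 0 = k 1 \<and> k 1 = k 2)"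
  proof
    assume e: "k 0 = k 1 \<and> k 1 = k 2"
    have c: "cross2 (dir N v (k 0)) u = 0" using o1 o0 e lines_rect_iff(1) by metis
    then have "r * (dir N v (k 0) \<bullet> u) = 0" using o2 o0 e lines_rect_iff(2)[of "k 0" "R $ 0" u r] by simp
    then show False using zero_if_parallel_orthogonal[OF c _ d] u r by simp
  qed
  show "\<not> (k 0 = k 1 \<and> k 2 = k 3)"
  proof
    assume e: "k 0 = k 1 \<and> k 2 = k 3"
    have c: "cross2 (dir N v (k 0)) u = 0" using o1 o0 e lines_rect_iff(1) by metis
    have c2: "cross2 (dir N v (k 2)) u = 0"
      using o2 o3 e lines_rect_iff(2)[of "k 2" "R $ 0" u r] lines_rect_iff(3)[of "k 2" "R $ 0" r u] by simp
    show False
    proof (cases "k 0 = k 2")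
      case True
      then have "r * (dir N v (k 0) \<bullet> u) = 0" using o3 o0 e lines_rect_iff(3)[of "k 0" "R $ 0" r u] by simp
      then show False using zero_if_parallel_orthogonal[OF c _ d] u r by simp
    next
      case False
      then show False using zero_if_cross2_zero[OF c c2] crs_nz[OF kN kN False] u by (simp add: crs_def)
    qed
  qed
qed

text \<open>
  The only case that \<open>no_two_opposite_pairs\<close> leaves open has both diagonals on edges. Their common midpoint is interior to
  both edges, which meet at most in a common vertex.
\<close>

lemma three_edges:
  assumes R: "ccw_rectangle R" and k: "sits k R"
  shows "card {k 0, k 1, k 2, k 3} \<ge> 3"
proof -
  have rel: "\<not> (k a = k (1+a) \<and> k (2+a) = k (3+a))" "\<not> (k a = k (1+a) \<and> k (1+a) = k (2+a))" for a
    using no_two_opposite_pairs[OF ccw_relabel_any[OF R] sits_on_lines[OF sits_relabel[OF k]], of a] by simp_all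
  have ar: "1 + 1 = (2::4)" "2 + 1 = (3::4)" "3 + 1 = (0::4)" "1 + 2 = (3::4)" "2 + 2 = (0::4)" "3 + 2 = (1::4)"
    "1 + 3 = (0::4)" "2 + 3 = (1::4)" "3 + 3 = (2::4)" by simp_all
  have 3: "\<not> (k 0 = k 1 \<and> k 2 = k 3)" "\<not> (k 0 = k 1 \<and> k 1 = k 2)" "\<not> (k 1 = k 2 \<and> k 3 = k 0)" "\<not> (k 1 = k 2 \<and> k 2 = k 3)"
    "\<not> (k 2 = k 3 \<and> k 3 = k 0)" "\<not> (k 3 = k 0 \<and> k 0 = k 1)"
    using rel[of 0, unfolded add_0_right] rel[of 1, unfolded ar] rel[of 2, unfolded ar] rel[of 3, unfolded ar] by blast+
  have "\<not> (k 0 = k 2 \<and> k 1 = k 3)"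
  proof
    assume e: "k 0 = k 2 \<and> k 1 = k 3"
    define m where "m = R $ 0 + (1/2) *\<^sub>R (R $ 2 - R $ 0)"
    have kN: "k i < N" for i using k by (simp add: sits_def)
    define z where "z = R $ 0"
    define u where "u = R $ 1 - R $ 0"
    define r where "r = aspect_ratio R"
    have Rr: "R = rect z u r" and u0: "u \<noteq> 0" using ccw_rectD[OF R] by (auto simp: u_def r_def z_def)
    have c: "R $ 0 = z" "R $ 1 = z + u" "R $ 2 = z + u + r *\<^sub>R perp u" "R $ 3 = z + r *\<^sub>R perp u"
      unfolding Rr by simp_all
    have m2: "m = R $ 1 + (1/2) *\<^sub>R (R $ 3 - R $ 1)"
      unfolding m_def c by (simp add: eq_2_iff field_simps)
    have mid: "\<exists>x. x \<in> {0<..<1} \<and> p + (1/2) *\<^sub>R (q - p) = v i + x *\<^sub>R dir N v i"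
      if pq: "p \<in> edge N v i" "q \<in> edge N v i" "p \<noteq> q" for p q i
    proof -
      obtain a where a: "a \<in> {0..1}" "p = v i + a *\<^sub>R dir N v i" using pq(1) edge_iff by blast
      obtain b where b: "b \<in> {0..1}" "q = v i + b *\<^sub>R dir N v i" using pq(2) edge_iff by blast
      have "a \<noteq> b" using pq(3) a b by auto
      then have "(a+b)/2 \<in> {0<..<1}" using a(1) b(1) by auto
      moreover have "p + (1/2) *\<^sub>R (q - p) = v i + ((a+b)/2) *\<^sub>R dir N v i"
        unfolding a b by (simp add: eq_2_iff field_simps)
      ultimately show ?thesis by blast
    qed
    have uu: "u \<bullet> u \<noteq> 0" using u0 by simp
    have n02: "R $ 0 \<noteq> R $ 2"
    proof
      assume "R $ 0 = R $ 2"
      then have "u = - (r *\<^sub>R perp u)" unfolding c by (simp add: eq_neg_iff_add_eq_0)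
      then have "u \<bullet> u = u \<bullet> (- (r *\<^sub>R perp u))" by (rule arg_cong)
      also have "\<dots> = 0" by (simp add: inner_2)
      finally show False using uu by simp
    qed
    have n13: "R $ 1 \<noteq> R $ 3"
    proof
      assume "R $ 1 = R $ 3"
      then have "u = r *\<^sub>R perp u" unfolding c by simp
      then have "u \<bullet> u = u \<bullet> (r *\<^sub>R perp u)" by (rule arg_cong)
      also have "\<dots> = 0" by (simp add: inner_2)
      finally show False using uu by simp
    qed
    obtain x where x: "x \<in> {0<..<1}" "m = v (k 0) + x *\<^sub>R dir N v (k 0)"
    proof -
      have "R $ 0 \<in> edge N v (k 0)" "R $ 2 \<in> edge N v (k 0)" using k e unfolding sits_def by metis+
      from mid[OF this n02] show thesis using that unfolding m_def by blast
    qed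
    obtain y where y: "y \<in> {0<..<1}" "m = v (k 1) + y *\<^sub>R dir N v (k 1)"
    proof -
      have "R $ 1 \<in> edge N v (k 1)" "R $ 3 \<in> edge N v (k 1)" using k e unfolding sits_def by metis+
      from mid[OF this n13] show thesis using that unfolding m2 by blast
    qed
    have ne: "k 0 \<noteq> k 1" using 3(2) e by metis
    have xy: "x \<in> {0..1}" "y \<in> {0..1}" using x(1) y(1) by auto
    have "m \<in> edge N v (k 0)" using xy(1) x(2) edge_iff by blast
    moreover have "m \<in> edge N v (k 1)" using xy(2) y(2) edge_iff by blast
    ultimately have "m = v (k 0) \<or> m = v (k 1)" using edge_inter[OF kN kN ne] by blast
    then show False
    proof
      assume "m = v (k 0)" then have "x *\<^sub>R dir N v (k 0) = 0" using x(2) by simp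
      then show False using x(1) dir_nonzero[OF kN] by simp
    next
      assume "m = v (k 1)" then have "y *\<^sub>R dir N v (k 1) = 0" using y(2) by simp
      then show False using y(1) dir_nonzero[OF kN] by simp
    qed
  qed
  then have d: "\<not> (k 0 = k 2 \<and> k 1 = k 3)" .
  show ?thesis
    by (cases "k 0 = k 1"; cases "k 0 = k 2"; cases "k 0 = k 3"; cases "k 1 = k 2"; cases "k 1 = k 3"; cases "k 2 = k 3")
       (use 3 d in \<open>simp_all add: card_insert_if\<close>)
qed

text \<open>
  Four edges and the aspect ratio determine the rectangle: \<open>Quad\<close> is affine along edge \<open>k 0\<close> with slope \<open>-Del\<close>, and
  \<open>Del\<close> is nonzero by \<open>no_common_root\<close>.
\<close>

lemma rectangle_determined:
  assumes R: "ccw_rectangle R" and k: "on_lines k R" and three: "card {k 0, k 1, k 2, k 3} \<ge> 3"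
  defines "r \<equiv> aspect_ratio R"
  defines "x \<equiv> Quad (k 1) (k 2) (k 3) (v (k 0)) r / Del (k 0) (k 1) (k 2) (k 3) r"
  shows "Del (k 0) (k 1) (k 2) (k 3) r \<noteq> 0" "R $ 0 = v (k 0) + x *\<^sub>R dir N v (k 0)"
    "R $ 1 - R $ 0 = side (k 1) (k 3) (R $ 0) r" "Quad (k 1) (k 2) (k 3) (R $ 0) r = 0"
proof -
  define u where "u = R $ 1 - R $ 0"
  have Rr: "R = rect (R $ 0) u r" and r: "r > 0" and u: "u \<noteq> 0" using ccw_rectD[OF R] by (auto simp: u_def r_def)
  have kN: "k i < N" for i using k by (simp add: on_lines_def)
  have o: "off (k i) (R $ i) = 0" for i using k by (simp add: on_lines_def)
  have o0: "off (k 0) (R $ 0) = 0" and o1: "off (k 1) (R $ 0 + u) = 0" and o2: "off (k 2) (R $ 0 + u + r *\<^sub>R perp u) = 0"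
    and o3: "off (k 3) (R $ 0 + r *\<^sub>R perp u) = 0"
    using o[of 0] o[of 1] o[of 2] o[of 3] Rr rect_nth by metis+
  have l: "cross2 (dir N v (k 1)) u = off (k 1) (R $ 0)" "cross2 (dir N v (k 2)) u + r * (dir N v (k 2) \<bullet> u) = off (k 2) (R $ 0)"
     "r * (dir N v (k 3) \<bullet> u) = off (k 3) (R $ 0)"
    using o1 o2 o3 lines_rect_iff by blast+
  note rl = rect_on_lines_imp[OF kN kN kN _ l]
  show Q: "Quad (k 1) (k 2) (k 3) (R $ 0) r = 0" using rl(1) r by simp
  show "R $ 1 - R $ 0 = side (k 1) (k 3) (R $ 0) r" using rl(2) r by (simp add: u_def)
  obtain y where y: "R $ 0 = v (k 0) + y *\<^sub>R dir N v (k 0)" using off_line_param[OF kN o0] by blast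
  have Qy: "Quad (k 1) (k 2) (k 3) (v (k 0)) r = y * Del (k 0) (k 1) (k 2) (k 3) r"
    using Q unfolding y Quad_add by simp
  show D: "Del (k 0) (k 1) (k 2) (k 3) r \<noteq> 0"
  proof
    assume D0: "Del (k 0) (k 1) (k 2) (k 3) r = 0"
    show False
    proof (rule no_common_root[OF kN kN kN kN three r])
      show "vq2 N v (k 0) (k 1) (k 2) (k 3) * r\<^sup>2 + vq1 N v (k 0) (k 1) (k 2) (k 3) * r + vq0 N v (k 0) (k 1) (k 2) (k 3) = 0"
        using Qy D0 unfolding Quad_vertex by simp
      show "dq2 N v (k 0) (k 1) (k 2) (k 3) * r\<^sup>2 + dq1 N v (k 0) (k 1) (k 2) (k 3) * r + dq0 N v (k 0) (k 1) (k 2) (k 3) = 0"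
        using D0 unfolding Del_def .
    qed
  qed
  have "x = y" unfolding x_def Qy using D by simp
  then show "R $ 0 = v (k 0) + x *\<^sub>R dir N v (k 0)" using y by simp
qed

text \<open>
  Adjacent corners at vertices make \<open>side_rel\<close> vanish. For opposite corners, \<open>diag_rel\<close> is, up to a square, the
  dot product of two consecutive sides if the remaining corners are on different lines; otherwise the sum of two offsets vanishes.
\<close>

lemma no_two_vertices_0:
  assumes R: "ccw_rectangle R" and k: "sits k R" and a: "a < N" "R $ 0 = v a"
  shows "b < N \<Longrightarrow> R $ 1 \<noteq> v b" "b < N \<Longrightarrow> R $ 2 \<noteq> v b"
proof -
  define u where "u = R $ 1 - R $ 0"
  define r where "r = aspect_ratio R"
  have Rr: "R = rect (R $ 0) u r" and r: "r > 0" and u: "u \<noteq> 0" using ccw_rectD[OF R] by (auto simp: u_def r_def)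
  have kN: "k i < N" for i using k by (simp add: sits_def)
  have o: "off (k i) (R $ i) = 0" for i using sits_on_lines[OF k] by (simp add: on_lines_def)
  have o1: "off (k 1) (R $ 0 + u) = 0" and o2: "off (k 2) (R $ 0 + u + r *\<^sub>R perp u) = 0"
    and o3: "off (k 3) (R $ 0 + r *\<^sub>R perp u) = 0"
    using o[of 1] o[of 2] o[of 3] Rr rect_nth by metis+
  have pz: "perp u \<noteq> 0" using u by (auto simp: eq_2_iff)
  show "R $ 1 \<noteq> v b" if b: "b < N"
  proof
    assume R1: "R $ 1 = v b"
    have uw: "u = v b - v a" using R1 a by (simp add: u_def)
    have ab: "b \<noteq> a" using u uw by auto
    have e2: "voff N v (k 2) b = r * vdot N v (k 2) b a"
      using o2 unfolding a uw vdot_def voff_def by (simp add: off_def cross2_def inner_2 algebra_simps)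
    have e3: "voff N v (k 3) a = r * vdot N v (k 3) b a"
      using o3 unfolding a uw vdot_def voff_def by (simp add: off_def cross2_def inner_2 algebra_simps)
    have n2: "voff N v (k 2) b \<noteq> 0" and n3: "voff N v (k 3) a \<noteq> 0"
      unfolding e2 e3 using r vdot_nz[OF kN b a(1) ab] by simp_all
    have "side_rel N v a b (k 2) (k 3) = 0" unfolding side_rel_def e2 e3 by simp
    moreover have "side_rel N v a b (k 2) (k 3) \<noteq> 0"
      by (rule side_rel_nz[OF kN kN b a(1) ab]) (use n2 n3 voff_zero[OF kN b] voff_zero[OF kN a(1)] in auto)
    ultimately show False by simp
  qed
  show "R $ 2 \<noteq> v b" if b: "b < N"
  proof
    assume R2: "R $ 2 = v b"
    define w where "w = v b - v a"
    have wu: "w - u = r *\<^sub>R perp u" using R2 a(2) Rr rect_nth(3)[of "R $ 0" u r] unfolding w_def by (metis add_diff_cancel_left' diff_diff_eq)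
    have wz: "w - u \<noteq> 0" unfolding wu using pz r by simp
    have orth: "u \<bullet> (w - u) = 0" unfolding wu by (simp add: inner_2)
    have ab: "b \<noteq> a"
    proof
      assume "b = a" then have "w = 0" by (simp add: w_def)
      then show False using orth u by simp
    qed
    define i where "i = k 1"
    define l where "l = k 3"
    define di where "di = dir N v i"
    define dl where "dl = dir N v l"
    have iN: "i < N" "l < N" using kN by (auto simp: i_def l_def)
    have e1: "voff N v i a = cross2 di u"
      using o1 unfolding a i_def di_def voff_def by (simp add: off_def cross2_def algebra_simps)
    have o3': "R $ 0 + r *\<^sub>R perp u = v b - u" using wu a(2) by (simp add: w_def algebra_simps)
    have e3: "voff N v l b = - cross2 dl u"
      using o3[unfolded o3'] unfolding l_def dl_def voff_def by (simp add: off_def cross2_def algebra_simps)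
    have ew: "voff N v m a - voff N v m b = cross2 (dir N v m) w" for m
      by (simp add: voff_def w_def cross2_def algebra_simps)
    have par: False if e: "cross2 e u = 0" "cross2 e w = 0" "e \<noteq> 0" for e
    proof -
      have "cross2 e (w - u) = 0" using e(1,2) by (simp add: cross2_def algebra_simps)
      then have "r * (e \<bullet> u) = 0" unfolding wu by (simp add: cross2_def inner_2 algebra_simps)
      then show False using zero_if_parallel_orthogonal[OF e(1) _ e(3)] r u by simp
    qed
    have d0: "di \<noteq> 0" "dl \<noteq> 0" using dir_nonzero iN by (auto simp: di_def dl_def)
    have c3: "\<not> (voff N v i a = 0 \<and> voff N v i b = 0)" using par[OF _ _ d0(1)] e1 ew[of i] unfolding di_def by force
    have c4: "\<not> (voff N v l a = 0 \<and> voff N v l b = 0)" using par[OF _ _ d0(2)] e3 ew[of l] unfolding dl_def by force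
    have il: "i \<noteq> l"
    proof
      assume il: "i = l"
      then have "voff N v i a + voff N v i b = 0" using e1 e3 by (simp add: di_def dl_def)
      then show False using voff_sum_nz[OF iN(1) b a(1)] c3 voff_zero[OF iN(1) a(1)] voff_zero[OF iN(1) b] by auto
    qed
    have q: "cross2 di dl \<noteq> 0" using crs_nz[OF iN il] by (simp add: crs_def di_def dl_def)
    have c1: "\<not> (voff N v i a = 0 \<and> voff N v l b = 0)" using zero_if_cross2_zero[of di u dl] e1 e3 q u by auto
    have c2: "\<not> (voff N v i b = 0 \<and> voff N v l a = 0)"
    proof
      assume z: "voff N v i b = 0 \<and> voff N v l a = 0"
      have "cross2 di (w - u) = 0" using ew[of i] e1 z unfolding di_def by (simp add: cross2_def algebra_simps)
      moreover have "cross2 dl (w - u) = 0" using ew[of l] e3 z unfolding dl_def by (simp add: cross2_def algebra_simps)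
      ultimately show False using zero_if_cross2_zero q wz by blast
    qed
    \<comment> \<open>Here \<open>u\<close> and \<open>w - u\<close> are consecutive sides.\<close>
    have "diag_rel N v a b i l = 0"
    proof -
      have "diag_rel N v a b i l = (cross2 di dl)\<^sup>2 * (u \<bullet> (w - u))"
        unfolding diag_rel_def crs_def vdot_def dotp_def e1 e3 w_def[symmetric] di_def[symmetric] dl_def[symmetric]
        by (simp add: cross2_def inner_2 power2_eq_square algebra_simps)
      then show ?thesis using orth by simp
    qed
    moreover have "diag_rel N v a b i l \<noteq> 0"
      by (rule diag_rel_nz[OF iN b a(1) ab il])
         (use c1 c2 c3 c4 voff_zero[OF iN(1) a(1)] voff_zero[OF iN(1) b] voff_zero[OF iN(2) a(1)] voff_zero[OF iN(2) b] in auto)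
    ultimately show False by simp
  qed
qed

lemma no_two_vertices:
  assumes R: "ccw_rectangle R" and k: "sits k R" and a: "a < N" "R $ i = v a" and ij: "i \<noteq> j" and b: "b < N"
  shows "R $ j \<noteq> v b"
proof
  assume Rj: "R $ j = v b"
  have 0: "relabel i R $ 0 = v a" "relabel j R $ 0 = v b" using a Rj by (simp_all add: relabel_nth)
  note i = no_two_vertices_0[OF ccw_relabel_any[OF R] sits_relabel[OF k] a(1) 0(1) b]
  note j = no_two_vertices_0(1)[OF ccw_relabel_any[OF R] sits_relabel[OF k] b 0(2) a(1)]
  have "j - i = 0 \<or> j - i = 1 \<or> j - i = 2 \<or> j - i = 3"
    using all_4[of "\<lambda>x. x = 0 \<or> x = 1 \<or> x = 2 \<or> x = 3"] by blast
  then consider "j - i = 1" | "j - i = 2" | "j - i = 3" using ij by auto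
  then show False
  proof cases
    case 1 then have "1 + i = j" by (simp add: algebra_simps)
    then show False using i(1) Rj by (simp add: relabel_nth)
  next
    case 2 then have "2 + i = j" by (simp add: algebra_simps)
    then show False using i(2) Rj by (simp add: relabel_nth)
  next
    case 3
    have "i - j = - (j - i)" by simp
    also have "\<dots> = 1" unfolding 3 by simp
    finally have "1 + j = i" by (simp add: algebra_simps)
    then show False using j a(2) by (simp add: relabel_nth)
  qed
qed

end

section \<open>Rational curves and two-sided parametrizations\<close>

text \<open>
  Rational functions whose denominator is a power of \<open>P\<close>. The class is closed under differentiation, so its members are
  smooth where \<open>P\<close> does not vanish.
\<close>

definition rat_over :: "real poly \<Rightarrow> (real \<Rightarrow> real) \<Rightarrow> bool" where
  "rat_over P f \<longleftrightarrow> (\<exists>Q n. \<forall>r. poly P r \<noteq> 0 \<longrightarrow> f r = poly Q r / poly (P ^ n) r)"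

lemma rat_poly: "rat_over P (poly Q)"
  unfolding rat_over_def by (intro exI[of _ Q] exI[of _ 0]) simp

lemma rat_const: "rat_over P (\<lambda>r. c)"
proof -
  have "poly [:c:] = (\<lambda>r. c)" by auto
  then show ?thesis using rat_poly[of P "[:c:]"] by metis
qed

lemma rat_ident: "rat_over P (\<lambda>r. r)"
proof -
  have "poly [:0,1:] = (\<lambda>r::real. r)" by auto
  then show ?thesis using rat_poly[of P "[:0,1:]"] by metis
qed

lemma rat_add:
  assumes "rat_over P f" "rat_over P g" shows "rat_over P (\<lambda>r. f r + g r)"
proof -
  obtain Q n where Q: "\<And>r. poly P r \<noteq> 0 \<Longrightarrow> f r = poly Q r / poly (P ^ n) r" using assms(1) unfolding rat_over_def by blast
  obtain S m where S: "\<And>r. poly P r \<noteq> 0 \<Longrightarrow> g r = poly S r / poly (P ^ m) r" using assms(2) unfolding rat_over_def by blast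
  have "f r + g r = poly (Q * P ^ m + S * P ^ n) r / poly (P ^ (n + m)) r" if "poly P r \<noteq> 0" for r
    using that unfolding Q[OF that] S[OF that] by (simp add: power_add add_frac_eq)
  then show ?thesis unfolding rat_over_def by blast
qed

lemma rat_mult:
  assumes "rat_over P f" "rat_over P g" shows "rat_over P (\<lambda>r. f r * g r)"
proof -
  obtain Q n where Q: "\<And>r. poly P r \<noteq> 0 \<Longrightarrow> f r = poly Q r / poly (P ^ n) r" using assms(1) unfolding rat_over_def by blast
  obtain S m where S: "\<And>r. poly P r \<noteq> 0 \<Longrightarrow> g r = poly S r / poly (P ^ m) r" using assms(2) unfolding rat_over_def by blast
  have "f r * g r = poly (Q * S) r / poly (P ^ (n + m)) r" if "poly P r \<noteq> 0" for r
    unfolding Q[OF that] S[OF that] by (simp add: power_add)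
  then show ?thesis unfolding rat_over_def by blast
qed

lemma rat_uminus: "rat_over P f \<Longrightarrow> rat_over P (\<lambda>r. - f r)"
  using rat_mult[OF rat_const[of P "-1"]] by simp

lemma rat_diff: "rat_over P f \<Longrightarrow> rat_over P g \<Longrightarrow> rat_over P (\<lambda>r. f r - g r)"
  using rat_add[OF _ rat_uminus, of P f g] by simp

lemma rat_power: "rat_over P f \<Longrightarrow> rat_over P (\<lambda>r. f r ^ n)"
  by (induction n) (auto intro: rat_mult rat_const)

lemma rat_inverse_factor: "P = A * B \<Longrightarrow> rat_over P (\<lambda>r. 1 / poly A r)"
  unfolding rat_over_def by (intro exI[of _ B] exI[of _ 1]) simp

lemmas rat_intros = rat_const rat_ident rat_add rat_mult rat_diff rat_uminus rat_power

lemma open_nonzero_poly: "open {r::real. poly P r \<noteq> 0}"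
  by (rule open_Collect_neq) (auto intro!: continuous_intros)

lemma rat_deriv:
  assumes "rat_over P f"
  shows "\<exists>f'. rat_over P f' \<and> (\<forall>r. poly P r \<noteq> 0 \<longrightarrow> (f has_real_derivative f' r) (at r))"
proof -
  obtain Q n where Q: "\<And>r. poly P r \<noteq> 0 \<Longrightarrow> f r = poly Q r / poly (P ^ n) r" using assms unfolding rat_over_def by blast
  define G where "G = P ^ n"
  define f' where "f' r = poly (pderiv Q * G - Q * pderiv G) r / poly (P ^ (n + n)) r" for r
  have "(f has_real_derivative f' r) (at r)" if P: "poly P r \<noteq> 0" for r
  proof -
    have G0: "poly G r \<noteq> 0" using P by (simp add: G_def)
    have GG: "poly (P ^ (n + n)) r = poly G r * poly G r" by (simp add: G_def power_add)
    have "((\<lambda>r. poly Q r / poly G r) has_real_derivative f' r) (at r)"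
      unfolding f'_def GG using DERIV_divide[OF poly_DERIV[of Q r] poly_DERIV[of G r] G0] by (simp add: mult.commute)
    then show ?thesis
      by (rule has_field_derivative_transform_within_open[OF _ open_nonzero_poly[of P]]) (use P Q in \<open>auto simp: G_def\<close>)
  qed
  moreover have "rat_over P f'" unfolding rat_over_def f'_def by blast
  ultimately show ?thesis by blast
qed

text \<open>
  A rational function is \<open>r^(a - b)\<close> times a function with a nonzero limit at \<open>0\<close>. Boundedness
  along some sequence excludes a pole.
\<close>

lemma rat_bounded_imp_convergent:
  assumes f: "rat_over P f" and P: "P \<noteq> 0" and bdd: "\<exists>\<^sub>F r in at_right 0. \<bar>f r\<bar> \<le> B"
  shows "\<exists>l. (f \<longlongrightarrow> l) (at_right 0)"
proof -
  obtain Q n where Q: "\<And>r. poly P r \<noteq> 0 \<Longrightarrow> f r = poly Q r / poly (P ^ n) r" using f unfolding rat_over_def by blast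
  define A where "A = {r. poly P r = 0}"
  have "finite A" unfolding A_def using P by (rule poly_roots_finite)
  then have "open (- (A - {0}))" by (intro open_Compl finite_imp_closed) simp
  then have "\<forall>\<^sub>F r in nhds 0. r \<in> - (A - {0})" by (rule eventually_nhds_in_open) simp
  then have evP: "\<forall>\<^sub>F r in at_right 0. poly P r \<noteq> 0"
    unfolding eventually_at_filter by eventually_elim (auto simp: A_def)
  show ?thesis
  proof (cases "Q = 0")
    case True
    have "\<forall>\<^sub>F r in at_right 0. f r = 0" using evP by eventually_elim (use True Q in simp)
    then show ?thesis using tendsto_eventually by blast
  next
    case False
    define G where "G = P ^ n"
    have G: "G \<noteq> 0" using P by (simp add: G_def)
    obtain Q1 where Q1: "Q = [:-0,1:] ^ order 0 Q * Q1" "\<not> [:-0,1:] dvd Q1" using order_decomp[OF False] by blast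
    obtain G1 where G1: "G = [:-0,1:] ^ order 0 G * G1" "\<not> [:-0,1:] dvd G1" using order_decomp[OF G] by blast
    define a where "a = order 0 Q"
    define b where "b = order 0 G"
    have z: "poly Q1 0 \<noteq> 0" "poly G1 0 \<noteq> 0" using Q1(2) G1(2) by (simp_all add: poly_eq_0_iff_dvd)
    have Qr: "poly Q r = r ^ a * poly Q1 r" for r using arg_cong[OF Q1(1), of "\<lambda>p. poly p r"] by (simp add: a_def)
    have Gr: "poly G r = r ^ b * poly G1 r" for r using arg_cong[OF G1(1), of "\<lambda>p. poly p r"] by (simp add: b_def)
    have lim: "((\<lambda>r. poly Q1 r / poly G1 r) \<longlongrightarrow> poly Q1 0 / poly G1 0) (at_right 0)"
      using z(2) by (auto intro!: tendsto_intros)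
    have pos: "\<forall>\<^sub>F r in at_right (0::real). r > 0" by (simp add: eventually_at_right_less)
    show ?thesis
    proof (cases "b \<le> a")
      case True
      have "\<forall>\<^sub>F r in at_right 0. r ^ (a - b) * (poly Q1 r / poly G1 r) = f r"
        using evP pos
      proof eventually_elim
        case (elim r)
        have "f r = (r ^ a * poly Q1 r) / (r ^ b * poly G1 r)" using Q[OF elim(1)] unfolding G_def[symmetric] Qr Gr .
        also have "r ^ a = r ^ (a - b) * r ^ b" using True by (simp flip: power_add)
        finally show ?case using elim(2) by simp
      qed
      moreover have "((\<lambda>r. r ^ (a - b) * (poly Q1 r / poly G1 r)) \<longlongrightarrow> 0 ^ (a - b) * (poly Q1 0 / poly G1 0)) (at_right 0)"
        by (intro tendsto_intros lim)
      ultimately show ?thesis using Lim_transform_eventually by blast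
    next
      case False
      define c where "c = poly Q1 0 / poly G1 0"
      have c: "\<bar>c\<bar> > 0" using z by (simp add: c_def)
      have ev1: "\<forall>\<^sub>F r in at_right 0. \<bar>poly Q1 r / poly G1 r\<bar> > \<bar>c\<bar> / 2"
        by (rule order_tendstoD(1)[OF tendsto_rabs[OF lim]]) (use c in \<open>simp add: c_def\<close>)
      have "((\<lambda>r. B * r ^ (b - a)) \<longlongrightarrow> B * 0 ^ (b - a)) (at_right 0)" by (intro tendsto_intros)
      moreover have "B * 0 ^ (b - a) = 0" using False by simp
      ultimately have "((\<lambda>r. B * r ^ (b - a)) \<longlongrightarrow> 0) (at_right 0)" by metis
      then have ev2: "\<forall>\<^sub>F r in at_right 0. B * r ^ (b - a) < \<bar>c\<bar> / 2"
        by (rule order_tendstoD(2)) (use c in simp)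
      have "\<forall>\<^sub>F r in at_right 0. \<not> \<bar>f r\<bar> \<le> B"
        using evP pos ev1 ev2
      proof eventually_elim
        case (elim r)
        have "f r = (r ^ a * poly Q1 r) / (r ^ b * poly G1 r)" using Q[OF elim(1)] unfolding G_def[symmetric] Qr Gr .
        also have "r ^ b = r ^ (b - a) * r ^ a" using False by (simp flip: power_add)
        finally have "poly Q1 r / poly G1 r = f r * r ^ (b - a)" using elim(2) by simp
        then have "\<bar>f r\<bar> * r ^ (b - a) > \<bar>c\<bar> / 2" using elim(2,3) by (simp add: abs_mult)
        show ?case
        proof
          assume "\<bar>f r\<bar> \<le> B"
          then have "\<bar>f r\<bar> * r ^ (b - a) \<le> B * r ^ (b - a)" using elim(2) by (intro mult_right_mono) auto
          then show False using elim(4) \<open>\<bar>f r\<bar> * r ^ (b - a) > \<bar>c\<bar> / 2\<close> by linarith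
        qed
      qed
      then show ?thesis using bdd unfolding frequently_def by blast
    qed
  qed
qed

lemma has_vector_derivative_vec:
  fixes f :: "real \<Rightarrow> ('a::real_normed_vector)^'n"
  assumes "\<And>i. ((\<lambda>t. f t $ i) has_vector_derivative g $ i) (at x)"
  shows "(f has_vector_derivative g) (at x)"
proof -
  have *: "((\<lambda>y. (f y $ i - f x $ i - (y - x) *\<^sub>R g $ i) /\<^sub>R norm (y - x)) \<longlongrightarrow> 0) (at x)" for i
    using assms[of i] unfolding has_vector_derivative_def has_derivative_at_within has_derivative_within by blast
  have "((\<lambda>y. (f y - f x - (y - x) *\<^sub>R g) /\<^sub>R norm (y - x)) \<longlongrightarrow> 0) (at x)"
    by (rule vec_tendstoI) (use * in simp)
  then show ?thesis
    unfolding has_vector_derivative_def has_derivative_within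
    by (simp add: bounded_linear_scaleR_left diff_diff_eq inverse_eq_divide)
qed

definition rat_curve :: "real poly \<Rightarrow> (real \<Rightarrow> real^2^4) \<Rightarrow> bool" where
  "rat_curve P X \<longleftrightarrow> (\<forall>i j. rat_over P (\<lambda>r. X r $ i $ j))"

lemma rat_curve_deriv:
  assumes X: "rat_curve P X"
  shows "\<exists>X'. rat_curve P X' \<and> (\<forall>r. poly P r \<noteq> 0 \<longrightarrow> (X has_vector_derivative X' r) (at r))"
proof -
  have "\<forall>i j. \<exists>f'. rat_over P f' \<and> (\<forall>r. poly P r \<noteq> 0 \<longrightarrow> ((\<lambda>r. X r $ i $ j) has_real_derivative f' r) (at r))"
    using rat_deriv X unfolding rat_curve_def by blast
  then obtain f' where f': "\<And>i j. rat_over P (f' i j)" "\<And>i j r. poly P r \<noteq> 0 \<Longrightarrow> ((\<lambda>r. X r $ i $ j) has_real_derivative f' i j r) (at r)"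
    by metis
  define X' where "X' r = (\<chi> i j. f' i j r)" for r
  have "rat_curve P X'" unfolding rat_curve_def X'_def using f'(1) by simp
  moreover have "(X has_vector_derivative X' r) (at r)" if "poly P r \<noteq> 0" for r
    by (intro has_vector_derivative_vec) (use f'(2)[OF that] in \<open>simp add: X'_def has_real_derivative_iff_has_vector_derivative\<close>)
  ultimately show ?thesis by blast
qed

lemma rat_curve_smooth:
  assumes X: "rat_curve P X" and S: "\<And>r. r \<in> S \<Longrightarrow> poly P r \<noteq> 0"
  shows "C_infinity_on S X"
proof -
  have "\<exists>D. \<forall>n. (rat_curve P (D n) \<and> (n = 0 \<longrightarrow> D n = X)) \<and> (\<forall>r. poly P r \<noteq> 0 \<longrightarrow> (D n has_vector_derivative D (Suc n) r) (at r))"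
  proof (rule dependent_nat_choice)
    show "\<exists>x. rat_curve P x \<and> (0 = (0::nat) \<longrightarrow> x = X)" using X by blast
    fix x and n :: nat assume "rat_curve P x \<and> (n = 0 \<longrightarrow> x = X)"
    then show "\<exists>y. (rat_curve P y \<and> (Suc n = 0 \<longrightarrow> y = X)) \<and> (\<forall>r. poly P r \<noteq> 0 \<longrightarrow> (x has_vector_derivative y r) (at r))"
      using rat_curve_deriv[of P x] by auto
  qed
  then obtain D where D: "\<And>n. (rat_curve P (D n) \<and> (n = 0 \<longrightarrow> D n = X)) \<and> (\<forall>r. poly P r \<noteq> 0 \<longrightarrow> (D n has_vector_derivative D (Suc n) r) (at r))" by blast
  show ?thesis unfolding C_infinity_on_def by (intro exI[of _ D]) (use D S in blast)
qed

lemma C_infinity_on_shift: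
  assumes "C_infinity_on S X" shows "C_infinity_on {t. a + t \<in> S} (\<lambda>t. X (a + t))"
proof -
  obtain D where D: "D 0 = X" "\<And>n t. t \<in> S \<Longrightarrow> (D n has_vector_derivative D (Suc n) t) (at t)"
    using assms unfolding C_infinity_on_def by blast
  have "((\<lambda>t. D n (a + t)) has_vector_derivative D (Suc n) (a + t)) (at t)" if "a + t \<in> S" for n t
  proof -
    have "((\<lambda>t. a + t) has_real_derivative 1) (at t)" by (auto intro!: derivative_eq_intros)
    from vector_diff_chain_at[OF this[unfolded has_real_derivative_iff_has_vector_derivative] D(2)[OF that, of n]]
    show ?thesis by (simp add: o_def)
  qed
  then show ?thesis unfolding C_infinity_on_def using D(1) by (intro exI[of _ "\<lambda>n t. D n (a + t)"]) auto
qed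

text \<open>
  Near \<open>p\<close> the set \<open>X\<close> is the union of two curves parametrized by \<open>\<tau>\<close>, each on one side of \<open>\<tau> p\<close>, which is given by
  a sign. With opposite signs \<open>\<tau>\<close> passes through its value at \<open>p\<close>, with equal signs \<open>X\<close> has a fold there.
\<close>

definition two_sided :: "'a::metric_space set \<Rightarrow> ('a \<Rightarrow> real) \<Rightarrow> 'a \<Rightarrow> (real \<Rightarrow> 'a) \<Rightarrow> (real \<Rightarrow> 'a) \<Rightarrow> real \<Rightarrow> real \<Rightarrow> real \<Rightarrow> 'a set \<Rightarrow> bool" where
  "two_sided X \<tau> p Y1 Y2 s1 s2 d V \<longleftrightarrow>
     d > 0 \<and> s1 \<in> {1,-1} \<and> s2 \<in> {1,-1} \<and> openin (top_of_set X) V \<and> p \<in> V \<and> Y1 (\<tau> p) = p \<and> Y2 (\<tau> p) = p \<and>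
     continuous_on {\<tau> p - d<..<\<tau> p + d} Y1 \<and> continuous_on {\<tau> p - d<..<\<tau> p + d} Y2 \<and>
     (\<forall>R\<in>V. \<bar>\<tau> R - \<tau> p\<bar> < d \<and> ((R = Y1 (\<tau> R) \<and> 0 \<le> s1 * (\<tau> R - \<tau> p)) \<or> (R = Y2 (\<tau> R) \<and> 0 \<le> s2 * (\<tau> R - \<tau> p)))) \<and>
     (\<forall>t. \<bar>t - \<tau> p\<bar> < d \<and> 0 \<le> s1 * (t - \<tau> p) \<longrightarrow> Y1 t \<in> V \<and> \<tau> (Y1 t) = t) \<and>
     (\<forall>t. \<bar>t - \<tau> p\<bar> < d \<and> 0 \<le> s2 * (t - \<tau> p) \<longrightarrow> Y2 t \<in> V \<and> \<tau> (Y2 t) = t) \<and>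
     (\<forall>t u. \<bar>t - \<tau> p\<bar> < d \<and> 0 < s1 * (t - \<tau> p) \<and> \<bar>u - \<tau> p\<bar> < d \<and> 0 < s2 * (u - \<tau> p) \<longrightarrow> Y1 t \<noteq> Y2 u)"

lemma two_sided_chart:
  assumes ts: "two_sided X \<tau> p Y1 Y2 s1 s2 d V" and ctau: "continuous_on X \<tau>"
  shows "\<exists>e f. unit_chart X \<tau> e f \<and> f 0 = p \<and> f ` {-e<..<e} \<subseteq> V \<and> (\<forall>t. 0 \<le> t \<and> t < e \<longrightarrow> \<tau> (f t) = \<tau> p + s1 * t) \<and> (\<forall>t. t \<le> 0 \<and> -e < t \<longrightarrow> \<tau> (f t) = \<tau> p - s2 * t)"
proof -
  define T where "T = \<tau> p"
  have d: "d > 0" and s: "s1 \<in> {1,-1}" "s2 \<in> {1,-1}" and V: "openin (top_of_set X) V" "p \<in> V" and Y0: "Y1 T = p" "Y2 T = p"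
    and cY: "continuous_on {T - d<..<T + d} Y1" "continuous_on {T - d<..<T + d} Y2"
    and Vd: "\<And>R. R \<in> V \<Longrightarrow> \<bar>\<tau> R - T\<bar> < d" "\<And>R. R \<in> V \<Longrightarrow> (R = Y1 (\<tau> R) \<and> 0 \<le> s1 * (\<tau> R - T)) \<or> (R = Y2 (\<tau> R) \<and> 0 \<le> s2 * (\<tau> R - T))"
    and Y1: "\<And>t. \<bar>t - T\<bar> < d \<Longrightarrow> 0 \<le> s1 * (t - T) \<Longrightarrow> Y1 t \<in> V \<and> \<tau> (Y1 t) = t"
    and Y2: "\<And>t. \<bar>t - T\<bar> < d \<Longrightarrow> 0 \<le> s2 * (t - T) \<Longrightarrow> Y2 t \<in> V \<and> \<tau> (Y2 t) = t"
    and Yne: "\<And>t u. \<bar>t - T\<bar> < d \<Longrightarrow> 0 < s1 * (t - T) \<Longrightarrow> \<bar>u - T\<bar> < d \<Longrightarrow> 0 < s2 * (u - T) \<Longrightarrow> Y1 t \<noteq> Y2 u"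
    using ts unfolding two_sided_def T_def by blast+
  define e where "e = d / 2"
  have e: "e > 0" "e < d" using d by (auto simp: e_def)
  define f where "f t = (if 0 \<le> t then Y1 (T + s1 * t) else Y2 (T - s2 * t))" for t
  have f1: "f t = Y1 (T + s1 * t)" if "0 \<le> t" for t using that by (simp add: f_def)
  have f2: "f t = Y2 (T - s2 * t)" if "t \<le> 0" for t using that Y0 by (cases "t = 0") (simp_all add: f_def)
  have in1: "f t \<in> V" "\<tau> (f t) = T + s1 * t" if "0 \<le> t" "t < d" for t
  proof -
    have "\<bar>(T + s1 * t) - T\<bar> < d" "0 \<le> s1 * ((T + s1 * t) - T)" using that s by auto
    from Y1[OF this] show "f t \<in> V" "\<tau> (f t) = T + s1 * t" using f1[OF that(1)] by auto
  qed
  have in2: "f t \<in> V" "\<tau> (f t) = T - s2 * t" if "t \<le> 0" "-d < t" for t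
  proof -
    have "\<bar>(T - s2 * t) - T\<bar> < d" "0 \<le> s2 * ((T - s2 * t) - T)" using that s by auto
    from Y2[OF this] show "f t \<in> V" "\<tau> (f t) = T - s2 * t" using f2[OF that(1)] by auto
  qed
  have inV: "f t \<in> V" if "t \<in> {-d<..<d}" for t using in1(1)[of t] in2(1)[of t] that by (cases "0 \<le> t") auto
  have f0: "f 0 = p" using f1[of 0] Y0 by simp
  have inj: "x = y" if "x \<in> {-d<..<d}" "y \<in> {-d<..<d}" "f x = f y" for x y
  proof -
    have same1: "x = y" if "0 \<le> x" "0 \<le> y" using in1(2)[of x] in1(2)[of y] that \<open>x \<in> _\<close> \<open>y \<in> _\<close> \<open>f x = f y\<close> s by auto
    have same2: "x = y" if "x \<le> 0" "y \<le> 0" using in2(2)[of x] in2(2)[of y] that \<open>x \<in> _\<close> \<open>y \<in> _\<close> \<open>f x = f y\<close> s by auto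
    have opp: False if "0 < a" "b < 0" "a \<in> {-d<..<d}" "b \<in> {-d<..<d}" "f a = f b" for a b
    proof -
      have "Y1 (T + s1 * a) \<noteq> Y2 (T - s2 * b)" by (rule Yne) (use that s in auto)
      then show False using f1[of a] f2[of b] that by simp
    qed
    consider "0 \<le> x" "0 \<le> y" | "x \<le> 0" "y \<le> 0" | "0 < x" "y < 0" | "x < 0" "0 < y" by linarith
    then show ?thesis
    proof cases
      case 3 then show ?thesis using opp[of x y] that by blast
    next
      case 4 then show ?thesis using opp[of y x] that by metis
    qed (use same1 same2 in auto)
  qed
  have c1: "continuous_on {0..e} f"
  proof (rule continuous_on_eq)
    show "continuous_on {0..e} (\<lambda>t. Y1 (T + s1 * t))"
      by (rule continuous_on_compose2[OF cY(1)]) (use s e in \<open>auto intro!: continuous_intros\<close>)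
  qed (use f1 in auto)
  have c2: "continuous_on {-e..0} f"
  proof (rule continuous_on_eq)
    show "continuous_on {-e..0} (\<lambda>t. Y2 (T - s2 * t))"
      by (rule continuous_on_compose2[OF cY(2)]) (use s e in \<open>auto intro!: continuous_intros\<close>)
  qed (use f2 in auto)
  have "continuous_on ({-e..0} \<union> {0..e}) f" by (rule continuous_on_closed_Un[OF _ _ c2 c1]) auto
  moreover have "{-e..0} \<union> {0..e} = {-e..e}" using e by auto
  ultimately have cont: "continuous_on {-e..e} f" by simp
  have injc: "inj_on f {-e..e}" by (rule inj_onI) (rule inj; use e in auto)
  obtain g where "homeomorphism {-e..e} (f ` {-e..e}) f g"
    using homeomorphism_compact[OF _ cont refl injc] by blast
  then have hom: "homeomorphism {-e<..<e} (f ` {-e<..<e}) f g"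
    by (rule homeomorphism_of_subsets) auto
  have surj: "\<exists>t\<in>{-e<..<e}. f t = R" if "R \<in> V" "\<bar>\<tau> R - T\<bar> < e" for R
    using Vd(2)[OF that(1)]
  proof
    assume h: "R = Y1 (\<tau> R) \<and> 0 \<le> s1 * (\<tau> R - T)"
    show ?thesis
    proof (rule bexI)
      have "T + s1 * (s1 * (\<tau> R - T)) = \<tau> R" using s(1) by auto
      then show "f (s1 * (\<tau> R - T)) = R" using f1[of "s1 * (\<tau> R - T)"] h by simp
      show "s1 * (\<tau> R - T) \<in> {-e<..<e}" using that(2) s(1) by auto
    qed
  next
    assume h: "R = Y2 (\<tau> R) \<and> 0 \<le> s2 * (\<tau> R - T)"
    show ?thesis
    proof (rule bexI)
      have "T - s2 * (- (s2 * (\<tau> R - T))) = \<tau> R" using s(2) by auto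
      then show "f (- (s2 * (\<tau> R - T))) = R" using f2[of "- (s2 * (\<tau> R - T))"] h by simp
      show "- (s2 * (\<tau> R - T)) \<in> {-e<..<e}" using that(2) s(2) by auto
    qed
  qed
  have tau: "\<bar>\<tau> (f t) - T\<bar> = \<bar>t\<bar>" if "t \<in> {-d<..<d}" for t
    using in1(2)[of t] in2(2)[of t] that s by (cases "0 \<le> t") auto
  have im: "f ` {-e<..<e} = V \<inter> \<tau> -` {T-e<..<T+e}"
  proof (intro equalityI subsetI)
    fix R assume "R \<in> f ` {-e<..<e}"
    then obtain t where t: "t \<in> {-e<..<e}" "R = f t" by blast
    then have "t \<in> {-d<..<d}" using e by auto
    then have "R \<in> V" "\<bar>\<tau> R - T\<bar> < e" using inV[of t] tau[of t] t by auto
    then show "R \<in> V \<inter> \<tau> -` {T-e<..<T+e}" by auto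
  next
    fix R assume "R \<in> V \<inter> \<tau> -` {T-e<..<T+e}"
    then have "R \<in> V" "\<bar>\<tau> R - T\<bar> < e" by auto
    from surj[OF this] show "R \<in> f ` {-e<..<e}" by blast
  qed
  have VX: "V \<subseteq> X" using V(1) openin_imp_subset by blast
  have "openin (top_of_set V) (V \<inter> \<tau> -` {T-e<..<T+e})"
    by (rule continuous_openin_preimage_gen[OF continuous_on_subset[OF ctau VX]]) simp
  then have op: "openin (top_of_set X) (f ` {-e<..<e})" unfolding im using V(1) openin_trans by blast
  have speed: "unit_speed_at X \<tau> f t" if t: "t \<in> {-e<..<e}" for t
  proof -
    define m where "m = (if t = 0 then e else min \<bar>t\<bar> (e - \<bar>t\<bar>))"
    have m: "m > 0" "m \<le> e - \<bar>t\<bar>" "t \<noteq> 0 \<Longrightarrow> m \<le> \<bar>t\<bar>" using t e by (auto simp: m_def)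
    have sub: "{t-m<..<t+m} \<subseteq> {-e<..<e}" using m(2) by auto
    have "\<bar>\<tau> (f (t+u)) - \<tau> (f t)\<bar> = \<bar>u\<bar>" if u: "\<bar>u\<bar> < m" for u
    proof -
      have tu: "t + u \<in> {-d<..<d}" "t \<in> {-d<..<d}" using u m(2) e(2) by auto
      consider "t = 0" | "t > 0" "t + u > 0" | "t < 0" "t + u < 0" using m(3) u by linarith
      then show ?thesis
      proof cases
        case 1 then show ?thesis using tau[OF tu(1)] f0 by (simp add: T_def)
      next
        case 2
        then have "\<tau> (f (t+u)) = T + s1 * (t+u)" "\<tau> (f t) = T + s1 * t" using in1(2)[of "t+u"] in1(2)[of t] tu by auto
        then show ?thesis using s by (auto simp: algebra_simps)
      next
        case 3
        then have "\<tau> (f (t+u)) = T - s2 * (t+u)" "\<tau> (f t) = T - s2 * t" using in2(2)[of "t+u"] in2(2)[of t] tu by auto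
        then show ?thesis using s by (auto simp: algebra_simps)
      qed
    qed
    moreover have "f ` {t-m<..<t+m} \<subseteq> X" using sub im VX by blast
    moreover have "continuous_on {t-m<..<t+m} f" by (rule continuous_on_subset[OF cont]) (use sub in auto)
    moreover have "inj_on f {t-m<..<t+m}" by (rule inj_on_subset[OF injc]) (use sub in auto)
    ultimately show ?thesis unfolding unit_speed_at_def using m(1) by blast
  qed
  have "unit_chart X \<tau> e f" unfolding unit_chart_def using e(1) speed op hom by blast
  moreover have "f ` {-e<..<e} \<subseteq> V" unfolding im by blast
  moreover have "\<forall>t. 0 \<le> t \<and> t < e \<longrightarrow> \<tau> (f t) = T + s1 * t" using in1(2) e(2) by auto
  moreover have "\<forall>t. t \<le> 0 \<and> -e < t \<longrightarrow> \<tau> (f t) = T - s2 * t" using in2(2) e(2) by auto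
  ultimately show ?thesis using f0 unfolding T_def by blast
qed

text \<open>
  Both curves are differentiable at \<open>p\<close> as functions of \<open>\<tau>\<close>.
\<close>

lemma two_sided_lipschitz:
  fixes X :: "('a::real_normed_vector) set"
  assumes ts: "two_sided X \<tau> p Y1 Y2 s1 s2 d V" and ctau: "continuous_on X \<tau>"
    and D: "(Y1 has_vector_derivative D1) (at (\<tau> p))" "(Y2 has_vector_derivative D2) (at (\<tau> p))"
  shows "\<exists>C W. openin (top_of_set X) W \<and> p \<in> W \<and> (\<forall>R\<in>W. norm (R - p) \<le> C * \<bar>\<tau> R - \<tau> p\<bar>)"
proof -
  have V: "openin (top_of_set X) V" "p \<in> V" "Y1 (\<tau> p) = p" "Y2 (\<tau> p) = p"
      and VY: "\<And>R. R \<in> V \<Longrightarrow> R = Y1 (\<tau> R) \<or> R = Y2 (\<tau> R)"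
    using ts unfolding two_sided_def by blast+
  have loc: "\<exists>e>0. \<forall>t. \<bar>t - \<tau> p\<bar> < e \<longrightarrow> norm (Y t - p) \<le> (norm D + 1) * \<bar>t - \<tau> p\<bar>"
    if Y: "(Y has_vector_derivative D) (at (\<tau> p))" "Y (\<tau> p) = p" for Y D
  proof -
    have "(Y has_derivative (\<lambda>h. h *\<^sub>R D)) (at (\<tau> p))" using Y(1) unfolding has_vector_derivative_def .
    then obtain e where e: "e > 0" "\<And>t. norm (t - \<tau> p) < e \<Longrightarrow> norm (Y t - Y (\<tau> p) - (t - \<tau> p) *\<^sub>R D) \<le> 1 * norm (t - \<tau> p)"
      unfolding has_derivative_at_alt using zero_less_one by blast
    have "norm (Y t - p) \<le> (norm D + 1) * \<bar>t - \<tau> p\<bar>" if t: "\<bar>t - \<tau> p\<bar> < e" for t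
    proof -
      have "norm (Y t - p) \<le> norm (Y t - p - (t - \<tau> p) *\<^sub>R D) + norm ((t - \<tau> p) *\<^sub>R D)"
        using norm_triangle_ineq[of "Y t - p - (t - \<tau> p) *\<^sub>R D" "(t - \<tau> p) *\<^sub>R D"] by simp
      also have "\<dots> \<le> \<bar>t - \<tau> p\<bar> + \<bar>t - \<tau> p\<bar> * norm D" using e(2)[of t] t Y(2) by simp
      finally show ?thesis by (simp add: algebra_simps)
    qed
    then show ?thesis using e(1) by blast
  qed
  obtain e1 where e1: "e1 > 0" "\<And>t. \<bar>t - \<tau> p\<bar> < e1 \<Longrightarrow> norm (Y1 t - p) \<le> (norm D1 + 1) * \<bar>t - \<tau> p\<bar>" using loc[OF D(1) V(3)] by blast
  obtain e2 where e2: "e2 > 0" "\<And>t. \<bar>t - \<tau> p\<bar> < e2 \<Longrightarrow> norm (Y2 t - p) \<le> (norm D2 + 1) * \<bar>t - \<tau> p\<bar>" using loc[OF D(2) V(4)] by blast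
  define e where "e = min e1 e2"
  define C where "C = norm D1 + norm D2 + 1"
  define W where "W = V \<inter> \<tau> -` {\<tau> p - e<..<\<tau> p + e}"
  have VX: "V \<subseteq> X" using V(1) openin_imp_subset by blast
  have "openin (top_of_set V) W" unfolding W_def
    by (rule continuous_openin_preimage_gen[OF continuous_on_subset[OF ctau VX]]) simp
  then have "openin (top_of_set X) W" using V(1) openin_trans by blast
  moreover have "p \<in> W" using V(2) e1(1) e2(1) by (simp add: W_def e_def)
  moreover have "norm (R - p) \<le> C * \<bar>\<tau> R - \<tau> p\<bar>" if "R \<in> W" for R
  proof -
    have R: "R \<in> V" "\<bar>\<tau> R - \<tau> p\<bar> < e1" "\<bar>\<tau> R - \<tau> p\<bar> < e2" using that by (auto simp: W_def e_def)
    have "norm (R - p) \<le> (norm D1 + 1) * \<bar>\<tau> R - \<tau> p\<bar> \<or> norm (R - p) \<le> (norm D2 + 1) * \<bar>\<tau> R - \<tau> p\<bar>"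
      using VY[OF R(1)] e1(2)[OF R(2)] e2(2)[OF R(3)] by metis
    moreover have "(norm D1 + 1) * \<bar>\<tau> R - \<tau> p\<bar> \<le> C * \<bar>\<tau> R - \<tau> p\<bar>" "(norm D2 + 1) * \<bar>\<tau> R - \<tau> p\<bar> \<le> C * \<bar>\<tau> R - \<tau> p\<bar>"
      by (intro mult_right_mono; simp add: C_def)+
    ultimately show ?thesis by linarith
  qed
  ultimately show ?thesis by blast
qed

section \<open>The curve of rectangles on four edges\<close>

context generic_polygon begin

abbreviation "\<gamma> \<equiv> polygon_curve N v"
abbreviation "M \<equiv> inscribed_rectangles \<gamma>"

text \<open>
  In terms of the logarithm, relabeling by one step is a change of sign.
\<close>

definition lratio :: "real^2^4 \<Rightarrow> real" where "lratio R = ln (aspect_ratio R)"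

text \<open>
  The factor \<open>r\<close> accounts for the division by the aspect ratio in \<open>side\<close>.
\<close>

definition den :: "(4 \<Rightarrow> nat) \<Rightarrow> real poly" where
  "den k = [:0,1:] * [:dq0 N v (k 0) (k 1) (k 2) (k 3), dq1 N v (k 0) (k 1) (k 2) (k 3), dq2 N v (k 0) (k 1) (k 2) (k 3):]"

text \<open>
  The parameter on edge \<open>k 0\<close> at which \<open>Quad\<close> vanishes.
\<close>

definition ratio :: "(4 \<Rightarrow> nat) \<Rightarrow> real \<Rightarrow> real" where
  "ratio k r = Quad (k 1) (k 2) (k 3) (v (k 0)) r / Del (k 0) (k 1) (k 2) (k 3) r"

definition corner :: "(4 \<Rightarrow> nat) \<Rightarrow> real \<Rightarrow> real^2" where
  "corner k r = v (k 0) + ratio k r *\<^sub>R dir N v (k 0)"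

definition curve :: "(4 \<Rightarrow> nat) \<Rightarrow> real \<Rightarrow> real^2^4" where
  "curve k r = rect (corner k r) (side (k 1) (k 3) (corner k r) r) r"

lemma poly_den: "poly (den k) r = r * Del (k 0) (k 1) (k 2) (k 3) r"
  by (simp add: den_def Del_def power2_eq_square algebra_simps)

lemma rat_over_curve: "rat_curve (den k) (curve k)"
proof -
  define P where "P = den k"
  have r: "rat_over P (\<lambda>r. 1 / r)"
    using rat_inverse_factor[of P "[:0,1:]"] unfolding P_def den_def by simp
  have "rat_over P (\<lambda>r. 1 / poly [:dq0 N v (k 0) (k 1) (k 2) (k 3), dq1 N v (k 0) (k 1) (k 2) (k 3), dq2 N v (k 0) (k 1) (k 2) (k 3):] r)"
    by (rule rat_inverse_factor[of P _ "[:0,1:]"]) (simp add: P_def den_def mult.commute)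
  moreover have "poly [:dq0 N v (k 0) (k 1) (k 2) (k 3), dq1 N v (k 0) (k 1) (k 2) (k 3), dq2 N v (k 0) (k 1) (k 2) (k 3):] r = Del (k 0) (k 1) (k 2) (k 3) r" for r
    by (simp add: Del_def power2_eq_square algebra_simps)
  ultimately have D: "rat_over P (\<lambda>r. 1 / Del (k 0) (k 1) (k 2) (k 3) r)" by simp
  have "rat_over P (\<lambda>r. Quad (k 1) (k 2) (k 3) (v (k 0)) r * (1 / Del (k 0) (k 1) (k 2) (k 3) r))"
    unfolding Quad_def by (intro rat_intros D)
  then have ra: "rat_over P (ratio k)" by (simp add: ratio_def[abs_def])
  have c: "rat_over P (\<lambda>r. corner k r $ j)" for j
    unfolding corner_def vector_add_component vector_scaleR_component real_scaleR_def by (intro rat_intros ra)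
  have o: "rat_over P (\<lambda>r. off i (corner k r))" for i
    unfolding off_def cross2_def vector_minus_component by (intro rat_intros c)
  have s: "rat_over P (\<lambda>r. side (k 1) (k 3) (corner k r) r $ j)" for j
  proof -
    have "rat_over P (\<lambda>r. (1 / dotp N v (k 1) (k 3)) * (off (k 1) (corner k r) * perp (dir N v (k 3)) $ j + (off (k 3) (corner k r) * (1/r)) * dir N v (k 1) $ j))"
      by (intro rat_intros o r)
    then show ?thesis unfolding side_def vector_add_component vector_scaleR_component real_scaleR_def by simp
  qed
  have pp: "rat_over P (\<lambda>r. perp (side (k 1) (k 3) (corner k r) r) $ j)" for j
  proof -
    consider "j = 1" | "j = 2" using exhaust_2 by blast
    then show ?thesis by cases (simp_all add: s rat_uminus)
  qed
  have "\<forall>i. \<forall>j. rat_over P (\<lambda>r. curve k r $ i $ j)"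
    unfolding all_4 curve_def rect_nth vector_add_component vector_scaleR_component real_scaleR_def
    by (intro conjI allI rat_intros c s pp)
  then show ?thesis unfolding rat_curve_def P_def by blast
qed

lemma determined:
  assumes R: "ccw_rectangle R" and k: "on_lines k R" and three: "card {k 0, k 1, k 2, k 3} \<ge> 3"
  shows "poly (den k) (aspect_ratio R) \<noteq> 0" "R = curve k (aspect_ratio R)"
    "R $ 0 = v (k 0) + ratio k (aspect_ratio R) *\<^sub>R dir N v (k 0)"
proof -
  note d = rectangle_determined[OF assms]
  have r: "aspect_ratio R > 0" using ccw_rectD[OF R] by blast
  show "poly (den k) (aspect_ratio R) \<noteq> 0" using d(1) r by (simp add: poly_den)
  have c: "R $ 0 = corner k (aspect_ratio R)" using d(2) by (simp add: corner_def ratio_def)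
  show "R $ 0 = v (k 0) + ratio k (aspect_ratio R) *\<^sub>R dir N v (k 0)" using d(2) by (simp add: ratio_def)
  have "R = rect (R $ 0) (R $ 1 - R $ 0) (aspect_ratio R)" by (rule ccw_rectD(3)[OF R])
  then show "R = curve k (aspect_ratio R)" unfolding d(3) unfolding curve_def c[symmetric] .
qed

lemma sits_determined:
  assumes "ccw_rectangle R" "sits k R"
  shows "poly (den k) (aspect_ratio R) \<noteq> 0" "R = curve k (aspect_ratio R)"
    "R $ 0 = v (k 0) + ratio k (aspect_ratio R) *\<^sub>R dir N v (k 0)"
  using determined[OF assms(1) sits_on_lines[OF assms(2)] three_edges[OF assms]] by blast+

lemma curve_on_lines:
  assumes kN: "\<And>i. k i < N" and r: "poly (den k) r \<noteq> 0"
  shows "on_lines k (curve k r)"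
proof -
  have r0: "r \<noteq> 0" and D: "Del (k 0) (k 1) (k 2) (k 3) r \<noteq> 0" using r by (auto simp: poly_den)
  define z where "z = corner k r"
  define u where "u = side (k 1) (k 3) z r"
  have Q: "Quad (k 1) (k 2) (k 3) z r = 0"
    unfolding z_def corner_def Quad_add using D by (simp add: ratio_def)
  note l = side_on_lines[OF kN kN kN r0 Q, folded u_def]
  have 0: "off (k 0) z = 0" unfolding z_def corner_def off_add by (simp add: off_def cross2_def)
  have "\<forall>i. off (k i) (curve k r $ i) = 0"
    unfolding all_4 curve_def rect_nth z_def[symmetric] u_def[symmetric]
    using l 0 lines_rect_iff by blast
  then show ?thesis using kN unfolding on_lines_def by blast
qed

lemma curve_continuous: "poly (den k) r \<noteq> 0 \<Longrightarrow> isCont (curve k) r"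
  using rat_curve_deriv[OF rat_over_curve] has_vector_derivative_continuous by (metis isCont_def continuous_within)

text \<open>
  Nearby members of the curve through an inscribed rectangle stay on their edges as long as no corner is at an end of its edge.
\<close>

lemma curve_nearby:
  assumes R: "ccw_rectangle R" and k: "sits k R"
  defines "r0 \<equiv> aspect_ratio R"
  shows "\<forall>\<^sub>F r in nhds r0. poly (den k) r \<noteq> 0 \<and> r > 0 \<and> ccw_rectangle (curve k r) \<and> aspect_ratio (curve k r) = r"
    "(\<And>a. a < N \<Longrightarrow> R $ i \<noteq> v a) \<Longrightarrow> \<forall>\<^sub>F r in nhds r0. curve k r $ i \<in> edge N v (k i)"
proof -
  note d = sits_determined[OF R k, folded r0_def]
  have r0: "r0 > 0" unfolding r0_def using ccw_rectD[OF R] by blast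
  have kN: "k i < N" for i using k by (simp add: sits_def)
  have e1: "\<forall>\<^sub>F r in nhds r0. r > 0"
    using eventually_nhds_in_open[of "{0<..}" r0] r0 by simp
  have e2: "\<forall>\<^sub>F r in nhds r0. poly (den k) r \<noteq> 0"
    using eventually_nhds_in_open[OF open_nonzero_poly[of "den k"], of r0] d(1) by simp
  have cc: "isCont (curve k) r0" by (rule curve_continuous[OF d(1)])
  have cn: "isCont (\<lambda>r. curve k r $ j) r0" for j using cc by (intro continuous_intros)
  have "isCont (\<lambda>r. dist (curve k r $ 1) (curve k r $ 0)) r0" by (intro continuous_intros cn)
  moreover have "dist (curve k r0 $ 1) (curve k r0 $ 0) > 0" using ccw_rectD(1)[OF R] d(2) by simp
  ultimately have "\<forall>\<^sub>F r in at r0. dist (curve k r $ 1) (curve k r $ 0) > 0"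
    unfolding isCont_def by (rule order_tendstoD(1))
  then have e3: "\<forall>\<^sub>F r in nhds r0. dist (curve k r $ 1) (curve k r $ 0) > 0"
    using \<open>dist (curve k r0 $ 1) (curve k r0 $ 0) > 0\<close> by (simp add: eventually_nhds_conv_at)
  show "\<forall>\<^sub>F r in nhds r0. poly (den k) r \<noteq> 0 \<and> r > 0 \<and> ccw_rectangle (curve k r) \<and> aspect_ratio (curve k r) = r"
    using e1 e2 e3
  proof eventually_elim
    case (elim r)
    define u where "u = side (k 1) (k 3) (corner k r) r"
    have c: "curve k r = rect (corner k r) u r" by (simp add: curve_def u_def)
    then have "u \<noteq> 0" using elim(3) by auto
    from ccw_rect[OF this elim(1)] show ?case using elim c by simp
  qed
  show "\<forall>\<^sub>F r in nhds r0. curve k r $ i \<in> edge N v (k i)" if nv: "\<And>a. a < N \<Longrightarrow> R $ i \<noteq> v a"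
  proof -
    define dd where "dd = dir N v (k i)"
    define L where "L r = ((curve k r $ i - v (k i)) \<bullet> dd) / (dd \<bullet> dd)" for r
    have dd: "dd \<bullet> dd \<noteq> 0" using dir_nonzero[OF kN] by (simp add: dd_def)
    have cL: "isCont L r0" unfolding L_def by (intro continuous_intros cn) (use dd in auto)
    have "R $ i \<in> edge N v (k i)" using k by (simp add: sits_def)
    then obtain l where l: "l \<in> {0..1}" "R $ i = v (k i) + l *\<^sub>R dd" using edge_iff unfolding dd_def by blast
    have "L r0 = l" unfolding L_def d(2)[symmetric] l(2) using dd by simp
    moreover have "l \<noteq> 0" using nv[OF kN, of i] l(2) by auto
    moreover have "l \<noteq> 1"
    proof
      assume "l = 1" then have "R $ i = v (nxt N (k i))" using l(2) by (simp add: dd_def dir_def)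
      then show False using nv[OF nxt_less[OF kN]] by blast
    qed
    ultimately have "L r0 \<in> {0<..<1}" using l(1) by auto
    then have "\<forall>\<^sub>F r in at r0. L r \<in> {0<..<1}"
      using cL unfolding isCont_def by (intro topological_tendstoD) auto
    then have "\<forall>\<^sub>F r in nhds r0. L r \<in> {0<..<1}" using \<open>L r0 \<in> {0<..<1}\<close> by (simp add: eventually_nhds_conv_at)
    then show ?thesis using e2
    proof eventually_elim
      case (elim r)
      have "off (k i) (curve k r $ i) = 0" using curve_on_lines[OF kN elim(2)] unfolding on_lines_def by blast
      from off_line_param[OF kN this] have "curve k r $ i = v (k i) + L r *\<^sub>R dir N v (k i)" unfolding L_def dd_def .
      moreover have "L r \<in> {0..1}" using elim(1) by auto
      ultimately show ?case using edge_iff by blast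
    qed
  qed
qed

text \<open>
  An open neighborhood of \<open>R\<close> in which a corner can lie only on those edges that already contain the corresponding
  corner of \<open>R\<close>.
\<close>

definition near_edges :: "real^2^4 \<Rightarrow> (real^2^4) set" where
  "near_edges R = (\<Inter>i. \<Inter>j\<in>{j. j < N \<and> R $ i \<notin> edge N v j}. {S. S $ i \<notin> edge N v j})"

lemma near_edges: "open (near_edges R)" "R \<in> near_edges R"
  "S \<in> near_edges R \<Longrightarrow> j < N \<Longrightarrow> S $ i \<in> edge N v j \<Longrightarrow> R $ i \<in> edge N v j"
proof -
  have "open {S :: real^2^4. S $ i \<notin> edge N v j}" for i j
  proof -
    have "open ((\<lambda>S :: real^2^4. S $ i) -` (- edge N v j))"
      by (rule open_vimage) (auto intro!: continuous_intros open_Compl closed_segment)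
    then show ?thesis by (simp add: vimage_def)
  qed
  then show "open (near_edges R)" unfolding near_edges_def by (intro open_INT ballI) auto
qed (auto simp: near_edges_def)

lemma unique_edge:
  assumes "j < N" "k < N" "x \<in> edge N v j" "x \<in> edge N v k" "\<And>a. a < N \<Longrightarrow> x \<noteq> v a"
  shows "j = k"
  using edge_inter[OF assms(1,2) _ assms(3,4)] assms(5)[OF assms(1)] assms(5)[OF assms(2)] by blast

lemma edges_at_vertex:
  assumes "a < N" "j < N" "v a \<in> edge N v j" shows "j = a \<or> j = prv N a"
  using vertex_on_edge[OF assms(1,2)] assms prv_nxt by metis

definition vertex_free :: "real^2^4 \<Rightarrow> bool" where "vertex_free R \<longleftrightarrow> (\<forall>i. \<forall>a<N. R $ i \<noteq> v a)"

lemma continuous_aspect_ratio: "continuous_on M aspect_ratio"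
  unfolding aspect_ratio_def
proof (intro continuous_intros)
  show "\<forall>x\<in>M. norm (x $ 1 - x $ 0) \<noteq> 0"
    using ccw_rectD(1) unfolding inscribed_rectangles_def by fastforce
qed

lemma continuous_lratio: "continuous_on M lratio"
  unfolding lratio_def
  by (intro continuous_intros continuous_aspect_ratio) (use ccw_rectD(2) in \<open>force simp: inscribed_rectangles_def\<close>)

lemma M_iff: "R \<in> M \<longleftrightarrow> ccw_rectangle R \<and> (\<exists>k. sits k R)"
  by (rule inscribed_iff)

lemma exp_lratio: "ccw_rectangle R \<Longrightarrow> exp (lratio R) = aspect_ratio R"
  unfolding lratio_def using ccw_rectD(2) by simp

lemma openin_near:
  assumes "p \<in> M"
  shows "openin (top_of_set M) (M \<inter> near_edges p \<inter> lratio -` {lratio p - d<..<lratio p + d})"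
proof -
  have 1: "openin (top_of_set M) (M \<inter> near_edges p)" using near_edges(1) by (simp add: openin_open_Int)
  have 2: "openin (top_of_set M) (M \<inter> lratio -` {lratio p - d<..<lratio p + d})"
    by (rule continuous_openin_preimage_gen[OF continuous_lratio]) simp
  show ?thesis using openin_Int[OF 1 2] by (simp add: Int_ac)
qed

lemma eventually_exp_nhds:
  assumes "\<forall>\<^sub>F r in nhds (exp t0). P r" shows "\<exists>d>0. \<forall>t. \<bar>t - t0\<bar> < d \<longrightarrow> P (exp t :: real)"
proof -
  have "(exp \<longlongrightarrow> exp t0) (nhds t0)" using isCont_exp[of t0] by (simp add: continuous_at tendsto_nhds_iff)
  then have "\<forall>\<^sub>F t in nhds t0. P (exp t)" using assms eventually_compose_filterlim by blast
  then show ?thesis unfolding eventually_nhds_metric dist_real_def by blast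
qed

lemma log_curve:
  assumes R: "ccw_rectangle R" and k: "sits k R"
  shows "\<exists>D. ((\<lambda>t. curve k (exp t)) has_vector_derivative D) (at (lratio R))" "curve k (exp (lratio R)) = R"
proof -
  note d = sits_determined[OF R k]
  show "curve k (exp (lratio R)) = R" using d(2) exp_lratio[OF R] by simp
  obtain X' where X': "\<forall>r. poly (den k) r \<noteq> 0 \<longrightarrow> (curve k has_vector_derivative X' r) (at r)"
    using rat_curve_deriv[OF rat_over_curve] by blast
  have "poly (den k) (exp (lratio R)) \<noteq> 0" using d(1) exp_lratio[OF R] by simp
  then have "(curve k has_vector_derivative X' (exp (lratio R))) (at (exp (lratio R)))" using X' by blast
  moreover have "(exp has_vector_derivative exp (lratio R)) (at (lratio R))"
    by (metis DERIV_exp has_real_derivative_iff_has_vector_derivative)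
  ultimately show "\<exists>D. ((\<lambda>t. curve k (exp t)) has_vector_derivative D) (at (lratio R))"
    using vector_diff_chain_at[of exp "exp (lratio R)" "lratio R" "curve k"] by (auto simp: o_def)
qed

lemma log_curve_cont: "poly (den k) (exp t) \<noteq> 0 \<Longrightarrow> isCont (\<lambda>t. curve k (exp t)) t"
  using isCont_o2[OF isCont_exp curve_continuous] by blast

text \<open>
  The inscribed rectangles near \<open>p\<close> lie on the same edges as \<open>p\<close>, hence on the curve of these edges.
\<close>

lemma two_sided_vertex_free:
  assumes p: "p \<in> M" and vf: "vertex_free p" and k: "sits k p"
  shows "\<exists>d V. two_sided M lratio p (\<lambda>t. curve k (exp t)) (\<lambda>t. curve k (exp t)) 1 (-1) d V \<and> V \<subseteq> near_edges p"
proof -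
  have pc: "ccw_rectangle p" using p M_iff by blast
  have kN: "k i < N" for i using k by (simp add: sits_def)
  have ne: "p $ i \<noteq> v a" if "a < N" for i a using vf that by (simp add: vertex_free_def)
  define Y where "Y t = curve k (exp t)" for t
  have Yp: "Y (lratio p) = p" using log_curve(2)[OF pc k] by (simp add: Y_def)
  have pd: "poly (den k) (exp (lratio p)) \<noteq> 0" using sits_determined(1)[OF pc k] exp_lratio[OF pc] by simp
  have "\<forall>\<^sub>F r in nhds (aspect_ratio p). \<forall>i\<in>UNIV. curve k r $ i \<in> edge N v (k i)"
    by (rule eventually_ball_finite) (use curve_nearby(2)[OF pc k ne] in auto)
  with curve_nearby(1)[OF pc k]
  have "\<forall>\<^sub>F r in nhds (exp (lratio p)). (poly (den k) r \<noteq> 0 \<and> r > 0 \<and> ccw_rectangle (curve k r) \<and> aspect_ratio (curve k r) = r) \<and> (\<forall>i. curve k r $ i \<in> edge N v (k i))"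
    unfolding exp_lratio[OF pc] by eventually_elim auto
  from eventually_exp_nhds[OF this] obtain d1 where d1: "d1 > 0"
    "\<And>t. \<bar>t - lratio p\<bar> < d1 \<Longrightarrow> (poly (den k) (exp t) \<noteq> 0 \<and> ccw_rectangle (Y t) \<and> aspect_ratio (Y t) = exp t) \<and> (\<forall>i. Y t $ i \<in> edge N v (k i))"
    unfolding Y_def by blast
  have "isCont Y (lratio p)" unfolding Y_def by (rule log_curve_cont[OF pd])
  then have "\<forall>\<^sub>F t in at (lratio p). Y t \<in> near_edges p"
    unfolding isCont_def Yp by (rule topological_tendstoD[OF _ near_edges(1,2)])
  then have "\<forall>\<^sub>F t in nhds (lratio p). Y t \<in> near_edges p" using Yp near_edges(2) by (simp add: eventually_nhds_conv_at)
  then obtain d2 where d2: "d2 > 0" "\<And>t. \<bar>t - lratio p\<bar> < d2 \<Longrightarrow> Y t \<in> near_edges p"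
    unfolding eventually_nhds_metric dist_real_def by blast
  define d where "d = min d1 d2"
  have d: "d > 0" "d \<le> d1" "d \<le> d2" using d1 d2 by (auto simp: d_def)
  define V where "V = M \<inter> near_edges p \<inter> lratio -` {lratio p - d<..<lratio p + d}"
  have YV: "Y t \<in> V \<and> lratio (Y t) = t" if "\<bar>t - lratio p\<bar> < d" for t
  proof -
    have h: "ccw_rectangle (Y t)" "aspect_ratio (Y t) = exp t" "\<forall>i. Y t $ i \<in> edge N v (k i)" using d1(2)[of t] that d by auto
    then have "sits k (Y t)" using kN by (simp add: sits_def)
    then have "Y t \<in> M" using h(1) M_iff by blast
    moreover have "lratio (Y t) = t" using h(2) by (simp add: lratio_def)
    ultimately show ?thesis using d2(2)[of t] that d unfolding V_def by auto
  qed
  have VY: "\<bar>lratio R - lratio p\<bar> < d \<and> R = Y (lratio R)" if R: "R \<in> V" for R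
  proof -
    have RM: "R \<in> M" "R \<in> near_edges p" "\<bar>lratio R - lratio p\<bar> < d" using R by (auto simp: V_def)
    then obtain k' where k': "ccw_rectangle R" "sits k' R" using M_iff by blast
    have "k' = k"
    proof
      fix i
      have "p $ i \<in> edge N v (k' i)" using near_edges(3)[OF RM(2)] k'(2) by (simp add: sits_def)
      moreover have "p $ i \<in> edge N v (k i)" using k by (simp add: sits_def)
      ultimately show "k' i = k i" using unique_edge[of "k' i" "k i" "p $ i"] k'(2) kN ne by (auto simp: sits_def)
    qed
    then have "R = curve k (aspect_ratio R)" using sits_determined(2)[OF k'] by simp
    then show ?thesis using RM(3) exp_lratio[OF k'(1)] by (simp add: Y_def)
  qed
  have cY: "continuous_on {lratio p - d<..<lratio p + d} Y"
    unfolding Y_def by (intro continuous_at_imp_continuous_on ballI log_curve_cont) (use d1(2) d in auto)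
  have "two_sided M lratio p Y Y 1 (-1) d V"
    unfolding two_sided_def
  proof (intro conjI ballI allI impI)
    show "openin (top_of_set M) V" unfolding V_def by (rule openin_near[OF p])
    show "p \<in> V" using p near_edges(2) d(1) by (simp add: V_def)
    fix t u assume tu: "\<bar>t - lratio p\<bar> < d \<and> 0 < 1 * (t - lratio p) \<and> \<bar>u - lratio p\<bar> < d \<and> 0 < - 1 * (u - lratio p)"
    then have "lratio (Y t) = t" "lratio (Y u) = u" using YV by blast+
    then show "Y t \<noteq> Y u" using tu by auto
  next
    fix R assume "R \<in> V"
    then have "R = Y (lratio R)" "\<bar>lratio R - lratio p\<bar> < d" using VY by blast+
    then show "\<bar>lratio R - lratio p\<bar> < d" "R = Y (lratio R) \<and> 0 \<le> 1 * (lratio R - lratio p) \<or> R = Y (lratio R) \<and> 0 \<le> - 1 * (lratio R - lratio p)"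
      by (simp_all add: linear)
  next
    fix t assume "\<bar>t - lratio p\<bar> < d \<and> 0 \<le> 1 * (t - lratio p)"
    then show "Y t \<in> V" "lratio (Y t) = t" using YV by blast+
  next
    fix t assume "\<bar>t - lratio p\<bar> < d \<and> 0 \<le> - 1 * (t - lratio p)"
    then show "Y t \<in> V" "lratio (Y t) = t" using YV by blast+
  qed (use d(1) Yp cY in auto)
  then show ?thesis unfolding Y_def V_def by blast
qed

end

section \<open>Rectangles with a corner at a vertex\<close>

text \<open>
  Turns a sign condition on the logarithm of the aspect ratio into one on the position of a corner on its edge.
\<close>

lemma sign_transfer:
  assumes "H * H0 > (0::real)"
  shows "0 \<le> sgn H0 * (t - t0) \<longleftrightarrow> 0 \<le> (exp t - exp t0) * H"
    "0 < sgn H0 * (t - t0) \<longleftrightarrow> 0 < (exp t - exp t0) * H"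
proof -
  have "(H > 0 \<and> H0 > 0) \<or> (H < 0 \<and> H0 < 0)" using assms by (auto simp: zero_less_mult_iff)
  then show "0 \<le> sgn H0 * (t - t0) \<longleftrightarrow> 0 \<le> (exp t - exp t0) * H"
    "0 < sgn H0 * (t - t0) \<longleftrightarrow> 0 < (exp t - exp t0) * H"
    by (auto simp: zero_le_mult_iff zero_less_mult_iff)
qed

lemma unit_chart_transport:
  assumes h: "homeomorphism X X \<phi> \<psi>" and iso: "\<And>x y. x \<in> X \<Longrightarrow> y \<in> X \<Longrightarrow> \<bar>\<tau> (\<phi> x) - \<tau> (\<phi> y)\<bar> = \<bar>\<tau> x - \<tau> y\<bar>"
    and f: "unit_chart X \<tau> e f"
  shows "unit_chart X \<tau> e (\<lambda>t. \<phi> (f t))"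
proof -
  let ?I = "{-e<..<e}"
  have inX: "f t \<in> X" if "t \<in> ?I" for t using f that unit_speed_at_isCont(2) unfolding unit_chart_def by blast
  have phi: "\<phi> ` X = X" "continuous_on X \<phi>" "\<And>x. x \<in> X \<Longrightarrow> \<psi> (\<phi> x) = x" using h unfolding homeomorphism_def by auto
  have op: "openin (top_of_set X) (f ` ?I)" using f unfolding unit_chart_def by blast
  obtain g where g: "homeomorphism ?I (f ` ?I) f g" using f unfolding unit_chart_def by blast
  have im: "(\<lambda>t. \<phi> (f t)) ` ?I = \<phi> ` (f ` ?I)" by (simp add: image_image)
  have o: "openin (top_of_set X) (\<phi> ` (f ` ?I))" using homeomorphism_imp_open_map[OF h op] .
  have h': "homeomorphism (f ` ?I) (\<phi> ` (f ` ?I)) \<phi> \<psi>"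
    by (rule homeomorphism_of_subsets[OF h]) (use inX phi(1) in auto)
  have hom: "\<exists>g'. homeomorphism ?I (\<phi> ` (f ` ?I)) (\<lambda>t. \<phi> (f t)) g'"
    using homeomorphism_compose[OF g h'] unfolding o_def by blast
  have "unit_speed_at X \<tau> (\<lambda>t. \<phi> (f t)) t" if t: "t \<in> ?I" for t
  proof -
    have "unit_speed_at X \<tau> f t" using f t unfolding unit_chart_def by blast
    then obtain d where d: "d > 0" "f ` {t-d<..<t+d} \<subseteq> X" "continuous_on {t-d<..<t+d} f"
      "inj_on f {t-d<..<t+d}" "\<And>u. \<bar>u\<bar> < d \<Longrightarrow> \<bar>\<tau> (f (t+u)) - \<tau> (f t)\<bar> = \<bar>u\<bar>"
      unfolding unit_speed_at_def by blast
    have dX: "f x \<in> X" if "x \<in> {t-d<..<t+d}" for x using d(2) that by blast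
    have "(\<lambda>t. \<phi> (f t)) ` {t-d<..<t+d} \<subseteq> X" using dX phi(1) by blast
    moreover have "continuous_on {t-d<..<t+d} (\<lambda>t. \<phi> (f t))" by (rule continuous_on_compose2[OF phi(2) d(3,2)])
    moreover have "inj_on (\<lambda>t. \<phi> (f t)) {t-d<..<t+d}"
    proof (rule inj_onI)
      fix x y assume xy: "x \<in> {t-d<..<t+d}" "y \<in> {t-d<..<t+d}" "\<phi> (f x) = \<phi> (f y)"
      have "f x = \<psi> (\<phi> (f x))" using phi(3)[OF dX[OF xy(1)]] by simp
      also have "\<dots> = f y" unfolding xy(3) by (rule phi(3)[OF dX[OF xy(2)]])
      finally show "x = y" using inj_onD[OF d(4)] xy by blast
    qed
    moreover have "\<bar>\<tau> (\<phi> (f (t+u))) - \<tau> (\<phi> (f t))\<bar> = \<bar>u\<bar>" if u: "\<bar>u\<bar> < d" for u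
    proof -
      have "f (t+u) \<in> X" "f t \<in> X" by (rule dX; use u d(1) in auto)+
      then show ?thesis using iso d(5)[OF u] by simp
    qed
    ultimately show ?thesis unfolding unit_speed_at_def using d(1) by blast
  qed
  then show ?thesis unfolding unit_chart_def im using o hom f unfolding unit_chart_def by blast
qed

context generic_polygon begin

lemma near_vertex:
  assumes S: "S \<in> near_edges p" and b: "b < N" "S $ i = v b"
  shows "p $ i = v b"
proof -
  have pb: "prv N b < N" using prv_less b by blast
  have e1: "S $ i \<in> edge N v b" unfolding b(2) by simp
  have e2: "S $ i \<in> edge N v (prv N b)" unfolding b(2) using vertex_on_edge[OF b(1) pb] nxt_prv[OF b(1)] by simp
  have "p $ i \<in> edge N v b" "p $ i \<in> edge N v (prv N b)" using near_edges(3)[OF S] e1 e2 b pb by blast+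
  from edge_inter[OF b(1) pb prv_neq[OF N_ge b(1), symmetric] this]
  show ?thesis using nxt_nxt_neq[OF b(1)] nxt_prv[OF b(1)] by metis
qed

text \<open>
  The first corner of \<open>p\<close> is at the vertex between the edges \<open>prv N a\<close> and \<open>a\<close>. Nearby inscribed rectangles have it on one of
  the two, and are on the curve of the respective edges. The position of the first corner on its edge is
  \<open>(r - r0) * H1 r\<close> on edge \<open>a\<close>, and \<open>1 + (r - r0) * H2 r\<close> on edge \<open>prv N a\<close>, with \<open>H1\<close> and \<open>H2\<close> nonzero at \<open>r0\<close>. So each of the
  two curves is inscribed exactly on one side of \<open>r0\<close>.
\<close>

lemma two_sided_vertex:
  assumes p: "p \<in> M" and a: "a < N" "p $ 0 = v a"
  shows "\<exists>k k' s1 s2 d V. two_sided M lratio p (\<lambda>t. curve k (exp t)) (\<lambda>t. curve k' (exp t)) s1 s2 d V \<and>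
    sits k p \<and> sits k' p \<and> (\<forall>R\<in>V. R \<noteq> p \<longrightarrow> vertex_free R)"
proof -
  obtain k where pc: "ccw_rectangle p" and k: "sits k p" using p M_iff by blast
  have kN: "k i < N" for i using k by (simp add: sits_def)
  have pa: "prv N a < N" using prv_less a by blast
  have ne: "p $ i \<noteq> v b" if "b < N" "i \<noteq> 0" for i b
    using no_two_vertices[OF pc k a _ that(1), of i] that(2) by blast
  \<comment> \<open>The edges on the two sides of the vertex.\<close>
  define T where "T = k(0 := a)"
  define T' where "T' = k(0 := prv N a)"
  have Ti: "T i = k i" "T' i = k i" if "i \<noteq> 0" for i using that by (simp_all add: T_def T'_def)
  have T0: "T 0 = a" "T' 0 = prv N a" by (simp_all add: T_def T'_def)
  have T123: "T 1 = k 1" "T 2 = k 2" "T 3 = k 3" "T' 1 = k 1" "T' 2 = k 2" "T' 3 = k 3"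
    by (rule Ti, simp)+
  have va: "v a = v (prv N a) + 1 *\<^sub>R dir N v (prv N a)" by (simp add: dir_def nxt_prv[OF a(1)])
  have sT: "sits T p" unfolding sits_def
  proof
    fix i show "T i < N \<and> p $ i \<in> edge N v (T i)"
      using k a by (cases "i = 0") (auto simp: T0 Ti sits_def)
  qed
  have sT': "sits T' p" unfolding sits_def
  proof
    fix i
    have "v a \<in> edge N v (prv N a)" unfolding edge_iff using va by (metis atLeastAtMost_iff order_refl zero_le_one)
    then show "T' i < N \<and> p $ i \<in> edge N v (T' i)"
      using k a pa by (cases "i = 0") (auto simp: T0 Ti sits_def)
  qed
  have TN: "T i < N" "T' i < N" for i using sT sT' by (auto simp: sits_def)
  define r0 where "r0 = aspect_ratio p"
  define t0 where "t0 = lratio p"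
  have r0: "r0 > 0" "exp t0 = r0" using ccw_rectD(2)[OF pc] exp_lratio[OF pc] by (auto simp: r0_def t0_def)
  define F where "F r = Quad (k 1) (k 2) (k 3) (v a) r" for r
  define D1 where "D1 r = Del a (k 1) (k 2) (k 3) r" for r
  define D2 where "D2 r = Del (prv N a) (k 1) (k 2) (k 3) r" for r
  have dn: "poly (den T) r0 \<noteq> 0" "poly (den T') r0 \<noteq> 0"
    using sits_determined(1)[OF pc sT] sits_determined(1)[OF pc sT'] by (simp_all add: r0_def)
  have den_iff: "poly (den T) r = r * D1 r" "poly (den T') r = r * D2 r" for r
    unfolding poly_den T0 T123 D1_def D2_def by simp_all
  have D0: "D1 r0 \<noteq> 0" "D2 r0 \<noteq> 0" using dn unfolding den_iff by auto
  have F0: "F r0 = 0"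
    using rectangle_determined(4)[OF pc sits_on_lines[OF sT] three_edges[OF pc sT]] unfolding T123 a(2) F_def r0_def .
  define c2 where "c2 = vq2 N v a (k 1) (k 2) (k 3)"
  define c1 where "c1 = vq1 N v a (k 1) (k 2) (k 3)"
  define c0 where "c0 = vq0 N v a (k 1) (k 2) (k 3)"
  have Fq: "F r = c2 * r\<^sup>2 + c1 * r + c0" for r unfolding F_def Quad_vertex c2_def c1_def c0_def ..
  \<comment> \<open>The quotient of the quadratic \<open>F\<close> by its root; its value at \<open>r0\<close> is the derivative of \<open>F\<close>.\<close>
  define G where "G r = c2 * (r + r0) + c1" for r
  have FG: "F r = (r - r0) * G r" for r
  proof -
    have "F r = F r - F r0" using F0 by simp
    also have "\<dots> = (r - r0) * G r" unfolding Fq G_def by (simp add: power2_eq_square algebra_simps)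
    finally show ?thesis .
  qed
  have out: "\<not> (k 1 \<in> {a, prv N a} \<and> k 2 \<in> {a, prv N a} \<and> k 3 \<in> {a, prv N a})"
  proof
    assume "k 1 \<in> {a, prv N a} \<and> k 2 \<in> {a, prv N a} \<and> k 3 \<in> {a, prv N a}"
    then have "{T 0, T 1, T 2, T 3} \<subseteq> {a, prv N a}" unfolding T0 T123 by auto
    then have "card {T 0, T 1, T 2, T 3} \<le> card {a, prv N a}" by (intro card_mono) auto
    also have "\<dots> \<le> 2" by (simp add: card_insert_if)
    finally show False using three_edges[OF pc sT] by simp
  qed
  have "2 * c2 * r0 + c1 \<noteq> 0"
    unfolding c2_def c1_def by (rule simple_root[OF a(1) kN kN kN r0(1) out]) (use F0 Fq in \<open>simp add: c2_def c1_def c0_def\<close>)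
  then have G0: "G r0 \<noteq> 0" by (simp add: G_def algebra_simps)
  define H1 where "H1 r = G r / D1 r" for r
  define H2 where "H2 r = G r / D2 r" for r
  have H0: "H1 r0 \<noteq> 0" "H2 r0 \<noteq> 0" using G0 D0 by (simp_all add: H1_def H2_def)
  have rat1: "ratio T r = (r - r0) * H1 r" for r
    unfolding ratio_def T0 T123 F_def[symmetric] D1_def[symmetric] FG H1_def by simp
  have rat2: "ratio T' r = 1 + (r - r0) * H2 r" if "D2 r \<noteq> 0" for r
  proof -
    have "F r = Quad (k 1) (k 2) (k 3) (v (prv N a)) r - 1 * D2 r"
      unfolding F_def D2_def by (subst va) (rule Quad_add)
    then have "Quad (k 1) (k 2) (k 3) (v (prv N a)) r = F r + D2 r" by simp
    then show ?thesis unfolding ratio_def T0 T123 D2_def[symmetric] using that by (simp add: FG H2_def field_simps)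
  qed
  have cG: "isCont G r0" unfolding G_def by (intro continuous_intros)
  have cH: "isCont H1 r0" "isCont H2 r0"
    unfolding H1_def H2_def D1_def D2_def Del_def
    by (intro continuous_intros cG; use D0 in \<open>simp add: D1_def D2_def Del_def\<close>)+
  have ev_nhds: "\<forall>\<^sub>F r in nhds r0. P (f r)" if "isCont f r0" "open {x. P x}" "P (f r0)" for f :: "real \<Rightarrow> real" and P
  proof -
    have "\<forall>\<^sub>F r in at r0. f r \<in> {x. P x}" using that unfolding isCont_def by (intro topological_tendstoD) auto
    then show ?thesis using that(3) by (simp add: eventually_nhds_conv_at)
  qed
  have eH1: "\<forall>\<^sub>F r in nhds r0. H1 r * H1 r0 > 0"
  proof (rule ev_nhds[OF cH(1), of "\<lambda>x. x * H1 r0 > 0"])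
    show "open {x. x * H1 r0 > 0}" by (rule open_Collect_less) (auto intro!: continuous_intros)
    show "H1 r0 * H1 r0 > 0" using H0 by (metis not_real_square_gt_zero)
  qed
  have eH2: "\<forall>\<^sub>F r in nhds r0. H2 r * H2 r0 > 0"
  proof (rule ev_nhds[OF cH(2), of "\<lambda>x. x * H2 r0 > 0"])
    show "open {x. x * H2 r0 > 0}" by (rule open_Collect_less) (auto intro!: continuous_intros)
    show "H2 r0 * H2 r0 > 0" using H0 by (metis not_real_square_gt_zero)
  qed
  have eb1: "\<forall>\<^sub>F r in nhds r0. \<bar>(r - r0) * H1 r\<bar> < 1"
  proof (rule ev_nhds[of "\<lambda>r. (r - r0) * H1 r" "\<lambda>x. \<bar>x\<bar> < 1"])
    show "isCont (\<lambda>r. (r - r0) * H1 r) r0" by (intro continuous_intros cH)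
    show "open {x::real. \<bar>x\<bar> < 1}" by (intro open_Collect_less continuous_intros)
  qed simp
  have eb2: "\<forall>\<^sub>F r in nhds r0. \<bar>(r - r0) * H2 r\<bar> < 1"
  proof (rule ev_nhds[of "\<lambda>r. (r - r0) * H2 r" "\<lambda>x. \<bar>x\<bar> < 1"])
    show "isCont (\<lambda>r. (r - r0) * H2 r) r0" by (intro continuous_intros cH)
    show "open {x::real. \<bar>x\<bar> < 1}" by (intro open_Collect_less continuous_intros)
  qed simp
  have ee: "\<forall>\<^sub>F r in nhds r0. \<forall>i\<in>UNIV - {0}. curve T r $ i \<in> edge N v (k i) \<and> curve T' r $ i \<in> edge N v (k i)"
  proof (rule eventually_ball_finite, simp, rule ballI)
    fix i :: 4 assume "i \<in> UNIV - {0}"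
    then have i: "i \<noteq> 0" by simp
    have nv: "p $ i \<noteq> v b" if "b < N" for b using ne[OF that i] .
    show "\<forall>\<^sub>F r in nhds r0. curve T r $ i \<in> edge N v (k i) \<and> curve T' r $ i \<in> edge N v (k i)"
      using curve_nearby(2)[OF pc sT nv] curve_nearby(2)[OF pc sT' nv] unfolding r0_def Ti[OF i] by (rule eventually_conj)
  qed
  have "\<forall>\<^sub>F r in nhds (exp t0).
     (poly (den T) r \<noteq> 0 \<and> r > 0 \<and> ccw_rectangle (curve T r) \<and> aspect_ratio (curve T r) = r)
     \<and> (poly (den T') r \<noteq> 0 \<and> r > 0 \<and> ccw_rectangle (curve T' r) \<and> aspect_ratio (curve T' r) = r)
     \<and> (\<forall>i\<in>UNIV - {0}. curve T r $ i \<in> edge N v (k i) \<and> curve T' r $ i \<in> edge N v (k i))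
     \<and> H1 r * H1 r0 > 0 \<and> H2 r * H2 r0 > 0 \<and> \<bar>(r - r0) * H1 r\<bar> < 1 \<and> \<bar>(r - r0) * H2 r\<bar> < 1"
    unfolding r0(2)
    using curve_nearby(1)[OF pc sT, folded r0_def] curve_nearby(1)[OF pc sT', folded r0_def] ee eH1 eH2 eb1 eb2
    by eventually_elim blast
  from eventually_exp_nhds[OF this] obtain d1 where d1: "d1 > 0" "\<And>t. \<bar>t - t0\<bar> < d1 \<Longrightarrow>
     (poly (den T) (exp t) \<noteq> 0 \<and> exp t > 0 \<and> ccw_rectangle (curve T (exp t)) \<and> aspect_ratio (curve T (exp t)) = exp t)
     \<and> (poly (den T') (exp t) \<noteq> 0 \<and> exp t > 0 \<and> ccw_rectangle (curve T' (exp t)) \<and> aspect_ratio (curve T' (exp t)) = exp t)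
     \<and> (\<forall>i\<in>UNIV - {0}. curve T (exp t) $ i \<in> edge N v (k i) \<and> curve T' (exp t) $ i \<in> edge N v (k i))
     \<and> H1 (exp t) * H1 r0 > 0 \<and> H2 (exp t) * H2 r0 > 0 \<and> \<bar>(exp t - r0) * H1 (exp t)\<bar> < 1 \<and> \<bar>(exp t - r0) * H2 (exp t)\<bar> < 1"
    by blast
  define Y where "Y t = curve T (exp t)" for t
  define Y' where "Y' t = curve T' (exp t)" for t
  have Yp: "Y t0 = p" "Y' t0 = p" unfolding Y_def Y'_def t0_def using log_curve(2)[OF pc sT] log_curve(2)[OF pc sT'] by auto
  have cY0: "isCont Y t0" "isCont Y' t0" unfolding Y_def Y'_def by (rule log_curve_cont; use dn r0 in simp)+
  have evY: "\<forall>\<^sub>F t in nhds t0. Z t \<in> near_edges p" if "isCont Z t0" "Z t0 = p" for Z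
  proof -
    have "\<forall>\<^sub>F t in at t0. Z t \<in> near_edges p"
      using that(1) unfolding isCont_def that(2) by (rule topological_tendstoD[OF _ near_edges(1,2)])
    then show ?thesis using that(2) near_edges(2) by (simp add: eventually_nhds_conv_at)
  qed
  have "\<forall>\<^sub>F t in nhds t0. Y t \<in> near_edges p \<and> Y' t \<in> near_edges p"
    by (intro eventually_conj evY cY0 Yp)
  then obtain d2 where d2: "d2 > 0" "\<And>t. \<bar>t - t0\<bar> < d2 \<Longrightarrow> Y t \<in> near_edges p \<and> Y' t \<in> near_edges p"
    unfolding eventually_nhds_metric dist_real_def by blast
  define d where "d = min d1 d2"
  have d: "d > 0" "d \<le> d1" "d \<le> d2" using d1(1) d2(1) by (auto simp: d_def)
  define V where "V = M \<inter> near_edges p \<inter> lratio -` {lratio p - d<..<lratio p + d}"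
  define s1 where "s1 = sgn (H1 r0)"
  \<comment> \<open>On edge \<open>prv N a\<close> the position has to be at most \<open>1\<close>, hence the sign.\<close>
  define s2 where "s2 = - sgn (H2 r0)"
  have s12: "s1 \<in> {1,-1}" "s2 \<in> {1,-1}" using H0 by (auto simp: s1_def s2_def sgn_real_def)
  have near: "poly (den T) (exp t) \<noteq> 0" "poly (den T') (exp t) \<noteq> 0" "ccw_rectangle (Y t)" "ccw_rectangle (Y' t)"
     "lratio (Y t) = t" "lratio (Y' t) = t" "\<And>i. i \<noteq> 0 \<Longrightarrow> Y t $ i \<in> edge N v (k i)" "\<And>i. i \<noteq> 0 \<Longrightarrow> Y' t $ i \<in> edge N v (k i)"
     "0 \<le> s1 * (t - t0) \<longleftrightarrow> 0 \<le> ratio T (exp t)" "0 < s1 * (t - t0) \<longleftrightarrow> 0 < ratio T (exp t)"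
     "0 \<le> s2 * (t - t0) \<longleftrightarrow> ratio T' (exp t) \<le> 1" "\<bar>ratio T (exp t)\<bar> < 1" "\<bar>ratio T' (exp t) - 1\<bar> < 1"
     "Y t $ 0 = v a + ratio T (exp t) *\<^sub>R dir N v a" "Y' t $ 0 = v (prv N a) + ratio T' (exp t) *\<^sub>R dir N v (prv N a)"
     "Y t \<in> near_edges p" "Y' t \<in> near_edges p"
    if t: "\<bar>t - t0\<bar> < d" for t
  proof -
    have h: "\<bar>t - t0\<bar> < d1" "\<bar>t - t0\<bar> < d2" using t d by auto
    note n = d1(2)[OF h(1)]
    show "poly (den T) (exp t) \<noteq> 0" "poly (den T') (exp t) \<noteq> 0" "ccw_rectangle (Y t)" "ccw_rectangle (Y' t)"
      "lratio (Y t) = t" "lratio (Y' t) = t" using n by (auto simp: Y_def Y'_def lratio_def)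
    show "Y t $ i \<in> edge N v (k i)" "Y' t $ i \<in> edge N v (k i)" if "i \<noteq> 0" for i using n that by (auto simp: Y_def Y'_def)
    have D2e: "D2 (exp t) \<noteq> 0" using n unfolding den_iff by auto
    have H: "H1 (exp t) * H1 r0 > 0" "H2 (exp t) * H2 r0 > 0" using n by auto
    show "0 \<le> s1 * (t - t0) \<longleftrightarrow> 0 \<le> ratio T (exp t)" "0 < s1 * (t - t0) \<longleftrightarrow> 0 < ratio T (exp t)"
      unfolding rat1 s1_def using sign_transfer[OF H(1), of t t0] r0(2) by simp_all
    have H': "(- H2 (exp t)) * (- H2 r0) > 0" using H(2) by simp
    have "s2 = sgn (- H2 r0)" by (simp add: s2_def sgn_minus)
    then show "0 \<le> s2 * (t - t0) \<longleftrightarrow> ratio T' (exp t) \<le> 1"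
      unfolding rat2[OF D2e] using sign_transfer(1)[OF H', of t t0] r0(2) by simp
    show "\<bar>ratio T (exp t)\<bar> < 1" "\<bar>ratio T' (exp t) - 1\<bar> < 1" unfolding rat1 rat2[OF D2e] using n by auto
    show "Y t $ 0 = v a + ratio T (exp t) *\<^sub>R dir N v a" "Y' t $ 0 = v (prv N a) + ratio T' (exp t) *\<^sub>R dir N v (prv N a)"
      unfolding Y_def Y'_def curve_def corner_def T0 by simp_all
    show "Y t \<in> near_edges p" "Y' t \<in> near_edges p" using d2(2)[OF h(2)] by auto
  qed
  have YV: "Y t \<in> V \<and> lratio (Y t) = t" if "\<bar>t - t0\<bar> < d" "0 \<le> s1 * (t - t0)" for t
  proof -
    note n = near[OF that(1)]
    have r01: "ratio T (exp t) \<in> {0..1}" using n(9,12) that(2) by auto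
    have "Y t $ 0 \<in> edge N v a" unfolding n(14) using r01 edge_iff by blast
    then have "sits T (Y t)" unfolding sits_def using TN n(7) T0 Ti by metis
    then have "Y t \<in> M" using n(3) M_iff by blast
    then show ?thesis unfolding V_def using n(5,16) that(1) by (auto simp: t0_def)
  qed
  have YV': "Y' t \<in> V \<and> lratio (Y' t) = t" if "\<bar>t - t0\<bar> < d" "0 \<le> s2 * (t - t0)" for t
  proof -
    note n = near[OF that(1)]
    have r01: "ratio T' (exp t) \<in> {0..1}" using n(11,13) that(2) by auto
    have "Y' t $ 0 \<in> edge N v (prv N a)" unfolding n(15) using r01 edge_iff by blast
    then have "sits T' (Y' t)" unfolding sits_def using TN n(8) T0 Ti by metis
    then have "Y' t \<in> M" using n(4) M_iff by blast
    then show ?thesis unfolding V_def using n(6,17) that(1) by (auto simp: t0_def)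
  qed
  have param: "l \<in> {0..1}" if "v b + l *\<^sub>R dir N v b \<in> edge N v b" "b < N" for b l
  proof -
    obtain m where m: "m \<in> {0..1}" "v b + l *\<^sub>R dir N v b = v b + m *\<^sub>R dir N v b" using edge_iff \<open>v b + l *\<^sub>R dir N v b \<in> edge N v b\<close> by blast
    then have "(l - m) *\<^sub>R dir N v b = 0" by (simp add: algebra_simps)
    then show ?thesis using dir_nonzero[OF \<open>b < N\<close>] m(1) by simp
  qed
  have VY: "\<bar>lratio R - t0\<bar> < d \<and> ((R = Y (lratio R) \<and> 0 \<le> s1 * (lratio R - t0)) \<or> (R = Y' (lratio R) \<and> 0 \<le> s2 * (lratio R - t0)))"
    if R: "R \<in> V" for R
  proof -
    have RM: "R \<in> M" "R \<in> near_edges p" and Rd: "\<bar>lratio R - t0\<bar> < d" using R by (auto simp: V_def t0_def)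
    obtain k' where k': "ccw_rectangle R" "sits k' R" using RM M_iff by blast
    note n = near[OF Rd]
    have k'N: "k' i < N" for i using k'(2) by (simp add: sits_def)
    have pk': "p $ i \<in> edge N v (k' i)" for i using near_edges(3)[OF RM(2)] k'(2) by (simp add: sits_def)
    have k'i: "k' i = k i" if "i \<noteq> 0" for i
      using unique_edge[OF k'N kN pk' _ ne[OF _ that]] k by (simp add: sits_def)
    have "k' 0 = a \<or> k' 0 = prv N a" using edges_at_vertex[OF a(1) k'N] pk'[of 0] a(2) by simp
    then have "k' = T \<or> k' = T'" using k'i unfolding T_def T'_def by (auto simp: fun_eq_iff)
    then show ?thesis
    proof
      assume kT: "k' = T"
      have RY: "R = Y (lratio R)" unfolding Y_def exp_lratio[OF k'(1)] using sits_determined(2)[OF k'] kT by simp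
      have "R $ 0 \<in> edge N v a" using k'(2) T0 unfolding kT sits_def by metis
      then have "v a + ratio T (exp (lratio R)) *\<^sub>R dir N v a \<in> edge N v a" using n(14) RY by simp
      then have "0 \<le> ratio T (exp (lratio R))" using param[OF _ a(1)] by auto
      then show ?thesis using RY Rd n(9) by blast
    next
      assume kT: "k' = T'"
      have RY: "R = Y' (lratio R)" unfolding Y'_def exp_lratio[OF k'(1)] using sits_determined(2)[OF k'] kT by simp
      have "R $ 0 \<in> edge N v (prv N a)" using k'(2) T0 unfolding kT sits_def by metis
      then have "v (prv N a) + ratio T' (exp (lratio R)) *\<^sub>R dir N v (prv N a) \<in> edge N v (prv N a)" using n(15) RY by simp
      then have "ratio T' (exp (lratio R)) \<le> 1" using param[OF _ pa] by auto
      then show ?thesis using RY Rd n(11) by blast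
    qed
  qed
  have Yne: "Y t \<noteq> Y' u" if "\<bar>t - t0\<bar> < d" "0 < s1 * (t - t0)" "\<bar>u - t0\<bar> < d" for t u
  proof
    assume eq: "Y t = Y' u"
    note n = near[OF that(1)] and m = near[OF that(3)]
    have "v a + ratio T (exp t) *\<^sub>R dir N v a = v (prv N a) + ratio T' (exp u) *\<^sub>R dir N v (prv N a)"
      using n(14) m(15) eq by metis
    then have "ratio T (exp t) *\<^sub>R dir N v a = (ratio T' (exp u) - 1) *\<^sub>R dir N v (prv N a)"
      using va by (simp add: algebra_simps)
    then have "cross2 (dir N v (prv N a)) (ratio T (exp t) *\<^sub>R dir N v a) = cross2 (dir N v (prv N a)) ((ratio T' (exp u) - 1) *\<^sub>R dir N v (prv N a))" by simp
    then have "ratio T (exp t) * crs N v (prv N a) a = 0" by (simp add: cross2_def crs_def algebra_simps)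
    moreover have "crs N v (prv N a) a \<noteq> 0" using crs_nz[OF pa a(1) prv_neq[OF N_ge a(1)]] .
    ultimately show False using n(10) that(2) by simp
  qed
  have cY: "continuous_on {t0 - d<..<t0 + d} Y" "continuous_on {t0 - d<..<t0 + d} Y'"
    unfolding Y_def Y'_def by (intro continuous_at_imp_continuous_on ballI log_curve_cont near(1) near(2); auto)+
  have ts: "two_sided M lratio p Y Y' s1 s2 d V"
    unfolding two_sided_def t0_def[symmetric]
  proof (intro conjI allI ballI impI)
    show "openin (top_of_set M) V" unfolding V_def by (rule openin_near[OF p])
    show "p \<in> V" using p near_edges(2) d(1) by (simp add: V_def)
    fix R assume "R \<in> V"
    from VY[OF this] show "\<bar>lratio R - t0\<bar> < d" "(R = Y (lratio R) \<and> 0 \<le> s1 * (lratio R - t0)) \<or> (R = Y' (lratio R) \<and> 0 \<le> s2 * (lratio R - t0))" by blast+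
  next
    fix t assume "\<bar>t - t0\<bar> < d \<and> 0 \<le> s1 * (t - t0)"
    then show "Y t \<in> V" "lratio (Y t) = t" using YV by blast+
  next
    fix t assume "\<bar>t - t0\<bar> < d \<and> 0 \<le> s2 * (t - t0)"
    then show "Y' t \<in> V" "lratio (Y' t) = t" using YV' by blast+
  next
    fix t u assume "\<bar>t - t0\<bar> < d \<and> 0 < s1 * (t - t0) \<and> \<bar>u - t0\<bar> < d \<and> 0 < s2 * (u - t0)"
    then show "Y t \<noteq> Y' u" using Yne by blast
  qed (use d(1) Yp cY s12 in auto)
  have "vertex_free R" if R: "R \<in> V" "R \<noteq> p" for R
    unfolding vertex_free_def
  proof (intro allI impI notI)
    fix i b assume b: "b < N" "R $ i = v b"
    have "R \<in> near_edges p" using R by (simp add: V_def)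
    from near_vertex[OF this b] have pb: "p $ i = v b" .
    have i0: "i = 0" using ne[OF b(1)] pb by blast
    have R0: "R $ 0 = v a" using b(2) pb a(2) unfolding i0 by simp
    have Rd: "\<bar>lratio R - t0\<bar> < d" using VY[OF R(1)] by blast
    note n = near[OF Rd]
    have H: "H1 (exp (lratio R)) \<noteq> 0" "H2 (exp (lratio R)) \<noteq> 0" "D2 (exp (lratio R)) \<noteq> 0"
      using d1(2)[of "lratio R"] Rd d(2) n(2) unfolding den_iff by auto
    have "exp (lratio R) = r0"
      using VY[OF R(1)]
    proof (elim conjE disjE)
      assume "R = Y (lratio R)"
      then have "ratio T (exp (lratio R)) *\<^sub>R dir N v a = 0" using n(14) R0 by simp
      then show ?thesis using dir_nonzero[OF a(1)] H(1) unfolding rat1 by simp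
    next
      assume "R = Y' (lratio R)"
      then have "v a = v (prv N a) + ratio T' (exp (lratio R)) *\<^sub>R dir N v (prv N a)" using n(15) R0 by simp
      then have "(ratio T' (exp (lratio R)) - 1) *\<^sub>R dir N v (prv N a) = 0" using va by (simp add: algebra_simps)
      then show ?thesis using dir_nonzero[OF pa] H(2) unfolding rat2[OF H(3)] by simp
    qed
    then have "lratio R = t0" using r0(2) by (metis exp_inj_iff)
    then have "R = p" using VY[OF R(1)] Yp by metis
    then show False using R(2) by simp
  qed
  then show ?thesis using ts sT sT' unfolding Y_def Y'_def by blast
qed

end

section \<open>Charts of the space of inscribed rectangles\<close>

lemma type_4_of_nat: "\<exists>n. (a::4) = of_nat n"
proof -
  have "a = of_nat 0 \<or> a = of_nat 1 \<or> a = of_nat 2 \<or> a = of_nat 3"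
    using exhaust_4[of a] numeral_type_4 by auto
  then show ?thesis by blast
qed

lemma relabel_pow: "(relabel 1 ^^ n) R = relabel (of_nat n) R"
  by (induction n) (simp_all add: relabel_add)

lemma relabel_minus [simp]: "relabel (-a) (relabel a R) = R" "relabel a (relabel (-a) R) = R"
  by (simp_all add: relabel_add)

lemma relabel_diff: "relabel a R - relabel a S = relabel a (R - S)"
  by (simp add: relabel_def vec_eq_iff)

lemma norm_relabel [simp]: "norm (relabel a R) = norm R"
proof -
  have "(\<Sum>i\<in>UNIV. (norm (R $ (i + a)))\<^sup>2) = (\<Sum>i\<in>UNIV. (norm (R $ i))\<^sup>2)"
    by (rule sum.reindex_bij_witness[of _ "\<lambda>i. i - a" "\<lambda>i. i + a"]) auto
  then show ?thesis unfolding norm_vec_def L2_set_def relabel_nth by simp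
qed

lemma continuous_relabel: "continuous_on A (relabel a)"
  unfolding relabel_def by (intro continuous_intros)

context generic_polygon begin

lemma relabel_M: "R \<in> M \<Longrightarrow> relabel a R \<in> M"
  unfolding M_iff using ccw_relabel_any sits_relabel by blast

lemma lratio_relabel_1: "R \<in> M \<Longrightarrow> lratio (relabel 1 R) = - lratio R"
  using ccw_relabel(2)[of R] ccw_rectD(2)[of R] unfolding M_iff lratio_def by (auto simp: ln_div)

lemma lratio_relabel: "\<exists>c\<in>{1,-1}. \<forall>R\<in>M. lratio (relabel a R) = c * lratio R"
proof -
  obtain n where a: "a = of_nat n" using type_4_of_nat by blast
  have "\<exists>c\<in>{1,-1}. \<forall>R\<in>M. lratio ((relabel 1 ^^ n) R) = c * lratio R"
  proof (induction n)
    case 0 then show ?case by (intro bexI[of _ 1]) auto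
  next
    case (Suc n)
    then obtain c where c: "c \<in> {1,-1}" "\<And>R. R \<in> M \<Longrightarrow> lratio ((relabel 1 ^^ n) R) = c * lratio R" by blast
    have "lratio ((relabel 1 ^^ Suc n) R) = - c * lratio R" if "R \<in> M" for R
      using lratio_relabel_1[of "(relabel 1 ^^ n) R"] relabel_M[OF that, of "of_nat n"] c(2)[OF that] by (simp add: relabel_pow)
    then show ?case using c(1) by (intro bexI[of _ "-c"]) auto
  qed
  then show ?thesis unfolding a relabel_pow .
qed

lemma relabel_homeomorphism: "homeomorphism M M (relabel a) (relabel (-a))"
  by (rule homeomorphismI) (auto simp: continuous_relabel intro: relabel_M)

lemma vertex_free_relabel: "vertex_free (relabel a R) \<longleftrightarrow> vertex_free R"
proof -
  have "vertex_free (relabel a R)" if "vertex_free R" for a R using that by (simp add: vertex_free_def relabel_nth)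
  from this[of R a] this[of "relabel a R" "-a"] show ?thesis by auto
qed

text \<open>
  The last condition is the substitute for differentiability that rules out a smooth parametrization at a fold.
\<close>

definition regular_at :: "real^2^4 \<Rightarrow> real \<Rightarrow> real \<Rightarrow> bool" where
  "regular_at p s1 s2 \<longleftrightarrow>
     s1 \<in> {1,-1} \<and> s2 \<in> {1,-1} \<and>
     (\<exists>e f. unit_chart M lratio e f \<and> f 0 = p \<and>
        (\<forall>t. 0 \<le> t \<and> t < e \<longrightarrow> lratio (f t) = lratio p + s1 * t) \<and>
        (\<forall>t. t \<le> 0 \<and> -e < t \<longrightarrow> lratio (f t) = lratio p - s2 * t) \<and>
        (\<forall>t\<in>{-e<..<e}. t \<noteq> 0 \<longrightarrow> vertex_free (f t))) \<and>
     (\<exists>C W. openin (top_of_set M) W \<and> p \<in> W \<and> (\<forall>R\<in>W. norm (R - p) \<le> C * \<bar>lratio R - lratio p\<bar>))"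

lemma two_sided_regular:
  assumes ts: "two_sided M lratio p (\<lambda>t. curve k (exp t)) (\<lambda>t. curve k' (exp t)) s1 s2 d V"
    and p: "p \<in> M" and k: "sits k p" "sits k' p" and vf: "\<And>R. R \<in> V \<Longrightarrow> R \<noteq> p \<Longrightarrow> vertex_free R"
  shows "regular_at p s1 s2"
proof -
  have pc: "ccw_rectangle p" using p M_iff by blast
  have s: "s1 \<in> {1,-1}" "s2 \<in> {1,-1}" using ts unfolding two_sided_def by blast+
  obtain D D' where "((\<lambda>t. curve k (exp t)) has_vector_derivative D) (at (lratio p))"
    "((\<lambda>t. curve k' (exp t)) has_vector_derivative D') (at (lratio p))"
    using log_curve(1)[OF pc] k by blast
  note L = two_sided_lipschitz[OF ts continuous_lratio this]
  obtain e f where f: "unit_chart M lratio e f" "f 0 = p" "f ` {-e<..<e} \<subseteq> V"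
    "\<forall>t. 0 \<le> t \<and> t < e \<longrightarrow> lratio (f t) = lratio p + s1 * t" "\<forall>t. t \<le> 0 \<and> -e < t \<longrightarrow> lratio (f t) = lratio p - s2 * t"
    using two_sided_chart[OF ts continuous_lratio] by blast
  have "vertex_free (f t)" if t: "t \<in> {-e<..<e}" "t \<noteq> 0" for t
  proof (rule vf)
    show "f t \<in> V" using f(3) t by blast
    obtain g where "homeomorphism {-e<..<e} (f ` {-e<..<e}) f g" using f(1) unfolding unit_chart_def by blast
    then have "g (f t) = t" "g (f 0) = 0" using t unfolding homeomorphism_def by auto
    then show "f t \<noteq> p" using f(2) t(2) by auto
  qed
  then show ?thesis unfolding regular_at_def using s L f by blast
qed

lemma regular_vertex_free:
  assumes p: "p \<in> M" "vertex_free p" shows "regular_at p 1 (-1)"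
proof -
  obtain k where k: "sits k p" using p M_iff by blast
  obtain d V where V: "two_sided M lratio p (\<lambda>t. curve k (exp t)) (\<lambda>t. curve k (exp t)) 1 (-1) d V" "V \<subseteq> near_edges p"
    using two_sided_vertex_free[OF p k] by blast
  have "vertex_free R" if R: "R \<in> V" for R
    unfolding vertex_free_def
  proof (intro allI impI notI)
    fix i b assume b: "b < N" "R $ i = v b"
    have "p $ i = v b" using near_vertex[OF _ b] R V(2) by blast
    then show False using p(2) b(1) unfolding vertex_free_def by blast
  qed
  then show ?thesis using two_sided_regular[OF V(1) p(1) k k] by blast
qed

lemma regular_relabel:
  assumes S: "regular_at S s1 s2" and SM: "S \<in> M"
  shows "\<exists>s1 s2. regular_at (relabel a S) s1 s2"
proof -
  obtain c where c: "c \<in> {1,-1::real}" "\<And>R. R \<in> M \<Longrightarrow> lratio (relabel a R) = c * lratio R" using lratio_relabel by blast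
  have s: "s1 \<in> {1,-1}" "s2 \<in> {1,-1}" using S unfolding regular_at_def by blast+
  obtain e f where f: "unit_chart M lratio e f" "f 0 = S"
    "\<And>t. 0 \<le> t \<and> t < e \<Longrightarrow> lratio (f t) = lratio S + s1 * t" "\<And>t. t \<le> 0 \<and> -e < t \<Longrightarrow> lratio (f t) = lratio S - s2 * t"
    "\<And>t. t\<in>{-e<..<e} \<Longrightarrow> t \<noteq> 0 \<Longrightarrow> vertex_free (f t)"
    using S unfolding regular_at_def by blast
  obtain C W where W: "openin (top_of_set M) W" "S \<in> W" "\<And>R. R \<in> W \<Longrightarrow> norm (R - S) \<le> C * \<bar>lratio R - lratio S\<bar>"
    using S unfolding regular_at_def by blast
  have fM: "f t \<in> M" if "t \<in> {-e<..<e}" for t using f(1) that unit_speed_at_isCont(2) unfolding unit_chart_def by blast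
  have ac: "\<bar>c\<bar> = 1" using c(1) by auto
  have iso: "\<bar>lratio (relabel a x) - lratio (relabel a y)\<bar> = \<bar>lratio x - lratio y\<bar>" if "x \<in> M" "y \<in> M" for x y
    using c(2)[OF that(1)] c(2)[OF that(2)] ac by (metis abs_mult mult_1 right_diff_distrib)
  define F where "F t = relabel a (f t)" for t
  have 1: "unit_chart M lratio e F" unfolding F_def by (rule unit_chart_transport[OF relabel_homeomorphism iso f(1)])
  have 2: "F 0 = relabel a S" by (simp add: F_def f(2))
  have 3: "lratio (F t) = lratio (relabel a S) + (c * s1) * t" if t: "0 \<le> t \<and> t < e" for t
  proof -
    have "f t \<in> M" using t by (intro fM) auto
    then show ?thesis unfolding F_def c(2)[OF SM] using c(2) f(3)[OF t] by (simp add: algebra_simps)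
  qed
  have 4: "lratio (F t) = lratio (relabel a S) - (c * s2) * t" if t: "t \<le> 0 \<and> -e < t" for t
  proof -
    have "f t \<in> M" using t by (intro fM) auto
    then show ?thesis unfolding F_def c(2)[OF SM] using c(2)[of "f t"] unfolding f(4)[OF t] by (simp add: algebra_simps)
  qed
  have 5: "vertex_free (F t)" if "t\<in>{-e<..<e}" "t \<noteq> 0" for t using f(5)[OF that] by (simp add: F_def vertex_free_relabel)
  have 6: "openin (top_of_set M) (relabel a ` W)" using homeomorphism_imp_open_map[OF relabel_homeomorphism W(1)] .
  have 7: "norm (R - relabel a S) \<le> C * \<bar>lratio R - lratio (relabel a S)\<bar>" if R: "R \<in> relabel a ` W" for R
  proof -
    obtain T where T: "T \<in> W" "R = relabel a T" using R by blast
    have "T \<in> M" using T(1) W(1) openin_imp_subset by blast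
    then show ?thesis using W(3)[OF T(1)] iso[OF _ SM] unfolding T(2) relabel_diff by simp
  qed
  have "c * s1 \<in> {1,-1}" "c * s2 \<in> {1,-1}" using c(1) s by auto
  moreover have "\<exists>C W. openin (top_of_set M) W \<and> relabel a S \<in> W \<and> (\<forall>R\<in>W. norm (R - relabel a S) \<le> C * \<bar>lratio R - lratio (relabel a S)\<bar>)"
    using 6 7 W(2) by blast
  ultimately have "regular_at (relabel a S) (c * s1) (c * s2)" unfolding regular_at_def using 1 2 3 4 5 by blast
  then show ?thesis by blast
qed

lemma regular:
  assumes p: "p \<in> M" shows "\<exists>s1 s2. regular_at p s1 s2"
proof (cases "vertex_free p")
  case True then show ?thesis using regular_vertex_free[OF p] by blast
next
  case False
  then obtain i a where a: "a < N" "p $ i = v a" unfolding vertex_free_def by blast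
  define S where "S = relabel i p"
  have S: "S \<in> M" "S $ 0 = v a" using relabel_M[OF p] a(2) by (simp_all add: S_def relabel_nth)
  obtain k k' s1 s2 d V where "two_sided M lratio S (\<lambda>t. curve k (exp t)) (\<lambda>t. curve k' (exp t)) s1 s2 d V"
    "sits k S" "sits k' S" "\<forall>R\<in>V. R \<noteq> S \<longrightarrow> vertex_free R"
    using two_sided_vertex[OF S(1) a(1) S(2)] by blast
  then have "regular_at S s1 s2" using two_sided_regular S(1) by blast
  then have "\<exists>s1 s2. regular_at (relabel (-i) S) s1 s2" using regular_relabel S(1) by blast
  then show ?thesis by (simp add: S_def)
qed

text \<open>
  On the curve the side from corner 0 to corner 3 is \<open>r\<close> times the rotated first side. If the derivative of the
  curve vanished, then differentiating this identity would make the first side zero.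
\<close>

lemma derivative_nonzero:
  assumes D: "(curve k has_vector_derivative D) (at r)" and r: "ccw_rectangle (curve k r)"
  shows "D \<noteq> 0"
proof
  assume "D = 0"
  then have 0: "(curve k has_vector_derivative 0) (at r)" using D by simp
  have c: "((\<lambda>s. curve k s $ i) has_vector_derivative 0) (at r)" for i
    using bounded_linear.has_vector_derivative[OF bounded_linear_vec_nth 0] by simp
  have c': "((\<lambda>s. curve k s $ i $ j) has_vector_derivative 0) (at r)" for i j
    using bounded_linear.has_vector_derivative[OF bounded_linear_vec_nth c[of i]] by simp
  have c2: "((\<lambda>s. curve k s $ i $ j) has_real_derivative 0) (at r)" for i j
    using c' has_real_derivative_iff_has_vector_derivative by blast
  define u where "u s = curve k s $ 1 - curve k s $ 0" for s
  have u: "curve k s $ 3 $ 1 - curve k s $ 0 $ 1 = s * (- u s $ 2)" "curve k s $ 3 $ 2 - curve k s $ 0 $ 2 = s * u s $ 1" for s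
    by (simp_all add: u_def curve_def)
  have du: "((\<lambda>s. u s $ j) has_real_derivative 0) (at r)" for j
    unfolding u_def vector_minus_component by (rule derivative_eq_intros c2 refl)+ simp
  have "((\<lambda>s. s * (- u s $ 2)) has_real_derivative - u r $ 2) (at r)" "((\<lambda>s. s * u s $ 1) has_real_derivative u r $ 1) (at r)"
    by (rule derivative_eq_intros du refl | simp)+
  moreover have "((\<lambda>s. s * (- u s $ 2)) has_real_derivative 0) (at r)" "((\<lambda>s. s * u s $ 1) has_real_derivative 0) (at r)"
    unfolding u[symmetric] by (rule derivative_eq_intros c2 refl | simp)+
  ultimately have "- u r $ 2 = 0" "u r $ 1 = 0" using DERIV_unique by blast+
  then have "u r = 0" by (simp add: eq_2_iff)
  then show False using ccw_rectD(1)[OF r] by (simp add: u_def)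
qed

lemma vertex_free_smooth:
  assumes p: "p \<in> M" "vertex_free p" shows "smooth_point M p"
proof -
  have pc: "ccw_rectangle p" using p M_iff by blast
  obtain k where k: "sits k p" using p M_iff by blast
  obtain d V where "two_sided M lratio p (\<lambda>t. curve k (exp t)) (\<lambda>t. curve k (exp t)) 1 (-1) d V"
    using two_sided_vertex_free[OF p k] by blast
  then have V: "openin (top_of_set M) V" "p \<in> V" "d > 0"
    and VY: "\<And>R. R \<in> V \<Longrightarrow> R = curve k (exp (lratio R))"
    and YV: "\<And>t. \<bar>t - lratio p\<bar> < d \<Longrightarrow> curve k (exp t) \<in> V"
    unfolding two_sided_def by (blast, blast, blast, blast, force)
  define r0 where "r0 = aspect_ratio p"
  have r0: "r0 > 0" using ccw_rectD(2)[OF pc] by (simp add: r0_def)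
  have lp: "lratio p = ln r0" by (simp add: lratio_def r0_def)
  have "isCont ln r0" using r0 by (intro isCont_ln) auto
  then have "\<forall>\<^sub>F r in at r0. dist (ln r) (ln r0) < d" unfolding isCont_def using V(3) tendstoD by blast
  then have "\<forall>\<^sub>F r in nhds r0. \<bar>ln r - lratio p\<bar> < d" using V(3) by (simp add: eventually_nhds_conv_at lp dist_real_def)
  with curve_nearby(1)[OF pc k, folded r0_def]
  have "\<forall>\<^sub>F r in nhds r0. (poly (den k) r \<noteq> 0 \<and> r > 0 \<and> ccw_rectangle (curve k r) \<and> aspect_ratio (curve k r) = r) \<and> \<bar>ln r - lratio p\<bar> < d"
    by (rule eventually_conj)
  then obtain e where e: "e > 0" "\<And>r. \<bar>r - r0\<bar> < e \<Longrightarrow> (poly (den k) r \<noteq> 0 \<and> r > 0 \<and> ccw_rectangle (curve k r) \<and> aspect_ratio (curve k r) = r) \<and> \<bar>ln r - lratio p\<bar> < d"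
    unfolding eventually_nhds_metric dist_real_def by blast
  define f where "f t = curve k (r0 + t)" for t
  define g where "g R = aspect_ratio R - r0" for R
  let ?I = "{-e<..<e}"
  have near: "poly (den k) (r0 + t) \<noteq> 0" "ccw_rectangle (f t)" "g (f t) = t" "f t \<in> V" if t: "t \<in> ?I" for t
  proof -
    have n: "(poly (den k) (r0+t) \<noteq> 0 \<and> r0+t > 0 \<and> ccw_rectangle (curve k (r0+t)) \<and> aspect_ratio (curve k (r0+t)) = r0+t) \<and> \<bar>ln (r0+t) - lratio p\<bar> < d"
      by (rule e(2)) (use t in auto)
    then show "poly (den k) (r0 + t) \<noteq> 0" "ccw_rectangle (f t)" "g (f t) = t" by (auto simp: f_def g_def)
    show "f t \<in> V" using YV[of "ln (r0+t)"] n by (simp add: f_def)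
  qed
  define U where "U = V \<inter> (M \<inter> aspect_ratio -` {r0 - e<..<r0 + e})"
  have U: "openin (top_of_set M) U"
    unfolding U_def by (intro openin_Int V(1) continuous_openin_preimage_gen[OF continuous_aspect_ratio]) simp
  have VM: "V \<subseteq> M" using V(1) openin_imp_subset by blast
  have fU: "f t \<in> U" if "t \<in> ?I" for t
    using near(3,4)[OF that] that VM by (auto simp: U_def g_def)
  have UfI: "g R \<in> ?I" "f (g R) = R" if R: "R \<in> U" for R
  proof -
    show "g R \<in> ?I" using R by (auto simp: U_def g_def)
    have "R \<in> V" "R \<in> M" using R by (auto simp: U_def)
    then show "f (g R) = R" using VY[of R] exp_lratio[of R] M_iff by (simp add: f_def g_def)
  qed
  have hom: "homeomorphism ?I U f g"
  proof (rule homeomorphismI)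
    show "continuous_on ?I f"
    proof (intro continuous_at_imp_continuous_on ballI)
      fix t assume "t \<in> ?I"
      then have "isCont (curve k) (r0 + t)" using curve_continuous near(1) by blast
      moreover have "isCont (\<lambda>t. r0 + t) t" by (intro continuous_intros)
      ultimately show "isCont f t" unfolding f_def using isCont_o2 by blast
    qed
    show "continuous_on U g" unfolding g_def
      by (intro continuous_intros continuous_on_subset[OF continuous_aspect_ratio]) (auto simp: U_def)
  qed (use fU UfI near(3) in auto)
  have "C_infinity_on {r. poly (den k) r \<noteq> 0} (curve k)" by (rule rat_curve_smooth[OF rat_over_curve]) simp
  from C_infinity_on_shift[OF this, of r0] have "C_infinity_on {t. poly (den k) (r0 + t) \<noteq> 0} f" unfolding f_def by simp
  then have sm: "C_infinity_on ?I f" unfolding C_infinity_on_def using near(1) by blast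
  obtain X' where X': "\<forall>r. poly (den k) r \<noteq> 0 \<longrightarrow> (curve k has_vector_derivative X' r) (at r)"
    using rat_curve_deriv[OF rat_over_curve] by blast
  have "vector_derivative f (at t) \<noteq> 0" if t: "t \<in> ?I" for t
  proof -
    have D: "(curve k has_vector_derivative X' (r0 + t)) (at (r0 + t))" using X' near(1)[OF t] by blast
    have "((\<lambda>t. r0 + t) has_vector_derivative 1) (at t)" by (rule derivative_eq_intros refl | simp)+
    then have "(curve k \<circ> (\<lambda>t. r0 + t) has_vector_derivative 1 *\<^sub>R X' (r0 + t)) (at t)"
      by (rule vector_diff_chain_at) (rule D)
    then have "(f has_vector_derivative X' (r0 + t)) (at t)" by (simp add: o_def f_def[abs_def])
    then have "vector_derivative f (at t) = X' (r0 + t)" by (rule vector_derivative_at)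
    moreover have "X' (r0 + t) \<noteq> 0" using derivative_nonzero[OF D] near(2)[OF t] by (simp add: f_def)
    ultimately show ?thesis by simp
  qed
  moreover have "f 0 = p" using sits_determined(2)[OF pc k] by (simp add: f_def r0_def)
  ultimately show ?thesis unfolding smooth_point_def using e(1) U hom sm by blast
qed

lemma Quad_vertex_zero:
  assumes R: "R \<in> M" and a: "a < N" "R $ 0 = v a"
  shows "\<exists>i1 i2 i3. i1 < N \<and> i2 < N \<and> i3 < N \<and> \<not> (i1 \<in> {a, prv N a} \<and> i2 \<in> {a, prv N a} \<and> i3 \<in> {a, prv N a}) \<and>
     Quad i1 i2 i3 (v a) (aspect_ratio R) = 0"
proof -
  obtain k where k: "ccw_rectangle R" "sits k R" using R M_iff by blast
  have kN: "k i < N" for i using k(2) by (simp add: sits_def)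
  have o: "off (k i) (R $ i) = 0" for i using sits_on_lines[OF k(2)] by (simp add: on_lines_def)
  define u where "u = R $ 1 - R $ 0"
  define r where "r = aspect_ratio R"
  have Rr: "R = rect (R $ 0) u r" and r: "r > 0" using ccw_rectD[OF k(1)] by (auto simp: u_def r_def)
  have "off (k 1) (R $ 0 + u) = 0" "off (k 2) (R $ 0 + u + r *\<^sub>R perp u) = 0" "off (k 3) (R $ 0 + r *\<^sub>R perp u) = 0"
    using o[of 1] o[of 2] o[of 3] Rr by (metis rect_nth)+
  then have l: "cross2 (dir N v (k 1)) u = off (k 1) (R $ 0)" "cross2 (dir N v (k 2)) u + r * (dir N v (k 2) \<bullet> u) = off (k 2) (R $ 0)"
     "r * (dir N v (k 3) \<bullet> u) = off (k 3) (R $ 0)" using lines_rect_iff by blast+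
  have "Quad (k 1) (k 2) (k 3) (R $ 0) r = 0" using rect_on_lines_imp(1)[OF kN kN kN _ l] r by simp
  then have Q: "Quad (k 1) (k 2) (k 3) (v a) (aspect_ratio R) = 0" by (simp add: a r_def)
  have k0: "k 0 \<in> {a, prv N a}" using edges_at_vertex[OF a(1) kN] k(2) a(2) unfolding sits_def by (metis insertCI)
  have "\<not> (k 1 \<in> {a, prv N a} \<and> k 2 \<in> {a, prv N a} \<and> k 3 \<in> {a, prv N a})"
  proof
    assume "k 1 \<in> {a, prv N a} \<and> k 2 \<in> {a, prv N a} \<and> k 3 \<in> {a, prv N a}"
    then have "{k 0, k 1, k 2, k 3} \<subseteq> {a, prv N a}" using k0 by blast
    then have "card {k 0, k 1, k 2, k 3} \<le> card {a, prv N a}" by (intro card_mono) auto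
    also have "\<dots> \<le> 2" by (simp add: card_insert_if)
    finally show False using three_edges[OF k] by simp
  qed
  then show ?thesis using kN Q by blast
qed

text \<open>
  This is where \<open>square_rel\<close> is used: inscribed squares have no corner at a vertex, so they are smooth points.
\<close>

lemma square_vertex_free:
  assumes p: "p \<in> M" "lratio p = 0" shows "vertex_free p"
  unfolding vertex_free_def
proof (intro allI impI notI)
  fix i a assume a: "a < N" "p $ i = v a"
  define S where "S = relabel i p"
  have S: "S \<in> M" "S $ 0 = v a" using relabel_M[OF p(1)] a(2) by (simp_all add: S_def relabel_nth)
  have "lratio S = 0" using lratio_relabel[of i] p unfolding S_def by auto
  then have "aspect_ratio S = 1" using exp_lratio[of S] S(1) M_iff by auto
  then obtain i1 i2 i3 where i: "i1 < N" "i2 < N" "i3 < N" "\<not> (i1 \<in> {a, prv N a} \<and> i2 \<in> {a, prv N a} \<and> i3 \<in> {a, prv N a})"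
     "Quad i1 i2 i3 (v a) 1 = 0" using Quad_vertex_zero[OF S(1) a(1) S(2)] by auto
  then have "square_rel N v a i1 i2 i3 = 0" unfolding Quad_vertex square_rel_def by simp
  then show False using square_rel_nz[OF a(1) i(1-4)] by simp
qed

end

section \<open>Smooth points, the manifold and compactness\<close>

lemma bounded_linear_perp: "bounded_linear perp"
proof -
  have "linear perp" by (rule linearI) (simp_all add: eq_2_iff)
  then show ?thesis by (simp add: linear_conv_bounded_linear)
qed

lemma continuous_rect:
  assumes "continuous_on A z" "continuous_on A u" "continuous_on A r"
  shows "continuous_on A (\<lambda>x. rect (z x) (u x) (r x))"
proof -
  have "continuous_on A (\<lambda>x. perp (u x))"
    by (rule bounded_linear.continuous_on[OF bounded_linear_perp assms(2)])
  then have "continuous_on A (\<lambda>x. if i = 0 then z x else if i = 1 then z x + u x else if i = 2 then z x + u x + r x *\<^sub>R perp (u x) else z x + r x *\<^sub>R perp (u x))"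
    for i :: 4 using assms by (cases "i = 0"; cases "i = 1"; cases "i = 2"; simp) (intro continuous_intros; assumption)+
  then show ?thesis unfolding rect_def by (intro continuous_intros)
qed

lemma aspect_ratio_differentiable:
  assumes f: "(f has_vector_derivative D) (at t)" and R: "ccw_rectangle (f t)"
  shows "(\<lambda>s. ln (aspect_ratio (f s))) differentiable at t"
proof -
  have d: "(\<lambda>s. f s $ i) differentiable at t" for i
    using bounded_linear.has_vector_derivative[OF bounded_linear_vec_nth f] differentiableI_vector by blast
  have n: "(\<lambda>s. norm (f s $ i - f s $ j)) differentiable at t" if "f t $ i \<noteq> f t $ j" for i j
  proof -
    have "(norm \<circ> (\<lambda>s. f s $ i - f s $ j)) differentiable at t"
      by (rule differentiable_chain_at) (use that in \<open>auto intro!: derivative_intros d\<close>)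
    then show ?thesis by (simp add: o_def)
  qed
  have ne: "f t $ 1 \<noteq> f t $ 0" "f t $ 2 \<noteq> f t $ 1"
  proof -
    show "f t $ 1 \<noteq> f t $ 0" by (rule ccw_rectD(1)[OF R])
    then show "f t $ 2 \<noteq> f t $ 1" using ccw_rectD(2)[OF R] by (auto simp: aspect_ratio_def)
  qed
  have 0: "(\<lambda>s. aspect_ratio (f s)) differentiable at t"
    unfolding aspect_ratio_def by (intro differentiable_divide n ne) (use ne(1) in simp)
  have "ln differentiable at (aspect_ratio (f t))"
    using ccw_rectD(2)[OF R] DERIV_ln real_differentiable_def by blast
  from differentiable_chain_at[OF 0 this] show ?thesis by (simp add: o_def)
qed

text \<open>
  A curve that moves at most in proportion to the change of \<open>g\<close> stops where \<open>g\<close> is stationary.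
\<close>

lemma flat_at_critical_point:
  fixes f :: "real \<Rightarrow> 'a::real_normed_vector"
  assumes f: "(f has_vector_derivative D) (at 0)" and g: "(g has_real_derivative 0) (at 0)"
    and le: "\<forall>\<^sub>F t in at 0. norm (f t - f 0) \<le> C * \<bar>g t - g 0\<bar>"
  shows "D = 0"
proof -
  have q: "((\<lambda>t. (1 / t) *\<^sub>R (f t - f 0)) \<longlongrightarrow> D) (at 0)"
  proof -
    have lim: "((\<lambda>h. norm (f (0 + h) - f 0 - h *\<^sub>R D) / norm h) \<longlongrightarrow> 0) (at 0)"
      using f unfolding has_vector_derivative_def has_derivative_at by blast
    have quot: "norm (f (0 + h) - f 0 - h *\<^sub>R D) / norm h = norm ((1 / h) *\<^sub>R (f h - f 0) - D)" if "h \<noteq> 0" for h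
    proof -
      have "f (0 + h) - f 0 - h *\<^sub>R D = h *\<^sub>R ((1 / h) *\<^sub>R (f h - f 0) - D)" using that by (simp add: algebra_simps)
      then show ?thesis using that by simp
    qed
    have ev: "\<forall>\<^sub>F h in at 0. norm (f (0 + h) - f 0 - h *\<^sub>R D) / norm h = norm ((1 / h) *\<^sub>R (f h - f 0) - D)"
      unfolding eventually_at_filter using quot by (intro always_eventually) blast
    have "((\<lambda>h. norm ((1 / h) *\<^sub>R (f h - f 0) - D)) \<longlongrightarrow> 0) (at 0)"
      by (rule Lim_transform_eventually[OF lim ev])
    then have "((\<lambda>h. (1 / h) *\<^sub>R (f h - f 0) - D) \<longlongrightarrow> 0) (at 0)" by (rule tendsto_norm_zero_cancel)
    then show ?thesis by (simp add: LIM_zero_cancel)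
  qed
  have "((\<lambda>t. (g (0 + t) - g 0) / t) \<longlongrightarrow> 0) (at 0)" using g unfolding DERIV_def .
  then have "((\<lambda>t. C * \<bar>(g t - g 0) / t\<bar>) \<longlongrightarrow> C * \<bar>0\<bar>) (at 0)" by (intro tendsto_intros) simp
  then have z: "((\<lambda>t. C * \<bar>(g t - g 0) / t\<bar>) \<longlongrightarrow> 0) (at 0)" by simp
  have "\<forall>\<^sub>F t in at 0. norm ((1 / t) *\<^sub>R (f t - f 0)) \<le> C * \<bar>(g t - g 0) / t\<bar>"
    using le
  proof eventually_elim
    case (elim t)
    then have "norm (f t - f 0) * (1 / \<bar>t\<bar>) \<le> (C * \<bar>g t - g 0\<bar>) * (1 / \<bar>t\<bar>)" by (intro mult_right_mono) auto
    then show ?case by (simp add: abs_divide mult.commute)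
  qed
  then have "((\<lambda>t. (1 / t) *\<^sub>R (f t - f 0)) \<longlongrightarrow> 0) (at 0)" by (rule Lim_null_comparison[OF _ z])
  then show "D = 0" using q LIM_unique by blast
qed

context generic_polygon begin

lemma inj_on_aspect_ratio: "inj_on lratio U \<Longrightarrow> inj_on aspect_ratio U"
  unfolding inj_on_def lratio_def by metis

text \<open>
  Where the two slopes have opposite signs \<open>\<tau>\<close> is monotone. At a fold \<open>\<tau>\<close> is extremal, hence
  stationary along any smooth parametrization, and \<open>flat_at_critical_point\<close> contradicts its regularity.
\<close>

lemma smooth_point_injective:
  assumes p: "p \<in> M" and sp: "smooth_point M p"
  shows "\<exists>U. openin (top_of_set M) U \<and> p \<in> U \<and> inj_on aspect_ratio U"
proof -
  obtain s1 s2 where reg: "regular_at p s1 s2" using regular[OF p] by blast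
  then have s: "s1 \<in> {1,-1}" "s2 \<in> {1,-1}" unfolding regular_at_def by blast+
  obtain e f where f: "unit_chart M lratio e f" "f 0 = p"
    "\<And>t. 0 \<le> t \<Longrightarrow> t < e \<Longrightarrow> lratio (f t) = lratio p + s1 * t" "\<And>t. t \<le> 0 \<Longrightarrow> -e < t \<Longrightarrow> lratio (f t) = lratio p - s2 * t"
    using reg unfolding regular_at_def by blast
  define I where "I = {-e<..<e}"
  have W: "openin (top_of_set M) (f ` I)" "p \<in> f ` I"
    using f(1,2) unfolding unit_chart_def I_def by (blast, force)
  show ?thesis
  proof (cases "s1 = s2")
    case False
    then have s2: "s2 = - s1" using s by auto
    have l: "lratio (f t) = lratio p + s1 * t" if "t \<in> I" for t
      using f(3)[of t] f(4)[of t] that unfolding s2 I_def by (cases "0 \<le> t") auto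
    have "inj_on lratio (f ` I)"
    proof (rule inj_onI)
      fix x y assume x: "x \<in> f ` I" and y: "y \<in> f ` I" and eq: "lratio x = lratio y"
      obtain t where t: "t \<in> I" "x = f t" using x by blast
      obtain u where u: "u \<in> I" "y = f u" using y by blast
      have "s1 * t = s1 * u" using l[OF t(1)] l[OF u(1)] eq unfolding t(2) u(2) by linarith
      moreover have "s1 \<noteq> 0" using s(1) by auto
      ultimately have "t = u" by simp
      then show "x = y" unfolding t(2) u(2) by simp
    qed
    then have "inj_on aspect_ratio (f ` I)" by (rule inj_on_aspect_ratio)
    with W show ?thesis by (intro exI[of _ "f ` I"] conjI)
  next
    case True
    have fold: "s1 * (lratio R - lratio p) \<ge> 0" if R: "R \<in> f ` I" for R
    proof -
      obtain t where t: "t \<in> I" "R = f t" using R by blast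
      have "s1 * s1 = 1" using s by auto
      then have m: "s1 * (s1 * t) = t" by (metis mult.assoc mult_1)
      show ?thesis
      proof (cases "0 \<le> t")
        case True
        then have "lratio R - lratio p = s1 * t" using f(3)[of t] t by (simp add: I_def)
        then show ?thesis using m True by metis
      next
        case False
        then have "lratio R - lratio p = s1 * (- t)" using f(4)[of t] t \<open>s1 = s2\<close> by (simp add: I_def)
        moreover have "s1 * (s1 * (- t)) = - t" using m by simp
        ultimately have "s1 * (lratio R - lratio p) = - t" by metis
        then show ?thesis using False by linarith
      qed
    qed
    obtain C W2 where W2: "openin (top_of_set M) W2" "p \<in> W2" "\<And>R. R \<in> W2 \<Longrightarrow> norm (R - p) \<le> C * \<bar>lratio R - lratio p\<bar>"
      using reg unfolding regular_at_def by blast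
    obtain e' U y g where y: "e' > 0" "openin (top_of_set M) U" "homeomorphism {-e'<..<e'} U y g" "y 0 = p"
       "C_infinity_on {-e'<..<e'} y" "\<forall>t\<in>{-e'<..<e'}. vector_derivative y (at t) \<noteq> 0"
      using sp unfolding smooth_point_def by blast
    obtain D where D: "(y has_vector_derivative D) (at 0)"
      using y(5,1) unfolding C_infinity_on_def by (metis greaterThanLessThan_iff neg_less_0_iff_less)
    have D0: "D \<noteq> 0" using y(1,6) vector_derivative_at[OF D] by auto
    have UM: "U \<subseteq> M" using y(2) openin_imp_subset by blast
    have yU: "y ` {-e'<..<e'} = U" "continuous_on {-e'<..<e'} y" using y(3) unfolding homeomorphism_def by auto
    have "openin (top_of_set M) (f ` I \<inter> W2)" using W(1) W2(1) by (rule openin_Int)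
    then obtain O1 where O1: "open O1" "f ` I \<inter> W2 = M \<inter> O1" by (meson openin_open)
    have "isCont y 0" using yU(2) y(1) continuous_on_eq_continuous_at[of "{-e'<..<e'}" y] by simp
    moreover have pO: "p \<in> O1" using O1(2) W(2) W2(2) by blast
    ultimately have "\<forall>\<^sub>F t in at 0. y t \<in> O1" unfolding isCont_def y(4) using O1(1) topological_tendstoD by blast
    then have "\<forall>\<^sub>F t in nhds 0. y t \<in> O1" using pO y(4) by (simp add: eventually_nhds_conv_at)
    moreover have "\<forall>\<^sub>F t in nhds 0. t \<in> {-e'<..<e'}" using y(1) by (intro eventually_nhds_in_open) auto
    ultimately have ev: "\<forall>\<^sub>F t in nhds 0. y t \<in> f ` I \<inter> W2"
    proof eventually_elim
      case (elim t) then show ?case using yU(1) UM unfolding O1(2) by blast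
    qed
    have "ccw_rectangle (y 0)" using p M_iff y(4) by simp
    from aspect_ratio_differentiable[OF D this] obtain l where l: "((\<lambda>t. lratio (y t)) has_real_derivative l) (at 0)"
      unfolding lratio_def[symmetric] real_differentiable_def by blast
    obtain d where d: "d > 0" "\<And>t. \<bar>t\<bar> < d \<Longrightarrow> y t \<in> f ` I \<inter> W2"
      using ev unfolding eventually_nhds_metric dist_real_def by auto
    have "l = 0"
    proof (cases "s1 = 1")
      case True
      have "\<forall>t. \<bar>0 - t\<bar> < d \<longrightarrow> lratio (y 0) \<le> lratio (y t)"
        using fold d(2) unfolding True y(4) by force
      then show ?thesis using DERIV_local_min[OF l d(1)] by blast
    next
      case False
      then have s1: "s1 = -1" using s by auto
      have "\<forall>t. \<bar>0 - t\<bar> < d \<longrightarrow> lratio (y t) \<le> lratio (y 0)"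
        using fold d(2) unfolding s1 y(4) by force
      then show ?thesis using DERIV_local_max[OF l d(1)] by blast
    qed
    have "\<forall>\<^sub>F t in at 0. norm (y t - y 0) \<le> C * \<bar>lratio (y t) - lratio (y 0)\<bar>"
      using d W2(3) unfolding y(4) eventually_at dist_real_def by auto
    then have "D = 0" using flat_at_critical_point[OF D] l \<open>l = 0\<close> by blast
    then show ?thesis using D0 by blast
  qed
qed

lemma vertex_free_chart:
  assumes p: "p \<in> M"
  obtains e f where "unit_chart M lratio e f" "f 0 = p" "\<And>t. t\<in>{-e<..<e} \<Longrightarrow> t \<noteq> 0 \<Longrightarrow> vertex_free (f t)"
proof -
  obtain s1 s2 where "regular_at p s1 s2" using regular[OF p] by blast
  then have "\<exists>e f. unit_chart M lratio e f \<and> f 0 = p \<and> (\<forall>t\<in>{-e<..<e}. t \<noteq> 0 \<longrightarrow> vertex_free (f t))"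
    unfolding regular_at_def by (elim conjE exE) (intro exI conjI; assumption)
  then show thesis using that by blast
qed

lemma topological_manifold: "topological_1_manifold M"
  unfolding topological_1_manifold_def
proof
  fix p assume "p \<in> M"
  then obtain e f where f: "unit_chart M lratio e f" "f 0 = p" using vertex_free_chart by metis
  then have e: "e > 0" by (simp add: unit_chart_def)
  have "{-e<..<e} homeomorphic f ` {-e<..<e}" using f unfolding unit_chart_def homeomorphic_def by blast
  moreover have "{-e<..<e} homeomorphic (UNIV :: real set)"
    using homeomorphic_ball_UNIV[OF e, of "0::real"] by (simp add: ball_eq_greaterThanLessThan)
  ultimately have "f ` {-e<..<e} homeomorphic (UNIV :: real set)" by (meson homeomorphic_sym homeomorphic_trans)
  moreover have "p \<in> f ` {-e<..<e}" using f(2) e by force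
  ultimately show "\<exists>U. openin (top_of_set M) U \<and> p \<in> U \<and> U homeomorphic (UNIV :: real set)"
    using f(1) unfolding unit_chart_def by blast
qed

lemma piecewise_smooth: "piecewise_smooth_1_manifold M"
proof -
  define F where "F = {p \<in> M. \<not> vertex_free p}"
  have "locally_finite_in (top_of_set M) ((\<lambda>x. {x}) ` F)"
    unfolding locally_finite_in_def
  proof (intro conjI ballI)
    show "\<Union> ((\<lambda>x. {x}) ` F) \<subseteq> topspace (top_of_set M)" by (auto simp: F_def)
    fix p assume "p \<in> topspace (top_of_set M)"
    then have "p \<in> M" by simp
    then obtain e f where f: "unit_chart M lratio e f" "f 0 = p" "\<And>t. t\<in>{-e<..<e} \<Longrightarrow> t \<noteq> 0 \<Longrightarrow> vertex_free (f t)"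
      using vertex_free_chart by metis
    let ?V = "f ` {-e<..<e}"
    have "{U \<in> (\<lambda>x. {x}) ` F. U \<inter> ?V \<noteq> {}} \<subseteq> {{p}}" using f(2,3) unfolding F_def by blast
    then have "finite {U \<in> (\<lambda>x. {x}) ` F. U \<inter> ?V \<noteq> {}}" by (rule finite_subset) simp
    moreover have "openin (top_of_set M) ?V" "p \<in> ?V" using f(1,2) unfolding unit_chart_def by (blast, force)
    ultimately show "\<exists>V. openin (top_of_set M) V \<and> p \<in> V \<and> finite {U \<in> (\<lambda>x. {x}) ` F. U \<inter> V \<noteq> {}}" by blast
  qed
  moreover have "\<forall>p\<in>M - F. smooth_point M p" using vertex_free_smooth by (auto simp: F_def)
  ultimately show ?thesis unfolding piecewise_smooth_1_manifold_def using topological_manifold by blast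
qed

text \<open>
  A point is on at most two edges, and an inscribed rectangle needs three.
\<close>

lemma no_rectangle_near_point:
  assumes "\<And>i. L $ i = x" "R \<in> near_edges L" shows "R \<notin> M"
proof
  assume "R \<in> M"
  then obtain k where k: "ccw_rectangle R" "sits k R" using M_iff by blast
  have kN: "k i < N" for i using k(2) by (simp add: sits_def)
  have x: "x \<in> edge N v (k i)" for i using near_edges(3)[OF assms(2), of "k i" i] k(2) assms(1) by (simp add: sits_def)
  have "\<exists>a b. \<forall>i. k i \<in> {a, b}"
  proof (cases "\<exists>a<N. x = v a")
    case True
    then obtain a where a: "a < N" "x = v a" by blast
    then have "\<forall>i. k i \<in> {a, prv N a}" using edges_at_vertex[OF a(1) kN] x by blast
    then show ?thesis by blast
  next
    case False
    then have "k i = k 0" for i using unique_edge[OF kN kN x x] by blast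
    then show ?thesis by blast
  qed
  then obtain a b where "\<forall>i. k i \<in> {a, b}" by blast
  then have "{k 0, k 1, k 2, k 3} \<subseteq> {a, b}" by blast
  then have "card {k 0, k 1, k 2, k 3} \<le> card {a, b}" by (intro card_mono) auto
  also have "\<dots> \<le> 2" by (simp add: card_insert_if)
  finally show False using three_edges[OF k] by simp
qed

lemma compact_curve: "compact \<gamma>"
proof -
  have "path (polygon_path N v)" using generic simple_path_imp_path unfolding generic_polygons_def polygon_space_def by auto
  then show ?thesis by (rule compact_path_image)
qed

text \<open>
  The first two corners and the bounded aspect ratio determine the rectangle continuously, so the only limits to be
  excluded are single points. These have neighborhoods without inscribed rectangles.
\<close>

lemma compact_bounded_ratio: "compact {R \<in> M. \<bar>lratio R\<bar> \<le> K}"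
proof -
  define S where "S = {R \<in> M. \<bar>lratio R\<bar> \<le> K}"
  define B where "B = (\<gamma> \<times> \<gamma>) \<times> {exp (-K)..exp K}"
  define \<Phi> where "\<Phi> = (\<lambda>x :: ((real^2) \<times> (real^2)) \<times> real. rect (fst (fst x)) (snd (fst x) - fst (fst x)) (snd x))"
  \<comment> \<open>A compact set that contains, besides the rectangles in question, only degenerate ones.\<close>
  define T where "T = \<Phi> ` B \<inter> {R. \<forall>i. R $ i \<in> \<gamma>}"
  have "compact (\<Phi> ` B)"
  proof (rule compact_continuous_image)
    show "continuous_on B \<Phi>" unfolding \<Phi>_def by (intro continuous_rect continuous_intros)
    show "compact B" unfolding B_def by (intro compact_Times compact_curve compact_Icc)
  qed
  moreover have "closed {R :: real^2^4. \<forall>i. R $ i \<in> \<gamma>}"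
  proof -
    have "closed ((\<lambda>R :: real^2^4. R $ i) -` \<gamma>)" for i
      by (intro closed_vimage compact_imp_closed compact_curve continuous_intros)
    then have "closed (\<Inter>i. (\<lambda>R :: real^2^4. R $ i) -` \<gamma>)" by blast
    moreover have "(\<Inter>i. (\<lambda>R :: real^2^4. R $ i) -` \<gamma>) = {R. \<forall>i. R $ i \<in> \<gamma>}" by auto
    ultimately show ?thesis by simp
  qed
  ultimately have cT: "compact T" unfolding T_def by (rule compact_Int_closed)
  have ST: "S \<subseteq> T"
  proof
    fix R assume R: "R \<in> S"
    then have c: "ccw_rectangle R" and g: "\<forall>i. R $ i \<in> \<gamma>" and l: "\<bar>lratio R\<bar> \<le> K" by (auto simp: S_def inscribed_rectangles_def)
    have "exp (-K) \<le> exp (lratio R)" "exp (lratio R) \<le> exp K" using l by auto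
    then have r: "aspect_ratio R \<in> {exp (-K)..exp K}" using exp_lratio[OF c] by simp
    have "R = \<Phi> ((R $ 0, R $ 1), aspect_ratio R)" using ccw_rectD(3)[OF c] by (simp add: \<Phi>_def)
    then show "R \<in> T" unfolding T_def B_def using g r by blast
  qed
  have iso: "near_edges L \<inter> S = {}" if L: "L \<in> T - S" for L
  proof -
    obtain z w r where zwr: "L = rect z (w - z) r" "r \<in> {exp (-K)..exp K}" using L by (auto simp: T_def B_def \<Phi>_def)
    have r: "r > 0" using zwr(2) by (meson atLeastAtMost_iff exp_gt_zero less_le_trans)
    have "w = z"
    proof (rule ccontr)
      assume "w \<noteq> z"
      then have "ccw_rectangle L" "aspect_ratio L = r" using ccw_rect[of "w - z" r z] r zwr(1) by auto
      moreover have "\<forall>i. L $ i \<in> \<gamma>" using L by (simp add: T_def)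
      moreover have "\<bar>ln r\<bar> \<le> K"
        using zwr(2) r ln_le_cancel_iff[of "exp (-K)" r] ln_le_cancel_iff[of r "exp K"] by auto
      ultimately have "L \<in> S" by (simp add: S_def inscribed_rectangles_def lratio_def)
      then show False using L by blast
    qed
    then have "\<forall>i. L $ i = z" unfolding all_4 zwr(1) by (simp add: eq_2_iff)
    then show ?thesis using no_rectangle_near_point[of L z] by (auto simp: S_def)
  qed
  have "S = T - (\<Union>L\<in>T - S. near_edges L)" using ST iso near_edges(2) by blast
  moreover have "compact (T - (\<Union>L\<in>T - S. near_edges L))"
    by (intro compact_diff cT open_UN ballI near_edges(1))
  ultimately show ?thesis unfolding S_def by simp
qed

sublocale flip: free_flip_space M lratio "relabel 1"
proof
  fix p assume p: "p \<in> M"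
  show "\<exists>e f. unit_chart M lratio e f \<and> f 0 = p" using vertex_free_chart[OF p] by metis
  show "relabel 1 p \<in> M" by (rule relabel_M[OF p])
  show "relabel 1 (relabel 1 (relabel 1 (relabel 1 p))) = p" by (simp add: relabel_add numeral_type_4)
  show "lratio (relabel 1 p) = - lratio p" by (rule lratio_relabel_1[OF p])
  show "relabel 1 (relabel 1 p) \<noteq> p"
  proof
    assume "relabel 1 (relabel 1 p) = p"
    then have "relabel 2 p $ 0 = p $ 0" by (simp add: relabel_add)
    then have eq: "p $ 2 = p $ 0" by (simp add: relabel_nth)
    have c: "ccw_rectangle p" using p M_iff by blast
    define u where "u = p $ 1 - p $ 0"
    have "p $ 2 = p $ 0 + u + aspect_ratio p *\<^sub>R perp u"
      using ccw_rectD(3)[OF c] rect_nth(3) unfolding u_def by metis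
    then have z: "u + aspect_ratio p *\<^sub>R perp u = 0" using eq by simp
    have "u \<bullet> (u + aspect_ratio p *\<^sub>R perp u) = u \<bullet> u" by (simp add: inner_2 algebra_simps)
    then have "u = 0" using z by simp
    then show False using ccw_rectD(1)[OF c] by (simp add: u_def)
  qed
  assume l: "lratio p = 0"
  have "regular_at p 1 (-1)" using regular_vertex_free[OF p square_vertex_free[OF p l]] .
  then obtain e f where f: "unit_chart M lratio e f" "f 0 = p" "\<And>t. 0 \<le> t \<and> t < e \<Longrightarrow> lratio (f t) = lratio p + 1 * t"
    "\<And>t. t \<le> 0 \<and> -e < t \<Longrightarrow> lratio (f t) = lratio p - (-1) * t" unfolding regular_at_def by blast
  have "lratio (f u) = u" if "\<bar>u\<bar> < e" for u using f(3)[of u] f(4)[of u] that l by (cases "0 \<le> u") auto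
  then show "\<exists>e f. unit_chart M lratio e f \<and> f 0 = p \<and> (\<forall>u. \<bar>u\<bar> < e \<longrightarrow> lratio (f u) = u)" using f(1,2) by blast
qed (use compact_bounded_ratio continuous_lratio continuous_relabel in auto)

end

section \<open>Limits at the ends of arcs\<close>

context generic_polygon begin

text \<open>
  The aspect ratios of rectangles with a corner at a given vertex are roots of finitely many quadratics, which are
  nonzero because all their positive roots are simple.
\<close>

lemma finite_vertex_ratios: "finite (lratio ` {R \<in> M. \<not> vertex_free R})"
proof -
  define T where "T = {(a, i1, i2, i3). a < N \<and> i1 < N \<and> i2 < N \<and> i3 < N \<and>
     \<not> (i1 \<in> {a, prv N a} \<and> i2 \<in> {a, prv N a} \<and> i3 \<in> {a, prv N a})}"
  define Z where "Z = (\<lambda>(a, i1, i2, i3). {r. Quad i1 i2 i3 (v a) r = 0})"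
  have "T \<subseteq> {..<N} \<times> {..<N} \<times> {..<N} \<times> {..<N}" by (auto simp: T_def)
  then have "finite T" by (rule finite_subset) simp
  moreover have "finite (Z x)" if x: "x \<in> T" for x
  proof -
    obtain a i1 i2 i3 where e: "x = (a, i1, i2, i3)" using prod_cases4 by blast
    then have t: "a < N" "i1 < N" "i2 < N" "i3 < N"
      "\<not> (i1 \<in> {a, prv N a} \<and> i2 \<in> {a, prv N a} \<and> i3 \<in> {a, prv N a})" using x by (auto simp: T_def)
    define q where "q = [:vq0 N v a i1 i2 i3, vq1 N v a i1 i2 i3, vq2 N v a i1 i2 i3:]"
    have Zq: "Z x = {r. poly q r = 0}"
      by (simp add: Z_def e q_def Quad_vertex power2_eq_square algebra_simps)
    have "q \<noteq> 0" using simple_root[OF t(1-4) _ t(5), of 1] by (auto simp: q_def)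
    then show ?thesis unfolding Zq by (rule poly_roots_finite)
  qed
  ultimately have "finite ((\<lambda>r. ln r) ` (\<Union>x\<in>T. Z x) \<union> (\<lambda>r. - ln r) ` (\<Union>x\<in>T. Z x))" by blast
  moreover have "lratio ` {R \<in> M. \<not> vertex_free R} \<subseteq> (\<lambda>r. ln r) ` (\<Union>x\<in>T. Z x) \<union> (\<lambda>r. - ln r) ` (\<Union>x\<in>T. Z x)"
  proof
    fix l assume "l \<in> lratio ` {R \<in> M. \<not> vertex_free R}"
    then obtain R where R: "R \<in> M" "\<not> vertex_free R" "l = lratio R" by blast
    obtain i a where a: "a < N" "R $ i = v a" using R(2) unfolding vertex_free_def by blast
    define S where "S = relabel i R"
    have S: "S \<in> M" "S $ 0 = v a" using relabel_M[OF R(1)] a(2) by (simp_all add: S_def relabel_nth)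
    obtain i1 i2 i3 where q: "(a, i1, i2, i3) \<in> T" "Quad i1 i2 i3 (v a) (aspect_ratio S) = 0"
      using Quad_vertex_zero[OF S(1) a(1) S(2)] a(1) unfolding T_def by blast
    have z: "aspect_ratio S \<in> (\<Union>x\<in>T. Z x)"
      by (rule UN_I[OF q(1)]) (simp add: Z_def q(2))
    have "lratio S = l \<or> lratio S = - l" using lratio_relabel[of i] R(1,3) unfolding S_def by auto
    then have "l = ln (aspect_ratio S) \<or> l = - ln (aspect_ratio S)" unfolding lratio_def by linarith
    then show "l \<in> (\<lambda>r. ln r) ` (\<Union>x\<in>T. Z x) \<union> (\<lambda>r. - ln r) ` (\<Union>x\<in>T. Z x)" using z by blast
  qed
  ultimately show ?thesis using finite_subset by blast
qed

lemma extreme_vertex_free: "\<exists>K. \<forall>R\<in>M. lratio R < K \<longrightarrow> vertex_free R"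
proof -
  obtain K where "\<forall>l\<in>lratio ` {R \<in> M. \<not> vertex_free R}. K \<le> l"
    using bounded_imp_bdd_below[OF finite_imp_bounded[OF finite_vertex_ratios]] unfolding bdd_below_def by blast
  then show ?thesis by (intro exI[of _ K]) force
qed

text \<open>
  The path \<open>c\<close> leaves through an end with aspect ratio tending to \<open>0\<close>, on the edges \<open>k\<close>, and converges to the
  degenerate rectangle \<open>L\<close>.
\<close>

definition path_end :: "(real \<Rightarrow> real^2^4) \<Rightarrow> (4 \<Rightarrow> nat) \<Rightarrow> real^2^4 \<Rightarrow> bool" where
  "path_end c k L \<longleftrightarrow> continuous_on UNIV c \<and> (\<forall>t. c t \<in> M) \<and> (\<forall>\<^sub>F t in at_top. sits k (c t)) \<and>
     (c \<longlongrightarrow> L) at_top \<and> filterlim (\<lambda>t. aspect_ratio (c t)) (at_right 0) at_top"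

text \<open>
  Rectangles of extreme aspect ratio have no corner at a vertex, so the edges on which \<open>c\<close> runs do not change any more. Then
  \<open>c\<close> runs on a single rational curve and is bounded.
\<close>

lemma path_end_exists:
  assumes c: "continuous_on UNIV c" "\<And>t. c t \<in> M" and lim: "filterlim (\<lambda>t. lratio (c t)) at_bot at_top"
  shows "\<exists>k L. path_end c k L"
proof -
  obtain K where K: "\<And>R. R \<in> M \<Longrightarrow> lratio R < K \<Longrightarrow> vertex_free R" using extreme_vertex_free by blast
  have "\<forall>\<^sub>F t in at_top. lratio (c t) < K" using lim by (simp add: filterlim_at_bot_dense)
  then obtain T where T: "\<And>t. t \<ge> T \<Longrightarrow> lratio (c t) < K" unfolding eventually_at_top_linorder by blast
  define \<kappa> where "\<kappa> t = (SOME k. sits k (c t))" for t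
  have \<kappa>: "sits (\<kappa> t) (c t)" for t using c(2)[of t] unfolding \<kappa>_def M_iff by (metis someI_ex)
  have "\<kappa> constant_on {T..}"
  proof (rule locally_constant_imp_constant)
    fix a assume a: "a \<in> {T..}"
    have vf: "vertex_free (c a)" using K[OF c(2) T] a by simp
    show "\<exists>W. openin (top_of_set {T..}) W \<and> a \<in> W \<and> (\<forall>t\<in>W. \<kappa> t = \<kappa> a)"
    proof (intro exI conjI ballI)
      show "openin (top_of_set {T..}) ({T..} \<inter> c -` near_edges (c a))"
        by (rule continuous_openin_preimage_gen[OF continuous_on_subset[OF c(1)] near_edges(1)]) simp
      show "a \<in> {T..} \<inter> c -` near_edges (c a)" using a near_edges(2) by simp
      fix t assume "t \<in> {T..} \<inter> c -` near_edges (c a)"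
      then have t: "c t \<in> near_edges (c a)" by simp
      show "\<kappa> t = \<kappa> a"
      proof
        fix i
        have "c a $ i \<in> edge N v (\<kappa> t i)" using near_edges(3)[OF t] \<kappa>[of t] by (simp add: sits_def)
        moreover have "c a $ i \<in> edge N v (\<kappa> a i)" using \<kappa>[of a] by (simp add: sits_def)
        ultimately show "\<kappa> t i = \<kappa> a i"
          using unique_edge[of "\<kappa> t i" "\<kappa> a i" "c a $ i"] \<kappa>[of a] \<kappa>[of t] vf by (auto simp: sits_def vertex_free_def)
      qed
    qed
  qed simp
  then obtain k where k: "\<And>t. t \<ge> T \<Longrightarrow> \<kappa> t = k" unfolding constant_on_def by auto
  have sk: "sits k (c t)" if "t \<ge> T" for t using \<kappa>[of t] k[OF that] by simp
  have cc: "ccw_rectangle (c t)" for t using c(2) M_iff by blast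
  have r0: "filterlim (\<lambda>t. aspect_ratio (c t)) (at_right 0) at_top"
    unfolding filterlim_at
  proof (intro conjI always_eventually allI)
    have "((\<lambda>t. exp (lratio (c t))) \<longlongrightarrow> 0) at_top" by (rule filterlim_compose[OF exp_at_bot lim])
    then show "((\<lambda>t. aspect_ratio (c t)) \<longlongrightarrow> 0) at_top" unfolding exp_lratio[OF cc] .
    show "aspect_ratio (c t) \<in> {0<..}" "aspect_ratio (c t) \<noteq> 0" for t using ccw_rectD(2)[OF cc, of t] by auto
  qed
  have det: "c t = curve k (aspect_ratio (c t))" if "t \<ge> T" for t using sits_determined(2)[OF cc sk[OF that]] .
  have "den k \<noteq> 0" using sits_determined(1)[OF cc sk, of T] by auto
  obtain B where B: "\<And>x. x \<in> \<gamma> \<Longrightarrow> norm x \<le> B"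
    using compact_imp_bounded[OF compact_curve] unfolding bounded_iff by blast
  have bd: "\<bar>c t $ i $ j\<bar> \<le> B" for t i j
  proof -
    have "c t $ i \<in> \<gamma>" using c(2)[of t] by (simp add: inscribed_rectangles_def)
    then show ?thesis using B component_le_norm_cart order_trans by blast
  qed
  have "\<exists>l. ((\<lambda>r. curve k r $ i $ j) \<longlongrightarrow> l) (at_right 0)" for i j
  proof (rule rat_bounded_imp_convergent)
    show "rat_over (den k) (\<lambda>r. curve k r $ i $ j)" using rat_over_curve unfolding rat_curve_def by blast
    show "den k \<noteq> 0" by fact
    show "\<exists>\<^sub>F r in at_right 0. \<bar>curve k r $ i $ j\<bar> \<le> B"
    proof (rule ccontr)
      assume "\<not> (\<exists>\<^sub>F r in at_right 0. \<bar>curve k r $ i $ j\<bar> \<le> B)"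
      then have "\<forall>\<^sub>F r in at_right 0. \<not> \<bar>curve k r $ i $ j\<bar> \<le> B" by (simp add: frequently_def)
      from eventually_compose_filterlim[OF this r0]
      have "\<forall>\<^sub>F t in at_top. \<not> \<bar>curve k (aspect_ratio (c t)) $ i $ j\<bar> \<le> B" .
      moreover have "\<forall>\<^sub>F t in at_top. t \<ge> T" by (rule eventually_ge_at_top)
      ultimately have "\<forall>\<^sub>F t :: real in at_top. False"
      proof eventually_elim
        case (elim t) then show ?case using bd[of t i j] det[of t] by simp
      qed
      then show False by simp
    qed
  qed
  then obtain l where l: "\<And>i j. ((\<lambda>r. curve k r $ i $ j) \<longlongrightarrow> l i j) (at_right 0)" by metis
  define L :: "real^2^4" where "L = (\<chi> i j. l i j)"
  have "(curve k \<longlongrightarrow> L) (at_right 0)"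
    by (intro vec_tendstoI) (simp add: L_def l)
  from filterlim_compose[OF this r0] have "((\<lambda>t. curve k (aspect_ratio (c t))) \<longlongrightarrow> L) at_top" .
  moreover have "\<forall>\<^sub>F t in at_top. curve k (aspect_ratio (c t)) = c t"
    using eventually_ge_at_top[of T] by eventually_elim (simp flip: det)
  ultimately have cL: "(c \<longlongrightarrow> L) at_top" by (rule Lim_transform_eventually)
  have "\<forall>\<^sub>F t in at_top. sits k (c t)" using eventually_ge_at_top[of T] by eventually_elim (rule sk)
  then show ?thesis unfolding path_end_def using c r0 cL by blast
qed

text \<open>
  The short sides shrink, and their direction tends to the normal of the limiting chord.
\<close>

lemma path_end_direction:
  assumes "path_end c k L"
  shows "((\<lambda>t. (1 / aspect_ratio (c t)) *\<^sub>R (c t $ 3 - c t $ 0)) \<longlongrightarrow> perp (L $ 1 - L $ 0)) at_top"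
    "L $ 3 = L $ 0" "L $ 2 = L $ 1"
proof -
  have c: "\<And>t. ccw_rectangle (c t)" and L: "(c \<longlongrightarrow> L) at_top" and r: "((\<lambda>t. aspect_ratio (c t)) \<longlongrightarrow> 0) at_top"
    using assms M_iff unfolding path_end_def filterlim_at by blast+
  have Li: "((\<lambda>t. c t $ i) \<longlongrightarrow> L $ i) at_top" for i using L by (rule tendsto_vec_nth)
  have p: "((\<lambda>t. perp (c t $ 1 - c t $ 0)) \<longlongrightarrow> perp (L $ 1 - L $ 0)) at_top"
    by (intro bounded_linear.tendsto[OF bounded_linear_perp] tendsto_intros Li)
  have e3: "c t $ 3 - c t $ 0 = aspect_ratio (c t) *\<^sub>R perp (c t $ 1 - c t $ 0)" for t
    using arg_cong[OF ccw_rectD(3)[OF c[of t]], of "\<lambda>R. R $ 3"] by simp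
  have e2: "c t $ 2 - c t $ 1 = aspect_ratio (c t) *\<^sub>R perp (c t $ 1 - c t $ 0)" for t
    using arg_cong[OF ccw_rectD(3)[OF c[of t]], of "\<lambda>R. R $ 2"] by simp
  have "aspect_ratio (c t) \<noteq> 0" for t using ccw_rectD(2)[OF c, of t] by simp
  then have "(1 / aspect_ratio (c t)) *\<^sub>R (c t $ 3 - c t $ 0) = perp (c t $ 1 - c t $ 0)" for t unfolding e3 by simp
  then show "((\<lambda>t. (1 / aspect_ratio (c t)) *\<^sub>R (c t $ 3 - c t $ 0)) \<longlongrightarrow> perp (L $ 1 - L $ 0)) at_top" using p by simp
  have "((\<lambda>t. aspect_ratio (c t) *\<^sub>R perp (c t $ 1 - c t $ 0)) \<longlongrightarrow> 0 *\<^sub>R perp (L $ 1 - L $ 0)) at_top"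
    by (intro tendsto_intros r p)
  then have z: "((\<lambda>t. aspect_ratio (c t) *\<^sub>R perp (c t $ 1 - c t $ 0)) \<longlongrightarrow> 0) at_top" by simp
  have "((\<lambda>t. c t $ 3 - c t $ 0) \<longlongrightarrow> L $ 3 - L $ 0) at_top" by (intro tendsto_intros Li)
  then have "L $ 3 - L $ 0 = 0" unfolding e3 using z tendsto_unique trivial_limit_at_top_linorder by blast
  then show "L $ 3 = L $ 0" by simp
  have "((\<lambda>t. c t $ 2 - c t $ 1) \<longlongrightarrow> L $ 2 - L $ 1) at_top" by (intro tendsto_intros Li)
  then have "L $ 2 - L $ 1 = 0" unfolding e2 using z tendsto_unique trivial_limit_at_top_linorder by blast
  then show "L $ 2 = L $ 1" by simp
qed

lemma path_end_limit:
  assumes pe: "path_end c k L"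
  shows "sits k L" "L $ 0 \<noteq> L $ 1" "L $ i \<in> \<gamma>" "card {k 0, k 1, k 2, k 3} \<ge> 3"
proof -
  have c: "\<And>t. c t \<in> M" and L: "(c \<longlongrightarrow> L) at_top" and s: "\<forall>\<^sub>F t in at_top. sits k (c t)"
    using pe unfolding path_end_def by blast+
  have Li: "((\<lambda>t. c t $ i) \<longlongrightarrow> L $ i) at_top" for i using L by (rule tendsto_vec_nth)
  obtain t0 where t0: "sits k (c t0)" using eventually_happens'[OF trivial_limit_at_top_linorder s] by blast
  show "card {k 0, k 1, k 2, k 3} \<ge> 3" using three_edges[OF _ t0] c[of t0] M_iff by blast
  show "L $ i \<in> \<gamma>" for i
    by (rule Lim_in_closed_set[OF compact_imp_closed[OF compact_curve] _ _ Li])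
      (use c in \<open>auto simp: inscribed_rectangles_def\<close>)
  have "L $ i \<in> edge N v (k i)" for i
  proof (rule Lim_in_closed_set[OF _ _ _ Li])
    show "\<forall>\<^sub>F t in at_top. c t $ i \<in> edge N v (k i)" using s by eventually_elim (simp add: sits_def)
  qed (auto intro: closed_segment)
  then show "sits k L" using t0 by (simp add: sits_def)
  show "L $ 0 \<noteq> L $ 1"
  proof
    assume eq: "L $ 0 = L $ 1"
    have "\<forall>i. L $ i = L $ 0" unfolding all_4 using path_end_direction(2,3)[OF pe] eq by simp
    moreover have "\<forall>\<^sub>F t in at_top. c t \<in> near_edges L" using L near_edges(1,2) by (rule topological_tendstoD)
    then obtain t where "c t \<in> near_edges L" using eventually_happens'[OF trivial_limit_at_top_linorder] by blast
    ultimately show False using no_rectangle_near_point c by blast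
  qed
qed

text \<open>
  The normal of the chord is the limit of the direction from corner 0 to corner 3. If this direction
  stays on one side of edge \<open>k 0\<close> (or \<open>k 3\<close>), then so does the normal, which is expressed by the dot product of the
  edge with the chord.
\<close>

lemma path_end_sign:
  assumes pe: "path_end c k L"
  defines "w \<equiv> L $ 1 - L $ 0"
  shows "(\<And>x. x \<in> edge N v (k 3) \<Longrightarrow> 0 \<le> s * cross2 (dir N v (k 0)) (x - L $ 0)) \<Longrightarrow> 0 \<le> s * (dir N v (k 0) \<bullet> w)"
    "(\<And>x. x \<in> edge N v (k 0) \<Longrightarrow> 0 \<le> s * cross2 (dir N v (k 3)) (L $ 0 - x)) \<Longrightarrow> 0 \<le> s * (dir N v (k 3) \<bullet> w)"
proof -
  have c: "\<And>t. ccw_rectangle (c t)" and s: "\<forall>\<^sub>F t in at_top. sits k (c t)" using pe M_iff unfolding path_end_def by blast+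
  have kL: "off (k i) (L $ i) = 0" for i using sits_on_lines[OF path_end_limit(1)[OF pe]] by (simp add: on_lines_def)
  have kL0: "off (k 0) (L $ 0) = 0" "off (k 3) (L $ 0) = 0" using kL[of 0] kL[of 3] path_end_direction(2)[OF pe] by simp_all
  have "0 \<le> s * (d \<bullet> w)" if ev: "\<And>t. sits k (c t) \<Longrightarrow> 0 \<le> s * cross2 d (c t $ 3 - c t $ 0)" for d
  proof -
    define y where "y t = (1 / aspect_ratio (c t)) *\<^sub>R (c t $ 3 - c t $ 0)" for t
    have "(y \<longlongrightarrow> perp w) at_top" using path_end_direction(1)[OF pe] unfolding y_def w_def .
    then have "((\<lambda>t. s * cross2 d (y t)) \<longlongrightarrow> s * cross2 d (perp w)) at_top"
      unfolding cross2_def by (intro tendsto_intros)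
    moreover have "\<forall>\<^sub>F t in at_top. 0 \<le> s * cross2 d (y t)"
      using s
    proof eventually_elim
      case (elim t)
      have "s * cross2 d (y t) = (1 / aspect_ratio (c t)) * (s * cross2 d (c t $ 3 - c t $ 0))"
        unfolding y_def cross2_def by (simp add: algebra_simps)
      then show ?case using ev[OF elim] ccw_rectD(2)[OF c, of t] by simp
    qed
    ultimately have "0 \<le> s * cross2 d (perp w)" using tendsto_lowerbound trivial_limit_at_top_linorder by blast
    then show ?thesis by (simp add: cross2_perp)
  qed note limit = this
  show "0 \<le> s * (dir N v (k 0) \<bullet> w)" if x: "\<And>x. x \<in> edge N v (k 3) \<Longrightarrow> 0 \<le> s * cross2 (dir N v (k 0)) (x - L $ 0)"
  proof (rule limit)
    fix t assume t: "sits k (c t)"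
    have "off (k 0) (c t $ 0) = 0" using sits_on_lines[OF t] by (simp add: on_lines_def)
    then have "cross2 (dir N v (k 0)) (c t $ 3 - c t $ 0) = cross2 (dir N v (k 0)) (c t $ 3 - L $ 0)"
      using kL0(1) unfolding off_def cross2_def by (simp add: algebra_simps)
    then show "0 \<le> s * cross2 (dir N v (k 0)) (c t $ 3 - c t $ 0)" using x[of "c t $ 3"] t by (simp add: sits_def)
  qed
  show "0 \<le> s * (dir N v (k 3) \<bullet> w)" if x: "\<And>x. x \<in> edge N v (k 0) \<Longrightarrow> 0 \<le> s * cross2 (dir N v (k 3)) (L $ 0 - x)"
  proof (rule limit)
    fix t assume t: "sits k (c t)"
    have "off (k 3) (c t $ 3) = 0" using sits_on_lines[OF t] by (simp add: on_lines_def)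
    then have "cross2 (dir N v (k 3)) (c t $ 3 - c t $ 0) = cross2 (dir N v (k 3)) (L $ 0 - c t $ 0)"
      using kL0(2) unfolding off_def cross2_def by (simp add: algebra_simps)
    then show "0 \<le> s * cross2 (dir N v (k 3)) (c t $ 3 - c t $ 0)" using x[of "c t $ 0"] t by (simp add: sits_def)
  qed
qed

text \<open>
  Here \<open>path_end_sign\<close> applies with both signs.
\<close>

lemma path_end_parallel:
  assumes pe: "path_end c k L" and eq: "k 0 = k 3"
  shows "dir N v (k 0) \<bullet> (L $ 1 - L $ 0) = 0"
proof -
  have "off (k 0) (L $ 0) = 0" using sits_on_lines[OF path_end_limit(1)[OF pe]] by (simp add: on_lines_def)
  have 0: "s * cross2 (dir N v (k 0)) (x - L $ 0) = 0" if "x \<in> edge N v (k 3)" for x s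
  proof -
    have "cross2 (dir N v (k 0)) (x - L $ 0) = 0"
      using off_edge[OF that] eq \<open>off (k 0) (L $ 0) = 0\<close> unfolding off_def cross2_def by (simp add: algebra_simps)
    then show ?thesis by simp
  qed
  have "0 \<le> 1 * (dir N v (k 0) \<bullet> (L $ 1 - L $ 0))" by (rule path_end_sign(1)[OF pe]) (simp only: 0 order_refl)
  moreover have "0 \<le> -1 * (dir N v (k 0) \<bullet> (L $ 1 - L $ 0))" by (rule path_end_sign(1)[OF pe]) (simp only: 0 order_refl)
  ultimately show ?thesis by linarith
qed

lemma path_end_relabel_2:
  assumes pe: "path_end c k L" shows "path_end (\<lambda>t. relabel 2 (c t)) (\<lambda>i. k (i + 2)) (relabel 2 L)"
proof -
  have c: "\<And>t. c t \<in> M" "continuous_on UNIV c" "(c \<longlongrightarrow> L) at_top" "\<forall>\<^sub>F t in at_top. sits k (c t)"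
    "filterlim (\<lambda>t. aspect_ratio (c t)) (at_right 0) at_top" using pe unfolding path_end_def by blast+
  have "lratio (relabel 2 R) = lratio R" if "R \<in> M" for R
    using lratio_relabel_1[OF that] lratio_relabel_1[OF relabel_M[OF that, of 1]] by (simp add: relabel_add)
  then have ar: "aspect_ratio (relabel 2 (c t)) = aspect_ratio (c t)" for t
    using exp_lratio c(1) relabel_M M_iff by metis
  have ev: "\<forall>\<^sub>F t in at_top. sits (\<lambda>i. k (i + 2)) (relabel 2 (c t))" using c(4) by eventually_elim (rule sits_relabel)
  have "isCont (relabel 2) L" using continuous_relabel[of UNIV 2] by (simp add: continuous_on_eq_continuous_at)
  then have lim: "((\<lambda>t. relabel 2 (c t)) \<longlongrightarrow> relabel 2 L) at_top" using c(3) isCont_tendsto_compose by blast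
  have co: "continuous_on UNIV (\<lambda>t. relabel 2 (c t))"
    by (rule continuous_on_compose2[OF continuous_relabel c(2)]) auto
  show ?thesis unfolding path_end_def ar using co ev lim c(1,5) relabel_M by blast
qed

lemma edge_at_vertex_params:
  assumes "a < N"
  shows "x \<in> edge N v a \<Longrightarrow> \<exists>l\<ge>0. x - v a = l *\<^sub>R dir N v a"
    "x \<in> edge N v (prv N a) \<Longrightarrow> \<exists>l\<ge>0. x - v a = - (l *\<^sub>R dir N v (prv N a))"
proof -
  show "\<exists>l\<ge>0. x - v a = l *\<^sub>R dir N v a" if x: "x \<in> edge N v a"
  proof -
    obtain l where "l \<in> {0..1}" "x = v a + l *\<^sub>R dir N v a" using x edge_iff by blast
    then show ?thesis by (intro exI[of _ l]) simp
  qed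
  show "\<exists>l\<ge>0. x - v a = - (l *\<^sub>R dir N v (prv N a))" if x: "x \<in> edge N v (prv N a)"
  proof -
    obtain l where "l \<in> {0..1}" "x = v (prv N a) + l *\<^sub>R dir N v (prv N a)" using x edge_iff by blast
    moreover have "v a = v (prv N a) + dir N v (prv N a)" by (simp add: dir_def nxt_prv[OF assms])
    ultimately show ?thesis by (intro exI[of _ "1 - l"]) (simp add: algebra_simps)
  qed
qed

lemma orthogonal_to_two_edges:
  assumes "i < N" "j < N" "i \<noteq> j" "dir N v i \<bullet> w = 0" "dir N v j \<bullet> w = 0" shows "w = 0"
proof -
  have "perp w = 0"
    using zero_if_cross2_zero[of "dir N v i" "perp w" "dir N v j"] assms crs_nz[OF assms(1-3)] by (simp add: cross2_perp crs_def)
  then have "norm w = 0" using norm_perp[of w] by simp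
  then show ?thesis by simp
qed

text \<open>
  At a chord that starts at a vertex the two converging corners are on different edges. Otherwise the chord is orthogonal to one of them, which is
  excluded by \<open>vdot_nz\<close> if it ends at a vertex, and by the fact that it would be orthogonal to two edges if not.
\<close>

lemma path_end_edges_at_vertex:
  assumes pe: "path_end c k L" and a: "a < N" "L $ 0 = v a"
  shows "(k 0 = a \<and> k 3 = prv N a) \<or> (k 0 = prv N a \<and> k 3 = a)"
proof -
  have sL: "\<And>i. k i < N" "\<And>i. L $ i \<in> edge N v (k i)" using path_end_limit(1)[OF pe] by (simp_all add: sits_def)
  have L3: "L $ 3 = v a" "L $ 2 = L $ 1" using path_end_direction(2,3)[OF pe] a(2) by simp_all
  have k03: "k 0 \<in> {a, prv N a}" "k 3 \<in> {a, prv N a}"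
    using edges_at_vertex[OF a(1) sL(1)] sL(2)[of 0] sL(2)[of 3] a(2) L3(1) by auto
  have "k 0 \<noteq> k 3"
  proof
    assume eq: "k 0 = k 3"
    have orth: "dir N v (k 0) \<bullet> (L $ 1 - L $ 0) = 0" by (rule path_end_parallel[OF pe eq])
    have ne: "L $ 0 \<noteq> L $ 1" by (rule path_end_limit(2)[OF pe])
    show False
    proof (cases "\<exists>b<N. L $ 1 = v b")
      case True
      then obtain b where b: "b < N" "L $ 1 = v b" by blast
      then have "b \<noteq> a" using ne a(2) by auto
      then show False using vdot_nz[OF sL(1)[of 0] b(1) a(1)] orth a(2) b(2) by (simp add: vdot_def)
    next
      case False
      then have k12: "k 1 = k 2" using unique_edge[OF sL(1) sL(1) sL(2)[of 1], of 2] sL(2)[of 2] L3(2) by auto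
      have "dir N v (k 2) \<bullet> (L $ 3 - L $ 2) = 0"
        using path_end_parallel[OF path_end_relabel_2[OF pe]] k12 by (simp add: relabel_nth numeral_type_4)
      then have "dir N v (k 2) \<bullet> (L $ 1 - L $ 0) = 0"
        using L3 a(2) by (simp add: inner_diff_right)
      moreover have "k 0 \<noteq> k 2"
      proof
        assume "k 0 = k 2"
        then have "card {k 0, k 1, k 2, k 3} = 1" using eq k12 by simp
        then show False using path_end_limit(4)[OF pe] by simp
      qed
      ultimately have "L $ 1 - L $ 0 = 0" using orthogonal_to_two_edges[OF sL(1) sL(1) _ orth] by blast
      then show False using ne by simp
    qed
  qed
  then show ?thesis using k03 by auto
qed

text \<open>
  At a vertex it remains to tell which of the two corners is on which edge. This is decided by the signs of
  the dot products of the chord with the two edges, by \<open>path_end_sign\<close>; both possibilities together would make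
  the chord orthogonal to both edges.
\<close>

lemma path_end_unique_0:
  assumes pe: "path_end c k L" and pe': "path_end c' k' L"
  shows "k 0 = k' 0 \<and> k 3 = k' 3"
proof -
  have sL: "\<And>i. k i < N" "\<And>i. L $ i \<in> edge N v (k i)" using path_end_limit(1)[OF pe] by (simp_all add: sits_def)
  have sL': "\<And>i. k' i < N" "\<And>i. L $ i \<in> edge N v (k' i)" using path_end_limit(1)[OF pe'] by (simp_all add: sits_def)
  have L3: "L $ 3 = L $ 0" using path_end_direction(2)[OF pe] .
  show ?thesis
  proof (cases "\<exists>a<N. L $ 0 = v a")
    case False
    then show ?thesis using unique_edge[OF sL(1) sL'(1) sL(2) sL'(2), of 0] unique_edge[OF sL(1) sL'(1) sL(2) sL'(2), of 3] L3 by auto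
  next
    case True
    then obtain a where a: "a < N" "L $ 0 = v a" by blast
    define b where "b = prv N a"
    have b: "b < N" "a \<noteq> b" using prv_less[OF a(1)] prv_neq[OF N_ge a(1)] by (auto simp: b_def)
    define w where "w = L $ 1 - L $ 0"
    define q where "q = crs N v a b"
    have q0: "q \<noteq> 0" using crs_nz[OF a(1) b] by (simp add: q_def)
    have qc: "cross2 (dir N v a) (dir N v b) = q" "cross2 (dir N v b) (dir N v a) = - q"
      by (simp_all add: q_def crs_def cross2_def)
    have cs: "cross2 d (l *\<^sub>R e) = l * cross2 d e" "cross2 d (- (l *\<^sub>R e)) = - (l * cross2 d e)" for d e l
      by (simp_all add: cross2_def algebra_simps)
    have sq: "0 \<le> l * (q * q)" if "l \<ge> 0" for l :: real using that by simp
    \<comment> \<open>The two arrangements of the corners 0 and 3 on the edges \<open>a\<close> and \<open>b\<close>.\<close>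
    have A: "0 \<le> - q * (dir N v a \<bullet> w) \<and> 0 \<le> q * (dir N v b \<bullet> w)" if pc: "path_end c k L" "k 0 = a" "k 3 = b" for c k
    proof
      show "0 \<le> - q * (dir N v a \<bullet> w)" unfolding w_def pc(2)[symmetric]
      proof (rule path_end_sign(1)[OF pc(1)])
        fix x assume "x \<in> edge N v (k 3)"
        then obtain l where l: "l \<ge> 0" "x - L $ 0 = - (l *\<^sub>R dir N v b)" using edge_at_vertex_params(2)[OF a(1)] pc(3) a(2) b_def by metis
        show "0 \<le> - q * cross2 (dir N v (k 0)) (x - L $ 0)"
          unfolding pc(2) l(2) cs qc using sq[OF l(1)] by (simp add: algebra_simps)
      qed
      show "0 \<le> q * (dir N v b \<bullet> w)" unfolding w_def pc(3)[symmetric]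
      proof (rule path_end_sign(2)[OF pc(1)])
        fix x assume "x \<in> edge N v (k 0)"
        then obtain l where l: "l \<ge> 0" "x - L $ 0 = l *\<^sub>R dir N v a" using edge_at_vertex_params(1)[OF a(1)] pc(2) a(2) by metis
        then have l2: "L $ 0 - x = - (l *\<^sub>R dir N v a)" by (metis minus_diff_eq)
        show "0 \<le> q * cross2 (dir N v (k 3)) (L $ 0 - x)"
          unfolding pc(3) l2 cs qc using sq[OF l(1)] by (simp add: algebra_simps)
      qed
    qed
    have B: "0 \<le> - q * (dir N v b \<bullet> w) \<and> 0 \<le> q * (dir N v a \<bullet> w)" if pc: "path_end c k L" "k 0 = b" "k 3 = a" for c k
    proof
      show "0 \<le> - q * (dir N v b \<bullet> w)" unfolding w_def pc(2)[symmetric]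
      proof (rule path_end_sign(1)[OF pc(1)])
        fix x assume "x \<in> edge N v (k 3)"
        then obtain l where l: "l \<ge> 0" "x - L $ 0 = l *\<^sub>R dir N v a" using edge_at_vertex_params(1)[OF a(1)] pc(3) a(2) by metis
        show "0 \<le> - q * cross2 (dir N v (k 0)) (x - L $ 0)"
          unfolding pc(2) l(2) cs qc using sq[OF l(1)] by (simp add: algebra_simps)
      qed
      show "0 \<le> q * (dir N v a \<bullet> w)" unfolding w_def pc(3)[symmetric]
      proof (rule path_end_sign(2)[OF pc(1)])
        fix x assume "x \<in> edge N v (k 0)"
        then obtain l where l: "l \<ge> 0" "x - L $ 0 = - (l *\<^sub>R dir N v b)" using edge_at_vertex_params(2)[OF a(1)] pc(2) a(2) b_def by metis
        then have l2: "L $ 0 - x = l *\<^sub>R dir N v b" by (metis add.inverse_inverse minus_diff_eq)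
        show "0 \<le> q * cross2 (dir N v (k 3)) (L $ 0 - x)"
          unfolding pc(3) l2 cs qc using sq[OF l(1)] by (simp add: algebra_simps)
      qed
    qed
    have clash: False if "path_end c1 k1 L" "k1 0 = a" "k1 3 = b" "path_end c2 k2 L" "k2 0 = b" "k2 3 = a" for c1 k1 c2 k2
    proof -
      have "q * (dir N v a \<bullet> w) = 0" "q * (dir N v b \<bullet> w) = 0" using A[OF that(1-3)] B[OF that(4-6)] by linarith+
      then have "w = 0" using orthogonal_to_two_edges[OF a(1) b] q0 by simp
      then show False using path_end_limit(2)[OF pe] by (simp add: w_def)
    qed
    show ?thesis
      using path_end_edges_at_vertex[OF pe a, folded b_def] path_end_edges_at_vertex[OF pe' a, folded b_def]
        clash[OF pe _ _ pe'] clash[OF pe' _ _ pe] by metis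
  qed
qed

lemma path_end_unique:
  assumes pe: "path_end c k L" and pe': "path_end c' k' L"
  shows "k = k'"
proof -
  have "k 2 = k' 2 \<and> k 1 = k' 1"
    using path_end_unique_0[OF path_end_relabel_2[OF pe] path_end_relabel_2[OF pe']] by (simp add: numeral_type_4)
  then have "\<forall>i. k i = k' i" unfolding all_4 using path_end_unique_0[OF pe pe'] by blast
  then show ?thesis by blast
qed

text \<open>
  Both paths attain all small aspect ratios, and at equal aspect ratio they are at the same point of the curve.
\<close>

lemma path_ends_meet:
  assumes pe: "path_end c k L" and pe': "path_end c' k' L"
  shows "\<exists>t>0. \<exists>t'>0. c t = c' t'"
proof -
  have attain: "\<exists>T0>0. \<forall>r. 0 < r \<and> r < T0 \<longrightarrow> (\<exists>t>0. c t = curve k r)" if pe: "path_end c k L" for c k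
  proof -
    have c: "\<And>t. c t \<in> M" "continuous_on UNIV c" "\<forall>\<^sub>F t in at_top. sits k (c t)"
      "((\<lambda>t. aspect_ratio (c t)) \<longlongrightarrow> 0) at_top" using pe unfolding path_end_def filterlim_at by blast+
    have cc: "ccw_rectangle (c t)" for t using c(1) M_iff by blast
    have ca: "continuous_on A (\<lambda>t. aspect_ratio (c t))" for A
      by (rule continuous_on_compose2[OF continuous_aspect_ratio]) (use c(1,2) in \<open>auto intro: continuous_on_subset\<close>)
    have "\<forall>\<^sub>F t in at_top. sits k (c t) \<and> t > 0" using c(3) eventually_gt_at_top by (rule eventually_conj)
    then obtain T where T: "\<And>t. t \<ge> T \<Longrightarrow> sits k (c t) \<and> t > 0" unfolding eventually_at_top_linorder by blast
    have "\<exists>t>0. c t = curve k r" if r: "0 < r" "r < aspect_ratio (c T)" for r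
    proof -
      have "\<forall>\<^sub>F t in at_top. aspect_ratio (c t) < r \<and> t \<ge> T"
        using order_tendstoD(2)[OF c(4) r(1)] eventually_ge_at_top by (rule eventually_conj)
      then obtain T2 where T2: "aspect_ratio (c T2) < r" "T2 \<ge> T"
        using eventually_happens'[OF trivial_limit_at_top_linorder] by blast
      obtain t where t: "T \<le> t" "t \<le> T2" "aspect_ratio (c t) = r"
        using IVT2'[of "\<lambda>t. aspect_ratio (c t)" T2 r T, OF _ _ T2(2) ca] T2(1) r(2) by auto
      have "c t = curve k r" using sits_determined(2)[OF cc[of t], of k] T[OF t(1)] t(3) by metis
      then show ?thesis using T[OF t(1)] by blast
    qed
    then show ?thesis using ccw_rectD(2)[OF cc] by blast
  qed
  have kk: "k' = k" using path_end_unique[OF pe' pe] .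
  obtain A where A: "A > 0" "\<And>r. 0 < r \<and> r < A \<Longrightarrow> \<exists>t>0. c t = curve k r" using attain[OF pe] by blast
  obtain B where B: "B > 0" "\<And>r. 0 < r \<and> r < B \<Longrightarrow> \<exists>t>0. c' t = curve k r" using attain[OF pe'[unfolded kk]] by blast
  define r where "r = min A B / 2"
  have r: "0 < r \<and> r < A" "0 < r \<and> r < B" using A(1) B(1) by (auto simp: r_def)
  show ?thesis using A(2)[OF r(1)] B(2)[OF r(2)] by metis
qed

text \<open>
  The same chord can occur with its endpoints exchanged, which amounts to relabeling by two steps.
\<close>

lemma path_ends_equal_chords_meet:
  assumes pe: "path_end c k L" and pe': "path_end c' k' L'"
    and eq: "closed_segment (L $ 0) (L $ 1) = closed_segment (L' $ 0) (L' $ 1)"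
  shows "\<exists>a. \<exists>t>0. \<exists>t'>0. relabel a (c t) = c' t'"
proof -
  note d = path_end_direction(2,3)[OF pe] path_end_direction(2,3)[OF pe']
  have "{L $ 0, L $ 1} = {L' $ 0, L' $ 1}" using eq closed_segment_eq by blast
  then consider "L $ 0 = L' $ 0" "L $ 1 = L' $ 1" | "L $ 0 = L' $ 1" "L $ 1 = L' $ 0" by (auto simp: doubleton_eq_iff)
  then show ?thesis
  proof cases
    case 1
    have "\<forall>i. L $ i = L' $ i" unfolding all_4 using d 1 by simp
    then have "L = L'" by (simp add: vec_eq_iff)
    then have "\<exists>t>0. \<exists>t'>0. c t = c' t'" using path_ends_meet pe pe' by blast
    then show ?thesis using relabel_0 by metis
  next
    case 2
    have "\<forall>i. relabel 2 L $ i = L' $ i" unfolding all_4 relabel_nth using d 2 by (simp add: numeral_type_4)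
    then have e: "relabel 2 L = L'" by (rule iffD2[OF vec_eq_iff])
    show ?thesis using path_ends_meet[OF path_end_relabel_2[OF pe, unfolded e] pe'] by blast
  qed
qed

end

section \<open>Proper arcs and the count of squares\<close>

text \<open>
  An increasing homeomorphism from the unit interval to the line.
\<close>

definition stretch :: "real \<Rightarrow> real" where "stretch t = tan (pi * (t - 1/2))"

lemma stretch_arctan: assumes "0 < t" "t < 1" shows "arctan (stretch t) = pi * (t - 1/2)"
proof -
  have "pi * (- 1/2) < pi * (t - 1/2)" "pi * (t - 1/2) < pi * (1/2)" using assms by (intro mult_strict_left_mono; simp)+
  then show ?thesis unfolding stretch_def by (intro arctan_tan) simp_all
qed

lemma arctan_over_pi: "- (1/2) < arctan x / pi" "arctan x / pi < 1/2"
  using arctan_lbound[of x] arctan_ubound[of x] by (auto simp: field_simps)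

lemma stretch_homeomorphism: "homeomorphism {0<..<1} UNIV stretch (\<lambda>x. arctan x / pi + 1/2)"
proof (rule homeomorphismI)
  have "cos (pi * (t - 1/2)) \<noteq> 0" if "t \<in> {0<..<1}" for t
  proof -
    have "pi * (- 1/2) < pi * (t - 1/2)" "pi * (t - 1/2) < pi * (1/2)" using that by (intro mult_strict_left_mono; simp)+
    then have "cos (pi * (t - 1/2)) > 0" by (intro cos_gt_zero_pi) simp_all
    then show ?thesis by simp
  qed
  then show "continuous_on {0<..<1} stretch" unfolding stretch_def by (intro continuous_on_tan continuous_intros) auto
  show "continuous_on UNIV (\<lambda>x. arctan x / pi + 1/2)" by (intro continuous_intros) simp_all
  show "(\<lambda>x. arctan x / pi + 1/2) ` UNIV \<subseteq> {0<..<1}"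
  proof
    fix y assume "y \<in> (\<lambda>x. arctan x / pi + 1/2) ` UNIV"
    then obtain x where y: "y = arctan x / pi + 1/2" by blast
    show "y \<in> {0<..<1}" unfolding y greaterThanLessThan_iff using arctan_over_pi[of x] by (intro conjI; linarith)
  qed
  show "arctan (stretch t) / pi + 1/2 = t" if "t \<in> {0<..<1}" for t using stretch_arctan[of t] that by simp
  show "stretch (arctan x / pi + 1/2) = x" for x by (simp add: stretch_def tan_arctan)
qed simp

lemma stretch_ends: "filterlim stretch at_top (at_left 1)" "filterlim (\<lambda>t. - stretch t) at_top (at_right 0)"
proof -
  have ge: "Z \<le> stretch t" if "0 < t" "t < 1" "arctan Z / pi + 1/2 \<le> t" for Z t
  proof -
    have "arctan Z \<le> pi * (t - 1/2)" using that(3) pi_gt_zero by (simp add: field_simps)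
    then show ?thesis using stretch_arctan[OF that(1,2)] by (metis arctan_le_iff)
  qed
  have le: "stretch t \<le> Z" if "0 < t" "t < 1" "t \<le> arctan Z / pi + 1/2" for Z t
  proof -
    have "pi * (t - 1/2) \<le> arctan Z" using that(3) pi_gt_zero by (simp add: field_simps)
    then show ?thesis using stretch_arctan[OF that(1,2)] by (metis arctan_le_iff)
  qed
  have lb: "0 < arctan Z / pi + 1/2" "arctan Z / pi + 1/2 < 1" for Z
    using arctan_over_pi[of Z] by linarith+
  show "filterlim stretch at_top (at_left 1)"
    unfolding filterlim_at_top
  proof
    fix Z
    have "0 < t \<and> t < 1 \<and> arctan Z / pi + 1/2 \<le> t" if "t > arctan Z / pi + 1/2" "t < 1" for t using that lb[of Z] by auto
    then show "\<forall>\<^sub>F t in at_left 1. Z \<le> stretch t"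
      unfolding eventually_at_left[OF lb(2)[of Z]] using lb(2)[of Z] ge by blast
  qed
  show "filterlim (\<lambda>t. - stretch t) at_top (at_right 0)"
    unfolding filterlim_at_top
  proof
    fix Z
    have a: "0 < t \<and> t < 1 \<and> t \<le> arctan (-Z) / pi + 1/2" if "t > 0" "t < arctan (-Z) / pi + 1/2" for t using that lb[of "-Z"] by auto
    have "Z \<le> - stretch t" if "t > 0" "t < arctan (-Z) / pi + 1/2" for t using le[of t "-Z"] a[OF that] by auto
    then show "\<forall>\<^sub>F t in at_right 0. Z \<le> - stretch t"
      unfolding eventually_at_right[OF lb(1)[of "-Z"]] using lb(1)[of "-Z"] by blast
  qed
qed

lemma open_arc_not_compact:
  assumes "C homeomorphic {0<..<1::real}" shows "\<not> compact C"
proof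
  assume "compact C"
  then have "compact {0<..<1::real}" using homeomorphic_compactness[OF assms] by blast
  then have "closed {0<..<1::real}" by (rule compact_imp_closed)
  then have "{0..1::real} = {0<..<1}" using closure_greaterThanLessThan[of 0 "1::real"] by (simp add: closure_closed)
  then have "(0::real) \<in> {0<..<1}" by (metis atLeastAtMost_iff order_refl zero_le_one)
  then show False by simp
qed

context generic_polygon begin

lemma range_relabel_vertices: "range (\<lambda>i. relabel a L $ i) = range (\<lambda>i. L $ i)"
proof
  show "range (\<lambda>i. relabel a L $ i) \<subseteq> range (\<lambda>i. L $ i)" by (auto simp: relabel_nth)
  show "range (\<lambda>i. L $ i) \<subseteq> range (\<lambda>i. relabel a L $ i)"
  proof
    fix x assume "x \<in> range (\<lambda>i. L $ i)"
    then obtain i where "x = relabel a L $ (i - a)" by (auto simp: relabel_nth)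
    then show "x \<in> range (\<lambda>i. relabel a L $ i)" by blast
  qed
qed

text \<open>
  If the aspect ratio tends to infinity, then relabeling by one step makes it tend to \<open>0\<close>.
\<close>

lemma proper_path_end:
  assumes c: "continuous_on UNIV c" "\<And>t. c t \<in> M"
    and lim: "filterlim (\<lambda>t. lratio (c t)) at_top at_top \<or> filterlim (\<lambda>t. lratio (c t)) at_bot at_top"
    and \<phi>: "filterlim \<phi> at_top F"
  shows "\<exists>a k L. path_end (\<lambda>t. relabel a (c t)) k L \<and> chord \<gamma> (closed_segment (L $ 0) (L $ 1)) \<and>
      proper_end (\<lambda>t. c (\<phi> t)) F (closed_segment (L $ 0) (L $ 1))"
proof -
  have ex: "\<exists>a k L. path_end (\<lambda>t. relabel a (c t)) k L"
  proof (cases "filterlim (\<lambda>t. lratio (c t)) at_bot at_top")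
    case True
    have "\<exists>k L. path_end (\<lambda>t. relabel 0 (c t)) k L" using path_end_exists[OF c True] by simp
    then show ?thesis by blast
  next
    case False
    then have "filterlim (\<lambda>t. lratio (c t)) at_top at_top" using lim by blast
    then have "filterlim (\<lambda>t. lratio (relabel 1 (c t))) at_bot at_top"
      unfolding lratio_relabel_1[OF c(2)] by (simp add: filterlim_uminus_at_top)
    moreover have "continuous_on UNIV (\<lambda>t. relabel 1 (c t))"
      by (rule continuous_on_compose2[OF continuous_relabel c(1)]) auto
    ultimately show ?thesis using path_end_exists[of "\<lambda>t. relabel 1 (c t)"] relabel_M[OF c(2)] by blast
  qed
  then obtain a k L where pe: "path_end (\<lambda>t. relabel a (c t)) k L" by blast
  note d = path_end_direction(2,3)[OF pe] and l = path_end_limit(2,3)[OF pe]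
  have ch: "chord \<gamma> (closed_segment (L $ 0) (L $ 1))" unfolding chord_def using l by blast
  have cc: "ccw_rectangle (c t)" for t using c(2) M_iff by blast
  have asp: "((\<lambda>t. aspect_ratio (c (\<phi> t))) \<longlongrightarrow> 0) F \<or> filterlim (\<lambda>t. aspect_ratio (c (\<phi> t))) at_top F"
    using lim
  proof
    assume "filterlim (\<lambda>t. lratio (c t)) at_top at_top"
    from filterlim_compose[OF exp_at_top filterlim_compose[OF this \<phi>]] show ?thesis unfolding exp_lratio[OF cc] by blast
  next
    assume "filterlim (\<lambda>t. lratio (c t)) at_bot at_top"
    from filterlim_compose[OF exp_at_bot filterlim_compose[OF this \<phi>]] show ?thesis unfolding exp_lratio[OF cc] by blast
  qed
  have "isCont (relabel (-a)) L" using continuous_relabel[of UNIV "-a"] by (simp add: continuous_on_eq_continuous_at)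
  moreover have "((\<lambda>t. relabel a (c t)) \<longlongrightarrow> L) at_top" using pe unfolding path_end_def by blast
  ultimately have "((\<lambda>t. relabel (-a) (relabel a (c t))) \<longlongrightarrow> relabel (-a) L) at_top" by (rule isCont_tendsto_compose)
  then have "(c \<longlongrightarrow> relabel (-a) L) at_top" by simp
  then have lim: "((\<lambda>t. c (\<phi> t)) \<longlongrightarrow> relabel (-a) L) F" using \<phi> by (rule filterlim_compose)
  have "range (\<lambda>i. L $ i) = {L $ 0, L $ 1}"
  proof -
    have "\<forall>i. L $ i \<in> {L $ 0, L $ 1}" unfolding all_4 using d by simp
    then show ?thesis by blast
  qed
  then have "convex hull (range (\<lambda>i. relabel (-a) L $ i)) = closed_segment (L $ 0) (L $ 1)"
    unfolding range_relabel_vertices by (simp add: segment_convex_hull)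
  then have "accumulates_on (\<lambda>t. c (\<phi> t)) F (closed_segment (L $ 0) (L $ 1))" unfolding accumulates_on_def using lim by blast
  then show ?thesis unfolding proper_end_def using pe ch asp by blast
qed

text \<open>
  If the chords at the two ends were equal, then a point far out on one end would be a relabeling of a point far out on the
  other end, and relabelings map no point of an arc to a different one.
\<close>

lemma arc_component_proper:
  assumes ac: "arc_component M C" shows "proper_arc \<gamma> C"
proof -
  have C: "C \<in> components M" "\<not> compact C" using ac open_arc_not_compact unfolding arc_component_def by blast+
  show ?thesis
  proof (rule flip.component_cases[OF C(1)], goal_cases loop arc)
    case loop then show ?thesis using C(2) by blast
  next
    case (arc h)
    have hM: "h t \<in> M" for t using arc(3) unit_speed_at_isCont(2) by blast
    have ch: "continuous_on UNIV h" using flip.unit_path_continuous[OF arc(3)] .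
    have inj: "inj h" using arc(5)[of 0] by (intro injI) simp
    have cm: "continuous_on UNIV (\<lambda>t. h (- t))" by (rule continuous_on_compose2[OF ch]) (auto intro!: continuous_intros)
    \<comment> \<open>The other end of \<open>h\<close>, traversed backwards.\<close>
    have lm: "filterlim (\<lambda>t. lratio (h (- t))) at_top at_top \<or> filterlim (\<lambda>t. lratio (h (- t))) at_bot at_top"
      using arc(7) unfolding filterlim_at_bot_mirror .
    obtain a k L where e1: "path_end (\<lambda>t. relabel a (h t)) k L" "chord \<gamma> (closed_segment (L $ 0) (L $ 1))"
      "proper_end (\<lambda>t. h (stretch t)) (at_left 1) (closed_segment (L $ 0) (L $ 1))"
      using proper_path_end[OF ch hM arc(6) stretch_ends(1)] by blast
    obtain a' k' L' where e2: "path_end (\<lambda>t. relabel a' (h (- t))) k' L'" "chord \<gamma> (closed_segment (L' $ 0) (L' $ 1))"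
      "proper_end (\<lambda>t. h (- (- stretch t))) (at_right 0) (closed_segment (L' $ 0) (L' $ 1))"
      using proper_path_end[OF cm hM lm stretch_ends(2)] by blast
    have ne: "closed_segment (L' $ 0) (L' $ 1) \<noteq> closed_segment (L $ 0) (L $ 1)"
    proof
      assume "closed_segment (L' $ 0) (L' $ 1) = closed_segment (L $ 0) (L $ 1)"
      from path_ends_equal_chords_meet[OF e1(1) e2(1) this[symmetric]]
      obtain b t t' where t: "t > 0" "t' > 0" "relabel b (relabel a (h t)) = relabel a' (h (- t'))" by blast
      have "relabel (- a' + (b + a)) (h t) = relabel (- a') (relabel b (relabel a (h t)))" by (simp add: relabel_add)
      also have "\<dots> = h (- t')" unfolding t(3) by simp
      finally obtain n where "(relabel 1 ^^ n) (h t) = h (- t')" unfolding relabel_pow using type_4_of_nat by metis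
      then have "t = - t'" using arc(5) by blast
      then show False using t by simp
    qed
    have "homeomorphism {0<..<1} C (h \<circ> stretch) ((\<lambda>x. arctan x / pi + 1/2) \<circ> inv h)"
      using homeomorphism_compose[OF stretch_homeomorphism flip.injective_path_homeomorphism[OF arc(3) inj]] arc(4) by simp
    moreover have "proper_end (h \<circ> stretch) (at_left 1) (closed_segment (L $ 0) (L $ 1))"
      "proper_end (h \<circ> stretch) (at_right 0) (closed_segment (L' $ 0) (L' $ 1))"
      using e1(3) e2(3) by (simp_all add: o_def)
    ultimately show ?thesis unfolding proper_arc_def using e1(2) e2(2) ne by blast
  qed
qed

lemma hyperbolic_path_component:
  assumes C: "C \<in> components M" and h: "homeomorphism UNIV C h g" and hyp: "flip.hyperbolic_path h"
  shows "hyperbolic_component \<gamma> C"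
proof -
  have hM: "h t \<in> M" for t using h in_components_subset[OF C] unfolding homeomorphism_def by blast
  then have cc: "ccw_rectangle (h t)" for t using M_iff by blast
  have f: "homeomorphism {0<..<1} C (h \<circ> stretch) ((\<lambda>x. arctan x / pi + 1/2) \<circ> g)"
    by (rule homeomorphism_compose[OF stretch_homeomorphism h])
  then have "C homeomorphic {0<..<1::real}" unfolding homeomorphic_def using homeomorphism_symD by blast
  then have ac: "arc_component M C" using C unfolding arc_component_def by blast
  have l: "filterlim (\<lambda>t. lratio (h t)) at_bot at_bot" "filterlim (\<lambda>t. lratio (h t)) at_top at_top"
    using hyp unfolding flip.hyperbolic_path_def by auto
  have "filterlim stretch at_bot (at_right 0)" using stretch_ends(2) by (simp add: filterlim_uminus_at_bot)
  from filterlim_compose[OF exp_at_bot filterlim_compose[OF l(1) this]]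
  have 1: "((\<lambda>t. aspect_ratio ((h \<circ> stretch) t)) \<longlongrightarrow> 0) (at_right 0)" unfolding exp_lratio[OF cc] by simp
  from filterlim_compose[OF exp_at_top filterlim_compose[OF l(2) stretch_ends(1)]]
  have 2: "filterlim (\<lambda>t. aspect_ratio ((h \<circ> stretch) t)) at_top (at_left 1)" unfolding exp_lratio[OF cc] by simp
  show ?thesis unfolding hyperbolic_component_def using ac f 1 2 by blast
qed

text \<open>
  This gives the converse of \<open>hyperbolic_path_component\<close> without comparing parametrizations: a path with the
  same behaviour at both ends is bounded on one side.
\<close>

lemma hyperbolic_unbounded:
  assumes "hyperbolic_component \<gamma> C" shows "\<exists>R\<in>C. lratio R < K" "\<exists>R\<in>C. lratio R > K"
proof -
  obtain f g where f: "homeomorphism {0<..<1::real} C f g" "((\<lambda>t. aspect_ratio (f t)) \<longlongrightarrow> 0) (at_right 0)"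
     "filterlim (\<lambda>t. aspect_ratio (f t)) at_top (at_left 1)" and CM: "C \<subseteq> M"
    using assms in_components_subset unfolding hyperbolic_component_def arc_component_def by blast
  have fC: "f t \<in> C" if "0 < t" "t < 1" for t using f(1) that unfolding homeomorphism_def by auto
  have ccC: "ccw_rectangle R" if "R \<in> C" for R using that CM M_iff by blast
  have "\<forall>\<^sub>F t in at_right 0. aspect_ratio (f t) < exp K" using order_tendstoD(2)[OF f(2)] by simp
  moreover have "\<forall>\<^sub>F t in at_right (0::real). 0 < t \<and> t < 1" using eventually_at_right_real[of 0 1] by simp
  ultimately have "\<forall>\<^sub>F t in at_right 0. aspect_ratio (f t) < exp K \<and> 0 < t \<and> t < 1" by (rule eventually_conj)
  then obtain t where t: "aspect_ratio (f t) < exp K" "0 < t" "t < 1" using eventually_happens'[OF trivial_limit_at_right_real] by blast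
  then have "lratio (f t) < K" using exp_lratio[OF ccC[OF fC]] by (metis exp_less_cancel_iff)
  then show "\<exists>R\<in>C. lratio R < K" using fC t by blast
  have "\<forall>\<^sub>F t in at_left 1. exp K < aspect_ratio (f t)" using f(3) by (simp add: filterlim_at_top_dense)
  moreover have "\<forall>\<^sub>F t in at_left (1::real). 0 < t \<and> t < 1" using eventually_at_left_real[of 0 1] by simp
  ultimately have "\<forall>\<^sub>F t in at_left 1. exp K < aspect_ratio (f t) \<and> 0 < t \<and> t < 1" by (rule eventually_conj)
  then obtain u where u: "exp K < aspect_ratio (f u)" "0 < u" "u < 1" using eventually_happens'[OF trivial_limit_at_left_real] by blast
  then have "K < lratio (f u)" using exp_lratio[OF ccC[OF fC]] by (metis exp_less_cancel_iff)
  then show "\<exists>R\<in>C. lratio R > K" using fC u by blast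
qed

lemma coercive_bounded_below:
  fixes g :: "real \<Rightarrow> real"
  assumes g: "continuous_on UNIV g" and top: "filterlim g at_top at_top" "filterlim g at_top at_bot"
  shows "\<exists>K. \<forall>t. K \<le> g t"
proof -
  obtain b where b: "\<And>t. t \<ge> b \<Longrightarrow> 0 \<le> g t" using top(1) unfolding filterlim_at_top eventually_at_top_linorder by blast
  obtain a where a: "\<And>t. t \<le> a \<Longrightarrow> 0 \<le> g t" using top(2) unfolding filterlim_at_top eventually_at_bot_linorder by blast
  have cg: "compact (g ` {a..b})" by (rule compact_continuous_image[OF continuous_on_subset[OF g subset_UNIV] compact_Icc])
  obtain K where K: "\<And>x. x \<in> g ` {a..b} \<Longrightarrow> K \<le> x"
    using bounded_imp_bdd_below[OF compact_imp_bounded[OF cg]] unfolding bdd_below_def by metis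
  have "min K 0 \<le> g t" for t
  proof (cases "t \<in> {a..b}")
    case True then show ?thesis using K[of "g t"] by auto
  next
    case False then show ?thesis using a[of t] b[of t] by auto
  qed
  then show ?thesis by blast
qed

lemma elliptic_iff:
  assumes "C \<in> components M" shows "elliptic_component \<gamma> C \<longleftrightarrow> relabel 1 ` C = C"
proof
  assume "elliptic_component \<gamma> C" then show "relabel 1 ` C = C" unfolding elliptic_component_def by blast
next
  assume C: "relabel 1 ` C = C"
  have "(relabel 1 ^^ n) ` C = C" for n
  proof (induction n)
    case (Suc n)
    have "(relabel 1 ^^ Suc n) ` C = relabel 1 ` ((relabel 1 ^^ n) ` C)" by (simp add: image_image)
    then show ?case using Suc C by simp
  qed simp
  then have "relabel (of_nat n) ` C = C" for n using relabel_pow by (metis (no_types, lifting) image_cong)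
  then have "relabel k ` C = C" for k using type_4_of_nat[of k] by metis
  then show "elliptic_component \<gamma> C" unfolding elliptic_component_def using assms by blast
qed

text \<open>
  The translation of \<open>component_cases\<close> into hyperbolic and elliptic components.
\<close>

lemma component_parity:
  assumes C: "C \<in> components M"
  shows "finite (flip.zero_orbits C)"
    "odd (card (flip.zero_orbits C)) \<longleftrightarrow> hyperbolic_component \<gamma> C \<or> elliptic_component \<gamma> C"
    "\<not> (hyperbolic_component \<gamma> C \<and> elliptic_component \<gamma> C)"
proof -
  have nh: "\<not> compact C" if "hyperbolic_component \<gamma> C"
    using that open_arc_not_compact unfolding hyperbolic_component_def arc_component_def by blast
  have "finite (flip.zero_orbits C) \<and> (odd (card (flip.zero_orbits C)) \<longleftrightarrow> hyperbolic_component \<gamma> C \<or> elliptic_component \<gamma> C)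
     \<and> \<not> (hyperbolic_component \<gamma> C \<and> elliptic_component \<gamma> C)"
  proof (rule flip.component_cases[OF C], goal_cases loop arc)
    case loop then show ?thesis using nh elliptic_iff[OF C] by blast
  next
    case (arc h)
    have hM: "h t \<in> M" for t using arc(3) unit_speed_at_isCont(2) by blast
    have inj: "inj h" using arc(5)[of 0] by (intro injI) simp
    have h: "homeomorphism UNIV C h (inv h)" using flip.injective_path_homeomorphism[OF arc(3) inj] arc(4) by simp
    have m: "homeomorphism (UNIV::real set) UNIV uminus uminus"
      by (rule homeomorphismI) (auto intro!: continuous_intros)
    have h': "homeomorphism UNIV C (\<lambda>t. h (- t)) (uminus \<circ> inv h)" using homeomorphism_compose[OF m h] by (simp add: o_def)
    have lc: "continuous_on UNIV (\<lambda>t. lratio (h t))"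
      by (rule continuous_on_compose2[OF continuous_lratio flip.unit_path_continuous[OF arc(3)]]) (use hM in auto)
    have "hyperbolic_component \<gamma> C \<longleftrightarrow> flip.hyperbolic_path h \<or> flip.hyperbolic_path (\<lambda>t. h (-t))"
    proof
      assume "flip.hyperbolic_path h \<or> flip.hyperbolic_path (\<lambda>t. h (-t))"
      then show "hyperbolic_component \<gamma> C" using hyperbolic_path_component[OF C h] hyperbolic_path_component[OF C h'] by blast
    next
      assume hyp: "hyperbolic_component \<gamma> C"
      have nb: "\<not> (\<forall>t. K \<le> lratio (h t))" "\<not> (\<forall>t. K \<le> - lratio (h t))" for K
      proof -
        obtain t where "lratio (h t) < K" using hyperbolic_unbounded(1)[OF hyp, of K] arc(4) by blast
        then show "\<not> (\<forall>t. K \<le> lratio (h t))" using not_less by blast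
        obtain u where "- K < lratio (h u)" using hyperbolic_unbounded(2)[OF hyp, of "-K"] arc(4) by blast
        then have "\<not> K \<le> - lratio (h u)" by linarith
        then show "\<not> (\<forall>t. K \<le> - lratio (h t))" by blast
      qed
      have "\<not> (filterlim (\<lambda>t. lratio (h t)) at_top at_top \<and> filterlim (\<lambda>t. lratio (h t)) at_top at_bot)"
        using coercive_bounded_below[OF lc] nb(1) by blast
      moreover have "\<not> (filterlim (\<lambda>t. lratio (h t)) at_bot at_top \<and> filterlim (\<lambda>t. lratio (h t)) at_bot at_bot)"
        using coercive_bounded_below[OF continuous_on_minus[OF lc]] nb(2) unfolding filterlim_uminus_at_bot by blast
      moreover have "flip.hyperbolic_path (\<lambda>t. h (- t))" if "filterlim (\<lambda>t. lratio (h t)) at_bot at_top" "filterlim (\<lambda>t. lratio (h t)) at_top at_bot"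
        unfolding flip.hyperbolic_path_def using that
        by (simp add: filterlim_at_bot_mirror[of "\<lambda>t. lratio (h (- t))"] filterlim_at_bot_mirror[of "\<lambda>t. lratio (h t)"])
      ultimately show "flip.hyperbolic_path h \<or> flip.hyperbolic_path (\<lambda>t. h (-t))"
        using arc(6,7) unfolding flip.hyperbolic_path_def[of h] by blast
    qed
    then show ?thesis using arc(2,8,9) elliptic_iff[OF C] by blast
  qed
  then show "finite (flip.zero_orbits C)"
    "odd (card (flip.zero_orbits C)) \<longleftrightarrow> hyperbolic_component \<gamma> C \<or> elliptic_component \<gamma> C"
    "\<not> (hyperbolic_component \<gamma> C \<and> elliptic_component \<gamma> C)" by blast+
qed

lemma orb_relabel: "flip.orb R = range (\<lambda>k. relabel k R)"
proof -
  have "flip.orb R = range (\<lambda>n. relabel (of_nat n) R)" unfolding flip.orb_def relabel_pow ..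
  also have "\<dots> = range (\<lambda>k. relabel k R)"
  proof
    show "range (\<lambda>k. relabel k R) \<subseteq> range (\<lambda>n. relabel (of_nat n) R)"
      using type_4_of_nat by (metis image_subsetI rangeI)
  qed blast
  finally show ?thesis .
qed

lemma unlabeled_squares_orb: "unlabeled_squares \<gamma> = flip.orb ` {R \<in> M. lratio R = 0}"
proof -
  have "aspect_ratio R = 1 \<longleftrightarrow> lratio R = 0" if "R \<in> M" for R
    using exp_lratio[of R] that M_iff by (auto simp: lratio_def)
  then have "{R \<in> M. aspect_ratio R = 1} = {R \<in> M. lratio R = 0}" by blast
  then show ?thesis unfolding unlabeled_squares_def orb_relabel by simp
qed

lemma finite_squares: "finite (unlabeled_squares \<gamma>)"
proof -
  define Z where "Z = {R \<in> M. lratio R = 0}"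
  have "compact Z" using compact_bounded_ratio[of 0] by (simp add: Z_def)
  moreover have "\<not> p islimpt Z" if p: "p \<in> Z" for p
  proof
    assume lim: "p islimpt Z"
    have pM: "p \<in> M" "lratio p = 0" using p by (auto simp: Z_def)
    have "smooth_point M p" using vertex_free_smooth square_vertex_free pM by blast
    then obtain U where U: "openin (top_of_set M) U" "p \<in> U" "inj_on aspect_ratio U" using smooth_point_injective pM(1) by blast
    obtain O1 where O1: "open O1" "U = M \<inter> O1" using U(1) by (meson openin_open)
    obtain y where y: "y \<in> Z" "y \<in> O1" "y \<noteq> p" using lim O1 U(2) unfolding islimpt_def by blast
    have yM: "y \<in> M" "lratio y = 0" using y(1) by (auto simp: Z_def)
    have "aspect_ratio y = aspect_ratio p" using exp_lratio pM yM M_iff by metis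
    then have "y = p" using inj_onD[OF U(3)] O1(2) y(2) yM(1) U(2) by blast
    then show False using y(3) by blast
  qed
  ultimately have "finite Z" unfolding compact_eq_Bolzano_Weierstrass by blast
  then show ?thesis unfolding unlabeled_squares_orb Z_def by simp
qed

lemma relabel_component:
  assumes "C \<in> components M" shows "relabel k ` C \<in> components M"
proof -
  have C: "C \<noteq> {}" "C \<subseteq> M" "connected C"
    and max: "\<And>D. D \<noteq> {} \<Longrightarrow> C \<subseteq> D \<Longrightarrow> D \<subseteq> M \<Longrightarrow> connected D \<Longrightarrow> D = C"
    using assms[unfolded in_components_maximal] by simp_all
  have "relabel k ` C = D" if D: "D \<noteq> {}" "relabel k ` C \<subseteq> D" "D \<subseteq> M" "connected D" for D
  proof -
    have CD: "C \<subseteq> relabel (-k) ` D"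
    proof
      fix x assume "x \<in> C"
      then have "relabel (-k) (relabel k x) \<in> relabel (-k) ` D" using D(2) by blast
      then show "x \<in> relabel (-k) ` D" by simp
    qed
    have "relabel (-k) ` D \<subseteq> M" using D(3) relabel_M by blast
    moreover have "connected (relabel (-k) ` D)" by (rule connected_continuous_image[OF continuous_relabel D(4)])
    moreover have "relabel (-k) ` D \<noteq> {}" using D(1) by simp
    ultimately have "relabel (-k) ` D = C" using max CD by metis
    then have "relabel k ` C = relabel k ` relabel (-k) ` D" by simp
    then show ?thesis by (simp add: image_image)
  qed
  moreover have "relabel k ` C \<noteq> {}" "relabel k ` C \<subseteq> M" using C(1,2) relabel_M by blast+
  moreover have "connected (relabel k ` C)" by (rule connected_continuous_image[OF continuous_relabel C(3)])
  ultimately show ?thesis unfolding in_components_maximal by blast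
qed

lemma zero_orbits_relabel:
  "flip.zero_orbits (relabel k ` C) = flip.zero_orbits C"
proof -
  have "flip.orb R \<inter> relabel k ` C \<noteq> {} \<longleftrightarrow> flip.orb R \<inter> C \<noteq> {}" for R
  proof
    assume "flip.orb R \<inter> relabel k ` C \<noteq> {}"
    then obtain j x where "relabel j R = relabel k x" "x \<in> C" unfolding orb_relabel by blast
    then have "relabel (- k + j) R \<in> C" by (metis relabel_add relabel_minus(1))
    then show "flip.orb R \<inter> C \<noteq> {}" unfolding orb_relabel by blast
  next
    assume "flip.orb R \<inter> C \<noteq> {}"
    then obtain j where j: "relabel j R \<in> C" unfolding orb_relabel by blast
    then have "relabel (k + j) R \<in> relabel k ` C" using relabel_add[of k j R] by (metis imageI)
    then show "flip.orb R \<inter> relabel k ` C \<noteq> {}" unfolding orb_relabel by blast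
  qed
  then show ?thesis unfolding flip.zero_orbits_def by simp
qed

text \<open>
  All members of an unlabeled component carry the same unlabeled squares, so the union is the value at any member.
\<close>

definition squares_on :: "(real^2^4) set set \<Rightarrow> (real^2^4) set set" where
  "squares_on X = (\<Union>C\<in>X. flip.zero_orbits C)"

lemma squares_on:
  assumes X: "X \<in> unlabeled_components \<gamma>" and C: "C \<in> X"
  shows "C \<in> components M" "squares_on X = flip.zero_orbits C" "X = range (\<lambda>k. relabel k ` C)"
proof -
  obtain D where D: "D \<in> components M" "X = range (\<lambda>k. relabel k ` D)" using X unfolding unlabeled_components_def by blast
  obtain j where j: "C = relabel j ` D" using C D(2) by blast
  show "C \<in> components M" unfolding j by (rule relabel_component[OF D(1)])
  show "squares_on X = flip.zero_orbits C" unfolding squares_on_def D(2) j by (simp add: zero_orbits_relabel)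
  have "relabel k ` D = relabel (k - j) ` C" for k unfolding j by (simp add: image_image relabel_add)
  moreover have "relabel k ` C = relabel (k + j) ` D" for k unfolding j by (simp add: image_image relabel_add)
  ultimately show "X = range (\<lambda>k. relabel k ` C)" unfolding D(2) by (metis (no_types, lifting) image_subsetI rangeI subset_antisym)
qed

text \<open>
  An unlabeled component with an elliptic member has no other member.
\<close>

lemma unlabeled_component_parity:
  assumes X: "X \<in> unlabeled_components \<gamma>"
  shows "finite (squares_on X)"
    "odd (card (squares_on X)) \<longleftrightarrow> X \<in> unlabeled_hyperbolic \<gamma> \<or> X \<in> unlabeled_elliptic \<gamma>"
    "\<not> (X \<in> unlabeled_hyperbolic \<gamma> \<and> X \<in> unlabeled_elliptic \<gamma>)"
proof -
  obtain C where C: "C \<in> X" using X unfolding unlabeled_components_def by blast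
  note s = squares_on[OF X]
  note p = component_parity[OF s(1)]
  show "finite (squares_on X)" using p(1)[OF C] s(2)[OF C] by simp
  show "\<not> (X \<in> unlabeled_hyperbolic \<gamma> \<and> X \<in> unlabeled_elliptic \<gamma>)"
    using p(3)[OF C] C unfolding unlabeled_hyperbolic_def unlabeled_elliptic_def by blast
  have one: "X = {D}" if D: "D \<in> X" "elliptic_component \<gamma> D" for D
    using s(3)[OF D(1)] D(2) unfolding elliptic_component_def by auto
  show "odd (card (squares_on X)) \<longleftrightarrow> X \<in> unlabeled_hyperbolic \<gamma> \<or> X \<in> unlabeled_elliptic \<gamma>"
  proof
    assume "odd (card (squares_on X))"
    then have all: "hyperbolic_component \<gamma> D \<or> elliptic_component \<gamma> D" if "D \<in> X" for D using p(2)[OF that] s(2)[OF that] by simp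
    show "X \<in> unlabeled_hyperbolic \<gamma> \<or> X \<in> unlabeled_elliptic \<gamma>"
    proof (cases "\<exists>D\<in>X. elliptic_component \<gamma> D")
      case True
      then obtain D where "D \<in> X" "elliptic_component \<gamma> D" by blast
      then show ?thesis using one X unfolding unlabeled_elliptic_def by blast
    next
      case False
      then show ?thesis using all X unfolding unlabeled_hyperbolic_def by blast
    qed
  next
    assume "X \<in> unlabeled_hyperbolic \<gamma> \<or> X \<in> unlabeled_elliptic \<gamma>"
    then have "hyperbolic_component \<gamma> C \<or> elliptic_component \<gamma> C"
      using C unfolding unlabeled_hyperbolic_def unlabeled_elliptic_def by blast
    then show "odd (card (squares_on X))" using p(2)[OF C] s(2)[OF C] by simp
  qed
qed

lemma squares_partition:
  "unlabeled_squares \<gamma> = (\<Union>X\<in>unlabeled_components \<gamma>. squares_on X)"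
  "X \<in> unlabeled_components \<gamma> \<Longrightarrow> Y \<in> unlabeled_components \<gamma> \<Longrightarrow> X \<noteq> Y \<Longrightarrow> squares_on X \<inter> squares_on Y = {}"
proof -
  show "unlabeled_squares \<gamma> = (\<Union>X\<in>unlabeled_components \<gamma>. squares_on X)"
  proof
    show "unlabeled_squares \<gamma> \<subseteq> (\<Union>X\<in>unlabeled_components \<gamma>. squares_on X)"
    proof
      fix q assume "q \<in> unlabeled_squares \<gamma>"
      then obtain R where R: "R \<in> M" "lratio R = 0" "q = flip.orb R" unfolding unlabeled_squares_orb by blast
      obtain C where C: "C \<in> components M" "R \<in> C" using R(1) Union_components[of M] by blast
      have "relabel 0 R \<in> flip.orb R" unfolding orb_relabel by blast
      then have qC: "q \<in> flip.zero_orbits C" unfolding flip.zero_orbits_def using R C(2) by auto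
      define X where "X = range (\<lambda>k. relabel k ` C)"
      have X: "X \<in> unlabeled_components \<gamma>" unfolding X_def unlabeled_components_def using C(1) by blast
      have "relabel 0 ` C \<in> X" unfolding X_def by blast
      then have "q \<in> squares_on X" using squares_on(2)[OF X] qC by simp
      then show "q \<in> (\<Union>X\<in>unlabeled_components \<gamma>. squares_on X)" using X by blast
    qed
    show "(\<Union>X\<in>unlabeled_components \<gamma>. squares_on X) \<subseteq> unlabeled_squares \<gamma>"
      unfolding squares_on_def unlabeled_squares_orb flip.zero_orbits_def by blast
  qed
  assume X: "X \<in> unlabeled_components \<gamma>" and Y: "Y \<in> unlabeled_components \<gamma>" and ne: "X \<noteq> Y"
  obtain C where C: "C \<in> X" using X unfolding unlabeled_components_def by blast
  obtain D where D: "D \<in> Y" using Y unfolding unlabeled_components_def by blast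
  show "squares_on X \<inter> squares_on Y = {}"
  proof (rule ccontr)
    assume "squares_on X \<inter> squares_on Y \<noteq> {}"
    then obtain q where q: "q \<in> flip.zero_orbits C" "q \<in> flip.zero_orbits D"
      using squares_on(2)[OF X C] squares_on(2)[OF Y D] by blast
    obtain R where R: "q = flip.orb R" "flip.orb R \<inter> C \<noteq> {}" using q(1) unfolding flip.zero_orbits_def by blast
    have "flip.orb R \<inter> D \<noteq> {}" using q(2) R(1) unfolding flip.zero_orbits_def by auto
    then obtain i j where ij: "relabel i R \<in> C" "relabel j R \<in> D" using R(2) unfolding orb_relabel by blast
    have "relabel (j - i) (relabel i R) = relabel j R" by (simp add: relabel_add)
    then have "relabel j R \<in> relabel (j - i) ` C" using ij(1) by (metis imageI)
    then have "relabel (j - i) ` C = D"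
      using components_eq[OF relabel_component[OF squares_on(1)[OF X C]] squares_on(1)[OF Y D]] ij(2) by blast
    then have "D \<in> X" using squares_on(3)[OF X C] by blast
    then have "X = Y" using squares_on(3)[OF X] squares_on(3)[OF Y D] by blast
    then show False using ne by blast
  qed
qed

lemma square_parity:
  "finite (unlabeled_squares \<gamma>) \<and> finite (unlabeled_hyperbolic \<gamma>) \<and> finite (unlabeled_elliptic \<gamma>) \<and>
   even (card (unlabeled_squares \<gamma>) + card (unlabeled_hyperbolic \<gamma>) + card (unlabeled_elliptic \<gamma>))"
proof -
  define A where "A = {X \<in> unlabeled_components \<gamma>. squares_on X \<noteq> {}}"
  have sub: "A \<subseteq> unlabeled_components \<gamma>" by (auto simp: A_def)
  have U: "unlabeled_squares \<gamma> = (\<Union>X\<in>A. squares_on X)" unfolding squares_partition(1) A_def by blast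
  have "inj_on squares_on A" using squares_partition(2) unfolding A_def inj_on_def by blast
  moreover have "finite (squares_on ` A)"
    by (rule finite_subset[of _ "Pow (unlabeled_squares \<gamma>)"]) (use U finite_squares in auto)
  ultimately have fA: "finite A" using finite_imageD by blast
  have "card (\<Union>X\<in>A. squares_on X) = (\<Sum>X\<in>A. card (squares_on X))"
    by (rule card_UN_disjoint[OF fA]) (use sub unlabeled_component_parity(1) squares_partition(2) in blast)+
  then have cU: "card (unlabeled_squares \<gamma>) = (\<Sum>X\<in>A. card (squares_on X))" using U by simp
  have odd: "{X \<in> A. odd (card (squares_on X))} = unlabeled_hyperbolic \<gamma> \<union> unlabeled_elliptic \<gamma>"
  proof
    show "{X \<in> A. odd (card (squares_on X))} \<subseteq> unlabeled_hyperbolic \<gamma> \<union> unlabeled_elliptic \<gamma>"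
    proof
      fix X assume "X \<in> {X \<in> A. odd (card (squares_on X))}"
      then have "X \<in> unlabeled_components \<gamma>" "odd (card (squares_on X))" using sub by auto
      then show "X \<in> unlabeled_hyperbolic \<gamma> \<union> unlabeled_elliptic \<gamma>"
        using unlabeled_component_parity(2) by simp
    qed
    show "unlabeled_hyperbolic \<gamma> \<union> unlabeled_elliptic \<gamma> \<subseteq> {X \<in> A. odd (card (squares_on X))}"
    proof
      fix X assume XU: "X \<in> unlabeled_hyperbolic \<gamma> \<union> unlabeled_elliptic \<gamma>"
      then have X: "X \<in> unlabeled_components \<gamma>" unfolding unlabeled_hyperbolic_def unlabeled_elliptic_def by blast
      then have o: "odd (card (squares_on X))" using unlabeled_component_parity(2) XU by blast
      then have "squares_on X \<noteq> {}" by force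
      then show "X \<in> {X \<in> A. odd (card (squares_on X))}" using X o by (simp add: A_def)
    qed
  qed
  have "finite (unlabeled_hyperbolic \<gamma> \<union> unlabeled_elliptic \<gamma>)" unfolding odd[symmetric] using fA by simp
  then have fin: "finite (unlabeled_hyperbolic \<gamma>)" "finite (unlabeled_elliptic \<gamma>)" by blast+
  have "unlabeled_hyperbolic \<gamma> \<inter> unlabeled_elliptic \<gamma> = {}"
    using unlabeled_component_parity(3) unfolding unlabeled_hyperbolic_def by blast
  then have "card {X \<in> A. odd (card (squares_on X))} = card (unlabeled_hyperbolic \<gamma>) + card (unlabeled_elliptic \<gamma>)"
    unfolding odd using fin by (simp add: card_Un_disjoint)
  then have "even (card (unlabeled_squares \<gamma>)) \<longleftrightarrow> even (card (unlabeled_hyperbolic \<gamma>) + card (unlabeled_elliptic \<gamma>))"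
    unfolding cU even_sum_iff[OF fA] by simp
  then show ?thesis using finite_squares fin by auto
qed

end

theorem mainTheorem8:
  shows "\<exists>P :: nat \<Rightarrow> (nat \<Rightarrow> real^2) set.
    (\<forall>N\<ge>3. openin (polygon_space N) (P N) \<and>
            polygon_space N closure_of P N = topspace (polygon_space N)) \<and>
    (\<forall>N\<ge>3. \<forall>v\<in>P N. let \<gamma> = polygon_curve N v; M = inscribed_rectangles \<gamma> in
       (piecewise_smooth_1_manifold M \<and>
        (\<forall>C. arc_component M C \<longrightarrow> proper_arc \<gamma> C) \<and>
        (\<forall>p\<in>M. smooth_point M p \<longrightarrow>
           (\<exists>U. openin (top_of_set M) U \<and> p \<in> U \<and> inj_on aspect_ratio U)) \<and>
        (\<forall>p\<in>M. aspect_ratio p = 1 \<longrightarrow> smooth_point M p)) \<and>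
       (finite (unlabeled_squares \<gamma>) \<and>
        finite (unlabeled_hyperbolic \<gamma>) \<and>
        finite (unlabeled_elliptic \<gamma>) \<and>
        even (card (unlabeled_squares \<gamma>) + card (unlabeled_hyperbolic \<gamma>)
              + card (unlabeled_elliptic \<gamma>))))"
proof (rule exI[of _ "\<lambda>N. generic_polygons N (conds N)"], intro conjI allI impI ballI)
  fix N :: nat assume N: "N \<ge> 3"
  show "openin (polygon_space N) (generic_polygons N (conds N))"
    by (rule generic_polygons_open) (use N finite_conds vpoly_conds in auto)
  show "polygon_space N closure_of generic_polygons N (conds N) = topspace (polygon_space N)"
    by (rule generic_polygons_dense) (use N finite_conds vpoly_conds in auto)
  fix v assume v: "v \<in> generic_polygons N (conds N)"
  interpret generic_polygon N v by unfold_locales (use N v in auto)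
  have sq: "smooth_point M p" if "p \<in> M" "aspect_ratio p = 1" for p
    using vertex_free_smooth[OF that(1) square_vertex_free[OF that(1)]] that(2) by (simp add: lratio_def)
  show "let \<gamma> = polygon_curve N v; M = inscribed_rectangles \<gamma> in
       (piecewise_smooth_1_manifold M \<and>
        (\<forall>C. arc_component M C \<longrightarrow> proper_arc \<gamma> C) \<and>
        (\<forall>p\<in>M. smooth_point M p \<longrightarrow>
           (\<exists>U. openin (top_of_set M) U \<and> p \<in> U \<and> inj_on aspect_ratio U)) \<and>
        (\<forall>p\<in>M. aspect_ratio p = 1 \<longrightarrow> smooth_point M p)) \<and>
       (finite (unlabeled_squares \<gamma>) \<and>
        finite (unlabeled_hyperbolic \<gamma>) \<and>
        finite (unlabeled_elliptic \<gamma>) \<and>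
        even (card (unlabeled_squares \<gamma>) + card (unlabeled_hyperbolic \<gamma>)
              + card (unlabeled_elliptic \<gamma>)))"
    unfolding Let_def
    using piecewise_smooth arc_component_proper smooth_point_injective sq square_parity by blast
qed

end
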